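(* For every $k\ge 1$ there exists a positive integer $t$ such that the following holds. If $G$ is a strongly $(36k^3+2k)$-connected directed graph on $n$ vertices containing a bramble $\mathcal B$ of depth two and size $t$, then every directed $k$-linkage problem instance $(G,S,T)$ is half-integrally feasible. Moreover, given $(G,S,T)$ and the bags of $\mathcal B$, a half-integral solution can be found in time $O(k^4n^2)$.
   Context: A separation in a directed graph $G$ is a pair $(A,B)$ with $A\cup B=V(G)$ and no edge from $A\setminus B$ to $B\setminus A$; its order is $|A\cap B|$; it is trivial if $A\subseteq B$ or $B\subseteq A$. $G$ is strongly $m$-connected if $|V(G)|\ge m+1$ and there is no nontrivial separation of order at most $m-1$. A bramble in $G$ is a set of strongly connected subgraphs (bags) such that any two bags either share a vertex or there are edges of $G$ in both directions between them; its size is its number of bags; depth two means no vertex lies in more than two bags. A directed $k$-linkage instance $(G,S,T)$ has $S=(s_1,\dots,s_k)$, $T=(t_1,\dots,t_k)$ ordered sets of $k$ distinct vertices each; it is half-integrally feasible if there are directed paths $P_1,\dots,P_k$, $P_i$ from $s_i$ to $t_i$, with every vertex in at most two distinct $P_i$ (a half-integral solution). *)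

theory Defs
  imports
    "Graph_Theory.Digraph_Component"
    "Graph_Theory.Pair_Digraph"
    "Graph_Theory.Vertex_Walk"
begin

section \<open>Separations and strong connectivity\<close>

definition separation :: "'a pair_pre_digraph \<Rightarrow> 'a set \<Rightarrow> 'a set \<Rightarrow> bool" where
  "separation G A B \<longleftrightarrow>
     A \<union> B = pverts G \<and> \<not> (\<exists>u \<in> A - B. \<exists>v \<in> B - A. (u, v) \<in> parcs G)"

definition sep_order :: "'a set \<Rightarrow> 'a set \<Rightarrow> nat" where
  "sep_order A B = card (A \<inter> B)"

definition trivial_separation :: "'a set \<Rightarrow> 'a set \<Rightarrow> bool" where
  "trivial_separation A B \<longleftrightarrow> A \<subseteq> B \<or> B \<subseteq> A"

text \<open>The order condition ``at most $m - 1$'' is written without truncated subtraction.\<close>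

definition strongly_m_connected :: "nat \<Rightarrow> 'a pair_pre_digraph \<Rightarrow> bool" where
  "strongly_m_connected m G \<longleftrightarrow>
     m + 1 \<le> card (pverts G) \<and>
     \<not> (\<exists>A B. separation G A B \<and> \<not> trivial_separation A B \<and> sep_order A B + 1 \<le> m)"


section \<open>Brambles\<close>

definition bramble :: "'a pair_pre_digraph \<Rightarrow> 'a pair_pre_digraph set \<Rightarrow> bool" where
  "bramble G \<B> \<longleftrightarrow>
     (\<forall>H \<in> \<B>. subgraph (with_proj H) (with_proj G) \<and> strongly_connected (with_proj H)) \<and>
     (\<forall>H \<in> \<B>. \<forall>K \<in> \<B>.
        pverts H \<inter> pverts K \<noteq> {} \<or>
        ((\<exists>u \<in> pverts H. \<exists>v \<in> pverts K. (u, v) \<in> parcs G) \<and>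
         (\<exists>u \<in> pverts K. \<exists>v \<in> pverts H. (u, v) \<in> parcs G)))"

definition depth_two :: "'a pair_pre_digraph set \<Rightarrow> bool" where
  "depth_two \<B> \<longleftrightarrow> (\<forall>v. \<not> (\<exists>\<C> \<subseteq> \<B>. card \<C> > 2 \<and> (\<forall>H \<in> \<C>. v \<in> pverts H)))"


section \<open>Linkage problems\<close>

definition linkage_instance ::
    "nat \<Rightarrow> 'a pair_pre_digraph \<Rightarrow> 'a list \<Rightarrow> 'a list \<Rightarrow> bool" where
  "linkage_instance k G S T \<longleftrightarrow>
     length S = k \<and> distinct S \<and> set S \<subseteq> pverts G \<and>
     length T = k \<and> distinct T \<and> set T \<subseteq> pverts G"

definition half_integral_solution ::
    "'a pair_pre_digraph \<Rightarrow> 'a list \<Rightarrow> 'a list \<Rightarrow> 'a list list \<Rightarrow> bool" where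
  "half_integral_solution G S T Ps \<longleftrightarrow>
     length Ps = length S \<and>
     (\<forall>i < length S. vpath (Ps ! i) (with_proj G) \<and> hd (Ps ! i) = S ! i \<and> last (Ps ! i) = T ! i) \<and>
     (\<forall>v. card {i. i < length S \<and> v \<in> set (Ps ! i)} \<le> 2)"

definition half_integrally_feasible ::
    "'a pair_pre_digraph \<Rightarrow> 'a list \<Rightarrow> 'a list \<Rightarrow> bool" where
  "half_integrally_feasible G S T \<longleftrightarrow> (\<exists>Ps. half_integral_solution G S T Ps)"


section \<open>Machine model\<close>

text \<open>
  Running times refer to a word RAM, programmed in a structured language. Memory consists of
  arrays of words; a program mentions only finitely many array names, so interleaving the arrays
  in one linear memory costs a constant factor only. Every expression node, store and test takes
  one unit of time. With word bound \<open>W\<close>, a program gets stuck (and has no execution at all) as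
  soon as it computes a value that is not below \<open>W\<close>; in particular all addresses are below \<open>W\<close>.
  Subtraction is truncated at \<open>0\<close>, and a test succeeds iff its value is nonzero.
\<close>

type_synonym memory = "nat \<Rightarrow> nat \<Rightarrow> nat"

datatype expr =
    Const nat
  | Load nat expr
  | Add expr expr
  | Sub expr expr
  | Mul expr expr
  | Div expr expr

datatype prog =
    Skip
  | Store nat expr expr
  | Seq prog prog
  | Cond expr prog prog
  | While expr prog

primrec val :: "memory \<Rightarrow> expr \<Rightarrow> nat" where
  "val \<sigma> (Const c) = c"
| "val \<sigma> (Load a e) = \<sigma> a (val \<sigma> e)"
| "val \<sigma> (Add e f) = val \<sigma> e + val \<sigma> f"
| "val \<sigma> (Sub e f) = val \<sigma> e - val \<sigma> f"
| "val \<sigma> (Mul e f) = val \<sigma> e * val \<sigma> f"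
| "val \<sigma> (Div e f) = val \<sigma> e div val \<sigma> f"

primrec fits :: "nat \<Rightarrow> memory \<Rightarrow> expr \<Rightarrow> bool" where
  "fits W \<sigma> (Const c) \<longleftrightarrow> c < W"
| "fits W \<sigma> (Load a e) \<longleftrightarrow> fits W \<sigma> e \<and> val \<sigma> (Load a e) < W"
| "fits W \<sigma> (Add e f) \<longleftrightarrow> fits W \<sigma> e \<and> fits W \<sigma> f \<and> val \<sigma> (Add e f) < W"
| "fits W \<sigma> (Sub e f) \<longleftrightarrow> fits W \<sigma> e \<and> fits W \<sigma> f \<and> val \<sigma> (Sub e f) < W"
| "fits W \<sigma> (Mul e f) \<longleftrightarrow> fits W \<sigma> e \<and> fits W \<sigma> f \<and> val \<sigma> (Mul e f) < W"
| "fits W \<sigma> (Div e f) \<longleftrightarrow> fits W \<sigma> e \<and> fits W \<sigma> f \<and> val \<sigma> (Div e f) < W"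

primrec cost :: "expr \<Rightarrow> nat" where
  "cost (Const c) = 1"
| "cost (Load a e) = 1 + cost e"
| "cost (Add e f) = 1 + cost e + cost f"
| "cost (Sub e f) = 1 + cost e + cost f"
| "cost (Mul e f) = 1 + cost e + cost f"
| "cost (Div e f) = 1 + cost e + cost f"

text \<open>\<open>exec W p \<sigma> \<tau> \<sigma>'\<close>: with word bound \<open>W\<close>, program \<open>p\<close> started in memory \<open>\<sigma>\<close> halts after
  exactly \<open>\<tau>\<close> units of time in memory \<open>\<sigma>'\<close>.\<close>

inductive exec :: "nat \<Rightarrow> prog \<Rightarrow> memory \<Rightarrow> nat \<Rightarrow> memory \<Rightarrow> bool" for W :: nat where
  Skip: "exec W Skip \<sigma> 1 \<sigma>"
| Store: "fits W \<sigma> e \<Longrightarrow> fits W \<sigma> f \<Longrightarrow>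
    exec W (Store a e f) \<sigma> (1 + cost e + cost f) (\<sigma>(a := (\<sigma> a)(val \<sigma> e := val \<sigma> f)))"
| Seq: "exec W p \<sigma> \<tau>\<^sub>1 \<sigma>\<^sub>1 \<Longrightarrow> exec W q \<sigma>\<^sub>1 \<tau>\<^sub>2 \<sigma>\<^sub>2 \<Longrightarrow> exec W (Seq p q) \<sigma> (\<tau>\<^sub>1 + \<tau>\<^sub>2) \<sigma>\<^sub>2"
| IfTrue: "fits W \<sigma> e \<Longrightarrow> val \<sigma> e \<noteq> 0 \<Longrightarrow> exec W p \<sigma> \<tau> \<sigma>' \<Longrightarrow>
    exec W (Cond e p q) \<sigma> (1 + cost e + \<tau>) \<sigma>'"
| IfFalse: "fits W \<sigma> e \<Longrightarrow> val \<sigma> e = 0 \<Longrightarrow> exec W q \<sigma> \<tau> \<sigma>' \<Longrightarrow>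
    exec W (Cond e p q) \<sigma> (1 + cost e + \<tau>) \<sigma>'"
| WhileFalse: "fits W \<sigma> e \<Longrightarrow> val \<sigma> e = 0 \<Longrightarrow> exec W (While e p) \<sigma> (1 + cost e) \<sigma>"
| WhileTrue: "fits W \<sigma> e \<Longrightarrow> val \<sigma> e \<noteq> 0 \<Longrightarrow> exec W p \<sigma> \<tau>\<^sub>1 \<sigma>\<^sub>1 \<Longrightarrow>
    exec W (While e p) \<sigma>\<^sub>1 \<tau>\<^sub>2 \<sigma>\<^sub>2 \<Longrightarrow> exec W (While e p) \<sigma> (1 + cost e + \<tau>\<^sub>1 + \<tau>\<^sub>2) \<sigma>\<^sub>2"

inductive_cases exec_SkipE: "exec W Skip \<sigma> \<tau> \<sigma>'"
inductive_cases exec_StoreE: "exec W (Store a e f) \<sigma> \<tau> \<sigma>'"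
inductive_cases exec_SeqE: "exec W (Seq p q) \<sigma> \<tau> \<sigma>'"
inductive_cases exec_CondE: "exec W (Cond e p q) \<sigma> \<tau> \<sigma>'"
inductive_cases exec_WhileE: "exec W (While e p) \<sigma> \<tau> \<sigma>'"

lemma exec_deterministic:
  "exec W p \<sigma> \<tau> \<sigma>' \<Longrightarrow> exec W p \<sigma> \<tau>' \<sigma>'' \<Longrightarrow> \<tau>' = \<tau> \<and> \<sigma>'' = \<sigma>'"
proof (induction arbitrary: \<tau>' \<sigma>'' rule: exec.induct)
  case Skip
  from Skip.prems show ?case by (rule exec_SkipE) simp
next
  case Store
  from Store.prems show ?case by (rule exec_StoreE) simp
next
  case Seq
  from Seq.prems show ?case by (rule exec_SeqE) (auto dest: Seq.IH)
next
  case IfTrue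
  from IfTrue.prems show ?case by (rule exec_CondE) (use IfTrue.hyps in \<open>auto dest: IfTrue.IH\<close>)
next
  case IfFalse
  from IfFalse.prems show ?case by (rule exec_CondE) (use IfFalse.hyps in \<open>auto dest: IfFalse.IH\<close>)
next
  case WhileFalse
  from WhileFalse.prems show ?case by (rule exec_WhileE) (use WhileFalse.hyps in auto)
next
  case WhileTrue
  from WhileTrue.prems show ?case by (rule exec_WhileE) (use WhileTrue.hyps in \<open>auto dest: WhileTrue.IH\<close>)
qed

text \<open>The input is the content of array \<open>0\<close>, all other words being \<open>0\<close>; the output is an initial
  segment of array \<open>1\<close>.\<close>

definition input_memory :: "nat list \<Rightarrow> memory" where
  "input_memory xs = (\<lambda>a i. if a = 0 \<and> i < length xs then xs ! i else 0)"

definition computes_within :: "nat \<Rightarrow> prog \<Rightarrow> nat list \<Rightarrow> nat \<Rightarrow> nat list \<Rightarrow> bool" where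
  "computes_within W p xs b ys \<longleftrightarrow>
     (\<exists>\<tau> \<sigma>. exec W p (input_memory xs) \<tau> \<sigma> \<and> \<tau> \<le> b \<and> (\<forall>i < length ys. \<sigma> 1 i = ys ! i))"


section \<open>Encoding of instances and solutions\<close>

text \<open>
  Vertices are presented to the machine as the numbers \<open>0, \<dots>, n - 1\<close>, via a numbering \<open>\<nu>\<close>; a
  digraph is presented by its vertices and its arcs, each listed once in an arbitrary order. All
  sequences are preceded by their lengths.
\<close>

definition vertex_numbering :: "'a pair_pre_digraph \<Rightarrow> ('a \<Rightarrow> nat) \<Rightarrow> bool" where
  "vertex_numbering G \<nu> \<longleftrightarrow> bij_betw \<nu> (pverts G) {..<card (pverts G)}"

definition encodes_digraph ::
    "('a \<Rightarrow> nat) \<Rightarrow> 'a pair_pre_digraph \<Rightarrow> nat list \<Rightarrow> bool" where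
  "encodes_digraph \<nu> H xs \<longleftrightarrow>
     (\<exists>vs es. distinct vs \<and> set vs = pverts H \<and> distinct es \<and> set es = parcs H \<and>
        xs = [length vs, length es] @ map \<nu> vs @ concat (map (\<lambda>(u, v). [\<nu> u, \<nu> v]) es))"

definition encodes_bags ::
    "('a \<Rightarrow> nat) \<Rightarrow> 'a pair_pre_digraph set \<Rightarrow> nat list \<Rightarrow> bool" where
  "encodes_bags \<nu> \<B> xs \<longleftrightarrow>
     (\<exists>Hs xss. distinct Hs \<and> set Hs = \<B> \<and> list_all2 (encodes_digraph \<nu>) Hs xss \<and>
        xs = length Hs # concat xss)"

definition encodes_input ::
    "('a \<Rightarrow> nat) \<Rightarrow> 'a pair_pre_digraph \<Rightarrow> 'a list \<Rightarrow> 'a list \<Rightarrow> 'a pair_pre_digraph set \<Rightarrow>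
     nat list \<Rightarrow> bool" where
  "encodes_input \<nu> G S T \<B> xs \<longleftrightarrow>
     (\<exists>gs bs. encodes_digraph \<nu> G gs \<and> encodes_bags \<nu> \<B> bs \<and>
        xs = gs @ [length S] @ map \<nu> S @ map \<nu> T @ bs)"

definition path_words :: "('a \<Rightarrow> nat) \<Rightarrow> 'a list list \<Rightarrow> nat list" where
  "path_words \<nu> Ps = concat (map (\<lambda>P. length P # map \<nu> P) Ps)"

end

theory Submission
  imports Defs
begin

text \<open>
  Every bag is untouched or claimed by one of the two sides (the side of \<open>S\<close>, or the side of \<open>T\<close> in the
  converse graph), and a vertex is settled if all of its at most two bags are claimed. For every
  terminal, Menger's theorem gives a fan of \<open>5 k\<close> paths to distinct untouched bags. Following each path
  until it first leaves the settled vertices, and claiming the bags met there, makes the terminal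
  robust: no set of fewer than \<open>k\<close> other vertices separates it, within the settled vertices, from all
  bags claimed by its side. All fans together claim at most \<open>24 k^2\<close> of the \<open>60 k^2\<close> bags.

  By robustness, each side then has \<open>k\<close> disjoint paths from its terminals to distinct untouched bags that
  use, before their end bag, only settled vertices and bags claimed by that side; the two sides use
  disjoint halves of the bags as end bags. The \<open>i\<close>-th solution path runs inside the union of the \<open>i\<close>-th
  paths of both sides and their two end bags, which touch each other. A settled vertex is in no end bag
  and on at most one path of either side; any other vertex has an untouched bag and hence at most one
  further bag, which leaves room for at most two solution paths as well.

  Each of the \<open>2 k\<close> fans takes \<open>5 k\<close> augmentations, and each augmentation is a search in a network with
  \<open>O(n)\<close> nodes, given by its matrix; this dominates the running time \<open>O(k^2 n^2)\<close>.
\<close>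

section \<open>Unit flows as orientations\<close>

text \<open>The number \<open>5\<close> comes from a loss count. Fewer than \<open>k\<close> deleted
  vertices meet at most \<open>k - 1\<close> paths of a fan and at most \<open>2 * (k - 1)\<close>
  bags, and a bag can serve two paths of the same fan, as the bag one of them claimed and as the end
  bag of another; so at most \<open>5 * (k - 1)\<close> paths are lost. A path claims the bags of a
  single vertex, so a terminal costs at most \<open>10 * k + 2\<close> bags including its own, and
  all terminals cost \<open>20 * k ^ 2 + 4 * k\<close>. Half of the \<open>60 * k ^ 2\<close> bags
  therefore keeps at least \<open>6 * k ^ 2 \<ge> 2 * k\<close> untouched ones, enough to survive
  every cut of fewer than \<open>k\<close> vertices and bags. Claims are never revoked: the settled
  set only grows, and terminals treated early stay robust while later fans claim more. Both the fans
  and the links are unit flows in one kind of network, whose inner nodes have indegree or outdegree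
  at most one; arc capacities then express disjointness in vertices and bags. Depth two allows at
  most \<open>2 * n\<close> bags, so the network has at most \<open>5 * n\<close> nodes.\<close>

definition outd :: "('x \<times> 'x) set \<Rightarrow> 'x \<Rightarrow> nat" where
  "outd R x = card (R `` {x})"

definition orients :: "('x \<times> 'x) set \<Rightarrow> ('x \<times> 'x) set \<Rightarrow> bool" where
  "orients E R \<longleftrightarrow> R \<subseteq> E \<union> E\<inverse> \<and> (\<forall>u v. (u, v) \<in> E \<longrightarrow> ((u, v) \<in> R) \<noteq> ((v, u) \<in> R))"

text \<open>A unit flow of value \<open>j\<close> is represented by its residual graph, which contains every arc of \<open>E\<close> either
  unchanged (no flow) or reversed (flow). During an augmentation, \<open>c\<close> is the node up to which the
  augmenting path has been reversed, starting at the sink \<open>z\<close>.\<close>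

definition residual_at ::
    "('x \<times> 'x) set \<Rightarrow> 'x \<Rightarrow> 'x \<Rightarrow> nat \<Rightarrow> 'x \<Rightarrow> ('x \<times> 'x) set \<Rightarrow> bool" where
  "residual_at E s z j c R \<longleftrightarrow> orients E R \<and>
     (\<forall>x. x \<noteq> z \<longrightarrow> outd R x + (if x = c then 1 else 0) + (if x = s then j else 0) = outd E x)"

abbreviation residual :: "('x \<times> 'x) set \<Rightarrow> 'x \<Rightarrow> 'x \<Rightarrow> nat \<Rightarrow> ('x \<times> 'x) set \<Rightarrow> bool" where
  "residual E s z j \<equiv> residual_at E s z j z"

definition flow_arcs :: "('x \<times> 'x) set \<Rightarrow> ('x \<times> 'x) set \<Rightarrow> ('x \<times> 'x) set" where
  "flow_arcs E R = {(u, v). (u, v) \<in> E \<and> (v, u) \<in> R}"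

lemma sum_outd:
  assumes "finite R" "finite A"
  shows "(\<Sum>x\<in>A. outd R x) = card (R \<inter> A \<times> UNIV)"
proof -
  have "R \<inter> A \<times> UNIV = Sigma A (\<lambda>x. R `` {x})" by auto
  moreover have "finite (R `` {x})" for x using assms(1) by (rule finite_Image)
  ultimately show ?thesis using assms(2) by (simp add: outd_def)
qed

text \<open>By \<open>thin\<close>, at most one unit of flow passes an inner node, so unit
  capacities on arcs act as capacities on nodes. Antisymmetry keeps a reversed arc distinguishable
  from an original one.\<close>

locale unit_network =
  fixes E :: "('x \<times> 'x) set" and s z :: 'x
  assumes finite_E: "finite E"
    and antisym_E: "(u, v) \<in> E \<Longrightarrow> (v, u) \<notin> E"
    and s_neq_z: "s \<noteq> z"
    and no_arc_into_s: "(u, s) \<notin> E"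
    and thin: "x \<noteq> s \<Longrightarrow> x \<noteq> z \<Longrightarrow> card (E `` {x}) \<le> 1 \<or> card (E\<inverse> `` {x}) \<le> 1"
begin

lemma finite_orients: "orients E R \<Longrightarrow> finite R"
  unfolding orients_def using finite_E by (meson finite_UnI finite_converse finite_subset)

lemma orientsD1: "orients E R \<Longrightarrow> (u, v) \<in> R \<Longrightarrow> (v, u) \<notin> R"
  unfolding orients_def by blast

lemma orientsD2: "orients E R \<Longrightarrow> (u, v) \<in> E \<Longrightarrow> (u, v) \<notin> R \<Longrightarrow> (v, u) \<in> R"
  unfolding orients_def by blast

lemma orientsD3: "orients E R \<Longrightarrow> (u, v) \<in> R \<Longrightarrow> (u, v) \<notin> E \<Longrightarrow> (v, u) \<in> E"
  unfolding orients_def by blast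

text \<open>Every arc inside \<open>A\<close> is present in exactly one of its two orientations,
  both of which lie inside \<open>A\<close>. Antisymmetry of \<open>E\<close> makes the map back to
  the original orientation well defined.\<close>

lemma card_orients_inside:
  assumes "orients E R"
  shows "card (R \<inter> A \<times> A) = card (E \<inter> A \<times> A)"
proof -
  let ?g = "\<lambda>(u, v). if (u, v) \<in> E then (u, v) else (v, u)"
  have "inj_on ?g (R \<inter> A \<times> A)"
    using orientsD1[OF assms] by (intro inj_onI) (auto split: if_splits)
  moreover have "?g ` (R \<inter> A \<times> A) = E \<inter> A \<times> A"
  proof
    show "?g ` (R \<inter> A \<times> A) \<subseteq> E \<inter> A \<times> A"
      using orientsD3[OF assms] by (auto split: if_splits)
    show "E \<inter> A \<times> A \<subseteq> ?g ` (R \<inter> A \<times> A)"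
    proof
      fix p assume p: "p \<in> E \<inter> A \<times> A"
      obtain u v where [simp]: "p = (u, v)" by force
      consider "(u, v) \<in> R" | "(v, u) \<in> R" using orientsD2[OF assms] p by auto
      then show "p \<in> ?g ` (R \<inter> A \<times> A)"
      proof cases
        case 1 then show ?thesis using p by (intro image_eqI[of _ _ "(u, v)"]) auto
      next
        case 2 then show ?thesis using p antisym_E[of u v] by (intro image_eqI[of _ _ "(v, u)"]) auto
      qed
    qed
  qed
  ultimately have "bij_betw ?g (R \<inter> A \<times> A) (E \<inter> A \<times> A)" by (simp add: bij_betw_def)
  then show ?thesis by (rule bij_betw_same_card)
qed

text \<open>The easy half of max-flow min-cut without any paths: sum the outdegree equation over
  \<open>A\<close>. Arcs inside \<open>A\<close> contribute equally to both sides, \<open>R\<close>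
  has no arc leaving \<open>A\<close>, and what remains are the arcs of \<open>E\<close> that leave
  \<open>A\<close>.\<close>

lemma residual_cut:
  assumes R: "residual E s z j R" and A: "finite A" "s \<in> A" "z \<notin> A" "R `` A \<subseteq> A"
  shows "card (E \<inter> A \<times> (- A)) = j"
proof -
  have o: "orients E R" using R by (simp add: residual_at_def)
  have "(\<Sum>x\<in>A. outd E x) = (\<Sum>x\<in>A. outd R x + (if x = s then j else 0))"
    using R A(3) by (intro sum.cong) (auto simp: residual_at_def split: if_splits)
  also have "\<dots> = (\<Sum>x\<in>A. outd R x) + j"
    using A by (simp add: sum.distrib)
  finally have "card (E \<inter> A \<times> UNIV) = card (R \<inter> A \<times> UNIV) + j"
    using sum_outd[OF finite_E A(1)] sum_outd[OF finite_orients[OF o] A(1)] by simp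
  moreover have "R \<inter> A \<times> UNIV = R \<inter> A \<times> A" using A(4) by auto
  moreover have "E \<inter> A \<times> UNIV = (E \<inter> A \<times> A) \<union> (E \<inter> A \<times> (- A))" by auto
  moreover have "card ((E \<inter> A \<times> A) \<union> (E \<inter> A \<times> (- A))) = card (E \<inter> A \<times> A) + card (E \<inter> A \<times> (- A))"
    using finite_E by (intro card_Un_disjoint) auto
  ultimately show ?thesis using card_orients_inside[OF o, of A] by simp
qed

lemma residual_initial: "residual E s z 0 E"
  unfolding residual_at_def orients_def using antisym_E by auto

text \<open>Reversing \<open>(u, c)\<close> gives \<open>c\<close> one more outgoing arc and
  \<open>u\<close> one fewer, so the missing unit moves from \<open>c\<close> to \<open>u\<close>.
  An augmenting path can thus be reversed arc by arc, starting at the sink, with an invariant that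
  holds in between.\<close>

lemma residual_at_step:
  assumes R: "residual_at E s z j c R" and uc: "(u, c) \<in> R" "u \<noteq> z" "u \<noteq> c"
  shows "residual_at E s z j u (insert (c, u) (R - {(u, c)}))" (is "residual_at _ _ _ _ _ ?R")
proof -
  have o: "orients E R" using R by (simp add: residual_at_def)
  note fin = finite_orients[OF o]
  have cu: "(c, u) \<notin> R" using orientsD1[OF o uc(1)] .
  have o': "orients E ?R"
    unfolding orients_def
  proof (intro conjI allI impI)
    show "?R \<subseteq> E \<union> E\<inverse>" using o uc(1) by (auto simp: orients_def)
    fix x y assume xy: "(x, y) \<in> E"
    have "((x, y) \<in> R) \<noteq> ((y, x) \<in> R)" using o xy by (simp add: orients_def)
    then show "((x, y) \<in> ?R) \<noteq> ((y, x) \<in> ?R)" using uc cu by auto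
  qed
  have outd': "outd ?R x = (if x = c then outd R x + 1 else if x = u then outd R x - 1 else outd R x)" for x
  proof -
    have fx: "finite (R `` {x})" using fin by (rule finite_Image)
    consider "x = c" | "x = u" "x \<noteq> c" | "x \<noteq> u" "x \<noteq> c" by blast
    then show ?thesis
    proof cases
      case 1
      have "?R `` {x} = insert u (R `` {x})" "u \<notin> R `` {x}" using 1 uc cu by auto
      then show ?thesis using 1 fx by (simp only: outd_def) simp
    next
      case 2
      have "?R `` {x} = R `` {x} - {c}" "c \<in> R `` {x}" using 2 uc by auto
      then show ?thesis using 2 fx by (simp only: outd_def) simp
    next
      case 3
      have "?R `` {x} = R `` {x}" using 3 by auto
      then show ?thesis using 3 by (simp only: outd_def) simp
    qed
  qed
  have pos: "outd R u > 0"
    using uc(1) fin unfolding outd_def by (metis Image_singleton_iff card_gt_0_iff empty_iff finite_Image)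
  have "outd ?R x + (if x = u then 1 else 0) + (if x = s then j else 0) = outd E x" if "x \<noteq> z" for x
  proof -
    have "outd R x + (if x = c then 1 else 0) + (if x = s then j else 0) = outd E x"
      using R that by (simp add: residual_at_def)
    then show ?thesis using outd'[of x] pos uc(3) by (cases "x = u"; cases "x = c") auto
  qed
  then show ?thesis using o' by (simp add: residual_at_def)
qed

text \<open>When the reversal arrives at the source, the unit missing there is just one more unit of
  value.\<close>

lemma residual_at_source: "residual_at E s z j s R \<longleftrightarrow> residual E s z (Suc j) R"
  using s_neq_z unfolding residual_at_def by (auto split: if_splits)

section \<open>Conservation, value and node degrees of the flow encoded by a residual graph\<close>

context
  fixes R j
  assumes R: "residual E s z j R"
begin

lemma finite_flow_arcs: "finite (flow_arcs E R)"
  by (rule finite_subset[OF _ finite_E]) (auto simp: flow_arcs_def)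

text \<open>A reversed arc takes one from the outdegree of its tail and gives one to its head.
  Outdegrees in \<open>R\<close> therefore record net inflow, which turns the equation of
  \<open>residual_at\<close> into conservation at inner nodes and into the flow value at the
  source.\<close>

lemma residual_image:
  "card (R `` {x}) + card (flow_arcs E R `` {x}) = card (E `` {x}) + card ((flow_arcs E R)\<inverse> `` {x})"
proof -
  let ?f = "flow_arcs E R"
  have o: "orients E R" using R by (simp add: residual_at_def)
  have fin: "finite (E `` {x})" "finite (?f `` {x})" "finite (?f\<inverse> `` {x})"
    using finite_E finite_flow_arcs by (auto intro: finite_Image)
  have "R `` {x} = (E `` {x} - ?f `` {x}) \<union> ?f\<inverse> `` {x}"
    using orientsD1[OF o] orientsD2[OF o] orientsD3[OF o] unfolding flow_arcs_def by blast
  moreover have "(E `` {x} - ?f `` {x}) \<inter> ?f\<inverse> `` {x} = {}"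
    using antisym_E unfolding flow_arcs_def by blast
  ultimately have "card (R `` {x}) = card (E `` {x} - ?f `` {x}) + card (?f\<inverse> `` {x})"
    using fin by (simp add: card_Un_disjoint)
  moreover have "card (E `` {x} - ?f `` {x}) = card (E `` {x}) - card (?f `` {x})" "card (?f `` {x}) \<le> card (E `` {x})"
    using fin by (auto simp: flow_arcs_def intro!: card_Diff_subset card_mono)
  ultimately show ?thesis by simp
qed

lemma flow_conservation:
  "x \<noteq> s \<Longrightarrow> x \<noteq> z \<Longrightarrow> card (flow_arcs E R `` {x}) = card ((flow_arcs E R)\<inverse> `` {x})"
  using residual_image[of x] R by (auto simp: residual_at_def outd_def split: if_splits)

lemma flow_value: "card (flow_arcs E R `` {s}) = j"
proof -
  have "(flow_arcs E R)\<inverse> `` {s} = {}" using no_arc_into_s by (auto simp: flow_arcs_def)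
  moreover have "outd R s + j = outd E s" using R s_neq_z by (auto simp: residual_at_def)
  ultimately show ?thesis using residual_image[of s] by (simp add: outd_def)
qed

text \<open>\<open>thin\<close> bounds one of the two flow degrees, and conservation carries the
  bound over to the other.\<close>

lemma flow_degree:
  assumes "x \<noteq> s" "x \<noteq> z"
  shows "card (flow_arcs E R `` {x}) \<le> 1" "card ((flow_arcs E R)\<inverse> `` {x}) \<le> 1"
proof -
  have "card (flow_arcs E R `` {x}) \<le> card (E `` {x})"
    using finite_E by (intro card_mono finite_Image) (auto simp: flow_arcs_def)
  moreover have "card ((flow_arcs E R)\<inverse> `` {x}) \<le> card (E\<inverse> `` {x})"
    using finite_E by (intro card_mono finite_Image) (auto simp: flow_arcs_def)
  ultimately show "card (flow_arcs E R `` {x}) \<le> 1" "card ((flow_arcs E R)\<inverse> `` {x}) \<le> 1"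
    using thin[OF assms] flow_conservation[OF assms] by auto
qed

lemma card_le_1_eq: "finite A \<Longrightarrow> card A \<le> Suc 0 \<Longrightarrow> a \<in> A \<Longrightarrow> b \<in> A \<Longrightarrow> a = b"
  using card_le_Suc0_iff_eq by blast

lemma flow_succ_unique:
  "(x, y) \<in> flow_arcs E R \<Longrightarrow> (x, y') \<in> flow_arcs E R \<Longrightarrow> x \<noteq> s \<Longrightarrow> x \<noteq> z \<Longrightarrow> y = y'"
  using flow_degree(1)[of x] finite_flow_arcs
  by (intro card_le_1_eq[of "flow_arcs E R `` {x}"]) (auto intro: finite_Image)

lemma flow_pred_unique:
  "(y, x) \<in> flow_arcs E R \<Longrightarrow> (y', x) \<in> flow_arcs E R \<Longrightarrow> x \<noteq> z \<Longrightarrow> y = y'"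
  using flow_degree(2)[of x] finite_flow_arcs no_arc_into_s
  by (intro card_le_1_eq[of "(flow_arcs E R)\<inverse> `` {x}"]) (auto intro: finite_Image simp: flow_arcs_def)

text \<open>Otherwise conservation holds throughout the set reachable from \<open>y\<close>, so as
  many flow arcs start in it as end in it. But every arc that starts in it also ends in it, while
  \<open>(s, y)\<close> ends in it and starts outside.\<close>

lemma flow_reaches_sink:
  assumes sy: "(s, y) \<in> flow_arcs E R"
  shows "(y, z) \<in> (flow_arcs E R)\<^sup>*"
proof (rule ccontr)
  let ?f = "flow_arcs E R"
  let ?A = "?f\<^sup>* `` {y}"
  assume "(y, z) \<notin> ?f\<^sup>*"
  have ys: "y \<noteq> s" using sy no_arc_into_s by (auto simp: flow_arcs_def)
  have sA: "s \<notin> ?A"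
  proof
    assume "s \<in> ?A"
    then have "(y, s) \<in> ?f\<^sup>+" using ys by (auto simp: rtrancl_eq_or_trancl)
    then obtain x where "(x, s) \<in> ?f" by (meson tranclE)
    then show False using no_arc_into_s by (auto simp: flow_arcs_def)
  qed
  have finA: "finite ?A"
  proof (rule finite_subset)
    show "?A \<subseteq> insert y (Range ?f)" by (auto elim: rtranclE)
    show "finite (insert y (Range ?f))" using finite_flow_arcs by (simp add: finite_Range)
  qed
  have "(\<Sum>x\<in>?A. outd ?f x) = (\<Sum>x\<in>?A. outd (?f\<inverse>) x)"
    unfolding outd_def using sA \<open>(y, z) \<notin> ?f\<^sup>*\<close> by (intro sum.cong refl flow_conservation) auto
  then have eq: "card (?f \<inter> ?A \<times> UNIV) = card (?f\<inverse> \<inter> ?A \<times> UNIV)"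
    using finA finite_flow_arcs by (simp add: sum_outd)
  have "?f\<inverse> \<inter> ?A \<times> UNIV = (?f \<inter> UNIV \<times> ?A)\<inverse>" by auto
  then have "card (?f\<inverse> \<inter> ?A \<times> UNIV) = card (?f \<inter> UNIV \<times> ?A)" by simp
  moreover have "?f \<inter> ?A \<times> UNIV \<subset> ?f \<inter> UNIV \<times> ?A"
  proof
    show "?f \<inter> ?A \<times> UNIV \<subseteq> ?f \<inter> UNIV \<times> ?A" by (auto intro: rtrancl_into_rtrancl)
    show "?f \<inter> ?A \<times> UNIV \<noteq> ?f \<inter> UNIV \<times> ?A" using sy sA by blast
  qed
  then have "card (?f \<inter> ?A \<times> UNIV) < card (?f \<inter> UNIV \<times> ?A)"
    using finite_flow_arcs by (intro psubset_card_mono) auto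
  ultimately show False using eq by simp
qed

end

end

section \<open>The split network of a digraph with bags\<close>

locale bag_network =
  fixes n t :: nat and B :: "nat \<Rightarrow> nat set" and a :: "nat \<Rightarrow> nat \<Rightarrow> bool"
    and en al sk src :: "nat \<Rightarrow> bool"
begin

text \<open>A vertex \<open>v\<close> is split into \<open>v\<close> and \<open>n + v\<close>, bag \<open>b\<close> is the node \<open>2 * n + b\<close>, and the sink and
  the source come last. The predicates \<open>en\<close> and \<open>al\<close> select the vertices that may be entered and those
  that may be left along arcs of the graph, \<open>sk\<close> the target bags, and \<open>src\<close> the starting vertices.\<close>

abbreviation "snk \<equiv> 2 * n + t"
abbreviation "sor \<equiv> Suc (2 * n + t)"

definition net_arc :: "nat \<Rightarrow> nat \<Rightarrow> bool" where
  "net_arc x y \<longleftrightarrow>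
     x < n \<and> y = n + x \<and> en x \<or>
     n \<le> x \<and> x < 2 * n \<and> y < n \<and> y \<noteq> x - n \<and> al (x - n) \<and> a (x - n) y \<or>
     n \<le> x \<and> x < 2 * n \<and> 2 * n \<le> y \<and> y < 2 * n + t \<and> sk (y - 2 * n) \<and> x - n \<in> B (y - 2 * n) \<or>
     2 * n \<le> x \<and> x < 2 * n + t \<and> y = snk \<or>
     x = sor \<and> y < n \<and> src y"

definition net :: "(nat \<times> nat) set" where "net = {(x, y). net_arc x y}"

lemma net_bounds: "(x, y) \<in> net \<Longrightarrow> x < 2 * n + t + 2 \<and> y < 2 * n + t + 2"
  by (auto simp: net_def net_arc_def)

lemma net_in: "x < n \<Longrightarrow> (x, y) \<in> net \<longleftrightarrow> y = n + x \<and> en x"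
  by (auto simp: net_def net_arc_def)

lemma net_into_out: "v < n \<Longrightarrow> (x, n + v) \<in> net \<longleftrightarrow> x = v \<and> en v"
  by (auto simp: net_def net_arc_def)

lemma net_bag: "b < t \<Longrightarrow> (2 * n + b, y) \<in> net \<longleftrightarrow> y = snk"
  by (auto simp: net_def net_arc_def)

lemma net_source: "(sor, y) \<in> net \<longleftrightarrow> y < n \<and> src y"
  by (auto simp: net_def net_arc_def)

lemma net_out: "v < n \<Longrightarrow> (n + v, y) \<in> net \<longleftrightarrow>
    y < n \<and> y \<noteq> v \<and> al v \<and> a v y \<or> (\<exists>b<t. y = 2 * n + b \<and> sk b \<and> v \<in> B b)"
proof -
  assume "v < n"
  have "(n \<le> n + v \<and> n + v < 2 * n \<and> 2 * n \<le> y \<and> y < 2 * n + t \<and> sk (y - 2 * n) \<and> n + v - n \<in> B (y - 2 * n))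
     \<longleftrightarrow> (\<exists>b<t. y = 2 * n + b \<and> sk b \<and> v \<in> B b)" (is "?l = ?r")
  proof
    assume ?l
    then show ?r by (intro exI[of _ "y - 2 * n"]) auto
  next
    assume ?r then show ?l using \<open>v < n\<close> by auto
  qed
  then show ?thesis using \<open>v < n\<close> by (auto simp: net_def net_arc_def)
qed

text \<open>For \<open>thin\<close>: an entry copy \<open>v\<close> can only be left towards
  \<open>n + v\<close>, the exit copy \<open>n + v\<close> can only be entered from
  \<open>v\<close>, and a bag can only be left towards the sink.\<close>

sublocale unit_network net sor snk
proof
  show "finite net"
    by (rule finite_subset[of _ "{..<2 * n + t + 2} \<times> {..<2 * n + t + 2}"]) (auto dest: net_bounds)
  fix u v assume "(u, v) \<in> net" then show "(v, u) \<notin> net"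
    by (auto simp: net_def net_arc_def)
next
  show "sor \<noteq> snk" by simp
  fix u show "(u, sor) \<notin> net" by (auto simp: net_def net_arc_def)
next
  fix x assume x: "x \<noteq> sor" "x \<noteq> snk"
  have le1: "card A \<le> 1" if "A \<subseteq> {c}" for A :: "nat set" and c
    using that by (metis card.empty card_insert_disjoint empty_iff finite.emptyI le_refl subset_singletonD One_nat_def zero_le_one card_1_singleton_iff)
  consider "x < n" | "n \<le> x" "x < 2 * n" | "2 * n \<le> x" "x < 2 * n + t" | "2 * n + t < x" using x by linarith
  then show "card (net `` {x}) \<le> 1 \<or> card (net\<inverse> `` {x}) \<le> 1"
  proof cases
    case 1
    then have "net `` {x} \<subseteq> {n + x}" by (auto simp: net_in)
    then show ?thesis using le1 by blast
  next
    case 2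
    then have "net\<inverse> `` {x} \<subseteq> {x - n}" using net_into_out[of "x - n"] by auto
    then show ?thesis using le1 by blast
  next
    case 3
    then have "net `` {x} \<subseteq> {snk}" using net_bag[of "x - 2 * n"] by auto
    then show ?thesis using le1 by blast
  next
    case 4
    \<comment> \<open>Numbers beyond the source are not nodes; the successor set is empty and
      \<open>0\<close> is a dummy.\<close>
    then have "net `` {x} \<subseteq> {0}" using x by (auto simp: net_def net_arc_def)
    then show ?thesis using le1 by blast
  qed
qed

lemma residual_bounds: "residual_at net sor snk j c R \<Longrightarrow> (x, y) \<in> R \<Longrightarrow> x < 2 * n + t + 2 \<and> y < 2 * n + t + 2"
  by (auto simp: residual_at_def orients_def dest!: subsetD dest: net_bounds)

text \<open>If no augmenting path exists, charge every arc of the cut to the vertex or bag at its head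
  (for arcs into the sink: at its tail).\<close>

lemma blocked_cut:
  assumes R: "residual net sor snk j R" and no: "(sor, snk) \<notin> R\<^sup>*"
  obtains C D P where "finite C" "finite D" "card C + card D \<le> j"
    "\<And>y. y < n \<Longrightarrow> src y \<Longrightarrow> y \<notin> C \<Longrightarrow> P y"
    "\<And>v u. P v \<Longrightarrow> v < n \<Longrightarrow> v \<notin> C \<Longrightarrow> en v \<Longrightarrow> al v \<Longrightarrow> a v u \<Longrightarrow> u < n \<Longrightarrow> u \<notin> C \<Longrightarrow> P u"
    "\<And>v b. P v \<Longrightarrow> v < n \<Longrightarrow> v \<notin> C \<Longrightarrow> en v \<Longrightarrow> v \<in> B b \<Longrightarrow> b < t \<Longrightarrow> sk b \<Longrightarrow> b \<in> D"
proof -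
  define A where "A = R\<^sup>* `` {sor}"
  have sA: "sor \<in> A" and zA: "snk \<notin> A" using no by (auto simp: A_def)
  have finA: "finite A"
  proof (rule finite_subset)
    show "A \<subseteq> {..<2 * n + t + 2}"
    proof
      fix x assume "x \<in> A"
      then have "(sor, x) \<in> R\<^sup>*" by (simp add: A_def)
      then show "x \<in> {..<2 * n + t + 2}"
        by (cases rule: rtranclE) (auto dest: residual_bounds[OF R])
    qed
  qed simp
  have clA: "R `` A \<subseteq> A" by (auto simp: A_def intro: rtrancl_into_rtrancl)
  define \<delta> where "\<delta> = net \<inter> A \<times> (- A)"
  have card\<delta>: "card \<delta> = j" unfolding \<delta>_def by (rule residual_cut[OF R finA sA zA clA])
  have fin\<delta>: "finite \<delta>" using finite_E by (simp add: \<delta>_def)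
  define C where "C = {v. v < n \<and> (\<exists>x. (x, v) \<in> \<delta> \<or> (x, n + v) \<in> \<delta>)}"
  define D where "D = {b. b < t \<and> ((\<exists>x. (x, 2 * n + b) \<in> \<delta>) \<or> (2 * n + b, snk) \<in> \<delta>)}"
  define \<kappa> where "\<kappa> = (\<lambda>(x, y). if y < n then y else if y < 2 * n then y - n else if y < 2 * n + t then y else x)"
  have fin: "finite C" "finite D" by (simp_all add: C_def D_def)
  have "C \<subseteq> \<kappa> ` \<delta>"
  proof
    fix v assume "v \<in> C"
    then consider x where "v < n" "(x, v) \<in> \<delta>" | x where "v < n" "(x, n + v) \<in> \<delta>" by (auto simp: C_def)
    then show "v \<in> \<kappa> ` \<delta>"
    proof cases
      case 1 then show ?thesis by (intro image_eqI[of _ _ "(x, v)"]) (auto simp: \<kappa>_def)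
    next
      case 2 then show ?thesis by (intro image_eqI[of _ _ "(x, n + v)"]) (auto simp: \<kappa>_def)
    qed
  qed
  moreover have "(\<lambda>b. 2 * n + b) ` D \<subseteq> \<kappa> ` \<delta>"
  proof
    fix y assume "y \<in> (\<lambda>b. 2 * n + b) ` D"
    then obtain b where b: "b \<in> D" "y = 2 * n + b" by auto
    then consider x where "b < t" "(x, 2 * n + b) \<in> \<delta>" | "b < t" "(2 * n + b, snk) \<in> \<delta>" by (auto simp: D_def)
    then show "y \<in> \<kappa> ` \<delta>"
    proof cases
      case 1 then show ?thesis using b by (intro image_eqI[of _ _ "(x, 2 * n + b)"]) (auto simp: \<kappa>_def)
    next
      case 2 then show ?thesis using b by (intro image_eqI[of _ _ "(2 * n + b, snk)"]) (auto simp: \<kappa>_def)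
    qed
  qed
  ultimately have "card (C \<union> (\<lambda>b. 2 * n + b) ` D) \<le> card (\<kappa> ` \<delta>)"
    using fin\<delta> by (intro card_mono) auto
  moreover have "card (C \<union> (\<lambda>b. 2 * n + b) ` D) = card C + card ((\<lambda>b. 2 * n + b) ` D)"
    using fin by (intro card_Un_disjoint) (auto simp: C_def)
  moreover have "card ((\<lambda>b. 2 * n + b) ` D) = card D" by (intro card_image) (auto simp: inj_on_def)
  moreover have "card (\<kappa> ` \<delta>) \<le> j" using card_image_le[OF fin\<delta>] card\<delta> by metis
  ultimately have card: "card C + card D \<le> j" by linarith
  have step: "y \<in> A" if "x \<in> A" "(x, y) \<in> net" "(x, y) \<notin> \<delta>" for x y
    using that by (auto simp: \<delta>_def)
  have mid: "n + v \<in> A" if "v \<in> A" "v < n" "v \<notin> C" "en v" for v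
    using that by - (rule step[of v], auto simp: net_in C_def)
  show ?thesis
  proof (rule that[OF fin card, of "\<lambda>v. v \<in> A"])
    fix y assume "y < n" "src y" "y \<notin> C"
    then show "y \<in> A" using sA by - (rule step[of sor], auto simp: net_source C_def)
  next
    fix v u assume *: "v \<in> A" "v < n" "v \<notin> C" "en v" "al v" "a v u" "u < n" "u \<notin> C"
    \<comment> \<open>The network contains no arcs for loops, since the arc from
      \<open>n + v\<close> to \<open>v\<close> would oppose the split arc of \<open>v\<close>. For a
      loop there is nothing to show.\<close>
    show "u \<in> A"
    proof (cases "u = v")
      case False
      then show ?thesis using * mid[of v] by - (rule step[of "n + v"], auto simp: net_out C_def)
    qed (use * in simp)
  next
    fix v b assume *: "v \<in> A" "v < n" "v \<notin> C" "en v" "v \<in> B b" "b < t" "sk b"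
    show "b \<in> D"
    proof (rule ccontr)
      assume "b \<notin> D"
      then have "2 * n + b \<in> A" using * mid[of v] by - (rule step[of "n + v"], auto simp: net_out D_def)
      then have "snk \<in> A" using * \<open>b \<notin> D\<close> by - (rule step[of "2 * n + b"], auto simp: net_bag D_def)
      then show False using zA by simp
    qed
  qed
qed

subsection \<open>Path decomposition\<close>

text \<open>One flow path, reduced to its vertices and its end bag. The arc from the source is left
  out, so that rows can be built from the back by prepending vertices.\<close>

definition row :: "(nat \<times> nat) set \<Rightarrow> nat list \<Rightarrow> nat \<Rightarrow> bool" where
  "row f p b \<longleftrightarrow> p \<noteq> [] \<and> set p \<subseteq> {..<n} \<and> b < t \<and>
     (\<forall>l. Suc l < length p \<longrightarrow> (n + p ! l, p ! Suc l) \<in> f) \<and> (n + last p, 2 * n + b) \<in> f \<and>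
     (\<forall>v\<in>set p. (v, n + v) \<in> f)"

lemma row_nth: "row f p b \<Longrightarrow> l < length p \<Longrightarrow> p ! l < n"
  unfolding row_def by (meson lessThan_iff nth_mem subsetD)

lemma row_Cons:
  assumes "row f p b" "v < n" "(n + v, hd p) \<in> f" "(v, n + v) \<in> f"
  shows "row f (v # p) b"
proof -
  have "(n + (v # p) ! l, (v # p) ! Suc l) \<in> f" if "Suc l < length (v # p)" for l
    using assms that by (cases l) (auto simp: row_def hd_conv_nth)
  then show ?thesis using assms by (auto simp: row_def)
qed

text \<open>Removes a closed detour at a repeated vertex; the arcs that remain are arcs of the old
  row.\<close>

lemma row_cut:
  assumes "row f (xs @ [v] @ ys @ [v] @ zs) b"
  shows "row f (xs @ [v] @ zs) b"
proof -
  let ?p = "xs @ [v] @ ys @ [v] @ zs" and ?q = "xs @ [v] @ zs"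
  have p: "(n + ?p ! l, ?p ! Suc l) \<in> f" if "Suc l < length ?p" for l
    using assms that by (simp add: row_def)
  have "(n + ?q ! l, ?q ! Suc l) \<in> f" if l: "Suc l < length ?q" for l
  proof (cases "l < length xs")
    case True
    then have "?q ! l = ?p ! l" "?q ! Suc l = ?p ! Suc l" by (auto simp: nth_append)
    then show ?thesis using p[of l] True by simp
  next
    case False
    then obtain d where d: "l = length xs + d" by (metis add.commute le_Suc_ex linorder_not_less)
    \<comment> \<open>The position in the old row that corresponds to \<open>l\<close>:
      \<open>d\<close> places after the second occurrence of \<open>v\<close>.\<close>
    define m where "m = length (xs @ [v] @ ys) + d"
    have "?q ! l = ([v] @ zs) ! d" "?q ! Suc l = ([v] @ zs) ! Suc d"
      using nth_append_length_plus[of xs "[v] @ zs"] d by (metis add_Suc_right)+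
    moreover have "?p ! m = ([v] @ zs) ! d" "?p ! Suc m = ([v] @ zs) ! Suc d"
      using nth_append_length_plus[of "xs @ [v] @ ys" "[v] @ zs"] m_def by (metis add_Suc_right append.assoc)+
    ultimately show ?thesis using p[of m] l d by (simp add: m_def)
  qed
  then show ?thesis using assms by (auto simp: row_def)
qed

context
  fixes R j
  assumes R: "residual net sor snk j R"
begin

abbreviation "f \<equiv> flow_arcs net R"

lemma f_net: "(x, y) \<in> f \<Longrightarrow> (x, y) \<in> net" by (simp add: flow_arcs_def)

text \<open>What enters \<open>v\<close> must leave it again, and the split arc is the only
  exit.\<close>

lemma flow_split_arc:
  assumes "v < n" "(x, v) \<in> f"
  shows "(v, n + v) \<in> f"
proof -
  have "card (f\<inverse> `` {v}) > 0" using assms finite_flow_arcs[OF R]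
    by (metis Image_singleton_iff card_gt_0_iff converse_iff empty_iff finite_Image finite_converse)
  then have "card (f `` {v}) > 0" using flow_conservation[OF R, of v] assms by simp
  then obtain y where "(v, y) \<in> f" by (metis Image_singleton_iff all_not_in_conv card.empty less_irrefl)
  then show ?thesis using f_net[of v y] assms by (auto simp: net_in)
qed

text \<open>Induction from the sink backwards along flow arcs. Entry and exit copies alternate on
  the way, so the claim treats both kinds of node at once, each under the assumption that flow
  passes its split arc.\<close>

lemma row_exists_aux:
  "(x, snk) \<in> f\<^sup>* \<Longrightarrow> (x < n \<longrightarrow> (v, n + v) \<in> f \<longrightarrow> x = v \<longrightarrow> (\<exists>p b. row f p b \<and> hd p = x)) \<and>
     (n \<le> x \<and> x < 2 * n \<longrightarrow> (x - n, x) \<in> f \<longrightarrow> (\<exists>p b. row f p b \<and> hd p = x - n))"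
proof (induction arbitrary: v rule: converse_rtrancl_induct)
  case base
  then show ?case by simp
next
  case (step x y)
  show ?case
  proof (intro conjI impI)
    assume x: "x < n" and v: "(v, n + v) \<in> f" "x = v"
    have "y = n + x" using f_net[OF step.hyps(1)] x by (simp add: net_in)
    then show "\<exists>p b. row f p b \<and> hd p = x"
      using step.IH x v by auto
  next
    assume x: "n \<le> x \<and> x < 2 * n" and fx: "(x - n, x) \<in> f"
    then obtain w where w: "x = n + w" "w < n" by (metis add_less_cancel_left le_Suc_ex mult_2)
    from f_net[OF step.hyps(1)] w net_out[of w y]
    consider "y < n" | b where "b < t" "y = 2 * n + b" by auto
    then show "\<exists>p b. row f p b \<and> hd p = x - n"
    proof cases
      case 1
      then obtain p b where "row f p b" "hd p = y"
        using step.IH[of y] flow_split_arc[OF 1 step.hyps(1)] by auto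
      then have "row f (w # p) b" using w fx step.hyps(1) by (intro row_Cons) auto
      then show ?thesis using w by (intro exI[of _ "w # p"]) auto
    next
      case 2
      then have "row f [w] b" using w fx step.hyps(1) by (auto simp: row_def)
      then show ?thesis using w by (intro exI[of _ "[w]"]) auto
    qed
  qed
qed

text \<open>A row of minimal length is distinct, because \<open>row_cut\<close> would shorten it at
  a repetition.\<close>

lemma row_exists:
  assumes "(sor, y) \<in> f"
  obtains p b where "row f p b" "hd p = y" "distinct p"
proof -
  have y: "y < n" using f_net[OF assms] by (simp add: net_source)
  define Q where "Q = (\<lambda>p. \<exists>b. row f p b \<and> hd p = y)"
  have "\<exists>p. Q p"
    using row_exists_aux[OF flow_reaches_sink[OF R assms], of y] flow_split_arc[OF y assms] y
    by (auto simp: Q_def)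
  then obtain p where p: "Q p" and min: "\<And>q. Q q \<Longrightarrow> length p \<le> length q"
    using ex_has_least_nat[of Q _ length] by blast
  have "distinct p"
  proof (rule ccontr)
    assume "\<not> distinct p"
    then obtain xs ys zs v where d: "p = xs @ [v] @ ys @ [v] @ zs" using not_distinct_decomp by blast
    obtain b where b: "row f p b" "hd p = y" using p by (auto simp: Q_def)
    have "Q (xs @ [v] @ zs)" unfolding Q_def
      using row_cut[of f xs v ys zs b] b d by (auto simp: hd_append)
    then show False using min[of "xs @ [v] @ zs"] d by simp
  qed
  then show ?thesis using p that by (auto simp: Q_def)
qed

text \<open>Flow predecessors are unique, so from a common vertex both rows can be followed
  backwards in step. They reach their heads together: a head has the source as its predecessor,
  every later vertex has an exit copy.\<close>

lemma rows_disjoint: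
  assumes p: "row f p b" "(sor, hd p) \<in> f" and q: "row f q b'" "(sor, hd q) \<in> f"
    and "l < length p" "l' < length q" "p ! l = q ! l'"
  shows "hd p = hd q"
  using assms(5-)
proof (induction l arbitrary: l')
  case 0
  show ?case
  proof (cases l')
    case 0
    then show ?thesis using p q \<open>p ! 0 = q ! l'\<close> by (simp add: row_def hd_conv_nth)
  next
    case (Suc m)
    have "(n + q ! m, q ! l') \<in> f" using q Suc \<open>l' < length q\<close> by (simp add: row_def)
    moreover have "(sor, q ! l') \<in> f" using p 0 by (simp add: row_def hd_conv_nth)
    moreover have ql: "q ! l' < n" "q ! m < n" using row_nth[OF q(1)] Suc \<open>l' < length q\<close> by auto
    ultimately have "n + q ! m = sor" by (intro flow_pred_unique[OF R]) auto
    then show ?thesis using ql by simp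
  qed
next
  case (Suc l)
  have pl: "(n + p ! l, p ! Suc l) \<in> f" "p ! l < n" "p ! Suc l < n"
    using p Suc.prems(1) row_nth[OF p(1)] by (auto simp: row_def)
  show ?case
  proof (cases l')
    case 0
    then have "(sor, p ! Suc l) \<in> f" using q Suc.prems by (simp add: row_def hd_conv_nth)
    then have "n + p ! l = sor" using pl by (intro flow_pred_unique[OF R, of _ "p ! Suc l"]) auto
    then show ?thesis using pl by simp
  next
    case (Suc m)
    have "(n + q ! m, p ! Suc l) \<in> f" using q Suc Suc.prems by (simp add: row_def)
    then have "n + p ! l = n + q ! m" using pl by (intro flow_pred_unique[OF R, of _ "p ! Suc l"]) auto
    then show ?thesis using Suc.IH[of m] Suc.prems Suc by simp
  qed
qed

lemma row_bag_unique:
  assumes "row f p b" "(sor, hd p) \<in> f" "row f q b" "(sor, hd q) \<in> f"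
  shows "hd p = hd q"
proof -
  have "b < t" using assms by (simp add: row_def)
  then have "n + last p = n + last q"
    using assms by (intro flow_pred_unique[OF R, of _ "2 * n + b"]) (auto simp: row_def)
  then show ?thesis using assms
    by (intro rows_disjoint[OF assms, of "length p - 1" "length q - 1"]) (auto simp: row_def last_conv_nth)
qed

text \<open>In \<open>net\<close> the exit copy \<open>n + v\<close> is entered from
  \<open>v\<close> only, so any other residual arc into it is a reversed flow arc. This is how the
  program reads successors along the flow off the matrix of \<open>R\<close>.\<close>

lemma flow_successor_iff:
  assumes "v < n" "x \<noteq> v"
  shows "(x, n + v) \<in> R \<longleftrightarrow> (n + v, x) \<in> f"
proof
  assume x: "(x, n + v) \<in> R"
  have "orients net R" using R by (simp add: residual_at_def)
  then have "(n + v, x) \<in> net" using orientsD3[OF _ x] assms by (auto simp: net_into_out)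
  then show "(n + v, x) \<in> f" using x by (simp add: flow_arcs_def)
qed (simp add: flow_arcs_def)

lemma flow_source_iff: "(y, sor) \<in> R \<longleftrightarrow> (sor, y) \<in> f"
proof
  assume x: "(y, sor) \<in> R"
  have "orients net R" using R by (simp add: residual_at_def)
  then have "(sor, y) \<in> net" using orientsD3[OF _ x] no_arc_into_s by auto
  then show "(sor, y) \<in> f" using x by (simp add: flow_arcs_def)
qed (simp add: flow_arcs_def)

lemma row_facts:
  assumes "row f p b"
  shows "last p \<in> B b" "sk b" "b < t" "p \<noteq> []" "set p \<subseteq> {..<n}" "\<And>v. v \<in> set p \<Longrightarrow> en v"
    "\<And>l. Suc l < length p \<Longrightarrow> a (p ! l) (p ! Suc l) \<and> al (p ! l)"
    "\<And>x l. l < length p \<Longrightarrow> x \<noteq> p ! l \<Longrightarrow> (x, n + p ! l) \<in> R \<longleftrightarrow>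
       (if Suc l < length p then x = p ! Suc l else x = 2 * n + b)"
proof -
  note r = assms[unfolded row_def]
  have b: "b < t" and ne: "p \<noteq> []" and sub: "set p \<subseteq> {..<n}" using r by auto
  have lf: "last p \<in> set p" using ne by simp
  then have "last p < n" using sub by auto
  then have "(n + last p, 2 * n + b) \<in> net" using r f_net by blast
  then show "last p \<in> B b" "sk b" using net_out[of "last p"] \<open>last p < n\<close> by auto
  show "b < t" "p \<noteq> []" "set p \<subseteq> {..<n}" using b ne sub by auto
  show "en v" if "v \<in> set p" for v
    using that r f_net[of v "n + v"] sub by (auto simp: net_in)
  show "a (p ! l) (p ! Suc l) \<and> al (p ! l)" if "Suc l < length p" for l
  proof -
    have "p ! l < n" "p ! Suc l < n" using row_nth[OF assms] that by auto
    moreover have "(n + p ! l, p ! Suc l) \<in> net" using r that f_net by blast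
    ultimately show ?thesis using net_out[of "p ! l" "p ! Suc l"] by auto
  qed
  show "(x, n + p ! l) \<in> R \<longleftrightarrow> (if Suc l < length p then x = p ! Suc l else x = 2 * n + b)"
    if l: "l < length p" "x \<noteq> p ! l" for x l
  proof -
    have pl: "p ! l < n" using row_nth[OF assms] l by auto
    define y where "y = (if Suc l < length p then p ! Suc l else 2 * n + b)"
    have "(n + p ! l, y) \<in> f"
    proof (cases "Suc l < length p")
      case False
      then have "l = length p - 1" using l by simp
      then have "last p = p ! l" using ne by (simp add: last_conv_nth)
      moreover have "(n + last p, 2 * n + b) \<in> f" using r by blast
      ultimately show ?thesis using False by (simp add: y_def)
    next
      case True
      then have "(n + p ! l, p ! Suc l) \<in> f" using r by blast
      then show ?thesis using True by (simp add: y_def)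
    qed
    then have "(n + p ! l, x) \<in> f \<longleftrightarrow> x = y"
      using flow_succ_unique[OF R, of "n + p ! l" x y] pl by auto
    then show ?thesis using flow_successor_iff[OF pl l(2)] by (simp add: y_def)
  qed
qed

end

end

section \<open>Routing through bags\<close>

locale bag_system =
  fixes n t :: nat and B :: "nat \<Rightarrow> nat set"
  assumes bag_sub: "b < t \<Longrightarrow> B b \<subseteq> {..<n}"
    and bag_ne: "b < t \<Longrightarrow> B b \<noteq> {}"
    and depth: "card {b. b < t \<and> v \<in> B b} \<le> 2"
begin

text \<open>A state \<open>st\<close> assigns to every bag \<open>0\<close> (untouched) or the side that claimed it.\<close>

definition settled :: "(nat \<Rightarrow> nat) \<Rightarrow> nat set" where
  "settled st = {v. v < n \<and> (\<forall>b<t. v \<in> B b \<longrightarrow> st b \<noteq> 0)}"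

definition claim :: "(nat \<Rightarrow> nat) \<Rightarrow> nat \<Rightarrow> nat \<Rightarrow> nat \<Rightarrow> nat" where
  "claim st s v = (\<lambda>b. if b < t \<and> v \<in> B b \<and> st b = 0 then s else st b)"

definition used :: "(nat \<Rightarrow> nat) \<Rightarrow> nat set" where
  "used st = {b. b < t \<and> st b \<noteq> 0}"

definition extends :: "(nat \<Rightarrow> nat) \<Rightarrow> (nat \<Rightarrow> nat) \<Rightarrow> bool" where
  "extends st st' \<longleftrightarrow> (\<forall>b. st b \<noteq> 0 \<longrightarrow> st' b = st b)"

definition allowed :: "(nat \<Rightarrow> nat) \<Rightarrow> nat \<Rightarrow> nat \<Rightarrow> bool" where
  "allowed st s v \<longleftrightarrow> v \<in> settled st \<or> (\<exists>b<t. v \<in> B b \<and> st b = s)"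

lemma finite_used [simp]: "finite (used st)" by (simp add: used_def)

lemma extends_refl [simp]: "extends st st" by (simp add: extends_def)

lemma extends_trans: "extends st st' \<Longrightarrow> extends st' st'' \<Longrightarrow> extends st st''"
  by (auto simp: extends_def)

lemma settled_extends: "extends st st' \<Longrightarrow> settled st \<subseteq> settled st'"
  by (auto simp: settled_def extends_def)

lemma claim_extends: "extends st (claim st s v)" by (auto simp: extends_def claim_def)

lemma claim_settled: "s \<noteq> 0 \<Longrightarrow> v < n \<Longrightarrow> v \<in> settled (claim st s v)"
  by (auto simp: settled_def claim_def)

lemma card_used_claim: "card (used (claim st s v)) \<le> card (used st) + 2"
proof -
  have "used (claim st s v) \<subseteq> used st \<union> {b. b < t \<and> v \<in> B b}"
    by (auto simp: used_def claim_def split: if_splits)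
  then have "card (used (claim st s v)) \<le> card (used st \<union> {b. b < t \<and> v \<in> B b})"
    by (intro card_mono) auto
  also have "\<dots> \<le> card (used st) + card {b. b < t \<and> v \<in> B b}" by (rule card_Un_le)
  finally show ?thesis using depth[of v] by simp
qed

lemma card_hit_bags: "finite C \<Longrightarrow> card {b. b < t \<and> B b \<inter> C \<noteq> {}} \<le> 2 * card C"
proof -
  assume C: "finite C"
  have "{b. b < t \<and> B b \<inter> C \<noteq> {}} = (\<Union>v\<in>C. {b. b < t \<and> v \<in> B b})" by auto
  then have "card {b. b < t \<and> B b \<inter> C \<noteq> {}} \<le> (\<Sum>v\<in>C. card {b. b < t \<and> v \<in> B b})"
    using card_UN_le[OF C] by simp
  also have "\<dots> \<le> (\<Sum>v\<in>C. 2)" using depth by (intro sum_mono) auto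
  finally show ?thesis by simp
qed

lemma unhit_bag:
  assumes "finite C" "finite D" "X \<subseteq> {..<t}" "card D + 2 * card C < card X"
  obtains b where "b \<in> X" "b \<notin> D" "B b \<inter> C = {}"
proof -
  have "card (D \<union> {b. b < t \<and> B b \<inter> C \<noteq> {}}) \<le> card D + card {b. b < t \<and> B b \<inter> C \<noteq> {}}"
    by (rule card_Un_le)
  then have "card (D \<union> {b. b < t \<and> B b \<inter> C \<noteq> {}}) < card X"
    using card_hit_bags[OF assms(1)] assms(4) by linarith
  then have "\<not> X \<subseteq> D \<union> {b. b < t \<and> B b \<inter> C \<noteq> {}}"
    using assms(2) card_mono[of "D \<union> {b. b < t \<and> B b \<inter> C \<noteq> {}}" X] by auto
  then show ?thesis using that assms(3) by auto
qed

lemma card_unused: "card {b. b < t \<and> st b = 0} = t - card (used st)"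
proof -
  have "{b. b < t \<and> st b = 0} = {..<t} - used st" by (auto simp: used_def)
  moreover have "card ({..<t} - used st) = card {..<t} - card (used st)"
    by (intro card_Diff_subset) (auto simp: used_def)
  ultimately show ?thesis by simp
qed

end

text \<open>Connectivity is assumed in the form in which the fans use it, as reachability after
  deleting fewer than \<open>5 * k\<close> vertices. The two touching conditions differ in the
  direction of the arc, which makes the locale closed under reversing all arcs; the side of
  \<open>T\<close> is handled by that symmetry.\<close>

locale bag_graph = bag_system +
  fixes k :: nat and Ed :: "(nat \<times> nat) set"
  assumes Ed_sub: "Ed \<subseteq> {..<n} \<times> {..<n}"
    and connected: "finite C \<Longrightarrow> card C < 5 * k \<Longrightarrow> u < n \<Longrightarrow> v < n \<Longrightarrow> u \<notin> C \<Longrightarrow> v \<notin> C \<Longrightarrow>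
      (u, v) \<in> (Ed \<inter> (- C) \<times> (- C))\<^sup>*"
    and bag_conn: "b < t \<Longrightarrow> x \<in> B b \<Longrightarrow> y \<in> B b \<Longrightarrow> (x, y) \<in> (Ed \<inter> B b \<times> B b)\<^sup>*"
    and touch: "b < t \<Longrightarrow> b' < t \<Longrightarrow> \<exists>x\<in>B b. \<exists>y\<in>B b'. x = y \<or> (x, y) \<in> Ed"
    and touch': "b < t \<Longrightarrow> b' < t \<Longrightarrow> \<exists>x\<in>B b. \<exists>y\<in>B b'. x = y \<or> (y, x) \<in> Ed"
begin

lemma bag_graph_converse: "bag_graph n t B k (Ed\<inverse>)"
proof unfold_locales
  show "Ed\<inverse> \<subseteq> {..<n} \<times> {..<n}" using Ed_sub by auto
next
  fix C u v assume "finite (C :: nat set)" "card C < 5 * k" "u < n" "v < n" "u \<notin> C" "v \<notin> C"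
  then have "(v, u) \<in> (Ed \<inter> (- C) \<times> (- C))\<^sup>*" using connected by auto
  then have "(u, v) \<in> ((Ed \<inter> (- C) \<times> (- C))\<inverse>)\<^sup>*" by (simp add: rtrancl_converse)
  moreover have "(Ed \<inter> (- C) \<times> (- C))\<inverse> = Ed\<inverse> \<inter> (- C) \<times> (- C)" by auto
  ultimately show "(u, v) \<in> (Ed\<inverse> \<inter> (- C) \<times> (- C))\<^sup>*" by simp
next
  fix b x y assume "b < t" "x \<in> B b" "y \<in> B b"
  then have "(x, y) \<in> ((Ed \<inter> B b \<times> B b)\<inverse>)\<^sup>*" using bag_conn by (simp add: rtrancl_converse)
  moreover have "(Ed \<inter> B b \<times> B b)\<inverse> = Ed\<inverse> \<inter> B b \<times> B b" by auto
  ultimately show "(x, y) \<in> (Ed\<inverse> \<inter> B b \<times> B b)\<^sup>*" by simp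
qed (use touch touch' in auto)

definition robust :: "(nat \<Rightarrow> nat) \<Rightarrow> nat \<Rightarrow> nat \<Rightarrow> bool" where
  "robust st s r \<longleftrightarrow> r \<in> settled st \<and>
     (\<forall>C. finite C \<and> card C < k \<and> r \<notin> C \<longrightarrow>
       (\<exists>b<t. st b = s \<and> B b \<inter> C = {} \<and>
          (\<exists>x\<in>B b. (r, x) \<in> (Ed \<inter> (settled st - C) \<times> (settled st - C))\<^sup>*)))"

text \<open>All parts of robustness are monotone in the state: settled vertices stay settled, and a
  bag claimed by \<open>s\<close> stays claimed by \<open>s\<close>. Hence later claims do no harm
  to terminals already treated.\<close>

lemma robust_extends:
  assumes "robust st s r" "extends st st'" "s \<noteq> 0"
  shows "robust st' s r"
proof -
  note sub = settled_extends[OF assms(2)]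
  have mono: "(Ed \<inter> (settled st - C) \<times> (settled st - C))\<^sup>* \<subseteq> (Ed \<inter> (settled st' - C) \<times> (settled st' - C))\<^sup>*" for C
    using sub by (intro rtrancl_mono) auto
  have "st' b = s" if "st b = s" for b using that assms(2,3) by (auto simp: extends_def)
  then show ?thesis using assms(1) sub mono unfolding robust_def by (meson subsetD)
qed

subsection \<open>Fans from a terminal\<close>

text \<open>The terminal itself cannot be passed, and its out-neighbours are the starting vertices.
  Disjoint flow paths in this network form a fan from \<open>r\<close>.\<close>

abbreviation "fan_net st r \<equiv> bag_network.net n t B (\<lambda>u v. (u, v) \<in> Ed) (\<lambda>v. v \<noteq> r) (\<lambda>_. True)
   (\<lambda>b. st b = 0) (\<lambda>y. (r, y) \<in> Ed \<and> y \<noteq> r)"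

text \<open>If the flow is stuck at value \<open>j\<close>, the charged cut \<open>C\<close>,
  \<open>D\<close> spoils at most \<open>2 * j < 10 * k\<close> bags, so some untouched bag avoids
  \<open>C\<close> and is not in \<open>D\<close>. By connectivity \<open>r\<close> reaches it
  outside \<open>C\<close>, and following this path puts the bag into \<open>D\<close> after
  all.\<close>

lemma fan_augment:
  assumes r: "r \<in> settled st" and few: "card (used st) + 10 * k \<le> t"
    and R: "residual (fan_net st r) (Suc (2 * n + t)) (2 * n + t) j R" and j: "j < 5 * k"
  shows "(Suc (2 * n + t), 2 * n + t) \<in> R\<^sup>*"
proof (rule ccontr)
  interpret bag_network n t B "\<lambda>u v. (u, v) \<in> Ed" "\<lambda>v. v \<noteq> r" "\<lambda>_. True"
    "\<lambda>b. st b = 0" "\<lambda>y. (r, y) \<in> Ed \<and> y \<noteq> r" .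
  assume "\<not> ?thesis"
  then obtain C D P where CD: "finite C" "finite D" "card C + card D \<le> j"
    and start: "\<And>y. y < n \<Longrightarrow> (r, y) \<in> Ed \<and> y \<noteq> r \<Longrightarrow> y \<notin> C \<Longrightarrow> P y"
    and step: "\<And>v u. P v \<Longrightarrow> v < n \<Longrightarrow> v \<notin> C \<Longrightarrow> v \<noteq> r \<Longrightarrow> True \<Longrightarrow> (v, u) \<in> Ed \<Longrightarrow> u < n \<Longrightarrow> u \<notin> C \<Longrightarrow> P u"
    and stop: "\<And>v b. P v \<Longrightarrow> v < n \<Longrightarrow> v \<notin> C \<Longrightarrow> v \<noteq> r \<Longrightarrow> v \<in> B b \<Longrightarrow> b < t \<Longrightarrow> st b = 0 \<Longrightarrow> b \<in> D"
    using blocked_cut[OF R] by blast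
  have "card D + 2 * card C < card {b. b < t \<and> st b = 0}"
    using CD(3) few j unfolding card_unused by linarith
  then obtain b where b: "b < t" "st b = 0" "b \<notin> D" "B b \<inter> C = {}"
    using unhit_bag[OF CD(1,2), of "{b. b < t \<and> st b = 0}"] by auto
  obtain w where w: "w \<in> B b" using bag_ne[OF b(1)] by blast
  have wn: "w < n" using w bag_sub[OF b(1)] by auto
  have wr: "w \<noteq> r" using w r b by (auto simp: settled_def)
  have rn: "r < n" using r by (simp add: settled_def)
  \<comment> \<open>The cut may contain \<open>r\<close>. Taking \<open>r\<close> out of it makes
    \<open>r\<close> a legal start for \<open>connected\<close>.\<close>
  define C' where "C' = C - {r}"
  have "card C' \<le> card C" using CD by (simp add: C'_def card_Diff1_le)
  then have "(r, w) \<in> (Ed \<inter> (- C') \<times> (- C'))\<^sup>*"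
    using CD j wn rn w b(4) by (intro connected) (auto simp: C'_def)
  \<comment> \<open>The path may return to \<open>r\<close>, where the network has no continuation;
    the alternative \<open>w = r\<close> lets the induction start afresh from there.\<close>
  then have "w = r \<or> P w \<and> w \<notin> C"
  proof (induction rule: rtrancl_induct)
    case (step x y)
    have yn: "y < n" "x < n" using step.hyps(2) Ed_sub by auto
    show ?case
    proof (cases "y = r")
      case False
      then have "y \<notin> C" using step.hyps(2) by (auto simp: C'_def)
      then show ?thesis using step.IH step.hyps(2) yn False start[of y] \<open>\<And>v u. P v \<Longrightarrow> v < n \<Longrightarrow> v \<notin> C \<Longrightarrow> v \<noteq> r \<Longrightarrow> True \<Longrightarrow> (v, u) \<in> Ed \<Longrightarrow> u < n \<Longrightarrow> u \<notin> C \<Longrightarrow> P u\<close>[of x y]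
        by auto
    qed simp
  qed simp
  then show False using stop[of w b] wr wn w b by auto
qed

text \<open>The state after tracing the rows that start below \<open>y0\<close>. The set
  \<open>M\<close> holds the rows that met an unsettled vertex and claimed a new bag
  \<open>\<gamma> y\<close>, so \<open>\<gamma>\<close> is injective there. The other rows ran
  through settled vertices only and use their own end bag \<open>\<beta> y\<close>. In both cases
  settled vertices lead from the start of the row into \<open>\<gamma> y\<close>.\<close>

definition fan_inv :: "(nat \<Rightarrow> nat) \<Rightarrow> nat \<Rightarrow> nat set \<Rightarrow> (nat \<Rightarrow> nat list) \<Rightarrow> (nat \<Rightarrow> nat) \<Rightarrow> nat \<Rightarrow> (nat \<Rightarrow> nat) \<Rightarrow> bool" where
  "fan_inv st0 s Y p \<beta> y0 st \<longleftrightarrow> extends st0 st \<and> (\<forall>b. st b \<noteq> st0 b \<longrightarrow> st b = s) \<and>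
     card (used st) \<le> card (used st0) + 2 * card (Y \<inter> {..<y0}) \<and>
     (\<exists>\<gamma> M. M \<subseteq> Y \<inter> {..<y0} \<and> inj_on \<gamma> M \<and>
       (\<forall>y\<in>Y \<inter> {..<y0}. \<gamma> y < t \<and> st (\<gamma> y) = s \<and> (y \<notin> M \<longrightarrow> \<gamma> y = \<beta> y) \<and>
          (\<exists>l<length (p y). (\<forall>l'\<le>l. p y ! l' \<in> settled st) \<and> p y ! l \<in> B (\<gamma> y))))"

lemma fan_inv_0: "fan_inv st s Y p \<beta> 0 st"
  by (simp add: fan_inv_def)

lemma lessThan_Suc_Int: "y0 \<in> Y \<Longrightarrow> Y \<inter> {..<Suc y0} = insert y0 (Y \<inter> {..<y0})"
  by (auto simp: less_Suc_eq)

lemma fan_inv_skip: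
  assumes "fan_inv st0 s Y p \<beta> y0 st" "y0 \<notin> Y"
  shows "fan_inv st0 s Y p \<beta> (Suc y0) st"
proof -
  have "Y \<inter> {..<Suc y0} = Y \<inter> {..<y0}" using assms(2) by (auto simp: less_Suc_eq)
  then show ?thesis using assms(1) by (simp add: fan_inv_def)
qed

text \<open>The end bag was untouched when tracing began, but its vertex on the row is settled by
  now. So it was claimed in between, and only \<open>s\<close> claims bags during the
  tracing.\<close>

lemma fan_inv_end:
  assumes inv: "fan_inv st0 s Y p \<beta> y0 st" and y0: "y0 \<in> Y" and p: "p y0 \<noteq> []"
    and all: "\<And>v. v \<in> set (p y0) \<Longrightarrow> v \<in> settled st"
    and last: "last (p y0) \<in> B (\<beta> y0)" "\<beta> y0 < t" "st0 (\<beta> y0) = 0"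
  shows "fan_inv st0 s Y p \<beta> (Suc y0) st"
proof -
  note inv = inv[unfolded fan_inv_def]
  obtain \<gamma> M where \<gamma>: "M \<subseteq> Y \<inter> {..<y0}" "inj_on \<gamma> M"
    "\<forall>y\<in>Y \<inter> {..<y0}. \<gamma> y < t \<and> st (\<gamma> y) = s \<and> (y \<notin> M \<longrightarrow> \<gamma> y = \<beta> y) \<and>
          (\<exists>l<length (p y). (\<forall>l'\<le>l. p y ! l' \<in> settled st) \<and> p y ! l \<in> B (\<gamma> y))"
    using inv by blast
  have "st (\<beta> y0) \<noteq> 0" using all[of "last (p y0)"] p last by (auto simp: settled_def)
  then have sb: "st (\<beta> y0) = s" using inv last by metis
  have ne: "y \<noteq> y0" if "y \<in> Y \<inter> {..<y0}" for y using that by auto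
  have row: "\<exists>l<length (p y0). (\<forall>l'\<le>l. p y0 ! l' \<in> settled st) \<and> p y0 ! l \<in> B (\<beta> y0)"
  proof (intro exI[of _ "length (p y0) - 1"] conjI allI impI)
    fix l' assume "l' \<le> length (p y0) - 1"
    then have "p y0 ! l' \<in> set (p y0)" using p by (intro nth_mem) (cases "p y0", auto)
    then show "p y0 ! l' \<in> settled st" by (rule all)
  qed (use p last in \<open>auto simp: last_conv_nth\<close>)
  have "M \<subseteq> Y \<inter> {..<Suc y0}" "inj_on (\<gamma>(y0 := \<beta> y0)) M"
    using \<gamma>(1,2) by (auto simp: inj_on_def)
  moreover have "\<forall>y\<in>Y \<inter> {..<Suc y0}. (\<gamma>(y0 := \<beta> y0)) y < t \<and> st ((\<gamma>(y0 := \<beta> y0)) y) = s \<and> (y \<notin> M \<longrightarrow> (\<gamma>(y0 := \<beta> y0)) y = \<beta> y) \<and>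
          (\<exists>l<length (p y). (\<forall>l'\<le>l. p y ! l' \<in> settled st) \<and> p y ! l \<in> B ((\<gamma>(y0 := \<beta> y0)) y))"
    unfolding lessThan_Suc_Int[OF y0] using \<gamma>(3) ne sb last row by simp
  moreover have "card (Y \<inter> {..<y0}) \<le> card (Y \<inter> {..<Suc y0})" by (intro card_mono) auto
  ultimately show ?thesis unfolding fan_inv_def using inv by (smt (verit, best) add_left_mono le_trans mult_le_mono2)
qed

text \<open>An unsettled vertex has an untouched bag \<open>b\<close>. All values of
  \<open>\<gamma>\<close> on \<open>M\<close> are bags claimed earlier, so adding \<open>b\<close>
  as a new value keeps injectivity.\<close>

lemma fan_inv_claim:
  assumes inv: "fan_inv st0 s Y p \<beta> y0 st" and s: "s \<noteq> 0" and y0: "y0 \<in> Y" and l: "l < length (p y0)"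
    and before: "\<And>l'. l' < l \<Longrightarrow> p y0 ! l' \<in> settled st"
    and hit: "p y0 ! l \<notin> settled st" "p y0 ! l < n"
  shows "fan_inv st0 s Y p \<beta> (Suc y0) (claim st s (p y0 ! l))"
proof -
  let ?v = "p y0 ! l" let ?st = "claim st s (p y0 ! l)"
  note inv = inv[unfolded fan_inv_def]
  obtain \<gamma> M where \<gamma>: "M \<subseteq> Y \<inter> {..<y0}" "inj_on \<gamma> M"
    "\<forall>y\<in>Y \<inter> {..<y0}. \<gamma> y < t \<and> st (\<gamma> y) = s \<and> (y \<notin> M \<longrightarrow> \<gamma> y = \<beta> y) \<and>
          (\<exists>l<length (p y). (\<forall>l'\<le>l. p y ! l' \<in> settled st) \<and> p y ! l \<in> B (\<gamma> y))"
    using inv by blast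
  obtain b where b: "b < t" "?v \<in> B b" "st b = 0" using hit by (auto simp: settled_def)
  have ext: "extends st ?st" by (rule claim_extends)
  note sub = settled_extends[OF ext]
  have sb: "?st b = s" using b by (simp add: claim_def)
  have keep: "?st b' = s" if "st b' = s" for b' using that s by (auto simp: claim_def)
  have ne: "y \<noteq> y0" if "y \<in> Y \<inter> {..<y0}" for y using that by auto
  have row: "\<exists>l<length (p y0). (\<forall>l'\<le>l. p y0 ! l' \<in> settled ?st) \<and> p y0 ! l \<in> B b"
  proof (intro exI[of _ l] conjI allI impI)
    fix l' assume "l' \<le> l"
    then show "p y0 ! l' \<in> settled ?st"
      using before[of l'] sub claim_settled[OF s hit(2)] by (cases "l' = l") auto
  qed (use l b in auto)
  have old: "\<exists>l<length (p y). (\<forall>l'\<le>l. p y ! l' \<in> settled ?st) \<and> p y ! l \<in> B (\<gamma> y)" if "y \<in> Y \<inter> {..<y0}" for y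
    using \<gamma>(3) that sub by (meson subsetD)
  have "st (\<gamma> y) = s" if "y \<in> M" for y using \<gamma>(1,3) that by blast
  then have notin: "b \<notin> \<gamma> ` M" using b s by force
  have "y0 \<notin> M" using \<gamma>(1) by auto
  then have "insert y0 M \<subseteq> Y \<inter> {..<Suc y0}" "inj_on (\<gamma>(y0 := b)) (insert y0 M)"
    using \<gamma>(1,2) y0 notin by (auto simp: inj_on_def)
  moreover have "\<forall>y\<in>Y \<inter> {..<Suc y0}. (\<gamma>(y0 := b)) y < t \<and> ?st ((\<gamma>(y0 := b)) y) = s \<and>
      (y \<notin> insert y0 M \<longrightarrow> (\<gamma>(y0 := b)) y = \<beta> y) \<and>
      (\<exists>l<length (p y). (\<forall>l'\<le>l. p y ! l' \<in> settled ?st) \<and> p y ! l \<in> B ((\<gamma>(y0 := b)) y))"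
    unfolding lessThan_Suc_Int[OF y0] using \<gamma>(3) ne sb b row keep old by simp
  moreover have "card (used ?st) \<le> card (used st0) + 2 * card (Y \<inter> {..<Suc y0})"
  proof -
    have "card (Y \<inter> {..<Suc y0}) = Suc (card (Y \<inter> {..<y0}))"
      unfolding lessThan_Suc_Int[OF y0] by (intro card_insert_disjoint) auto
    then show ?thesis using inv card_used_claim[of st s ?v] by simp
  qed
  moreover have "extends st0 ?st" using inv ext extends_trans by blast
  moreover have "?st b' = s" if "?st b' \<noteq> st0 b'" for b' using inv that by (auto simp: claim_def split: if_splits)
  ultimately show ?thesis unfolding fan_inv_def by blast
qed

text \<open>Each of the \<open>5 k\<close> rows leads to a bag claimed for \<open>s\<close>, and each bag serves at most two rows (one as
  \<open>\<gamma> y\<close> with \<open>y \<in> M\<close>, one as \<open>\<beta> y\<close>). Fewer than \<open>k\<close> vertices meet fewer than \<open>k\<close> rows and \<open>2 k\<close> bags.\<close>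

lemma fan_inv_robust:
  assumes inv: "fan_inv st0 s Y p \<beta> n st" and Y: "Y \<subseteq> {..<n}" "card Y = 5 * k" and k: "k > 0" and \<beta>: "inj_on \<beta> Y"
    and rows: "\<And>y. y \<in> Y \<Longrightarrow> hd (p y) = y \<and> (r, y) \<in> Ed \<and> p y \<noteq> []"
    and arcs: "\<And>y l. y \<in> Y \<Longrightarrow> Suc l < length (p y) \<Longrightarrow> (p y ! l, p y ! Suc l) \<in> Ed"
    and disj: "\<And>y y' v. y \<in> Y \<Longrightarrow> y' \<in> Y \<Longrightarrow> v \<in> set (p y) \<Longrightarrow> v \<in> set (p y') \<Longrightarrow> y = y'"
    and r: "r \<in> settled st0"
  shows "robust st s r"
  unfolding robust_def
proof (intro conjI allI impI)
  note inv = inv[unfolded fan_inv_def]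
  have YY: "Y \<inter> {..<n} = Y" using Y by auto
  have finY: "finite Y" using Y(1) finite_subset by blast
  obtain \<gamma> M where \<gamma>: "M \<subseteq> Y" "inj_on \<gamma> M"
    "\<And>y. y \<in> Y \<Longrightarrow> \<gamma> y < t \<and> st (\<gamma> y) = s \<and> (y \<notin> M \<longrightarrow> \<gamma> y = \<beta> y) \<and>
          (\<exists>l<length (p y). (\<forall>l'\<le>l. p y ! l' \<in> settled st) \<and> p y ! l \<in> B (\<gamma> y))"
    using inv unfolding YY by blast
  show rs: "r \<in> settled st" using r inv settled_extends by blast
  fix C assume C: "finite C \<and> card C < k \<and> r \<notin> C"
  define hit where "hit = {b. b < t \<and> B b \<inter> C \<noteq> {}}"
  have ch: "card hit \<le> 2 * card C" "finite hit" using C card_hit_bags by (auto simp: hit_def)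
  define X1 where "X1 = {y \<in> Y. set (p y) \<inter> C \<noteq> {}}"
  define X2 where "X2 = {y \<in> M. \<gamma> y \<in> hit}"
  define X3 where "X3 = {y \<in> Y - M. \<gamma> y \<in> hit}"
  \<comment> \<open>Picks a deleted vertex on every row that meets \<open>C\<close>. Rows are
    disjoint, so the choice is injective.\<close>
  define g where "g = (\<lambda>y. SOME v. v \<in> set (p y) \<and> v \<in> C)"
  have g: "g y \<in> set (p y)" "g y \<in> C" if "y \<in> X1" for y
  proof -
    have "\<exists>v. v \<in> set (p y) \<and> v \<in> C" using that by (auto simp: X1_def)
    from someI_ex[OF this] show "g y \<in> set (p y)" "g y \<in> C" by (auto simp: g_def)
  qed
  have "card X1 \<le> card C"
  proof (rule card_inj_on_le)
    show "inj_on g X1"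
    proof (rule inj_onI)
      fix y y' assume yy: "y \<in> X1" "y' \<in> X1" "g y = g y'"
      then show "y = y'" using disj[of y y' "g y"] g[of y] g[of y'] by (auto simp: X1_def)
    qed
  qed (use C g in auto)
  moreover have "card X2 \<le> card hit"
    by (rule card_inj_on_le[of \<gamma>]) (use \<gamma>(2) ch in \<open>auto simp: X2_def inj_on_def\<close>)
  moreover have "card X3 \<le> card hit"
  proof (rule card_inj_on_le[of \<beta>])
    show "inj_on \<beta> X3" by (rule inj_on_subset[OF \<beta>]) (auto simp: X3_def)
    show "\<beta> ` X3 \<subseteq> hit" using \<gamma>(3) by (auto simp: X3_def)
  qed (use ch in auto)
  moreover have "card (X1 \<union> X2 \<union> X3) \<le> card X1 + card X2 + card X3"
    by (metis (no_types, lifting) add_le_mono1 card_Un_le le_trans)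
  ultimately have "card (X1 \<union> X2 \<union> X3) < card Y" using ch C Y(2) by linarith
  moreover have "finite (X1 \<union> X2 \<union> X3)"
    by (rule finite_subset[OF _ finY]) (use \<gamma>(1) in \<open>auto simp: X1_def X2_def X3_def\<close>)
  ultimately have "\<not> Y \<subseteq> X1 \<union> X2 \<union> X3" using card_mono[of "X1 \<union> X2 \<union> X3" Y] by linarith
  then obtain y where y: "y \<in> Y" "y \<notin> X1" "y \<notin> X2" "y \<notin> X3" by auto
  have gy: "\<gamma> y < t" "st (\<gamma> y) = s" using \<gamma>(3)[OF y(1)] by auto
  have "B (\<gamma> y) \<inter> C = {}" using y gy by (auto simp: X2_def X3_def hit_def)
  obtain l where l: "l < length (p y)" "\<forall>l'\<le>l. p y ! l' \<in> settled st" "p y ! l \<in> B (\<gamma> y)"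
    using \<gamma>(3)[OF y(1)] by blast
  have "(r, p y ! l') \<in> (Ed \<inter> (settled st - C) \<times> (settled st - C))\<^sup>*" if "l' \<le> l" for l'
    using that
  proof (induction l')
    case 0
    have "p y ! 0 = y" using rows[OF y(1)] hd_conv_nth[of "p y"] by simp
    moreover have "p y ! 0 \<in> set (p y)" using l(1) by (cases "p y") auto
    moreover have "p y ! 0 \<in> settled st" using l(2) by blast
    moreover have "p y ! 0 \<notin> C" using calculation(2) y(1,2) by (auto simp: X1_def)
    ultimately have "(r, p y ! 0) \<in> Ed \<inter> (settled st - C) \<times> (settled st - C)"
      using rows[OF y(1)] rs C by simp
    then show ?case by blast
  next
    case (Suc m)
    have "p y ! m \<in> set (p y)" "p y ! Suc m \<in> set (p y)" using Suc.prems l(1) by auto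
    then have "p y ! m \<notin> C" "p y ! Suc m \<notin> C" using y(1,2) by (auto simp: X1_def)
    moreover have "p y ! m \<in> settled st" "p y ! Suc m \<in> settled st" using l(2) Suc.prems by auto
    moreover have "(p y ! m, p y ! Suc m) \<in> Ed" using arcs[OF y(1), of m] Suc.prems l(1) by simp
    ultimately have "(p y ! m, p y ! Suc m) \<in> Ed \<inter> (settled st - C) \<times> (settled st - C)" by simp
    then show ?case using Suc by (meson Suc_leD rtrancl.rtrancl_into_rtrancl)
  qed
  then show "\<exists>b<t. st b = s \<and> B b \<inter> C = {} \<and>
      (\<exists>x\<in>B b. (r, x) \<in> (Ed \<inter> (settled st - C) \<times> (settled st - C))\<^sup>*)"
    using gy \<open>B (\<gamma> y) \<inter> C = {}\<close> l(3) by blast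
qed

subsection \<open>Linking all terminals to untouched bags\<close>

abbreviation "link_net st s X q \<equiv> bag_network.net n t B (\<lambda>u v. (u, v) \<in> Ed) (\<lambda>_. True) (allowed st s)
   (\<lambda>b. st b = 0 \<and> q b) (\<lambda>y. y \<in> X)"

text \<open>A cut of fewer than \<open>k\<close> vertices and bags misses a terminal, a bag claimed by \<open>s\<close> that this terminal
  reaches, and one of the \<open>2 k\<close> target bags; the two bags touch.\<close>

lemma link_augment:
  assumes rob: "\<And>r. r \<in> X \<Longrightarrow> robust st s r" and X: "card X = k"
    and many: "2 * k \<le> card {b. b < t \<and> st b = 0 \<and> q b}"
    and R: "residual (link_net st s X q) (Suc (2 * n + t)) (2 * n + t) j R" and j: "j < k"
  shows "(Suc (2 * n + t), 2 * n + t) \<in> R\<^sup>*"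
proof (rule ccontr)
  interpret bag_network n t B "\<lambda>u v. (u, v) \<in> Ed" "\<lambda>_. True" "allowed st s"
    "\<lambda>b. st b = 0 \<and> q b" "\<lambda>y. y \<in> X" .
  assume "\<not> ?thesis"
  then obtain C D P where CD: "finite C" "finite D" "card C + card D \<le> j"
    and start: "\<And>y. y < n \<Longrightarrow> y \<in> X \<Longrightarrow> y \<notin> C \<Longrightarrow> P y"
    and step: "\<And>v u. P v \<Longrightarrow> v < n \<Longrightarrow> v \<notin> C \<Longrightarrow> True \<Longrightarrow> allowed st s v \<Longrightarrow> (v, u) \<in> Ed \<Longrightarrow> u < n \<Longrightarrow> u \<notin> C \<Longrightarrow> P u"
    and stop: "\<And>v b. P v \<Longrightarrow> v < n \<Longrightarrow> v \<notin> C \<Longrightarrow> True \<Longrightarrow> v \<in> B b \<Longrightarrow> b < t \<Longrightarrow> st b = 0 \<and> q b \<Longrightarrow> b \<in> D"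
    using blocked_cut[OF R] by blast
  have "card C < card X" using CD j X by simp
  then have "\<not> X \<subseteq> C" using card_mono[OF CD(1), of X] by auto
  then obtain r where r: "r \<in> X" "r \<notin> C" by blast
  have "finite C \<and> card C < k \<and> r \<notin> C" using CD j r by auto
  then obtain b x where b: "b < t" "st b = s" "B b \<inter> C = {}" and x: "x \<in> B b"
     and rx: "(r, x) \<in> (Ed \<inter> (settled st - C) \<times> (settled st - C))\<^sup>*"
    using rob[OF r(1)] unfolding robust_def by blast
  have rs: "r \<in> settled st" using rob[OF r(1)] by (simp add: robust_def)
  then have rn: "r < n" by (simp add: settled_def)
  have "card D + 2 * card C < card {b. b < t \<and> st b = 0 \<and> q b}" using CD(3) many j by linarith
  then obtain z where z: "z < t" "st z = 0" "q z" "z \<notin> D" "B z \<inter> C = {}"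
    using unhit_bag[OF CD(1,2), of "{b. b < t \<and> st b = 0 \<and> q b}"] by auto
  have Px: "P x" using rx
  proof (induction rule: rtrancl_induct)
    case base
    then show ?case using start rn r by blast
  next
    case (step x y)
    then show ?case using \<open>\<And>v u. P v \<Longrightarrow> v < n \<Longrightarrow> v \<notin> C \<Longrightarrow> True \<Longrightarrow> allowed st s v \<Longrightarrow> (v, u) \<in> Ed \<Longrightarrow> u < n \<Longrightarrow> u \<notin> C \<Longrightarrow> P u\<close>[of x y]
      by (auto simp: allowed_def settled_def)
  qed
  have al: "allowed st s v" if "v \<in> B b" for v using that b by (auto simp: allowed_def)
  obtain x' w where xw: "x' \<in> B b" "w \<in> B z" "x' = w \<or> (x', w) \<in> Ed" using touch[OF b(1) z(1)] by blast
  have "(x, x') \<in> (Ed \<inter> B b \<times> B b)\<^sup>*" using bag_conn b x xw by blast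
  then have Px': "P x'"
  proof (induction rule: rtrancl_induct)
    case base
    then show ?case using Px by blast
  next
    case (step x y)
    then show ?case using \<open>\<And>v u. P v \<Longrightarrow> v < n \<Longrightarrow> v \<notin> C \<Longrightarrow> True \<Longrightarrow> allowed st s v \<Longrightarrow> (v, u) \<in> Ed \<Longrightarrow> u < n \<Longrightarrow> u \<notin> C \<Longrightarrow> P u\<close>[of x y]
      b al[of x] bag_sub[OF b(1)] by auto
  qed
  have wn: "w < n" "w \<notin> C" "x' < n" "x' \<notin> C" using xw z b bag_sub by (blast | auto)+
  have "P w" using xw(3) Px' step[of x' w] wn al[OF xw(1)] by auto
  then show False using stop[of w z] wn xw z by auto
qed

end

subsection \<open>Combining both sides\<close>

text \<open>Indices whose path meets \<open>v\<close> inside its own end bag are counted with the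
  end bags (\<open>Z1\<close>, \<open>Z2\<close>). If no end bag contains \<open>v\<close>, each
  side adds at most one index. Otherwise \<open>v\<close> is unsettled, so a path of side
  \<open>s\<close> that passes \<open>v\<close> outside its end bag needs a bag of \<open>v\<close>
  claimed by \<open>s\<close>. Every index is thus paid for by a bag of \<open>v\<close> of its own,
  and \<open>v\<close> has at most two.\<close>

lemma (in bag_system) load_le_2:
  fixes p1 p2 :: "nat \<Rightarrow> nat list"
  assumes inj: "inj_on z1 {..<k}" "inj_on z2 {..<k}" and zz: "\<And>i j. i < k \<Longrightarrow> j < k \<Longrightarrow> z1 i \<noteq> z2 j"
    and z: "\<And>i. i < k \<Longrightarrow> z1 i < t \<and> st (z1 i) = 0 \<and> z2 i < t \<and> st (z2 i) = 0"
    and d1: "\<And>i j v. i < k \<Longrightarrow> j < k \<Longrightarrow> v \<in> set (p1 i) \<Longrightarrow> v \<in> set (p1 j) \<Longrightarrow> i = j"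
    and d2: "\<And>i j v. i < k \<Longrightarrow> j < k \<Longrightarrow> v \<in> set (p2 i) \<Longrightarrow> v \<in> set (p2 j) \<Longrightarrow> i = j"
    and a1: "\<And>i v. i < k \<Longrightarrow> v \<in> set (p1 i) \<Longrightarrow> v \<in> B (z1 i) \<or> allowed st 1 v"
    and a2: "\<And>i v. i < k \<Longrightarrow> v \<in> set (p2 i) \<Longrightarrow> v \<in> B (z2 i) \<or> allowed st 2 v"
  shows "card {i. i < k \<and> v \<in> set (p1 i) \<union> set (p2 i) \<union> B (z1 i) \<union> B (z2 i)} \<le> 2"
proof -
  define L1 where "L1 = {i. i < k \<and> v \<in> set (p1 i)}"
  define L2 where "L2 = {i. i < k \<and> v \<in> set (p2 i)}"
  define Z1 where "Z1 = {i. i < k \<and> v \<in> B (z1 i)}"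
  define Z2 where "Z2 = {i. i < k \<and> v \<in> B (z2 i)}"
  let ?I = "{i. i < k \<and> v \<in> set (p1 i) \<union> set (p2 i) \<union> B (z1 i) \<union> B (z2 i)}"
  have fin: "finite L1" "finite L2" "finite Z1" "finite Z2" by (auto simp: L1_def L2_def Z1_def Z2_def)
  have I: "?I = (L1 - Z1) \<union> (L2 - Z2) \<union> (Z1 \<union> Z2)" by (auto simp: L1_def L2_def Z1_def Z2_def)
  have le1: "card L1 \<le> 1" "card L2 \<le> 1"
    using fin d1 d2 by (auto simp: card_le_Suc0_iff_eq L1_def L2_def)
  then have le1': "card (L1 - Z1) \<le> 1" "card (L2 - Z2) \<le> 1"
    using fin by (meson card_Diff1_le card_mono Diff_subset le_trans)+
  have cI: "card ?I \<le> card (L1 - Z1) + card (L2 - Z2) + card (Z1 \<union> Z2)"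
    unfolding I by (meson add_le_mono1 card_Un_le le_trans)
  define BV where "BV = {b. b < t \<and> v \<in> B b}"
  have BV: "finite BV" "card BV \<le> 2" using depth[of v] by (auto simp: BV_def)
  define ZB where "ZB = z1 ` Z1 \<union> z2 ` Z2"
  have ZB: "ZB \<subseteq> BV" "\<And>b. b \<in> ZB \<Longrightarrow> st b = 0" using z by (auto simp: ZB_def Z1_def Z2_def BV_def)
  have "card ZB = card (z1 ` Z1) + card (z2 ` Z2)"
    unfolding ZB_def using fin zz by (intro card_Un_disjoint) (auto simp: Z1_def Z2_def)
  also have "\<dots> = card Z1 + card Z2"
    using inj by (simp add: card_image inj_on_subset Z1_def Z2_def subset_eq)
  finally have cZ: "card (Z1 \<union> Z2) \<le> card ZB" by (simp add: card_Un_le)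
  have claimed: "\<exists>b\<in>BV. st b = s" if "allowed st s v" "ZB \<noteq> {}" for s
    using that ZB by (fastforce simp: allowed_def settled_def BV_def)
  have A1: "\<exists>b\<in>BV - ZB. st b = 1" if "L1 - Z1 \<noteq> {}" "ZB \<noteq> {}"
    using that a1 claimed[of 1] ZB(2) by (force simp: L1_def Z1_def)
  have A2: "\<exists>b\<in>BV - ZB. st b = 2" if "L2 - Z2 \<noteq> {}" "ZB \<noteq> {}"
    using that a2 claimed[of 2] ZB(2) by (force simp: L2_def Z2_def)
  show ?thesis
  proof (cases "ZB = {}")
    case True
    then show ?thesis using cI cZ le1' by simp
  next
    case False
    have finZB: "finite ZB" using ZB(1) BV(1) finite_subset by blast
    have cd: "card (BV - ZB) = card BV - card ZB" using ZB(1) finZB by (intro card_Diff_subset)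
    have pos: "card ZB \<ge> 1" using False finZB by (simp add: Suc_le_eq card_gt_0_iff)
    consider "L1 - Z1 = {}" "L2 - Z2 = {}" | "L1 - Z1 \<noteq> {}" "L2 - Z2 = {}" | "L1 - Z1 = {}" "L2 - Z2 \<noteq> {}"
      | "L1 - Z1 \<noteq> {}" "L2 - Z2 \<noteq> {}" by blast
    then show ?thesis
    proof cases
      case 1
      then have "card (L1 - Z1) = 0" "card (L2 - Z2) = 0" by (simp_all only: card.empty)
      then show ?thesis using cI cZ card_mono[OF BV(1) ZB(1)] BV(2) by linarith
    next
      case 2
      then have "card (BV - ZB) > 0" using A1 False BV by (auto simp: card_gt_0_iff)
      moreover have "card (L2 - Z2) = 0" using 2 by (simp only: card.empty)
      ultimately show ?thesis using cI cZ le1' cd BV(2) by linarith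
    next
      case 3
      then have "card (BV - ZB) > 0" using A2 False BV by (auto simp: card_gt_0_iff)
      moreover have "card (L1 - Z1) = 0" using 3 by (simp only: card.empty)
      ultimately show ?thesis using cI cZ le1' cd BV(2) by linarith
    next
      \<comment> \<open>This case cannot occur: \<open>v\<close> would lie in three bags, one
        claimed by each side and one untouched.\<close>
      case 4
      obtain b where b: "b \<in> BV - ZB" "st b = 1" using A1[OF 4(1) False] by blast
      obtain b' where b': "b' \<in> BV - ZB" "st b' = 2" using A2[OF 4(2) False] by blast
      have "b \<noteq> b'" using b b' by auto
      have "card {b, b'} \<le> card (BV - ZB)" using BV b b' by (intro card_mono) auto
      then have "2 \<le> card (BV - ZB)" using \<open>b \<noteq> b'\<close> by simp
      then show ?thesis using cd BV(2) pos by linarith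
    qed
  qed
qed

lemma list_path_rtrancl:
  assumes "\<And>l. Suc l < length p \<Longrightarrow> (p ! l, p ! Suc l) \<in> r" "l < length p"
  shows "(hd p, p ! l) \<in> r\<^sup>*"
  using assms(2)
proof (induction l)
  case 0
  then show ?case by (cases p) auto
next
  case (Suc l)
  then show ?case using assms(1)[of l] by (meson Suc_lessD rtrancl.rtrancl_into_rtrancl)
qed

text \<open>The route follows \<open>p\<close> into \<open>B x\<close>, moves inside
  \<open>B x\<close> to the place where the bags touch, crosses to \<open>B y\<close>, and returns
  along \<open>q\<close>, which is a path of the converse graph.\<close>

lemma (in bag_graph) union_path:
  assumes p: "p \<noteq> []" "\<And>l. Suc l < length p \<Longrightarrow> (p ! l, p ! Suc l) \<in> Ed" "last p \<in> B x" "x < t"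
    and q: "q \<noteq> []" "\<And>l. Suc l < length q \<Longrightarrow> (q ! Suc l, q ! l) \<in> Ed" "last q \<in> B y" "y < t"
    and U: "set p \<union> set q \<union> B x \<union> B y \<subseteq> U"
  shows "(hd p, hd q) \<in> (Ed \<inter> U \<times> U)\<^sup>*"
proof -
  let ?r = "Ed \<inter> U \<times> U"
  have "(hd p, p ! (length p - 1)) \<in> ?r\<^sup>*"
    using p U by (intro list_path_rtrancl) (auto dest: nth_mem)
  then have 1: "(hd p, last p) \<in> ?r\<^sup>*" using p by (simp add: last_conv_nth)
  have "(hd q, q ! (length q - 1)) \<in> (?r\<inverse>)\<^sup>*"
    using q U by (intro list_path_rtrancl) (auto dest: nth_mem)
  then have 2: "(last q, hd q) \<in> ?r\<^sup>*" using q by (simp add: last_conv_nth rtrancl_converse)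
  obtain u w where uw: "u \<in> B x" "w \<in> B y" "u = w \<or> (u, w) \<in> Ed" using touch[OF p(4) q(4)] by blast
  have "(last p, u) \<in> (Ed \<inter> B x \<times> B x)\<^sup>*" using bag_conn p uw by blast
  then have 3: "(last p, u) \<in> ?r\<^sup>*" using U by (elim rtrancl_mono[THEN subsetD, rotated]) auto
  have "(w, last q) \<in> (Ed \<inter> B y \<times> B y)\<^sup>*" using bag_conn q uw by blast
  then have 4: "(w, last q) \<in> ?r\<^sup>*" using U by (elim rtrancl_mono[THEN subsetD, rotated]) auto
  have "(u, w) \<in> ?r\<^sup>*" using uw U by auto
  then show ?thesis using 1 2 3 4 by (meson rtrancl_trans)
qed

section \<open>Total correctness of RAM programs\<close>

text \<open>If all words are at most \<open>K\<close>, then the value of \<open>e\<close> is at most \<open>K ^ edeg e\<close>.\<close>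

primrec edeg :: "expr \<Rightarrow> nat" where
  "edeg (Const c) = 1"
| "edeg (Load a e) = edeg e"
| "edeg (Add e f) = Suc (max (edeg e) (edeg f))"
| "edeg (Sub e f) = max (edeg e) (edeg f)"
| "edeg (Mul e f) = edeg e + edeg f"
| "edeg (Div e f) = max (edeg e) (edeg f)"

primrec elit :: "expr \<Rightarrow> nat" where
  "elit (Const c) = c"
| "elit (Load a e) = elit e"
| "elit (Add e f) = max (elit e) (elit f)"
| "elit (Sub e f) = max (elit e) (elit f)"
| "elit (Mul e f) = max (elit e) (elit f)"
| "elit (Div e f) = max (elit e) (elit f)"

text \<open>The limits are constants that cover every expression of the program. With words at most
  \<open>K\<close> and \<open>100 \<le> K\<close>, the value of such an expression is at most
  \<open>K ^ 60\<close>.\<close>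

definition eok :: "expr \<Rightarrow> bool" where "eok e \<longleftrightarrow> edeg e \<le> 60 \<and> elit e \<le> 100"

primrec pok :: "prog \<Rightarrow> bool" where
  "pok Skip \<longleftrightarrow> True"
| "pok (Store a e f) \<longleftrightarrow> eok e \<and> eok f"
| "pok (Seq p q) \<longleftrightarrow> pok p \<and> pok q"
| "pok (Cond e p q) \<longleftrightarrow> eok e \<and> pok p \<and> pok q"
| "pok (While e p) \<longleftrightarrow> False"

text \<open>These functions are meant for programs without loops; the values at loops are junk.\<close>

primrec stp :: "prog \<Rightarrow> memory \<Rightarrow> memory" where
  "stp Skip \<sigma> = \<sigma>"
| "stp (Store a e f) \<sigma> = \<sigma>(a := (\<sigma> a)(val \<sigma> e := val \<sigma> f))"
| "stp (Seq p q) \<sigma> = stp q (stp p \<sigma>)"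
| "stp (Cond e p q) \<sigma> = (if val \<sigma> e \<noteq> 0 then stp p \<sigma> else stp q \<sigma>)"
| "stp (While e p) \<sigma> = \<sigma>"

primrec safe :: "nat \<Rightarrow> prog \<Rightarrow> memory \<Rightarrow> bool" where
  "safe K Skip \<sigma> \<longleftrightarrow> True"
| "safe K (Store a e f) \<sigma> \<longleftrightarrow> val \<sigma> f \<le> K"
| "safe K (Seq p q) \<sigma> \<longleftrightarrow> safe K p \<sigma> \<and> safe K q (stp p \<sigma>)"
| "safe K (Cond e p q) \<sigma> \<longleftrightarrow> (if val \<sigma> e \<noteq> 0 then safe K p \<sigma> else safe K q \<sigma>)"
| "safe K (While e p) \<sigma> \<longleftrightarrow> False"

primrec psz :: "prog \<Rightarrow> nat" where
  "psz Skip = 1"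
| "psz (Store a e f) = 1 + cost e + cost f"
| "psz (Seq p q) = psz p + psz q"
| "psz (Cond e p q) = 1 + cost e + max (psz p) (psz q)"
| "psz (While e p) = 0"

text \<open>The limit \<open>m\<close> is evaluated anew in every round, which is why
  \<open>run_for\<close> asks for its value to be invariant.\<close>

definition For :: "nat \<Rightarrow> expr \<Rightarrow> prog \<Rightarrow> prog" where
  "For v m p = Seq (Store v (Const 0) (Const 0)) (While (Sub m (Load v (Const 0)))
     (Seq p (Store v (Const 0) (Add (Load v (Const 0)) (Const 1)))))"

lemma edeg_pos: "edeg e \<ge> 1" by (induction e) auto

definition keeps :: "nat set \<Rightarrow> memory \<Rightarrow> memory \<Rightarrow> bool" where
  "keeps A \<sigma> \<sigma>' \<longleftrightarrow> (\<forall>a. a \<notin> A \<longrightarrow> \<sigma>' a = \<sigma> a)"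

lemma keeps_refl [simp]: "keeps A \<sigma> \<sigma>" by (simp add: keeps_def)

lemma keepsD: "keeps A \<sigma> \<sigma>' \<Longrightarrow> a \<notin> A \<Longrightarrow> \<sigma>' a = \<sigma> a" by (simp add: keeps_def)

lemma keeps_upd [simp]: "keeps A \<sigma> \<sigma>' \<Longrightarrow> a \<in> A \<Longrightarrow> keeps A \<sigma> (\<sigma>'(a := f))" by (simp add: keeps_def)

lemma keeps_trans: "keeps A \<sigma> \<sigma>' \<Longrightarrow> keeps B \<sigma>' \<sigma>'' \<Longrightarrow> A \<union> B \<subseteq> C \<Longrightarrow> keeps C \<sigma> \<sigma>''"
  unfolding keeps_def by (metis Un_subset_iff subsetD)

text \<open>Two bounds are kept apart: \<open>K\<close> bounds the words stored in memory,
  \<open>W\<close> bounds every intermediate value of an expression. The second follows from the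
  first by \<open>edeg\<close>, so only stores have to be checked.\<close>

locale ram =
  fixes W K :: nat
  assumes K100: "100 \<le> K" and KW: "K ^ 60 < W"
begin

definition bd :: "memory \<Rightarrow> bool" where "bd \<sigma> \<longleftrightarrow> (\<forall>a i. \<sigma> a i \<le> K)"

lemma bdD: "bd \<sigma> \<Longrightarrow> \<sigma> a i \<le> K" by (simp add: bd_def)

lemma bd_upd: "bd \<sigma> \<Longrightarrow> x \<le> K \<Longrightarrow> bd (\<sigma>(a := (\<sigma> a)(i := x)))" by (simp add: bd_def)

lemma val_le: "bd \<sigma> \<Longrightarrow> elit e \<le> 100 \<Longrightarrow> val \<sigma> e \<le> K ^ edeg e"
proof (induction e)
  case (Const c)
  then show ?case using K100 by simp
next
  case (Load a e)
  have "K ^ 1 \<le> K ^ edeg e" using K100 edeg_pos by (intro power_increasing) auto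
  then show ?case using bdD[OF Load.prems(1), of a "val \<sigma> e"] by simp
next
  case (Add e f)
  let ?m = "max (edeg e) (edeg f)"
  have "K ^ edeg e \<le> K ^ ?m" "K ^ edeg f \<le> K ^ ?m" using K100 by (auto intro!: power_increasing)
  then have "val \<sigma> e + val \<sigma> f \<le> 2 * K ^ ?m" using Add by (auto intro: order_trans)
  also have "\<dots> \<le> K * K ^ ?m" using K100 by simp
  finally show ?case by simp
next
  case (Sub e f)
  have "K ^ edeg e \<le> K ^ max (edeg e) (edeg f)" using K100 by (auto intro!: power_increasing)
  moreover have "val \<sigma> e \<le> K ^ edeg e" using Sub by simp
  ultimately show ?case unfolding val.simps edeg.simps by linarith
next
  case (Mul e f)
  then show ?case by (simp add: power_add mult_le_mono)
next
  case (Div e f)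
  have "K ^ edeg e \<le> K ^ max (edeg e) (edeg f)" using K100 by (auto intro!: power_increasing)
  moreover have "val \<sigma> e \<le> K ^ edeg e" using Div by simp
  moreover have "val \<sigma> e div val \<sigma> f \<le> val \<sigma> e" by (rule div_le_dividend)
  ultimately show ?case unfolding val.simps edeg.simps by linarith
qed

lemma val_less_W: "bd \<sigma> \<Longrightarrow> elit e \<le> 100 \<Longrightarrow> edeg e \<le> 60 \<Longrightarrow> val \<sigma> e < W"
proof -
  assume "bd \<sigma>" "elit e \<le> 100" "edeg e \<le> 60"
  then have "val \<sigma> e \<le> K ^ edeg e" "K ^ edeg e \<le> K ^ 60"
    using val_le K100 by (auto intro!: power_increasing)
  then show ?thesis using KW by linarith
qed

lemma fits_aux: "bd \<sigma> \<Longrightarrow> elit e \<le> 100 \<Longrightarrow> edeg e \<le> 60 \<Longrightarrow> fits W \<sigma> e"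
proof (induction e)
  case (Const c)
  then show ?case using val_less_W[of \<sigma> "Const c"] by simp
next
  case (Load a e)
  then show ?case using val_less_W[of \<sigma> "Load a e"] by simp
next
  case (Add e f)
  then show ?case using val_less_W[of \<sigma> "Add e f"] by simp
next
  case (Sub e f)
  then show ?case using val_less_W[of \<sigma> "Sub e f"] by simp
next
  case (Mul e f)
  then show ?case using val_less_W[of \<sigma> "Mul e f"] edeg_pos[of e] edeg_pos[of f] by simp
next
  case (Div e f)
  then show ?case using val_less_W[of \<sigma> "Div e f"] by simp
qed

lemma fitsI: "bd \<sigma> \<Longrightarrow> eok e \<Longrightarrow> fits W \<sigma> e"
  using fits_aux by (simp add: eok_def)

text \<open>A total-correctness triple with a time bound. Carrying \<open>bd\<close> in every
  postcondition makes all later expressions fit without further proof.\<close>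

definition run :: "prog \<Rightarrow> memory \<Rightarrow> nat \<Rightarrow> (memory \<Rightarrow> bool) \<Rightarrow> bool" where
  "run p \<sigma> b Q \<longleftrightarrow> (\<exists>\<tau> \<sigma>'. exec W p \<sigma> \<tau> \<sigma>' \<and> \<tau> \<le> b \<and> bd \<sigma>' \<and> Q \<sigma>')"

lemma run_conseq: "run p \<sigma> b Q \<Longrightarrow> b \<le> b' \<Longrightarrow> (\<And>\<sigma>'. bd \<sigma>' \<Longrightarrow> Q \<sigma>' \<Longrightarrow> Q' \<sigma>') \<Longrightarrow> run p \<sigma> b' Q'"
  unfolding run_def by (meson le_trans)

lemma run_block_aux:
  "pok p \<Longrightarrow> bd \<sigma> \<Longrightarrow> safe K p \<sigma> \<Longrightarrow> \<exists>\<tau>. exec W p \<sigma> \<tau> (stp p \<sigma>) \<and> \<tau> \<le> psz p \<and> bd (stp p \<sigma>)"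
proof (induction p arbitrary: \<sigma>)
  case Skip
  then show ?case using exec.Skip by fastforce
next
  case (Store a e f)
  have "exec W (Store a e f) \<sigma> (1 + cost e + cost f) (\<sigma>(a := (\<sigma> a)(val \<sigma> e := val \<sigma> f)))"
    using Store.prems by (intro exec.Store fitsI) auto
  moreover have "bd (\<sigma>(a := (\<sigma> a)(val \<sigma> e := val \<sigma> f)))" using Store.prems by (intro bd_upd) auto
  ultimately show ?case unfolding stp.simps psz.simps by blast
next
  case (Seq p q)
  obtain \<tau>1 where 1: "exec W p \<sigma> \<tau>1 (stp p \<sigma>)" "\<tau>1 \<le> psz p" "bd (stp p \<sigma>)" using Seq by fastforce
  obtain \<tau>2 where 2: "exec W q (stp p \<sigma>) \<tau>2 (stp q (stp p \<sigma>))" "\<tau>2 \<le> psz q" "bd (stp q (stp p \<sigma>))"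
    using Seq.IH(2)[OF _ 1(3)] Seq.prems by fastforce
  show ?case using exec.Seq[OF 1(1) 2(1)] 1 2 by (intro exI[of _ "\<tau>1 + \<tau>2"]) auto
next
  case (Cond e p q)
  show ?case
  proof (cases "val \<sigma> e = 0")
    case True
    then obtain \<tau> where t: "exec W q \<sigma> \<tau> (stp q \<sigma>)" "\<tau> \<le> psz q" "bd (stp q \<sigma>)" using Cond by fastforce
    show ?thesis using exec.IfFalse[OF fitsI True t(1)] Cond.prems t True
      by (intro exI[of _ "1 + cost e + \<tau>"]) auto
  next
    case False
    then obtain \<tau> where t: "exec W p \<sigma> \<tau> (stp p \<sigma>)" "\<tau> \<le> psz p" "bd (stp p \<sigma>)" using Cond by fastforce
    show ?thesis using exec.IfTrue[OF fitsI False t(1)] Cond.prems t False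
      by (intro exI[of _ "1 + cost e + \<tau>"]) auto
  qed
qed simp

lemma run_block:
  assumes "pok p" "bd \<sigma>" "safe K p \<sigma>" "psz p \<le> b" "bd (stp p \<sigma>) \<Longrightarrow> Q (stp p \<sigma>)"
  shows "run p \<sigma> b Q"
  using run_block_aux[OF assms(1-3)] assms(4,5) unfolding run_def by (meson le_trans)

lemma run_seq:
  assumes "run p \<sigma> b1 (\<lambda>\<sigma>'. run q \<sigma>' b2 Q)" "b1 + b2 \<le> b"
  shows "run (Seq p q) \<sigma> b Q"
proof -
  obtain \<tau>1 \<sigma>1 where 1: "exec W p \<sigma> \<tau>1 \<sigma>1" "\<tau>1 \<le> b1" "run q \<sigma>1 b2 Q" using assms(1) by (auto simp: run_def)
  then obtain \<tau>2 \<sigma>2 where 2: "exec W q \<sigma>1 \<tau>2 \<sigma>2" "\<tau>2 \<le> b2" "bd \<sigma>2" "Q \<sigma>2" by (auto simp: run_def)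
  show ?thesis unfolding run_def using exec.Seq[OF 1(1) 2(1)] 1 2 assms(2)
    by (intro exI[of _ "\<tau>1 + \<tau>2"] exI[of _ \<sigma>2]) auto
qed

lemma run_seqI:
  assumes "run p \<sigma> b1 Q1" "\<And>\<sigma>'. bd \<sigma>' \<Longrightarrow> Q1 \<sigma>' \<Longrightarrow> run q \<sigma>' b2 Q" "b1 + b2 \<le> b"
  shows "run (Seq p q) \<sigma> b Q"
  by (rule run_seq[OF run_conseq[OF assms(1) order_refl assms(2)] assms(3)])

lemma run_cond:
  assumes "bd \<sigma>" "eok e" "val \<sigma> e \<noteq> 0 \<Longrightarrow> run p \<sigma> b1 Q" "val \<sigma> e = 0 \<Longrightarrow> run q \<sigma> b1 Q" "b1 + cost e + 1 \<le> b"
  shows "run (Cond e p q) \<sigma> b Q"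
proof (cases "val \<sigma> e = 0")
  case True
  then obtain \<tau> \<sigma>' where t: "exec W q \<sigma> \<tau> \<sigma>'" "\<tau> \<le> b1" "bd \<sigma>'" "Q \<sigma>'" using assms(4) by (auto simp: run_def)
  show ?thesis unfolding run_def using exec.IfFalse[OF fitsI True t(1)] assms t
    by (intro exI[of _ "1 + cost e + \<tau>"] exI[of _ \<sigma>']) auto
next
  case False
  then obtain \<tau> \<sigma>' where t: "exec W p \<sigma> \<tau> \<sigma>'" "\<tau> \<le> b1" "bd \<sigma>'" "Q \<sigma>'" using assms(3) by (auto simp: run_def)
  show ?thesis unfolding run_def using exec.IfTrue[OF fitsI False t(1)] assms t
    by (intro exI[of _ "1 + cost e + \<tau>"] exI[of _ \<sigma>']) auto
qed

text \<open>The measure serves for termination and as a bound on the number of rounds. It may drop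
  by more than one in a round.\<close>

lemma run_while:
  assumes "bd \<sigma>" "eok e" "I m \<sigma>"
    and step: "\<And>j \<tau>. bd \<tau> \<Longrightarrow> I j \<tau> \<Longrightarrow> val \<tau> e \<noteq> 0 \<Longrightarrow> run p \<tau> c (\<lambda>\<tau>'. \<exists>j'<j. I j' \<tau>')"
    and post: "\<And>j \<tau>. bd \<tau> \<Longrightarrow> I j \<tau> \<Longrightarrow> val \<tau> e = 0 \<Longrightarrow> Q \<tau>"
    and b: "m * (c + cost e + 1) + cost e + 1 \<le> b"
  shows "run (While e p) \<sigma> b Q"
proof -
  have "run (While e p) \<sigma> (m * (c + cost e + 1) + cost e + 1) Q"
    using assms(1,3)
  proof (induction m arbitrary: \<sigma> rule: less_induct)
    case (less m)
    show ?case
    proof (cases "val \<sigma> e = 0")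
      case True
      show ?thesis unfolding run_def
        using exec.WhileFalse[OF fitsI[OF less.prems(1) assms(2)] True, of p] post[OF less.prems True] less.prems
        by (intro exI[of _ "1 + cost e"] exI[of _ \<sigma>]) auto
    next
      case False
      obtain \<tau>1 \<sigma>1 j' where 1: "exec W p \<sigma> \<tau>1 \<sigma>1" "\<tau>1 \<le> c" "bd \<sigma>1" "j' < m" "I j' \<sigma>1"
        using step[OF less.prems False] by (auto simp: run_def)
      obtain \<tau>2 \<sigma>2 where 2: "exec W (While e p) \<sigma>1 \<tau>2 \<sigma>2" "\<tau>2 \<le> j' * (c + cost e + 1) + cost e + 1" "bd \<sigma>2" "Q \<sigma>2"
        using less.IH[OF 1(4,3,5)] by (auto simp: run_def)
      have "Suc j' * (c + cost e + 1) \<le> m * (c + cost e + 1)" using 1(4) by (intro mult_le_mono1) simp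
      then have "1 + cost e + \<tau>1 + \<tau>2 \<le> m * (c + cost e + 1) + cost e + 1"
        using 1(2) 2(2) by simp
      then show ?thesis unfolding run_def
        using exec.WhileTrue[OF fitsI[OF less.prems(1) assms(2)] False 1(1) 2(1)] 2 by blast
    qed
  qed
  then show ?thesis using b by (rule run_conseq)
qed

text \<open>\<open>I j\<close> speaks of the memory in which the counter already holds
  \<open>j\<close>; hence the body has to establish \<open>I (Suc j)\<close> for the memory with the
  increment carried out. \<open>mK\<close> keeps the counter within the word bound.\<close>

lemma run_for:
  assumes bd: "bd \<sigma>" and lok: "eok lm" and lm: "\<And>j \<tau>. I j \<tau> \<Longrightarrow> val \<tau> lm = m" and mK: "m < K"
    and init: "I 0 (\<sigma>(v := (\<sigma> v)(0 := 0)))"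
    and step: "\<And>j \<tau>. j < m \<Longrightarrow> bd \<tau> \<Longrightarrow> \<tau> v 0 = j \<Longrightarrow> I j \<tau> \<Longrightarrow>
      run p \<tau> c (\<lambda>\<tau>'. \<tau>' v 0 = j \<and> I (Suc j) (\<tau>'(v := (\<tau>' v)(0 := Suc j))))"
    and post: "\<And>\<tau>. bd \<tau> \<Longrightarrow> I m \<tau> \<Longrightarrow> Q \<tau>"
    and b: "m * (c + cost lm + 10) + cost lm + 10 \<le> b"
  shows "run (For v lm p) \<sigma> b Q"
  unfolding For_def
proof (rule run_seqI)
  show "run (Store v (Const 0) (Const 0)) \<sigma> 3 (\<lambda>\<tau>. \<tau> v 0 = 0 \<and> I 0 \<tau>)"
    using init bd by (intro run_block) (auto simp: eok_def)
next
  fix \<sigma>1 assume s1: "bd \<sigma>1" "\<sigma>1 v 0 = 0 \<and> I 0 \<sigma>1"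
  let ?J = "\<lambda>i \<tau>. \<exists>j\<le>m. i = m - j \<and> \<tau> v 0 = j \<and> I j \<tau>"
  show "run (While (Sub lm (Load v (Const 0))) (Seq p (Store v (Const 0) (Add (Load v (Const 0)) (Const 1))))) \<sigma>1
     (m * (c + cost lm + 10) + cost lm + 5) Q"
  proof (rule run_while[where I = ?J and m = m and c = "c + 6"])
    show "bd \<sigma>1" by fact
    show "eok (Sub lm (Load v (Const 0)))" using lok by (simp add: eok_def)
    show "?J m \<sigma>1" using s1 by (intro exI[of _ 0]) auto
  next
    fix i \<tau> assume t: "bd \<tau>" "?J i \<tau>" "val \<tau> (Sub lm (Load v (Const 0))) \<noteq> 0"
    then obtain j where j: "j \<le> m" "i = m - j" "\<tau> v 0 = j" "I j \<tau>" by blast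
    then have jm: "j < m" using t(3) lm[OF j(4)] by simp
    show "run (Seq p (Store v (Const 0) (Add (Load v (Const 0)) (Const 1)))) \<tau> (c + 6) (\<lambda>\<tau>'. \<exists>j'<i. ?J j' \<tau>')"
    proof (rule run_seqI[OF step[OF jm t(1) j(3,4)]])
      fix \<tau>' assume t': "bd \<tau>'" "\<tau>' v 0 = j \<and> I (Suc j) (\<tau>'(v := (\<tau>' v)(0 := Suc j)))"
      show "run (Store v (Const 0) (Add (Load v (Const 0)) (Const 1))) \<tau>' 6 (\<lambda>\<tau>'. \<exists>j'<i. ?J j' \<tau>')"
      proof (rule run_block)
        show "\<exists>j'<i. ?J j' (stp (Store v (Const 0) (Add (Load v (Const 0)) (Const 1))) \<tau>')"
          using t' jm j by (intro exI[of _ "m - Suc j"] conjI exI[of _ "Suc j"]) auto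
      qed (use t' mK jm in \<open>auto simp: eok_def\<close>)
    next
      show "c + 6 \<le> c + 6" by simp
    qed
  next
    fix i \<tau> assume t: "bd \<tau>" "?J i \<tau>" "val \<tau> (Sub lm (Load v (Const 0))) = 0"
    then obtain j where j: "j \<le> m" "i = m - j" "\<tau> v 0 = j" "I j \<tau>" by blast
    then have "j = m" using t(3) lm[OF j(4)] by simp
    then show "Q \<tau>" using post[OF t(1)] j by simp
  next
    show "m * (c + 6 + cost (Sub lm (Load v (Const 0))) + 1) + cost (Sub lm (Load v (Const 0))) + 1 \<le> m * (c + cost lm + 10) + cost lm + 5"
      by (auto simp: algebra_simps)
  qed
next
  show "3 + (m * (c + cost lm + 10) + cost lm + 5) \<le> b" using b by simp
qed

end

section \<open>Graph search and augmentation on the RAM\<close>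

text \<open>
  Scalars are kept at index \<open>0\<close> of an array of their own. The arrays are: \<open>aD\<close>, the adjacency matrices of
  the graph and of its converse; \<open>aC1\<close> and \<open>aC2\<close>, the two bags of a vertex, numbered from \<open>1\<close>, with \<open>0\<close>
  for a missing bag; \<open>aTm\<close>, the terminals of either side; \<open>aSt\<close>, the states of the bags, where
  \<open>aSt[0] = 3\<close> lets a missing bag count as claimed by neither side; \<open>aM\<close>, the residual graph; \<open>aVis\<close>,
  \<open>aPar\<close> and \<open>aQ\<close>, the marks, tree and queue of a search; \<open>aNx\<close>, successors along the flow; \<open>aLab\<close> and
  \<open>aZ\<close>, the terminal whose path contains a vertex, and the end bags of the paths, again from \<open>1\<close>.
\<close>

abbreviation V :: "nat \<Rightarrow> expr" where "V x \<equiv> Load x (Const 0)"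
abbreviation assign :: "nat \<Rightarrow> expr \<Rightarrow> prog" (infix "::=" 60) where "x ::= e \<equiv> Store x (Const 0) e"
abbreviation seq_syn :: "prog \<Rightarrow> prog \<Rightarrow> prog" (infixr ";;" 55) where "p ;; q \<equiv> Seq p q"
text \<open>Every nonzero word counts as true. Truncated subtraction then decides order, a sum of
  words is their disjunction and a product their conjunction.\<close>

abbreviation NotE :: "expr \<Rightarrow> expr" where "NotE e \<equiv> Sub (Const 1) e"
abbreviation NeqE :: "expr \<Rightarrow> expr \<Rightarrow> expr" where "NeqE e f \<equiv> Add (Sub e f) (Sub f e)"
abbreviation EqE :: "expr \<Rightarrow> expr \<Rightarrow> expr" where "EqE e f \<equiv> NotE (NeqE e f)"
abbreviation LtE :: "expr \<Rightarrow> expr \<Rightarrow> expr" where "LtE e f \<equiv> Sub f e"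
abbreviation LeE :: "expr \<Rightarrow> expr \<Rightarrow> expr" where "LeE e f \<equiv> Sub (Add f (Const 1)) e"

abbreviation (input) vn :: nat where "vn \<equiv> 2"
abbreviation (input) ve :: nat where "ve \<equiv> 3"
abbreviation (input) vb :: nat where "vb \<equiv> 4"
abbreviation (input) vk :: nat where "vk \<equiv> 5"
abbreviation (input) vt :: nat where "vt \<equiv> 6"
abbreviation (input) vN :: nat where "vN \<equiv> 7"
abbreviation (input) vpos :: nat where "vpos \<equiv> 8"
abbreviation (input) vj :: nat where "vj \<equiv> 9"
abbreviation (input) vu :: nat where "vu \<equiv> 10"
abbreviation (input) vv :: nat where "vv \<equiv> 11"
abbreviation (input) vi :: nat where "vi \<equiv> 12"
abbreviation (input) vs :: nat where "vs \<equiv> 13"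
abbreviation (input) vr :: nat where "vr \<equiv> 14"
abbreviation (input) vx :: nat where "vx \<equiv> 15"
abbreviation (input) vy :: nat where "vy \<equiv> 16"
abbreviation (input) vtl :: nat where "vtl \<equiv> 17"
abbreviation (input) vcur :: nat where "vcur \<equiv> 18"
abbreviation (input) vc :: nat where "vc \<equiv> 19"
abbreviation (input) vo :: nat where "vo \<equiv> 20"
abbreviation (input) vp :: nat where "vp \<equiv> 21"
abbreviation (input) aD :: nat where "aD \<equiv> 30"
abbreviation (input) aC1 :: nat where "aC1 \<equiv> 31"
abbreviation (input) aC2 :: nat where "aC2 \<equiv> 32"
abbreviation (input) aTm :: nat where "aTm \<equiv> 33"
abbreviation (input) aSt :: nat where "aSt \<equiv> 34"
abbreviation (input) aM :: nat where "aM \<equiv> 35"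
abbreviation (input) aVis :: nat where "aVis \<equiv> 36"
abbreviation (input) aPar :: nat where "aPar \<equiv> 37"
abbreviation (input) aQ :: nat where "aQ \<equiv> 38"
abbreviation (input) aNx :: nat where "aNx \<equiv> 39"
abbreviation (input) aLab :: nat where "aLab \<equiv> 40"
abbreviation (input) aZ :: nat where "aZ \<equiv> 41"

definition mat :: "nat \<Rightarrow> memory \<Rightarrow> (nat \<times> nat) set" where
  "mat N \<sigma> = {(x, y). x < N \<and> y < N \<and> \<sigma> aM (x * N + y) \<noteq> 0}"

lemma matrix_index_eq:
  assumes "y < N" "y' < (N :: nat)"
  shows "x * N + y = x' * N + y' \<longleftrightarrow> x = x' \<and> y = y'"
proof
  assume eq: "x * N + y = x' * N + y'"
  have "(x * N + y) div N = x" "(x' * N + y') div N = x'" using assms by auto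
  then have "x = x'" using eq by metis
  then show "x = x' \<and> y = y'" using eq by simp
qed simp

lemma mat_upd:
  assumes "x < N" "y < N"
  shows "mat N (\<sigma>(aM := (\<sigma> aM)(x * N + y := w))) = (if w = 0 then mat N \<sigma> - {(x, y)} else insert (x, y) (mat N \<sigma>))"
  using assms by (auto simp: mat_def matrix_index_eq)

lemma mat_other [simp]: "a \<noteq> aM \<Longrightarrow> mat N (\<sigma>(a := f)) = mat N \<sigma>"
  by (simp add: mat_def)

lemma mat_keeps: "keeps A \<sigma> \<sigma>' \<Longrightarrow> aM \<notin> A \<Longrightarrow> mat N \<sigma>' = mat N \<sigma>"
  using keepsD[of A \<sigma> \<sigma>' aM] by (simp add: mat_def)

subsection \<open>Breadth-first search\<close>

text \<open>The first \<open>h\<close> queue entries are completely scanned, entry \<open>h\<close>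
  is scanned for the nodes below \<open>y\<close>, and \<open>qe\<close> is the length of the queue.
  Parents precede their children in the queue, so the queue position will serve as a rank.\<close>

definition search_inv ::
    "(nat \<times> nat) set \<Rightarrow> nat \<Rightarrow> nat \<Rightarrow> nat \<Rightarrow> (nat \<Rightarrow> nat) \<Rightarrow> (nat \<Rightarrow> nat) \<Rightarrow> (nat \<Rightarrow> nat) \<Rightarrow> nat \<Rightarrow> bool" where
  "search_inv R N h y q par vis qe \<longleftrightarrow> 1 \<le> qe \<and> q 0 = N - 1 \<and> inj_on q {..<qe} \<and>
     q ` {..<qe} = {x. x < N \<and> vis x \<noteq> 0} \<and>
     (\<forall>j. 0 < j \<and> j < qe \<longrightarrow> (\<exists>i<j. par (q j) = q i \<and> (q i, q j) \<in> R)) \<and>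
     (\<forall>i<h. i < qe \<longrightarrow> (\<forall>z<N. (q i, z) \<in> R \<longrightarrow> vis z \<noteq> 0)) \<and>
     (h < qe \<longrightarrow> (\<forall>z<y. z < N \<longrightarrow> (q h, z) \<in> R \<longrightarrow> vis z \<noteq> 0))"

lemma search_inv_tl: "search_inv R N h y q par vis qe \<Longrightarrow> qe \<le> N"
proof -
  assume a: "search_inv R N h y q par vis qe"
  then have "inj_on q {..<qe}" by (simp add: search_inv_def)
  then have "card (q ` {..<qe}) = qe" by (simp add: card_image)
  moreover have "q ` {..<qe} \<subseteq> {..<N}" using a by (auto simp: search_inv_def)
  then have "card (q ` {..<qe}) \<le> card {..<N}" by (intro card_mono) auto
  ultimately show ?thesis by simp
qed

lemma search_inv_q: "search_inv R N h y q par vis qe \<Longrightarrow> i < qe \<Longrightarrow> q i < N \<and> vis (q i) \<noteq> 0"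
  by (auto simp: search_inv_def)

lemma search_inv_push:
  assumes inv: "search_inv R N h y q par vis qe" and h: "h < qe" and y: "y < N" "(q h, y) \<in> R" "vis y = 0"
  shows "search_inv R N h (Suc y) (q(qe := y)) (par(y := q h)) (vis(y := Suc 0)) (Suc qe)" "qe < N"
proof -
  have qe1: "1 \<le> qe" and q0: "q 0 = N - 1" and inj: "inj_on q {..<qe}"
    and im0: "q ` {..<qe} = {x. x < N \<and> vis x \<noteq> 0}"
    and par: "\<And>j. 0 < j \<Longrightarrow> j < qe \<Longrightarrow> \<exists>i<j. par (q j) = q i \<and> (q i, q j) \<in> R"
    and old: "\<And>i z. i < h \<Longrightarrow> i < qe \<Longrightarrow> z < N \<Longrightarrow> (q i, z) \<in> R \<Longrightarrow> vis z \<noteq> 0"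
    and cur: "\<And>z. h < qe \<Longrightarrow> z < y \<Longrightarrow> z < N \<Longrightarrow> (q h, z) \<in> R \<Longrightarrow> vis z \<noteq> 0"
    using inv by (simp_all add: search_inv_def)
  have new: "y \<notin> q ` {..<qe}" using im0 y by auto
  have im: "(q(qe := y)) ` {..<Suc qe} = insert y (q ` {..<qe})" by (auto simp: lessThan_Suc)
  have ny: "q i \<noteq> y" if "i < qe" for i using new that by auto
  have 1: "inj_on (q(qe := y)) {..<Suc qe}"
    using inj new by (auto simp: lessThan_Suc inj_on_def image_iff)
  have 2: "(q(qe := y)) ` {..<Suc qe} = {x. x < N \<and> (vis(y := Suc 0)) x \<noteq> 0}"
    unfolding im im0 using y by auto
  have 3: "\<exists>i<j. (par(y := q h)) ((q(qe := y)) j) = (q(qe := y)) i \<and> ((q(qe := y)) i, (q(qe := y)) j) \<in> R"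
    if j0: "0 < j \<and> j < Suc qe" for j
  proof (cases "j = qe")
    case True
    then show ?thesis using h y by (intro exI[of _ h]) auto
  next
    case False
    then have j: "j < qe" using j0 by simp
    then obtain i where "i < j" "par (q j) = q i" "(q i, q j) \<in> R" using par[of j] j0 by auto
    then show ?thesis using j ny[of j] False by (intro exI[of _ i]) auto
  qed
  have 4: "(vis(y := Suc 0)) z \<noteq> 0" if "i < h" "z < N" "((q(qe := y)) i, z) \<in> R" for i z
    using old[of i z] that h by simp
  have 5: "(vis(y := Suc 0)) z \<noteq> 0" if "z < Suc y" "z < N" "((q(qe := y)) h, z) \<in> R" for z
    using cur[of z] that h by (cases "z = y") auto
  show inv': "search_inv R N h (Suc y) (q(qe := y)) (par(y := q h)) (vis(y := Suc 0)) (Suc qe)"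
    unfolding search_inv_def using qe1 q0 1 2 3 4 5 by simp
  show "qe < N" using search_inv_tl[OF inv'] by simp
qed

lemma search_inv_skip:
  "search_inv R N h y q par vis qe \<Longrightarrow> (h < qe \<Longrightarrow> (q h, y) \<in> R \<Longrightarrow> vis y \<noteq> 0) \<Longrightarrow> search_inv R N h (Suc y) q par vis qe"
  unfolding search_inv_def by (auto simp: less_Suc_eq)

lemma search_inv_next:
  "search_inv R N h N q par vis qe \<Longrightarrow> search_inv R N (Suc h) 0 q par vis qe"
  unfolding search_inv_def by (auto simp: less_Suc_eq)

lemma search_inv_idle:
  "search_inv R N h 0 q par vis qe \<Longrightarrow> qe \<le> h \<Longrightarrow> search_inv R N (Suc h) 0 q par vis qe"
  unfolding search_inv_def by (auto simp: less_Suc_eq)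

text \<open>The rank makes a walk along parents terminate at node \<open>N - 1\<close>, and its
  bound \<open>N\<close> limits the number of steps.\<close>

definition search_tree :: "(nat \<times> nat) set \<Rightarrow> nat \<Rightarrow> (nat \<Rightarrow> nat) \<Rightarrow> bool" where
  "search_tree R N par \<longleftrightarrow> (\<exists>rk. \<forall>x. (N - 1, x) \<in> R\<^sup>* \<and> x \<noteq> N - 1 \<longrightarrow>
     (par x, x) \<in> R \<and> (N - 1, par x) \<in> R\<^sup>* \<and> rk (par x) < (rk x :: nat) \<and> rk x < N)"

text \<open>The queue has at most \<open>N\<close> entries, so after \<open>N\<close> rounds all of
  them are scanned and the queue is closed under arcs. The rank of a node is its position in the
  queue.\<close>

lemma search_inv_finish:
  assumes inv: "search_inv R N N 0 q par vis qe" and R: "R \<subseteq> {..<N} \<times> {..<N}" and N: "0 < N"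
  shows "search_tree R N par"
proof -
  note i = inv[unfolded search_inv_def]
  have qe: "qe \<le> N" by (rule search_inv_tl[OF inv])
  have reach: "x \<in> q ` {..<qe}" if "(N - 1, x) \<in> R\<^sup>*" for x using that
  proof (induction rule: rtrancl_induct)
    case base
    have "1 \<le> qe" "q 0 = N - 1" using i by blast+
    then have "q 0 \<in> q ` {..<qe}" by (intro imageI) simp
    then show ?case using \<open>q 0 = N - 1\<close> by simp
  next
    case (step x z)
    then obtain m where m: "m < qe" "x = q m" by auto
    have "z < N" using step R by auto
    moreover have "m < N" using m qe by simp
    then have "\<forall>z<N. (q m, z) \<in> R \<longrightarrow> vis z \<noteq> 0" using i m by blast
    ultimately have "vis z \<noteq> 0" using step.hyps m by auto
    then show ?case using \<open>z < N\<close> i by auto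
  qed
  have sound: "(N - 1, q j) \<in> R\<^sup>*" if "j < qe" for j using that
  proof (induction j rule: less_induct)
    case (less j)
    show ?case
    proof (cases "j = 0")
      case True
      then show ?thesis using i by simp
    next
      case False
      then obtain m where m: "m < j" "(q m, q j) \<in> R" using i less.prems by auto
      then have "(N - 1, q m) \<in> R\<^sup>*" using less by simp
      then show ?thesis using m by (meson rtrancl_into_rtrancl)
    qed
  qed
  define rk where "rk = the_inv_into {..<qe} q"
  have rk: "rk (q j) = j" if "j < qe" for j using that i by (simp add: rk_def the_inv_into_f_f)
  have "(par x, x) \<in> R \<and> (N - 1, par x) \<in> R\<^sup>* \<and> rk (par x) < rk x \<and> rk x < N"
    if x: "(N - 1, x) \<in> R\<^sup>*" "x \<noteq> N - 1" for x
  proof -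
    obtain j where j: "j < qe" "x = q j" using reach[OF x(1)] by auto
    have "j \<noteq> 0" using x j i by auto
    then obtain m where m: "m < j" "par (q j) = q m" "(q m, q j) \<in> R" using i j by auto
    then show ?thesis using j rk sound qe by simp
  qed
  then show ?thesis unfolding search_tree_def by blast
qed

text \<open>The search starts at node \<open>N - 1\<close>. The outer loop runs for \<open>N\<close>
  rounds whatever the length of the queue, so that counted loops suffice; rounds beyond the end of
  the queue do nothing.\<close>

definition search :: prog where
  "search =
     For vx (V vN) (Store aVis (V vx) (Const 0)) ;;
     (Store aQ (Const 0) (Sub (V vN) (Const 1)) ;; Store aVis (Sub (V vN) (Const 1)) (Const 1) ;; vtl ::= Const 1) ;;
     For vx (V vN) (Cond (LtE (V vx) (V vtl))
       (For vy (V vN)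
          (Cond (Mul (Load aM (Add (Mul (Load aQ (V vx)) (V vN)) (V vy))) (NotE (Load aVis (V vy))))
            (Store aVis (V vy) (Const 1) ;; Store aPar (V vy) (Load aQ (V vx)) ;; Store aQ (V vtl) (V vy) ;;
             vtl ::= Add (V vtl) (Const 1))
            Skip))
       Skip)"

lemma square_bound: "1 \<le> (N :: nat) \<Longrightarrow> N \<le> N * N \<and> 1 \<le> N * N" by simp

context ram
begin

lemma run_search:
  assumes bd: "bd \<sigma>" and N: "\<sigma> vN 0 = N" "1 \<le> N" "N < K"
  shows "run search \<sigma> (200 * (N * N))
    (\<lambda>\<sigma>'. keeps {vx, vy, vtl, aVis, aPar, aQ} \<sigma> \<sigma>' \<and> search_tree (mat N \<sigma>) N (\<sigma>' aPar))"
proof -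
  define R where "R = mat N \<sigma>"
  let ?S = "{vx, vy, vtl, aVis, aPar, aQ}"
  have RN: "R \<subseteq> {..<N} \<times> {..<N}" by (auto simp: R_def mat_def)
  let ?I1 = "\<lambda>j \<tau>. keeps ?S \<sigma> \<tau> \<and> (\<forall>x<j. \<tau> aVis x = 0)"
  have 1: "run (For vx (V vN) (Store aVis (V vx) (Const 0))) \<sigma> (17 * N + 12) (?I1 N)"
  proof (rule run_for[where I = ?I1 and m = N and c = 5])
    fix j \<tau> assume t: "j < N" "bd \<tau>" "\<tau> vx 0 = j" "?I1 j \<tau>"
    show "run (Store aVis (V vx) (Const 0)) \<tau> 5 (\<lambda>\<tau>'. \<tau>' vx 0 = j \<and> ?I1 (Suc j) (\<tau>'(vx := (\<tau>' vx)(0 := Suc j))))"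
      using t by (intro run_block) (auto simp: eok_def less_Suc_eq)
  qed (use bd N in \<open>auto simp: eok_def keeps_def\<close>)
  have 2: "run (Store aQ (Const 0) (Sub (V vN) (Const 1)) ;; Store aVis (Sub (V vN) (Const 1)) (Const 1) ;; vtl ::= Const 1) \<tau> 30
     (\<lambda>\<tau>'. keeps ?S \<sigma> \<tau>' \<and> search_inv R N 0 0 (\<tau>' aQ) (\<tau>' aPar) (\<tau>' aVis) (\<tau>' vtl 0))"
    if t: "bd \<tau>" "?I1 N \<tau>" for \<tau>
  proof -
    have N': "\<tau> vN 0 = N" using t N by (simp add: keeps_def)
    show ?thesis using t N' N K100
      by (intro run_block) (auto simp: eok_def search_inv_def lessThan_Suc split: if_splits)
  qed
  have 3: "run (For vx (V vN) (Cond (LtE (V vx) (V vtl))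
       (For vy (V vN)
          (Cond (Mul (Load aM (Add (Mul (Load aQ (V vx)) (V vN)) (V vy))) (NotE (Load aVis (V vy))))
            (Store aVis (V vy) (Const 1) ;; Store aPar (V vy) (Load aQ (V vx)) ;; Store aQ (V vtl) (V vy) ;;
             vtl ::= Add (V vtl) (Const 1))
            Skip))
       Skip)) \<sigma>1 (N * (72 * N + 40) + 12) (\<lambda>\<sigma>'. keeps ?S \<sigma> \<sigma>' \<and> search_tree R N (\<sigma>' aPar))"
    if s1: "bd \<sigma>1" "keeps ?S \<sigma> \<sigma>1 \<and> search_inv R N 0 0 (\<sigma>1 aQ) (\<sigma>1 aPar) (\<sigma>1 aVis) (\<sigma>1 vtl 0)" for \<sigma>1
  proof -
    let ?I = "\<lambda>h \<tau>. keeps ?S \<sigma> \<tau> \<and> search_inv R N h 0 (\<tau> aQ) (\<tau> aPar) (\<tau> aVis) (\<tau> vtl 0)"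
    show ?thesis
    proof (rule run_for[where I = ?I and m = N and c = "72 * N + 20"])
      fix h \<tau> assume h: "h < N" "bd \<tau>" "\<tau> vx 0 = h" "?I h \<tau>"
      let ?P = "\<lambda>\<tau>'. \<tau>' vx 0 = h \<and> ?I (Suc h) (\<tau>'(vx := (\<tau>' vx)(0 := Suc h)))"
      show "run (Cond (LtE (V vx) (V vtl))
       (For vy (V vN)
          (Cond (Mul (Load aM (Add (Mul (Load aQ (V vx)) (V vN)) (V vy))) (NotE (Load aVis (V vy))))
            (Store aVis (V vy) (Const 1) ;; Store aPar (V vy) (Load aQ (V vx)) ;; Store aQ (V vtl) (V vy) ;;
             vtl ::= Add (V vtl) (Const 1))
            Skip)) Skip) \<tau> (72 * N + 20) ?P"
      proof (rule run_cond[where ?b1.0 = "72 * N + 12"])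
        assume ht: "val \<tau> (LtE (V vx) (V vtl)) \<noteq> 0"
        let ?J = "\<lambda>y \<tau>. keeps ?S \<sigma> \<tau> \<and> \<tau> vx 0 = h \<and> h < \<tau> vtl 0 \<and> search_inv R N h y (\<tau> aQ) (\<tau> aPar) (\<tau> aVis) (\<tau> vtl 0)"
        show "run (For vy (V vN)
          (Cond (Mul (Load aM (Add (Mul (Load aQ (V vx)) (V vN)) (V vy))) (NotE (Load aVis (V vy))))
            (Store aVis (V vy) (Const 1) ;; Store aPar (V vy) (Load aQ (V vx)) ;; Store aQ (V vtl) (V vy) ;;
             vtl ::= Add (V vtl) (Const 1))
            Skip)) \<tau> (72 * N + 12) ?P"
        proof (rule run_for[where I = ?J and m = N and c = 60])
          fix y \<rho> assume y: "y < N" "bd \<rho>" "\<rho> vy 0 = y" "?J y \<rho>"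
          have N': "\<rho> vN 0 = N" using y N by (simp add: keeps_def)
          have qh: "\<rho> aQ h < N" using search_inv_q y by blast
          have Rm: "(\<rho> aQ h, y) \<in> R \<longleftrightarrow> \<rho> aM (\<rho> aQ h * N + y) \<noteq> 0"
            using y qh by (simp add: R_def mat_def keeps_def)
          have qe: "\<rho> vtl 0 \<le> N" using y search_inv_tl by blast
          have push: "search_inv R N h (Suc y) ((\<rho> aQ)(\<rho> vtl 0 := y)) ((\<rho> aPar)(y := \<rho> aQ h)) ((\<rho> aVis)(y := Suc 0)) (Suc (\<rho> vtl 0))"
            if "(\<rho> aQ h, y) \<in> R" "\<rho> aVis y = 0"
            using search_inv_push(1)[of R N h y] y that by blast
          have skip: "search_inv R N h (Suc y) (\<rho> aQ) (\<rho> aPar) (\<rho> aVis) (\<rho> vtl 0)"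
            if "\<not> ((\<rho> aQ h, y) \<in> R \<and> \<rho> aVis y = 0)"
            using search_inv_skip[of R N h y] y that by blast
          show "run (Cond (Mul (Load aM (Add (Mul (Load aQ (V vx)) (V vN)) (V vy))) (NotE (Load aVis (V vy))))
            (Store aVis (V vy) (Const 1) ;; Store aPar (V vy) (Load aQ (V vx)) ;; Store aQ (V vtl) (V vy) ;;
             vtl ::= Add (V vtl) (Const 1)) Skip) \<rho> 60 (\<lambda>\<tau>'. \<tau>' vy 0 = y \<and> ?J (Suc y) (\<tau>'(vy := (\<tau>' vy)(0 := Suc y))))"
          proof (cases "(\<rho> aQ h, y) \<in> R \<and> \<rho> aVis y = 0")
            case True
            then show ?thesis using y N' N K100 qe push Rm qh
              by (intro run_block) (auto simp: eok_def)
          next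
            case False
            then show ?thesis using y N' N skip Rm
              by (intro run_block) (auto simp: eok_def)
          qed
        next
          fix \<rho> assume "bd \<rho>" "?J N \<rho>"
          then show "?P \<rho>" using search_inv_next by auto
        qed (use h N ht in \<open>auto simp: eok_def keeps_def\<close>)
      next
        assume "val \<tau> (LtE (V vx) (V vtl)) = 0"
        then show "run Skip \<tau> (72 * N + 12) ?P"
          using h search_inv_idle by (intro run_block) auto
      qed (use h in \<open>auto simp: eok_def\<close>)
    next
      fix \<tau> assume "bd \<tau>" "?I N \<tau>"
      then show "keeps ?S \<sigma> \<tau> \<and> search_tree R N (\<tau> aPar)" using search_inv_finish[OF _ RN] N by auto
    qed (use s1 N in \<open>auto simp: eok_def keeps_def\<close>)
  qed
  show ?thesis unfolding search_def R_def[symmetric]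
  proof (rule run_seqI[OF 1], rule run_seqI)
    fix \<sigma>' assume s: "bd \<sigma>'" "?I1 N \<sigma>'"
    show "run (Store aQ (Const 0) (Sub (V vN) (Const 1)) ;; Store aVis (Sub (V vN) (Const 1)) (Const 1) ;; vtl ::= Const 1) \<sigma>' 30
     (\<lambda>\<tau>'. keeps ?S \<sigma> \<tau>' \<and> search_inv R N 0 0 (\<tau>' aQ) (\<tau>' aPar) (\<tau>' aVis) (\<tau>' vtl 0))" by (rule 2[OF s])
  next
    fix \<sigma>1 assume "bd \<sigma>1" "keeps ?S \<sigma> \<sigma>1 \<and> search_inv R N 0 0 (\<sigma>1 aQ) (\<sigma>1 aPar) (\<sigma>1 aVis) (\<sigma>1 vtl 0)"
    then show "run (For vx (V vN) (Cond (LtE (V vx) (V vtl))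
       (For vy (V vN)
          (Cond (Mul (Load aM (Add (Mul (Load aQ (V vx)) (V vN)) (V vy))) (NotE (Load aVis (V vy))))
            (Store aVis (V vy) (Const 1) ;; Store aPar (V vy) (Load aQ (V vx)) ;; Store aQ (V vtl) (V vy) ;;
             vtl ::= Add (V vtl) (Const 1))
            Skip))
       Skip)) \<sigma>1 (N * (72 * N + 40) + 12) (\<lambda>\<sigma>'. keeps ?S \<sigma> \<sigma>' \<and> search_tree R N (\<sigma>' aPar))" by (rule 3)
  next
    show "30 + (N * (72 * N + 40) + 12) \<le> 72 * (N * N) + 40 * N + 42" by (simp add: algebra_simps)
    show "17 * N + 12 + (72 * (N * N) + 40 * N + 42) \<le> 200 * (N * N)" using square_bound[OF N(2)] by linarith
  qed
qed

end

subsection \<open>Filling the matrix\<close>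

abbreviation matE :: "expr \<Rightarrow> expr \<Rightarrow> expr" where "matE e f \<equiv> Add (Mul e (V vN)) f"

definition fill :: "expr \<Rightarrow> prog" where
  "fill ex = For vx (V vN) (For vy (V vN) (Cond ex
     (Store aM (matE (V vx) (V vy)) (Const 1)) (Store aM (matE (V vx) (V vy)) (Const 0))))"

context ram
begin

text \<open>A network is handed to the program as one expression in the row and column registers.
  The cost limit \<open>600\<close> is a constant large enough for all networks below.\<close>

lemma run_fill:
  assumes bd: "bd \<sigma>" and N: "\<sigma> vN 0 = N" "1 \<le> N" "N < K" and ex: "eok ex" "cost ex \<le> 600"
    and P: "\<And>\<tau> x y. keeps {vx, vy, aM} \<sigma> \<tau> \<Longrightarrow> \<tau> vx 0 = x \<Longrightarrow> \<tau> vy 0 = y \<Longrightarrow> x < N \<Longrightarrow> y < N \<Longrightarrow>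
      val \<tau> ex \<noteq> 0 \<longleftrightarrow> P x y"
  shows "run (fill ex) \<sigma> (700 * (N * N))
    (\<lambda>\<sigma>'. keeps {vx, vy, aM} \<sigma> \<sigma>' \<and> mat N \<sigma>' = {(x, y). x < N \<and> y < N \<and> P x y})"
proof -
  let ?S = "{vx, vy, aM}"
  let ?I = "\<lambda>i \<tau>. keeps ?S \<sigma> \<tau> \<and> (\<forall>x<i. \<forall>y<N. \<tau> aM (x * N + y) \<noteq> 0 \<longleftrightarrow> P x y)"
  show ?thesis unfolding fill_def
  proof (rule run_for[where I = ?I and m = N and c = "624 * N + 12"])
    fix i \<tau> assume i: "i < N" "bd \<tau>" "\<tau> vx 0 = i" "?I i \<tau>"
    let ?J = "\<lambda>j \<tau>. keeps ?S \<sigma> \<tau> \<and> \<tau> vx 0 = i \<and> (\<forall>x<i. \<forall>y<N. \<tau> aM (x * N + y) \<noteq> 0 \<longleftrightarrow> P x y) \<and>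
       (\<forall>y<j. \<tau> aM (i * N + y) \<noteq> 0 \<longleftrightarrow> P i y)"
    show "run (For vy (V vN) (Cond ex
     (Store aM (matE (V vx) (V vy)) (Const 1)) (Store aM (matE (V vx) (V vy)) (Const 0)))) \<tau> (624 * N + 12)
       (\<lambda>\<tau>'. \<tau>' vx 0 = i \<and> ?I (Suc i) (\<tau>'(vx := (\<tau>' vx)(0 := Suc i))))"
    proof (rule run_for[where I = ?J and m = N and c = 612])
      fix j \<rho> assume j: "j < N" "bd \<rho>" "\<rho> vy 0 = j" "?J j \<rho>"
      have N': "\<rho> vN 0 = N" using j N by (simp add: keeps_def)
      have v: "val \<rho> ex \<noteq> 0 \<longleftrightarrow> P i j" using P[of \<rho> i j] j i by blast
      have other: "x * N + y \<noteq> i * N + j" if "y < N" "x \<noteq> i \<or> y \<noteq> j" for x y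
        using matrix_index_eq[OF that(1) j(1), of x i] that(2) by blast
      show "run (Cond ex (Store aM (matE (V vx) (V vy)) (Const 1)) (Store aM (matE (V vx) (V vy)) (Const 0))) \<rho> 612
        (\<lambda>\<tau>'. \<tau>' vy 0 = j \<and> ?J (Suc j) (\<tau>'(vy := (\<tau>' vy)(0 := Suc j))))"
      proof (cases "P i j")
        case True
        then show ?thesis using v j N' K100 ex other
          by (intro run_block) (auto simp: eok_def less_Suc_eq)
      next
        case False
        then show ?thesis using v j N' K100 ex other
          by (intro run_block) (auto simp: eok_def less_Suc_eq)
      qed
    qed (use i N in \<open>auto simp: eok_def keeps_def less_Suc_eq\<close>)
  next
    fix \<tau> assume "bd \<tau>" "?I N \<tau>"
    then show "keeps ?S \<sigma> \<tau> \<and> mat N \<tau> = {(x, y). x < N \<and> y < N \<and> P x y}" by (auto simp: mat_def)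
  next
    show "N * (624 * N + 12 + cost (V vN) + 10) + cost (V vN) + 10 \<le> 700 * (N * N)"
    proof -
      have "N * (624 * N + 12 + cost (V vN) + 10) + cost (V vN) + 10 = 624 * (N * N) + 24 * N + 12"
        by (simp add: algebra_simps)
      then show ?thesis using square_bound[OF N(2)] by linarith
    qed
  qed (use bd N in \<open>auto simp: eok_def keeps_def\<close>)
qed

end

subsection \<open>Augmentation\<close>

text \<open>As in \<open>bag_network\<close>, sink and source are the last two nodes,
  \<open>N - 2\<close> and \<open>N - 1\<close>. The loop climbs from the sink to the source and
  reverses the tree arcs on its way.\<close>

definition augment :: prog where
  "augment = search ;; vcur ::= Sub (V vN) (Const 2) ;;
     While (NeqE (V vcur) (Sub (V vN) (Const 1)))
       (vu ::= Load aPar (V vcur) ;; Store aM (matE (V vu) (V vcur)) (Const 0) ;;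
        Store aM (matE (V vcur) (V vu)) (Const 1) ;; vcur ::= V vu)"

abbreviation "aug_regs \<equiv> {vx, vy, vtl, aVis, aPar, aQ, vcur, vu, aM}"

context ram
begin

lemma run_augment:
  assumes bd: "bd \<sigma>" and N: "\<sigma> vN 0 = N" "2 \<le> N" "N < K"
    and net: "unit_network E (N - 1) (N - 2)" and res: "residual E (N - 1) (N - 2) j (mat N \<sigma>)"
    and reach: "(N - 1, N - 2) \<in> (mat N \<sigma>)\<^sup>*"
  shows "run augment \<sigma> (300 * (N * N))
    (\<lambda>\<sigma>'. keeps aug_regs \<sigma> \<sigma>' \<and> residual E (N - 1) (N - 2) (Suc j) (mat N \<sigma>'))"
proof -
  interpret unit_network E "N - 1" "N - 2" by (rule net)
  let ?s = "N - 1" and ?z = "N - 2"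
  define R where "R = mat N \<sigma>"
  let ?body = "vu ::= Load aPar (V vcur) ;; Store aM (matE (V vu) (V vcur)) (Const 0) ;;
        Store aM (matE (V vcur) (V vu)) (Const 1) ;; vcur ::= V vu"
  have loop: "run (vcur ::= Sub (V vN) (Const 2) ;; While (NeqE (V vcur) (Sub (V vN) (Const 1))) ?body) \<sigma>1 (60 * N + 30)
     (\<lambda>\<sigma>'. keeps {vcur, vu, aM} \<sigma>1 \<sigma>' \<and> residual E ?s ?z (Suc j) (mat N \<sigma>'))"
    if s1: "bd \<sigma>1" "keeps {vx, vy, vtl, aVis, aPar, aQ} \<sigma> \<sigma>1 \<and> search_tree (mat N \<sigma>) N (\<sigma>1 aPar)" for \<sigma>1
  proof -
    define par where "par = \<sigma>1 aPar"
    have m1: "mat N \<sigma>1 = R" using mat_keeps[OF s1(2)[THEN conjunct1]] by (simp add: R_def)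
    have N1: "\<sigma>1 vN 0 = N" using s1 N by (simp add: keeps_def)
    obtain rk where rk: "\<And>x. (?s, x) \<in> R\<^sup>* \<Longrightarrow> x \<noteq> ?s \<Longrightarrow>
       (par x, x) \<in> R \<and> (?s, par x) \<in> R\<^sup>* \<and> rk (par x) < (rk x :: nat) \<and> rk x < N"
      using s1 unfolding search_tree_def R_def par_def by blast
    \<comment> \<open>The tree was computed for the old residual graph. Tree arcs into nodes of rank
      at most \<open>rk c\<close> are still in place, because only arcs into nodes of larger rank
      have been reversed. The last clause keeps the walk from meeting the sink again.\<close>
    let ?I = "\<lambda>m \<tau>. \<exists>c. m = rk c \<and> \<tau> vcur 0 = c \<and> keeps {vcur, vu, aM} \<sigma>1 \<tau> \<and> (?s, c) \<in> R\<^sup>* \<and>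
       residual_at E ?s ?z j c (mat N \<tau>) \<and> (\<forall>x. (?s, x) \<in> R\<^sup>* \<and> x \<noteq> ?s \<and> rk x \<le> rk c \<longrightarrow> (par x, x) \<in> mat N \<tau>) \<and>
       (c = ?z \<or> rk c < rk ?z)"
    show ?thesis
    proof (rule run_seqI[where ?Q1.0 = "?I (rk ?z)" and ?b1.0 = 10])
      have "?I (rk ?z) (\<sigma>1(vcur := (\<sigma>1 vcur)(0 := N - 2)))"
        using rk reach res m1 by (intro exI[of _ ?z]) (auto simp: R_def)
      then show "run (vcur ::= Sub (V vN) (Const 2)) \<sigma>1 10 (?I (rk ?z))"
        using s1 N1 N by (intro run_block) (auto simp: eok_def)
    next
      fix \<sigma>2 assume s2: "bd \<sigma>2" "?I (rk ?z) \<sigma>2"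
      show "run (While (NeqE (V vcur) (Sub (V vN) (Const 1))) ?body) \<sigma>2 (60 * N + 20)
         (\<lambda>\<sigma>'. keeps {vcur, vu, aM} \<sigma>1 \<sigma>' \<and> residual E ?s ?z (Suc j) (mat N \<sigma>'))"
      proof (rule run_while[where I = ?I and m = "rk ?z" and c = 40])
        fix m \<tau> assume t: "bd \<tau>" "?I m \<tau>" "val \<tau> (NeqE (V vcur) (Sub (V vN) (Const 1))) \<noteq> 0"
        then obtain c where c: "m = rk c" "\<tau> vcur 0 = c" "keeps {vcur, vu, aM} \<sigma>1 \<tau>" "(?s, c) \<in> R\<^sup>*"
          "residual_at E ?s ?z j c (mat N \<tau>)" "\<forall>x. (?s, x) \<in> R\<^sup>* \<and> x \<noteq> ?s \<and> rk x \<le> rk c \<longrightarrow> (par x, x) \<in> mat N \<tau>"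
          "c = ?z \<or> rk c < rk ?z" by blast
        have Nt: "\<tau> vN 0 = N" using c(3) N1 by (simp add: keeps_def)
        have pt: "\<tau> aPar = par" using c(3) by (simp add: keeps_def par_def)
        have cs: "c \<noteq> ?s" using t(3) c(2) Nt by auto
        define u where "u = par c"
        note r = rk[OF c(4) cs, folded u_def]
        have uc: "(u, c) \<in> mat N \<tau>" using c(6) c(4) cs by (auto simp: u_def)
        then have lt: "u < N" "c < N" by (auto simp: mat_def)
        have uz: "u \<noteq> ?z" "u \<noteq> c" using r c(7) by auto
        let ?\<tau> = "stp ?body \<tau>"
        have st: "?\<tau> = \<tau>(vu := (\<tau> vu)(0 := u), aM := (\<tau> aM)(u * N + c := 0, c * N + u := 1), vcur := (\<tau> vcur)(0 := u))"
          using c(2) Nt pt by (simp add: u_def fun_upd_twist)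
        have "mat N (\<tau>(aM := (\<tau> aM)(u * N + c := 0))) = mat N \<tau> - {(u, c)}" using mat_upd[OF lt, of \<tau> 0] by simp
        moreover have "mat N (\<tau>(aM := (\<tau> aM)(u * N + c := 0, c * N + u := 1))) = insert (c, u) (mat N (\<tau>(aM := (\<tau> aM)(u * N + c := 0))))"
          using mat_upd[OF lt(2,1), of "\<tau>(aM := (\<tau> aM)(u * N + c := 0))" 1] by simp
        moreover have "mat N ?\<tau> = mat N (\<tau>(aM := (\<tau> aM)(u * N + c := 0, c * N + u := 1)))" unfolding st by (simp add: mat_def)
        ultimately have mt: "mat N ?\<tau> = insert (c, u) (mat N \<tau> - {(u, c)})" by simp
        have "?I (rk u) ?\<tau>"
        proof (intro exI[of _ u] conjI)
          show "?\<tau> vcur 0 = u" unfolding st by simp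
          show "keeps {vcur, vu, aM} \<sigma>1 ?\<tau>" using c(3) unfolding st by simp
          show "(?s, u) \<in> R\<^sup>*" using r by blast
          show "residual_at E ?s ?z j u (mat N ?\<tau>)" unfolding mt by (rule residual_at_step[OF c(5) uc uz])
          \<comment> \<open>The arc just removed is the tree arc into \<open>c\<close>, and the rank
            of \<open>c\<close> exceeds that of \<open>u\<close>.\<close>
          show "\<forall>x. (?s, x) \<in> R\<^sup>* \<and> x \<noteq> ?s \<and> rk x \<le> rk u \<longrightarrow> (par x, x) \<in> mat N ?\<tau>"
            unfolding mt using c(6) r by (metis Diff_iff insertCI le_less_trans less_imp_le not_less prod.inject singletonD)
          show "u = ?z \<or> rk u < rk ?z" using r c(7) by auto
        qed simp
        then have "\<exists>j'<m. ?I j' ?\<tau>" using r c(1) by blast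
        moreover have "safe K ?body \<tau>" using c(2) Nt pt lt N(3) K100 by (simp add: u_def)
        ultimately show "run ?body \<tau> 40 (\<lambda>\<tau>'. \<exists>j'<m. ?I j' \<tau>')"
          using t(1) by (intro run_block) (auto simp: eok_def)
      next
        fix m \<tau> assume t: "bd \<tau>" "?I m \<tau>" "val \<tau> (NeqE (V vcur) (Sub (V vN) (Const 1))) = 0"
        then have "\<tau> vN 0 = N" using N1 by (auto simp: keeps_def)
        then have "\<tau> vcur 0 = ?s" using t(3) by auto
        then show "keeps {vcur, vu, aM} \<sigma>1 \<tau> \<and> residual E ?s ?z (Suc j) (mat N \<tau>)"
          using t(2) residual_at_source by auto
      next
        have "rk ?z < N" using rk[of ?z] reach N by (auto simp: R_def)
        then have "rk ?z * 60 \<le> N * 60" by simp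
        then show "rk ?z * (40 + cost (NeqE (V vcur) (Sub (V vN) (Const 1))) + 1) + cost (NeqE (V vcur) (Sub (V vN) (Const 1))) + 1 \<le> 60 * N + 20"
          by simp
      qed (use s2 in \<open>auto simp: eok_def\<close>)
    qed simp
  qed
  show ?thesis unfolding augment_def
  proof (rule run_seqI[OF run_search[OF bd N(1) _ N(3)]])
    fix \<sigma>1 assume s1: "bd \<sigma>1" "keeps {vx, vy, vtl, aVis, aPar, aQ} \<sigma> \<sigma>1 \<and> search_tree (mat N \<sigma>) N (\<sigma>1 aPar)"
    show "run (vcur ::= Sub (V vN) (Const 2) ;; While (NeqE (V vcur) (Sub (V vN) (Const 1))) ?body) \<sigma>1 (60 * N + 30)
      (\<lambda>\<sigma>'. keeps aug_regs \<sigma> \<sigma>' \<and> residual E ?s ?z (Suc j) (mat N \<sigma>'))"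
      by (rule run_conseq[OF loop[OF s1]]) (use s1 in \<open>auto elim: keeps_trans\<close>)
  next
    show "200 * (N * N) + (60 * N + 30) \<le> 300 * (N * N)" using square_bound[of N] N(2) by linarith
  qed (use N in simp)
qed

end

subsection \<open>Successors along the flow\<close>

text \<open>Records, for every vertex \<open>v\<close>, a node other than \<open>v\<close> with a
  residual arc into \<open>n + v\<close>. By \<open>flow_successor_iff\<close> and uniqueness of
  flow successors this is the successor if flow passes \<open>v\<close>; other vertices keep an old
  entry.\<close>

definition nexts :: prog where
  "nexts = For vx (V vN) (For vy (V vn) (Cond
     (Mul (Load aM (Add (matE (V vx) (V vn)) (V vy))) (NeqE (V vx) (V vy))) (Store aNx (V vy) (V vx)) Skip))"

context ram
begin

lemma run_nexts:
  assumes bd: "bd \<sigma>" and N: "\<sigma> vN 0 = N" "1 \<le> N" "N < K" and n: "\<sigma> vn 0 = n" "2 * n \<le> N"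
  shows "run nexts \<sigma> (100 * (N * N)) (\<lambda>\<sigma>'. keeps {vx, vy, aNx} \<sigma> \<sigma>' \<and>
    (\<forall>v w. v < n \<and> w < N \<and> w \<noteq> v \<and> (\<forall>x. x \<noteq> v \<longrightarrow> (x, n + v) \<in> mat N \<sigma> \<longleftrightarrow> x = w) \<longrightarrow> \<sigma>' aNx v = w))"
proof -
  let ?S = "{vx, vy, aNx}"
  define U where "U = (\<lambda>v w. v < n \<and> w < N \<and> w \<noteq> v \<and> (\<forall>x. x \<noteq> v \<longrightarrow> (x, n + v) \<in> mat N \<sigma> \<longleftrightarrow> x = w))"
  let ?I = "\<lambda>i \<tau>. keeps ?S \<sigma> \<tau> \<and> (\<forall>v w. U v w \<and> w < i \<longrightarrow> \<tau> aNx v = w)"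
  let ?b = "Cond (Mul (Load aM (Add (matE (V vx) (V vn)) (V vy))) (NeqE (V vx) (V vy))) (Store aNx (V vy) (V vx)) Skip"
  have "run nexts \<sigma> (100 * (N * N)) (\<lambda>\<sigma>'. keeps ?S \<sigma> \<sigma>' \<and> (\<forall>v w. U v w \<longrightarrow> \<sigma>' aNx v = w))"
    unfolding nexts_def
  proof (rule run_for[where I = ?I and m = N and c = "52 * n + 12"])
    fix i \<tau> assume i: "i < N" "bd \<tau>" "\<tau> vx 0 = i" "?I i \<tau>"
    let ?J = "\<lambda>j \<tau>. keeps ?S \<sigma> \<tau> \<and> \<tau> vx 0 = i \<and> (\<forall>v w. U v w \<and> (w < i \<or> w = i \<and> v < j) \<longrightarrow> \<tau> aNx v = w)"
    show "run (For vy (V vn) ?b) \<tau> (52 * n + 12)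
       (\<lambda>\<tau>'. \<tau>' vx 0 = i \<and> ?I (Suc i) (\<tau>'(vx := (\<tau>' vx)(0 := Suc i))))"
    proof (rule run_for[where I = ?J and m = n and c = 40])
      fix j \<rho> assume j: "j < n" "bd \<rho>" "\<rho> vy 0 = j" "?J j \<rho>"
      have N': "\<rho> vN 0 = N" "\<rho> vn 0 = n" using j N n by (simp_all add: keeps_def)
      have "mat N \<rho> = mat N \<sigma>" using j by (intro mat_keeps[of ?S]) auto
      moreover have "n + j < N" using j n by simp
      ultimately have m: "\<rho> aM (i * N + n + j) \<noteq> 0 \<longleftrightarrow> (i, n + j) \<in> mat N \<sigma>"
        using i by (auto simp: mat_def add.assoc)
      have iK: "i \<le> K" using i N by simp
      show "run ?b \<rho> 40 (\<lambda>\<tau>'. \<tau>' vy 0 = j \<and> ?J (Suc j) (\<tau>'(vy := (\<tau>' vy)(0 := Suc j))))"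
      proof (cases "(i, n + j) \<in> mat N \<sigma> \<and> i \<noteq> j")
        case True
        have uq: "w = i" if "U j w" for w using that True unfolding U_def by metis
        have "\<forall>v w. U v w \<and> (w < i \<or> w = i \<and> v < Suc j) \<longrightarrow> ((\<rho> aNx)(j := i)) v = w"
          using j uq by (auto simp: less_Suc_eq)
        then show ?thesis using True m j N' iK
          by (intro run_block) (auto simp: eok_def)
      next
        case False
        have "\<not> U j i" using False unfolding U_def by blast
        then have "\<forall>v w. U v w \<and> (w < i \<or> w = i \<and> v < Suc j) \<longrightarrow> \<rho> aNx v = w"
          using j by (auto simp: less_Suc_eq)
        then show ?thesis using False m j N'
          by (intro run_block) (auto simp: eok_def)
      qed
    next
      fix \<rho> assume r: "bd \<rho>" "?J n \<rho>"
      have "v < n" if "U v w" for v w using that by (simp add: U_def)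
      then show "\<rho> vx 0 = i \<and> ?I (Suc i) (\<rho>(vx := (\<rho> vx)(0 := Suc i)))" using r by (auto simp: less_Suc_eq)
    qed (use i N n in \<open>auto simp: eok_def keeps_def\<close>)
  next
    fix \<tau> assume "bd \<tau>" "?I N \<tau>"
    moreover have "w < N" if "U v w" for v w using that by (simp add: U_def)
    ultimately show "keeps ?S \<sigma> \<tau> \<and> (\<forall>v w. U v w \<longrightarrow> \<tau> aNx v = w)" by auto
  next
    have "52 * n \<le> 52 * N" using n by simp
    then have "N * (52 * n) \<le> 52 * (N * N)" by (metis mult.left_commute mult_le_mono2)
    moreover have "N * (52 * n + 12 + cost (V vN) + 10) + cost (V vN) + 10 = N * (52 * n) + 24 * N + 12"
      by (simp add: algebra_simps)
    ultimately show "N * (52 * n + 12 + cost (V vN) + 10) + cost (V vN) + 10 \<le> 100 * (N * N)"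
      using square_bound[OF N(2)] by linarith
  qed (use bd N in \<open>auto simp: eok_def keeps_def\<close>)
  then show ?thesis unfolding U_def .
qed

end

section \<open>The algorithm\<close>

text \<open>Side \<open>0\<close> belongs to \<open>S\<close> and side \<open>1\<close> to
  \<open>T\<close>; side \<open>s\<close> marks its bags with state \<open>Suc s\<close>.
  \<open>N\<close> is the number of network nodes. The condition on \<open>N * N\<close> also covers
  arc counts and the length of the output.\<close>

locale linkage_ram = ram W K + bag_graph n t B k Ed
  for W K n t :: nat and B k Ed +
  fixes tm :: "nat \<Rightarrow> nat \<Rightarrow> nat" and N :: nat
  assumes N_def: "N = Suc (Suc (2 * n + t))" and NK: "N * N < K" and k_pos: "1 \<le> k" and kn: "5 * k \<le> n"
    and t_eq: "t = 60 * k ^ 2"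
    and tm_lt: "s < 2 \<Longrightarrow> i < k \<Longrightarrow> tm s i < n"
    and tm_inj: "s < 2 \<Longrightarrow> inj_on (tm s) {..<k}"
begin

definition Eds :: "nat \<Rightarrow> (nat \<times> nat) set" where "Eds s = (if s = 0 then Ed else Ed\<inverse>)"

lemma side_graph: "bag_graph n t B k (Eds s)"
  using bag_graph_converse bag_graph_axioms by (simp add: Eds_def)

lemma N_less_K: "N < K" using NK N_def by (metis add_Suc le_square less_le_trans not_less)

lemma N_ge: "2 \<le> N" "2 * n \<le> N" "n < N" "t < N" "k < N" "5 * k < K" using N_def N_less_K kn by auto

lemma N_minus [simp]: "N - Suc 0 = Suc (2 * n + t)" "N - 2 = 2 * n + t" by (simp_all add: N_def)

text \<open>The part of the memory that stays fixed once the input has been read. Terminals are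
  looked up in the input itself, behind the position \<open>vb\<close>.\<close>

definition stat :: "memory \<Rightarrow> bool" where
  "stat \<sigma> \<longleftrightarrow> \<sigma> vn 0 = n \<and> \<sigma> vk 0 = k \<and> \<sigma> vt 0 = t \<and> \<sigma> vN 0 = N \<and>
     (\<forall>s<2. \<forall>i<k. \<sigma> 0 (\<sigma> vb 0 + 1 + s * k + i) = tm s i) \<and>
     (\<forall>s<2. \<forall>u<n. \<forall>v<n. \<sigma> aD (s * (n * n) + u * n + v) \<noteq> 0 \<longleftrightarrow> (u, v) \<in> Eds s) \<and>
     (\<forall>v<n. \<forall>b<t. v \<in> B b \<longleftrightarrow> \<sigma> aC1 v = Suc b \<or> \<sigma> aC2 v = Suc b) \<and>
     (\<forall>v<n. \<sigma> aC1 v \<le> t \<and> \<sigma> aC2 v \<le> t) \<and>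
     (\<forall>s<2. \<forall>v<n. \<sigma> aTm (s * n + v) \<noteq> 0 \<longleftrightarrow> v \<in> tm s ` {..<k})"

abbreviation "stat_regs \<equiv> {0, vn, vk, vt, vN, vb, aD, aC1, aC2, aTm}"

lemma stat_cong: "(\<And>a. a \<in> stat_regs \<Longrightarrow> \<sigma>' a = \<sigma> a) \<Longrightarrow> stat \<sigma>' = stat \<sigma>"
  by (simp add: stat_def)

lemma stat_keeps: "keeps A \<sigma> \<sigma>' \<Longrightarrow> A \<inter> stat_regs = {} \<Longrightarrow> stat \<sigma>' = stat \<sigma>"
  by (rule stat_cong) (auto simp: keeps_def)

lemma stat_upd [simp]: "a \<notin> stat_regs \<Longrightarrow> stat (\<sigma>(a := f)) = stat \<sigma>"
  by (rule stat_cong) auto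

lemma statD:
  assumes "stat \<sigma>"
  shows "\<sigma> vn 0 = n" "\<sigma> vk 0 = k" "\<sigma> vt 0 = t" "\<sigma> vN 0 = N"
    "\<And>s i. s < 2 \<Longrightarrow> i < k \<Longrightarrow> \<sigma> 0 (Suc (\<sigma> vb 0 + s * k + i)) = tm s i"
    "\<And>s u v. s < 2 \<Longrightarrow> u < n \<Longrightarrow> v < n \<Longrightarrow> \<sigma> aD (s * (n * n) + u * n + v) \<noteq> 0 \<longleftrightarrow> (u, v) \<in> Eds s"
    "\<And>v b. v < n \<Longrightarrow> b < t \<Longrightarrow> v \<in> B b \<longleftrightarrow> \<sigma> aC1 v = Suc b \<or> \<sigma> aC2 v = Suc b"
    "\<And>v. v < n \<Longrightarrow> \<sigma> aC1 v \<le> t" "\<And>v. v < n \<Longrightarrow> \<sigma> aC2 v \<le> t"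
    "\<And>s v. s < 2 \<Longrightarrow> v < n \<Longrightarrow> \<sigma> aTm (s * n + v) \<noteq> 0 \<longleftrightarrow> v \<in> tm s ` {..<k}"
  using assms unfolding stat_def by auto

definition stf :: "memory \<Rightarrow> nat \<Rightarrow> nat" where "stf \<sigma> = (\<lambda>b. \<sigma> aSt (Suc b))"

lemma stf_upd [simp]: "a \<noteq> aSt \<Longrightarrow> stf (\<sigma>(a := f)) = stf \<sigma>" by (simp add: stf_def)

lemma stf_keeps: "keeps A \<sigma> \<sigma>' \<Longrightarrow> aSt \<notin> A \<Longrightarrow> stf \<sigma>' = stf \<sigma>" by (simp add: stf_def keeps_def)

text \<open>Two lookups decide whether all bags of a vertex are claimed, since a missing bag points
  to \<open>aSt[0]\<close>, which is nonzero.\<close>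

lemma settled_iff:
  assumes "stat \<sigma>" "\<sigma> aSt 0 = 3" "v < n"
  shows "v \<in> settled (stf \<sigma>) \<longleftrightarrow> \<sigma> aSt (\<sigma> aC1 v) \<noteq> 0 \<and> \<sigma> aSt (\<sigma> aC2 v) \<noteq> 0" (is "?l = ?r")
proof
  assume l: ?l
  have "\<sigma> aSt c \<noteq> 0" if "c = \<sigma> aC1 v \<or> c = \<sigma> aC2 v" for c
  proof (cases c)
    case (Suc b)
    have "c \<le> t" using that statD(8,9)[OF assms(1,3)] by auto
    then have "b < t" using Suc by simp
    then have "v \<in> B b" using statD(7)[OF assms(1,3)] that Suc by auto
    then show ?thesis using l \<open>b < t\<close> Suc by (simp add: settled_def stf_def)
  qed (use assms in simp)
  then show ?r by auto
next
  assume ?r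
  then show ?l using statD(7)[OF assms(1,3)] assms(3) by (auto simp: settled_def stf_def)
qed

end

subsection \<open>Network expressions\<close>

abbreviation (input) n2E :: expr where "n2E \<equiv> Mul (Const 2) (V vn)"
abbreviation (input) n2tE :: expr where "n2tE \<equiv> Add (Mul (Const 2) (V vn)) (V vt)"
abbreviation (input) adjE :: "expr \<Rightarrow> expr \<Rightarrow> expr" where
  "adjE e f \<equiv> Load aD (Add (Add (Mul (V vs) (Mul (V vn) (V vn))) (Mul e (V vn))) f)"
abbreviation (input) xv :: expr where "xv \<equiv> Sub (V vx) (V vn)"
abbreviation (input) yb :: expr where "yb \<equiv> Sub (V vy) n2E"

text \<open>The five expressions are the five disjuncts of \<open>net_arc\<close>. All factors of a
  product are evaluated, also those that make no sense outside the range tested by the other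
  factors; there the product is \<open>0\<close>.\<close>

definition netE1 :: "expr \<Rightarrow> expr" where
  "netE1 enE = Mul (LtE (V vx) (V vn)) (Mul (EqE (V vy) (Add (V vn) (V vx))) enE)"
definition netE2 :: "expr \<Rightarrow> expr" where
  "netE2 alE = Mul (Mul (LeE (V vn) (V vx)) (LtE (V vx) n2E)) (Mul (LtE (V vy) (V vn)) (Mul (NeqE (V vy) xv)
     (Mul alE (adjE xv (V vy)))))"
definition netE3 :: "expr \<Rightarrow> expr" where
  "netE3 skE = Mul (Mul (LeE (V vn) (V vx)) (LtE (V vx) n2E)) (Mul (Mul (LeE n2E (V vy)) (LtE (V vy) n2tE)) (Mul skE
     (Add (EqE (Load aC1 xv) (Add yb (Const 1))) (EqE (Load aC2 xv) (Add yb (Const 1))))))"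
definition netE4 :: expr where
  "netE4 = Mul (Mul (LeE n2E (V vx)) (LtE (V vx) n2tE)) (EqE (V vy) n2tE)"
definition netE5 :: "expr \<Rightarrow> expr" where
  "netE5 srcE = Mul (EqE (V vx) (Add n2tE (Const 1))) (Mul (LtE (V vy) (V vn)) srcE)"
definition netE :: "expr \<Rightarrow> expr \<Rightarrow> expr \<Rightarrow> expr \<Rightarrow> expr" where
  "netE enE alE skE srcE = Add (netE1 enE) (Add (netE2 alE) (Add (netE3 skE) (Add netE4 (netE5 srcE))))"

lemma val_EqE: "val \<tau> (EqE e f) \<noteq> 0 \<longleftrightarrow> val \<tau> e = val \<tau> f" by auto
lemma val_NeqE: "val \<tau> (NeqE e f) \<noteq> 0 \<longleftrightarrow> val \<tau> e \<noteq> val \<tau> f" by auto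
lemma val_MulE: "val \<tau> (Mul e f) \<noteq> 0 \<longleftrightarrow> val \<tau> e \<noteq> 0 \<and> val \<tau> f \<noteq> 0" by simp
lemma val_AddE: "val \<tau> (Add e f) \<noteq> 0 \<longleftrightarrow> val \<tau> e \<noteq> 0 \<or> val \<tau> f \<noteq> 0" by simp
lemma val_LeE: "val \<tau> (LeE e f) \<noteq> 0 \<longleftrightarrow> val \<tau> e \<le> val \<tau> f" by auto
lemma val_LtE: "val \<tau> (LtE e f) \<noteq> 0 \<longleftrightarrow> val \<tau> e < val \<tau> f" by auto

lemmas netE_defs = netE_def netE1_def netE2_def netE3_def netE4_def netE5_def

context linkage_ram
begin

abbreviation "netr s en al sk src \<equiv> bag_network.net n t B (\<lambda>u v. (u, v) \<in> Eds s) en al sk src"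

lemma netE_correct:
  assumes st: "stat \<tau>" and x: "\<tau> vx 0 = x" and y: "\<tau> vy 0 = y" and s: "\<tau> vs 0 = s" "s < 2"
    and en: "x < n \<Longrightarrow> val \<tau> enE \<noteq> 0 \<longleftrightarrow> en x"
    and al: "n \<le> x \<Longrightarrow> x < 2 * n \<Longrightarrow> val \<tau> alE \<noteq> 0 \<longleftrightarrow> al (x - n)"
    and sk: "2 * n \<le> y \<Longrightarrow> y < 2 * n + t \<Longrightarrow> val \<tau> skE \<noteq> 0 \<longleftrightarrow> sk (y - 2 * n)"
    and src: "y < n \<Longrightarrow> val \<tau> srcE \<noteq> 0 \<longleftrightarrow> src y"
  shows "val \<tau> (netE enE alE skE srcE) \<noteq> 0 \<longleftrightarrow> (x, y) \<in> netr s en al sk src"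
proof -
  note d = statD(1-4)[OF st]
  have leaf: "val \<tau> (V vx) = x" "val \<tau> (V vy) = y" "val \<tau> (V vn) = n" "val \<tau> n2E = 2 * n" "val \<tau> n2tE = 2 * n + t"
    "val \<tau> xv = x - n" "val \<tau> (Add yb (Const 1)) = Suc (y - 2 * n)" "val \<tau> (Add n2tE (Const 1)) = Suc (2 * n + t)"
    "val \<tau> (Add (V vn) (V vx)) = n + x" "val \<tau> (Load aC1 xv) = \<tau> aC1 (x - n)" "val \<tau> (Load aC2 xv) = \<tau> aC2 (x - n)"
    "val \<tau> (adjE xv (V vy)) = \<tau> aD (s * (n * n) + (x - n) * n + y)"
    using d x y s by simp_all
  have 1: "val \<tau> (netE1 enE) \<noteq> 0 \<longleftrightarrow> x < n \<and> y = n + x \<and> en x"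
    unfolding netE1_def val_MulE val_EqE unfolding val_LtE leaf using en by blast
  have 2: "val \<tau> (netE2 alE) \<noteq> 0 \<longleftrightarrow> n \<le> x \<and> x < 2 * n \<and> y < n \<and> y \<noteq> x - n \<and> al (x - n) \<and> (x - n, y) \<in> Eds s"
  proof -
    have "\<tau> aD (s * (n * n) + (x - n) * n + y) \<noteq> 0 \<longleftrightarrow> (x - n, y) \<in> Eds s" if "n \<le> x" "x < 2 * n" "y < n"
    proof -
      have "x - n < n" using that by auto
      then show ?thesis using that statD(6)[OF st s(2)] by blast
    qed
    then show ?thesis unfolding netE2_def val_MulE val_NeqE val_LeE unfolding val_LtE leaf using al by blast
  qed
  have 3: "val \<tau> (netE3 skE) \<noteq> 0 \<longleftrightarrow> n \<le> x \<and> x < 2 * n \<and> 2 * n \<le> y \<and> y < 2 * n + t \<and> sk (y - 2 * n) \<and> x - n \<in> B (y - 2 * n)"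
  proof -
    have "x - n \<in> B (y - 2 * n) \<longleftrightarrow> \<tau> aC1 (x - n) = Suc (y - 2 * n) \<or> \<tau> aC2 (x - n) = Suc (y - 2 * n)"
      if "n \<le> x" "x < 2 * n" "2 * n \<le> y" "y < 2 * n + t"
    proof -
      have "x - n < n" "y - 2 * n < t" using that by auto
      then show ?thesis using statD(7)[OF st] by blast
    qed
    then show ?thesis unfolding netE3_def val_MulE val_EqE val_LeE val_AddE unfolding val_LtE leaf using sk by blast
  qed
  have 4: "val \<tau> netE4 \<noteq> 0 \<longleftrightarrow> 2 * n \<le> x \<and> x < 2 * n + t \<and> y = 2 * n + t"
    unfolding netE4_def val_MulE val_EqE val_LeE unfolding val_LtE leaf by blast
  have 5: "val \<tau> (netE5 srcE) \<noteq> 0 \<longleftrightarrow> x = Suc (2 * n + t) \<and> y < n \<and> src y"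
    unfolding netE5_def val_MulE val_EqE unfolding val_LtE leaf using src by blast
  have "val \<tau> (netE enE alE skE srcE) \<noteq> 0 \<longleftrightarrow> val \<tau> (netE1 enE) \<noteq> 0 \<or> val \<tau> (netE2 alE) \<noteq> 0 \<or>
     val \<tau> (netE3 skE) \<noteq> 0 \<or> val \<tau> netE4 \<noteq> 0 \<or> val \<tau> (netE5 srcE) \<noteq> 0" by (simp add: netE_def)
  then show ?thesis unfolding 1 2 3 4 5 by (simp add: bag_network.net_def bag_network.net_arc_def)
qed

lemma run_netE:
  assumes bd: "bd \<sigma>" and st: "stat \<sigma>" and s: "\<sigma> vs 0 = s" "s < 2"
    and ok: "eok (netE enE alE skE srcE)" "cost (netE enE alE skE srcE) \<le> 600"
    and en: "\<And>\<tau>. keeps {vx, vy, aM} \<sigma> \<tau> \<Longrightarrow> \<tau> vx 0 < n \<Longrightarrow> val \<tau> enE \<noteq> 0 \<longleftrightarrow> en (\<tau> vx 0)"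
    and al: "\<And>\<tau>. keeps {vx, vy, aM} \<sigma> \<tau> \<Longrightarrow> n \<le> \<tau> vx 0 \<Longrightarrow> \<tau> vx 0 < 2 * n \<Longrightarrow> val \<tau> alE \<noteq> 0 \<longleftrightarrow> al (\<tau> vx 0 - n)"
    and sk: "\<And>\<tau>. keeps {vx, vy, aM} \<sigma> \<tau> \<Longrightarrow> 2 * n \<le> \<tau> vy 0 \<Longrightarrow> \<tau> vy 0 < 2 * n + t \<Longrightarrow> val \<tau> skE \<noteq> 0 \<longleftrightarrow> sk (\<tau> vy 0 - 2 * n)"
    and src: "\<And>\<tau>. keeps {vx, vy, aM} \<sigma> \<tau> \<Longrightarrow> \<tau> vy 0 < n \<Longrightarrow> val \<tau> srcE \<noteq> 0 \<longleftrightarrow> src (\<tau> vy 0)"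
  shows "run (fill (netE enE alE skE srcE)) \<sigma> (700 * (N * N))
    (\<lambda>\<sigma>'. keeps {vx, vy, aM} \<sigma> \<sigma>' \<and> mat N \<sigma>' = netr s en al sk src)"
proof -
  have "run (fill (netE enE alE skE srcE)) \<sigma> (700 * (N * N))
    (\<lambda>\<sigma>'. keeps {vx, vy, aM} \<sigma> \<sigma>' \<and> mat N \<sigma>' = {(x, y). x < N \<and> y < N \<and> (x, y) \<in> netr s en al sk src})"
  proof (rule run_fill[OF bd statD(4)[OF st] _ N_less_K ok])
    fix \<tau> x y assume t: "keeps {vx, vy, aM} \<sigma> \<tau>" "\<tau> vx 0 = x" "\<tau> vy 0 = y" "x < N" "y < N"
    have "stat \<tau>" using stat_keeps[OF t(1)] st by simp
    moreover have "\<tau> vs 0 = s" using t(1) s by (simp add: keeps_def)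
    ultimately show "val \<tau> (netE enE alE skE srcE) \<noteq> 0 \<longleftrightarrow> (x, y) \<in> netr s en al sk src"
      using t s en[OF t(1)] al[OF t(1)] sk[OF t(1)] src[OF t(1)] by (intro netE_correct) auto
  qed (use N_ge in simp)
  moreover have "{(x, y). x < N \<and> y < N \<and> (x, y) \<in> netr s en al sk src} = netr s en al sk src"
    using bag_network.net_bounds[of _ _ n t B "\<lambda>u v. (u, v) \<in> Eds s" en al sk src] by (auto simp: N_def)
  ultimately show ?thesis by simp
qed

abbreviation "flow_regs \<equiv> insert vc aug_regs"

text \<open>Ford-Fulkerson with a fixed number of rounds: \<open>aug\<close> supplies an augmenting
  path in each of them, so the program never tests for failure.\<close>

lemma run_flow:
  assumes bd: "bd \<sigma>" and st: "stat \<sigma>" and mat: "mat N \<sigma> = netr s en al sk src"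
    and lm: "eok lm" "\<And>\<tau>. keeps flow_regs \<sigma> \<tau> \<Longrightarrow> val \<tau> lm = m" "m < K"
    and aug: "\<And>j R. j < m \<Longrightarrow> residual (netr s en al sk src) (Suc (2 * n + t)) (2 * n + t) j R \<Longrightarrow>
       (Suc (2 * n + t), 2 * n + t) \<in> R\<^sup>*"
  shows "run (For vc lm augment) \<sigma> (m * (300 * (N * N) + cost lm + 10) + cost lm + 10)
    (\<lambda>\<sigma>'. keeps flow_regs \<sigma> \<sigma>' \<and> residual (netr s en al sk src) (Suc (2 * n + t)) (2 * n + t) m (mat N \<sigma>'))"
proof -
  interpret bag_network n t B "\<lambda>u v. (u, v) \<in> Eds s" en al sk src .
  let ?I = "\<lambda>j \<tau>. keeps flow_regs \<sigma> \<tau> \<and> residual net (Suc (2 * n + t)) (2 * n + t) j (mat N \<tau>)"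
  show ?thesis
  proof (rule run_for[where I = ?I and m = m and c = "300 * (N * N)"])
    show "?I 0 (\<sigma>(vc := (\<sigma> vc)(0 := 0)))" using residual_initial mat by simp
  next
    fix j \<tau> assume t: "j < m" "bd \<tau>" "\<tau> vc 0 = j" "?I j \<tau>"
    have Nt: "\<tau> vN 0 = N" using t statD(4)[OF st] by (simp add: keeps_def)
    have "run augment \<tau> (300 * (N * N)) (\<lambda>\<sigma>'. keeps aug_regs \<tau> \<sigma>' \<and> residual net (N - 1) (N - 2) (Suc j) (mat N \<sigma>'))"
      using t Nt N_ge N_less_K aug[OF t(1)] unit_network_axioms by (intro run_augment) auto
    then show "run augment \<tau> (300 * (N * N)) (\<lambda>\<tau>'. \<tau>' vc 0 = j \<and> ?I (Suc j) (\<tau>'(vc := (\<tau>' vc)(0 := Suc j))))"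
    proof (rule run_conseq[OF _ order_refl])
      fix \<tau>' assume t': "keeps aug_regs \<tau> \<tau>' \<and> residual net (N - 1) (N - 2) (Suc j) (mat N \<tau>')"
      have "keeps flow_regs \<sigma> \<tau>'" using t t' by (auto elim: keeps_trans)
      moreover have "\<tau>' vc = \<tau> vc" using t' by (simp add: keeps_def)
      ultimately show "\<tau>' vc 0 = j \<and> ?I (Suc j) (\<tau>'(vc := (\<tau>' vc)(0 := Suc j)))"
        using t t' by simp
    qed
  qed (use bd lm in auto)
qed

end

subsection \<open>Claiming the bags of a vertex\<close>

text \<open>The argument is the register that holds the vertex. For a missing bag the test fails, as
  its state is \<open>3\<close>.\<close>

definition claimp :: "nat \<Rightarrow> prog" where
  "claimp r =
     Cond (NotE (Load aSt (Load aC1 (V r)))) (Store aSt (Load aC1 (V r)) (Add (V vs) (Const 1))) Skip ;;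
     Cond (NotE (Load aSt (Load aC2 (V r)))) (Store aSt (Load aC2 (V r)) (Add (V vs) (Const 1))) Skip"

context linkage_ram
begin

lemma run_claimp:
  assumes bd: "bd \<sigma>" and st: "stat \<sigma>" and s: "\<sigma> vs 0 = s" "s < 2" and z: "\<sigma> aSt 0 = 3"
    and r: "\<sigma> r 0 = v" "v < n" "r \<in> {vr, vcur}"
  shows "run (claimp r) \<sigma> 40
    (\<lambda>\<sigma>'. keeps {aSt} \<sigma> \<sigma>' \<and> stf \<sigma>' = claim (stf \<sigma>) (Suc s) v \<and> \<sigma>' aSt 0 = 3)"
proof -
  define c1 c2 where "c1 = \<sigma> aC1 v" and "c2 = \<sigma> aC2 v"
  define S where "S = \<sigma> aSt"
  define S1 where "S1 = (if S c1 = 0 then S(c1 := Suc s) else S)"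
  define S2 where "S2 = (if S1 c2 = 0 then S1(c2 := Suc s) else S1)"
  have r34: "r \<noteq> aSt" "r \<noteq> aC1" "r \<noteq> aC2" "r \<noteq> vs" using r(3) by auto
  have le: "c1 \<le> t" "c2 \<le> t" using statD(8,9)[OF st r(2)] by (auto simp: c1_def c2_def)
  have mem: "v \<in> B b \<longleftrightarrow> c1 = Suc b \<or> c2 = Suc b" if "b < t" for b
    using statD(7)[OF st r(2) that] by (simp add: c1_def c2_def)
  have S2: "S2 (Suc b) = claim (stf \<sigma>) (Suc s) v b" for b
  proof (cases "b < t")
    case True
    have "S2 (Suc b) = (if (c1 = Suc b \<or> c2 = Suc b) \<and> S (Suc b) = 0 then Suc s else S (Suc b))"
      unfolding S2_def S1_def by (cases "c1 = c2"; simp; fastforce)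
    then show ?thesis using mem[OF True] True by (simp add: claim_def stf_def S_def)
  next
    case False
    then have "c1 \<noteq> Suc b" "c2 \<noteq> Suc b" using le by auto
    then have "S2 (Suc b) = S (Suc b)" unfolding S2_def S1_def by simp
    then show ?thesis using False by (simp add: claim_def stf_def S_def)
  qed
  have S20: "S2 0 = 3" using z by (auto simp: S2_def S1_def S_def)
  have stp: "stp (claimp r) \<sigma> = \<sigma>(aSt := S2)"
    using r s r34 by (auto simp: claimp_def S2_def S1_def S_def c1_def c2_def fun_eq_iff)
  have sf: "safe K (claimp r) \<sigma>" using s K100 r34 by (simp add: claimp_def)
  show ?thesis
  proof (rule run_block[OF _ bd sf])
    show "keeps {aSt} \<sigma> (stp (claimp r) \<sigma>) \<and> stf (stp (claimp r) \<sigma>) = claim (stf \<sigma>) (Suc s) v \<and> stp (claimp r) \<sigma> aSt 0 = 3"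
      unfolding stp using S2 S20 by (auto simp: stf_def)
  qed (use r in \<open>auto simp: claimp_def eok_def\<close>)
qed

end

subsection \<open>Fans\<close>

abbreviation (input) rootE :: expr where
  "rootE \<equiv> Load 0 (Add (Add (Add (V vb) (Const 1)) (Mul (V vs) (V vk))) (V vi))"

definition fan_netE :: expr where
  "fan_netE = netE (NeqE (V vx) (V vr)) (Const 1) (NotE (Load aSt (Add yb (Const 1))))
     (Mul (adjE (V vr) (V vy)) (NeqE (V vy) (V vr)))"

text \<open>Rows start at the vertices with a residual arc into the source. The successor of the
  last vertex of a row is its end bag, whose number is at least \<open>n\<close>; this ends the walk
  on a row that is settled throughout.\<close>

definition trace :: prog where
  "trace = For vj (V vn) (Cond (Load aM (matE (V vj) (Sub (V vN) (Const 1))))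
     (vcur ::= V vj ;;
      While (Mul (LtE (V vcur) (V vn)) (Mul (Load aSt (Load aC1 (V vcur))) (Load aSt (Load aC2 (V vcur)))))
        (vcur ::= Load aNx (V vcur)) ;;
      Cond (LtE (V vcur) (V vn)) (claimp vcur) Skip)
     Skip)"

text \<open>The bags of the terminal itself are claimed at the outset, which makes the terminal
  settled and accounts for the two bags beyond \<open>10 * k\<close>.\<close>

definition fan :: prog where
  "fan = vr ::= rootE ;; claimp vr ;; fill fan_netE ;; For vc (Mul (Const 5) (V vk)) augment ;; nexts ;; trace"

abbreviation "fan_regs \<equiv> {vx, vy, vtl, aVis, aPar, aQ, vcur, vu, aM, vc, aNx, vj, aSt, vr}"

section \<open>Correctness of the fans: flow decomposition, tracing and claiming\<close>

context linkage_ram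
begin

text \<open>A path decomposition in terms of the residual graph alone: starting vertices
  \<open>Y\<close>, vertex lists \<open>p\<close> and end bags \<open>\<beta>\<close>. The last
  clause says what the scan for successors finds in the matrix.\<close>

definition rows :: "nat \<Rightarrow> (nat \<Rightarrow> bool) \<Rightarrow> (nat \<Rightarrow> bool) \<Rightarrow> (nat \<Rightarrow> bool) \<Rightarrow> (nat \<Rightarrow> bool) \<Rightarrow>
    (nat \<times> nat) set \<Rightarrow> nat set \<Rightarrow> (nat \<Rightarrow> nat list) \<Rightarrow> (nat \<Rightarrow> nat) \<Rightarrow> bool" where
  "rows s en al sk src R Y p \<beta> \<longleftrightarrow> Y = {y. (y, Suc (2 * n + t)) \<in> R} \<and> Y \<subseteq> {..<n} \<and> inj_on \<beta> Y \<and>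
     (\<forall>y\<in>Y. \<forall>y'\<in>Y. \<forall>v. v \<in> set (p y) \<longrightarrow> v \<in> set (p y') \<longrightarrow> y = y') \<and>
     (\<forall>y\<in>Y. src y \<and> hd (p y) = y \<and> p y \<noteq> [] \<and> distinct (p y) \<and> set (p y) \<subseteq> {..<n} \<and> \<beta> y < t \<and> sk (\<beta> y) \<and>
        last (p y) \<in> B (\<beta> y) \<and> (\<forall>l. Suc l < length (p y) \<longrightarrow> (p y ! l, p y ! Suc l) \<in> Eds s \<and> al (p y ! l)) \<and>
        (\<forall>l<length (p y). \<forall>x. x \<noteq> p y ! l \<longrightarrow> (x, n + p y ! l) \<in> R \<longleftrightarrow>
           x = (if Suc l < length (p y) then p y ! Suc l else 2 * n + \<beta> y)))"

lemma rows_exist: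
  assumes R: "residual (netr s en al sk src) (Suc (2 * n + t)) (2 * n + t) m R"
  obtains Y p \<beta> where "rows s en al sk src R Y p \<beta>" "card Y = m"
proof -
  interpret bag_network n t B "\<lambda>u v. (u, v) \<in> Eds s" en al sk src .
  let ?f = "flow_arcs net R"
  define Y where "Y = {y. (y, sor) \<in> R}"
  have Yf: "y \<in> Y \<longleftrightarrow> (sor, y) \<in> ?f" for y using flow_source_iff[OF R] by (simp add: Y_def)
  then have "Y = ?f `` {sor}" by auto
  then have card: "card Y = m" using flow_value[OF R] by simp
  have Ysrc: "y < n \<and> src y" if "y \<in> Y" for y
    using that f_net[OF R, of sor y] Yf by (simp add: net_source)
  have "\<forall>y\<in>Y. \<exists>g. row ?f (fst g) (snd g) \<and> hd (fst g) = y \<and> distinct (fst g)"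
  proof
    fix y assume "y \<in> Y"
    then obtain q b where "row ?f q b" "hd q = y" "distinct q" using row_exists[OF R, of y] Yf[of y] by auto
    then show "\<exists>g. row ?f (fst g) (snd g) \<and> hd (fst g) = y \<and> distinct (fst g)" by (intro exI[of _ "(q, b)"]) simp
  qed
  then obtain g where g: "\<forall>y\<in>Y. row ?f (fst (g y)) (snd (g y)) \<and> hd (fst (g y)) = y \<and> distinct (fst (g y))"
    using bchoice[of Y "\<lambda>y g. row ?f (fst g) (snd g) \<and> hd (fst g) = y \<and> distinct (fst g)"] by auto
  define p \<beta> where "p = (\<lambda>y. fst (g y))" and "\<beta> = (\<lambda>y. snd (g y))"
  have pb: "row ?f (p y) (\<beta> y) \<and> hd (p y) = y \<and> distinct (p y)" if "y \<in> Y" for y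
    using g that by (simp add: p_def \<beta>_def)
  have disj: "y = y'" if yy: "y \<in> Y" "y' \<in> Y" "v \<in> set (p y)" "v \<in> set (p y')" for y y' v
  proof -
    obtain l where "l < length (p y)" "p y ! l = v" using yy(3) unfolding in_set_conv_nth by blast
    moreover obtain l' where "l' < length (p y')" "p y' ! l' = v" using yy(4) unfolding in_set_conv_nth by blast
    moreover have 1: "row ?f (p y) (\<beta> y)" "(sor, hd (p y)) \<in> ?f" using pb[OF yy(1)] Yf[of y] yy(1) by auto
    moreover have 2: "row ?f (p y') (\<beta> y')" "(sor, hd (p y')) \<in> ?f" using pb[OF yy(2)] Yf[of y'] yy(2) by auto
    ultimately show ?thesis using rows_disjoint[OF R 1 2, of l l'] pb[OF yy(1)] pb[OF yy(2)] by simp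
  qed
  have "inj_on \<beta> Y"
  proof (rule inj_onI)
    fix y y' assume yy: "y \<in> Y" "y' \<in> Y" "\<beta> y = \<beta> y'"
    have 1: "row ?f (p y) (\<beta> y)" "(sor, hd (p y)) \<in> ?f" using pb[OF yy(1)] Yf[of y] yy(1) by auto
    have 2: "row ?f (p y') (\<beta> y)" "(sor, hd (p y')) \<in> ?f" using pb[OF yy(2)] Yf[of y'] yy(2,3) by auto
    show "y = y'" using row_bag_unique[OF R 1 2] pb[OF yy(1)] pb[OF yy(2)] by simp
  qed
  moreover have "src y \<and> hd (p y) = y \<and> p y \<noteq> [] \<and> distinct (p y) \<and> set (p y) \<subseteq> {..<n} \<and> \<beta> y < t \<and> sk (\<beta> y) \<and>
        last (p y) \<in> B (\<beta> y) \<and> (\<forall>l. Suc l < length (p y) \<longrightarrow> (p y ! l, p y ! Suc l) \<in> Eds s \<and> al (p y ! l)) \<and>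
        (\<forall>l<length (p y). \<forall>x. x \<noteq> p y ! l \<longrightarrow> (x, n + p y ! l) \<in> R \<longleftrightarrow>
           x = (if Suc l < length (p y) then p y ! Suc l else 2 * n + \<beta> y))" if y: "y \<in> Y" for y
  proof -
    have r: "row ?f (p y) (\<beta> y)" "hd (p y) = y" "distinct (p y)" using pb[OF y] by auto
    note rf = row_facts[OF R r(1)]
    show ?thesis using r(2,3) Ysrc[OF y] rf(1-5,7) rf(8) by simp
  qed
  ultimately have "rows s en al sk src R Y p \<beta>"
    unfolding rows_def using Ysrc disj by (auto simp: Y_def)
  then show ?thesis using that card by blast
qed

lemma rowsY:
  assumes "rows s en al sk src R Y p \<beta>"
  shows "Y = {y. (y, Suc (2 * n + t)) \<in> R}" "Y \<subseteq> {..<n}" "inj_on \<beta> Y"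
    "\<And>y y' v. y \<in> Y \<Longrightarrow> y' \<in> Y \<Longrightarrow> v \<in> set (p y) \<Longrightarrow> v \<in> set (p y') \<Longrightarrow> y = y'"
proof -
  note r = assms[unfolded rows_def]
  show "Y = {y. (y, Suc (2 * n + t)) \<in> R}" by (rule conjunct1[OF r])
  show "Y \<subseteq> {..<n}" by (rule conjunct1[OF conjunct2[OF r]])
  show "inj_on \<beta> Y" by (rule conjunct1[OF conjunct2[OF conjunct2[OF r]]])
  note r4 = conjunct1[OF conjunct2[OF conjunct2[OF conjunct2[OF r]]]]
  fix y y' v assume "y \<in> Y" "y' \<in> Y" "v \<in> set (p y)" "v \<in> set (p y')"
  then show "y = y'" using r4 by blast
qed

lemma rowsD:
  assumes "rows s en al sk src R Y p \<beta>" "y \<in> Y"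
  shows "src y" "hd (p y) = y" "p y \<noteq> []" "distinct (p y)" "set (p y) \<subseteq> {..<n}" "\<beta> y < t" "sk (\<beta> y)"
    "last (p y) \<in> B (\<beta> y)" "\<And>l. Suc l < length (p y) \<Longrightarrow> (p y ! l, p y ! Suc l) \<in> Eds s \<and> al (p y ! l)"
    "\<And>l x. l < length (p y) \<Longrightarrow> x \<noteq> p y ! l \<Longrightarrow> (x, n + p y ! l) \<in> R \<longleftrightarrow>
           x = (if Suc l < length (p y) then p y ! Suc l else 2 * n + \<beta> y)"
    "\<And>l. l < length (p y) \<Longrightarrow> p y ! l < n" "length (p y) \<le> n"
proof -
  note r = bspec[OF assms(1)[unfolded rows_def, THEN conjunct2, THEN conjunct2, THEN conjunct2, THEN conjunct2] assms(2)]
  show a: "src y" "hd (p y) = y" "p y \<noteq> []" "distinct (p y)" "set (p y) \<subseteq> {..<n}" "\<beta> y < t" "sk (\<beta> y)"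
    "last (p y) \<in> B (\<beta> y)" "\<And>l. Suc l < length (p y) \<Longrightarrow> (p y ! l, p y ! Suc l) \<in> Eds s \<and> al (p y ! l)"
    "\<And>l x. l < length (p y) \<Longrightarrow> x \<noteq> p y ! l \<Longrightarrow> (x, n + p y ! l) \<in> R \<longleftrightarrow>
           x = (if Suc l < length (p y) then p y ! Suc l else 2 * n + \<beta> y)"
    using r by blast+
  show "p y ! l < n" if "l < length (p y)" for l using a(5) nth_mem[OF that] by auto
  have "card (set (p y)) \<le> card {..<n}" using a(5) by (intro card_mono) auto
  then show "length (p y) \<le> n" using distinct_card[OF a(4)] by simp
qed

text \<open>The node at position \<open>l\<close> of a row, where the end bag counts as the position
  behind the last vertex.\<close>

definition succ_of :: "nat list \<Rightarrow> nat \<Rightarrow> nat \<Rightarrow> nat" where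
  "succ_of p b l = (if l < length p then p ! l else 2 * n + b)"

lemma rows_next:
  assumes rows: "rows s en al sk src (mat N \<sigma>) Y p \<beta>"
    and nx: "\<forall>v w. v < n \<and> w < N \<and> w \<noteq> v \<and> (\<forall>x. x \<noteq> v \<longrightarrow> (x, n + v) \<in> mat N \<sigma> \<longleftrightarrow> x = w) \<longrightarrow> nxt v = w"
    and y: "y \<in> Y" "l < length (p y)"
  shows "nxt (p y ! l) = succ_of (p y) (\<beta> y) (Suc l)"
proof -
  note r = rowsD[OF rows y(1)]
  have "succ_of (p y) (\<beta> y) (Suc l) < N"
    using r(6) r(11)[of "Suc l"] by (auto simp: succ_of_def N_def)
  moreover have "succ_of (p y) (\<beta> y) (Suc l) \<noteq> p y ! l"
    using r(11)[OF y(2)] r(4) y(2) by (auto simp: succ_of_def nth_eq_iff_index_eq)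
  ultimately show ?thesis
    using nx[rule_format, of "p y ! l" "succ_of (p y) (\<beta> y) (Suc l)"] r(10)[OF y(2)] r(11)[OF y(2)]
    by (auto simp: succ_of_def)
qed

text \<open>Each value of the loop counter is one step of \<open>fan_inv\<close>: no row starts
  there, or the row claims bags at an unsettled vertex, or it runs to its end bag. Every row sees
  the state left by the rows before it.\<close>

lemma run_trace:
  assumes bd: "bd \<sigma>" and st: "stat \<sigma>" and s: "\<sigma> vs 0 = s" "s < 2" and z: "\<sigma> aSt 0 = 3"
    and rows: "rows s en al sk src (mat N \<sigma>) Y p \<beta>"
    and nx: "\<And>y l. y \<in> Y \<Longrightarrow> l < length (p y) \<Longrightarrow> \<sigma> aNx (p y ! l) = succ_of (p y) (\<beta> y) (Suc l)"
    and st0: "\<And>y. y \<in> Y \<Longrightarrow> stf \<sigma> (\<beta> y) = 0"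
  shows "run trace \<sigma> (200 * (N * N)) (\<lambda>\<sigma>'. keeps {vj, vcur, aSt} \<sigma> \<sigma>' \<and>
    fan_inv (stf \<sigma>) (Suc s) Y p \<beta> n (stf \<sigma>') \<and> \<sigma>' aSt 0 = 3)"
proof -
  let ?S = "{vj, vcur, aSt}"
  let ?I = "\<lambda>j \<tau>. keeps ?S \<sigma> \<tau> \<and> fan_inv (stf \<sigma>) (Suc s) Y p \<beta> j (stf \<tau>) \<and> \<tau> aSt 0 = 3"
  let ?t = "Mul (LtE (V vcur) (V vn)) (Mul (Load aSt (Load aC1 (V vcur))) (Load aSt (Load aC2 (V vcur))))"
  let ?w = "While ?t (vcur ::= Load aNx (V vcur))"
  let ?b = "vcur ::= V vj ;; ?w ;; Cond (LtE (V vcur) (V vn)) (claimp vcur) Skip"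
  have YR: "y \<in> Y \<longleftrightarrow> (y, Suc (2 * n + t)) \<in> mat N \<sigma>" for y using rowsY(1)[OF rows] by blast
  show ?thesis unfolding trace_def
  proof (rule run_for[where I = ?I and m = n and c = "21 * n + 100"])
    fix j \<tau> assume j: "j < n" "bd \<tau>" "\<tau> vj 0 = j" "?I j \<tau>"
    have stt: "stat \<tau>" using stat_keeps[of ?S \<sigma> \<tau>] j st by simp
    have st': "\<tau> vs 0 = s" using j s by (simp add: keeps_def)
    note d = statD(1-4)[OF stt]
    let ?P = "\<lambda>\<tau>'. \<tau>' vj 0 = j \<and> ?I (Suc j) (\<tau>'(vj := (\<tau>' vj)(0 := Suc j)))"
    have aM: "\<tau> aM = \<sigma> aM" using j by (simp add: keeps_def)
    have test: "val \<tau> (Load aM (matE (V vj) (Sub (V vN) (Const 1)))) \<noteq> 0 \<longleftrightarrow> j \<in> Y"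
      using j(1,3) d N_ge(3) aM unfolding YR mat_def by (simp add: N_def)
    show "run (Cond (Load aM (matE (V vj) (Sub (V vN) (Const 1)))) ?b Skip) \<tau> (21 * n + 100) ?P"
    proof (rule run_cond[where ?b1.0 = "21 * n + 86"])
      assume "val \<tau> (Load aM (matE (V vj) (Sub (V vN) (Const 1)))) = 0"
      then have "j \<notin> Y" using test by simp
      then show "run Skip \<tau> (21 * n + 86) ?P" using j fan_inv_skip by (intro run_block) auto
    next
      assume "val \<tau> (Load aM (matE (V vj) (Sub (V vN) (Const 1)))) \<noteq> 0"
      then have jY: "j \<in> Y" using test by simp
      note r = rowsD[OF rows jY]
      define q where "q = p j"
      have q0: "q \<noteq> []" "q ! 0 = j" "length q \<le> n" using r(2,3,12) by (auto simp: q_def hd_conv_nth)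
      \<comment> \<open>The walk has passed \<open>l\<close> vertices of the row, all settled. The
        state does not change during the walk, so settledness refers to \<open>\<tau>\<close>
        throughout.\<close>
      let ?J = "\<lambda>m \<rho>. \<exists>l\<le>length q. m = length q - l \<and> \<rho> vcur 0 = succ_of q (\<beta> j) l \<and> keeps {vcur} \<tau> \<rho> \<and>
         (\<forall>l'<l. q ! l' \<in> settled (stf \<tau>))"
      have val: "val \<rho> ?t \<noteq> 0 \<longleftrightarrow> \<rho> vcur 0 < n \<and> \<rho> vcur 0 \<in> settled (stf \<tau>)" if "keeps {vcur} \<tau> \<rho>" for \<rho>
      proof -
        have "stat \<rho>" "\<rho> aSt 0 = 3" "stf \<rho> = stf \<tau>"
          using stat_keeps[OF that] stt stf_keeps[OF that] that j by (auto simp: keeps_def)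
        then show ?thesis using settled_iff[of \<rho> "\<rho> vcur 0"] statD(1)[of \<rho>] by auto
      qed
      show "run ?b \<tau> (21 * n + 86) ?P"
      proof (rule run_seqI[where ?Q1.0 = "?J (length q)" and ?b1.0 = 10])
        have "?J (length q) (\<tau>(vcur := (\<tau> vcur)(0 := j)))"
          using q0 by (intro exI[of _ 0]) (auto simp: succ_of_def)
        then show "run (vcur ::= V vj) \<tau> 10 (?J (length q))"
          using j N_less_K N_ge(3) by (intro run_block) (auto simp: eok_def)
      next
        fix \<tau>1 assume t1: "bd \<tau>1" "?J (length q) \<tau>1"
        show "run (?w ;; Cond (LtE (V vcur) (V vn)) (claimp vcur) Skip) \<tau>1 (21 * n + 70) ?P"
        proof (rule run_seqI)
          show "run ?w \<tau>1 (21 * n + 20) (\<lambda>\<rho>. \<exists>m. ?J m \<rho> \<and> \<not> (\<rho> vcur 0 < n \<and> \<rho> vcur 0 \<in> settled (stf \<tau>)))"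
          proof (rule run_while[where I = ?J and m = "length q" and c = 5])
            fix m \<rho> assume rho: "bd \<rho>" "?J m \<rho>" "val \<rho> ?t \<noteq> 0"
            then obtain l where l: "l \<le> length q" "m = length q - l" "\<rho> vcur 0 = succ_of q (\<beta> j) l" "keeps {vcur} \<tau> \<rho>"
              "\<forall>l'<l. q ! l' \<in> settled (stf \<tau>)" by blast
            have v: "\<rho> vcur 0 < n" "\<rho> vcur 0 \<in> settled (stf \<tau>)" using rho(3) val[OF l(4)] by auto
            have ll: "l < length q" using v(1) l(1,3) by (auto simp: succ_of_def split: if_splits)
            then have cur: "\<rho> vcur 0 = q ! l" using l(3) by (simp add: succ_of_def)
            have "\<rho> aNx = \<sigma> aNx" using l(4) j by (simp add: keeps_def)
            then have "\<rho> aNx (q ! l) = succ_of q (\<beta> j) (Suc l)" using nx[OF jY, of l] ll by (simp add: q_def)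
            moreover have "\<rho> aNx (q ! l) \<le> K" using bdD[OF rho(1)] .
            moreover have "\<forall>l'<Suc l. q ! l' \<in> settled (stf \<tau>)" using l(5) v(2) cur by (auto simp: less_Suc_eq)
            ultimately have "\<exists>j'<m. ?J j' (\<rho>(vcur := (\<rho> vcur)(0 := \<rho> aNx (q ! l))))"
              using ll l by (intro exI[of _ "length q - Suc l"] conjI exI[of _ "Suc l"]) auto
            then show "run (vcur ::= Load aNx (V vcur)) \<rho> 5 (\<lambda>\<tau>'. \<exists>j'<m. ?J j' \<tau>')"
              using rho(1) cur \<open>\<rho> aNx (q ! l) \<le> K\<close> by (intro run_block) (auto simp: eok_def)
          next
            fix m \<rho> assume rho: "bd \<rho>" "?J m \<rho>" "val \<rho> ?t = 0"
            then have "keeps {vcur} \<tau> \<rho>" by blast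
            then show "\<exists>m. ?J m \<rho> \<and> \<not> (\<rho> vcur 0 < n \<and> \<rho> vcur 0 \<in> settled (stf \<tau>))" using val[of \<rho>] rho by blast
          next
            have "length q * 21 \<le> n * 21" using q0 by simp
            then show "length q * (5 + cost ?t + 1) + cost ?t + 1 \<le> 21 * n + 20" by simp
          qed (use t1 in \<open>auto simp: eok_def\<close>)
        next
          fix \<rho> assume rho: "bd \<rho>" "\<exists>m. ?J m \<rho> \<and> \<not> (\<rho> vcur 0 < n \<and> \<rho> vcur 0 \<in> settled (stf \<tau>))"
          then obtain l where l: "l \<le> length q" "\<rho> vcur 0 = succ_of q (\<beta> j) l" "keeps {vcur} \<tau> \<rho>"
              "\<forall>l'<l. q ! l' \<in> settled (stf \<tau>)" and ns: "\<not> (\<rho> vcur 0 < n \<and> \<rho> vcur 0 \<in> settled (stf \<tau>))" by blast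
          have str: "stat \<rho>" "\<rho> aSt 0 = 3" "stf \<rho> = stf \<tau>" "\<rho> vs 0 = s" "\<rho> vj 0 = j"
            using stat_keeps[OF l(3)] stt stf_keeps[OF l(3)] l(3) j st' by (auto simp: keeps_def)
          have kr: "keeps ?S \<sigma> \<rho>" using j l(3) by (auto elim: keeps_trans)
          show "run (Cond (LtE (V vcur) (V vn)) (claimp vcur) Skip) \<rho> 50 ?P"
          proof (rule run_cond[where ?b1.0 = 40])
            assume "val \<rho> (LtE (V vcur) (V vn)) \<noteq> 0"
            then have v: "\<rho> vcur 0 < n" using statD(1)[OF str(1)] by simp
            have ll: "l < length q" using v l(1,2) by (auto simp: succ_of_def split: if_splits)
            then have cur: "\<rho> vcur 0 = q ! l" using l(2) by (simp add: succ_of_def)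
            have "fan_inv (stf \<sigma>) (Suc s) Y p \<beta> (Suc j) (claim (stf \<tau>) (Suc s) (p j ! l))"
              using j jY ll l(4) ns v cur by (intro fan_inv_claim) (auto simp: q_def)
            then have fi: "fan_inv (stf \<sigma>) (Suc s) Y p \<beta> (Suc j) (claim (stf \<rho>) (Suc s) (\<rho> vcur 0))"
              using str cur by (simp add: q_def)
            show "run (claimp vcur) \<rho> 40 ?P"
            proof (rule run_conseq[OF run_claimp[OF rho(1) str(1,4) s(2) str(2) refl v] order_refl])
              fix \<rho>' assume r': "keeps {aSt} \<rho> \<rho>' \<and> stf \<rho>' = claim (stf \<rho>) (Suc s) (\<rho> vcur 0) \<and> \<rho>' aSt 0 = 3"
              have "keeps ?S \<sigma> \<rho>'" using kr r' by (auto elim: keeps_trans)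
              moreover have "\<rho>' vj = \<rho> vj" using r' by (simp add: keeps_def)
              ultimately show "?P \<rho>'" using r' fi str by simp
            qed simp
          next
            assume "val \<rho> (LtE (V vcur) (V vn)) = 0"
            then have v: "\<not> \<rho> vcur 0 < n" using statD(1)[OF str(1)] by simp
            have ll: "l = length q" using v l(1,2) r(11)[of l] by (cases "l = length q") (auto simp: succ_of_def q_def)
            have "fan_inv (stf \<sigma>) (Suc s) Y p \<beta> (Suc j) (stf \<tau>)"
            proof (rule fan_inv_end[OF _ jY])
              show "v \<in> settled (stf \<tau>)" if "v \<in> set (p j)" for v
                using that l(4) ll by (auto simp: in_set_conv_nth q_def)
            qed (use j r st0[OF jY] in auto)
            then show "run Skip \<rho> 40 ?P" using str kr rho(1)
              by (intro run_block) auto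
          qed (use rho in \<open>auto simp: eok_def\<close>)
        qed simp
      qed simp
    qed (use j in \<open>auto simp: eok_def\<close>)
  next
    have "n * n \<le> N * N" using N_ge(3) by (intro mult_le_mono) auto
    moreover have "n * (21 * n + 100 + cost (V vn) + 10) + cost (V vn) + 10 = 21 * (n * n) + 112 * n + 12"
      by (simp add: algebra_simps)
    ultimately show "n * (21 * n + 100 + cost (V vn) + 10) + cost (V vn) + 10 \<le> 200 * (N * N)"
      using square_bound[of N] N_ge(1,3) by linarith
  qed (use bd st z fan_inv_0 N_less_K N_ge(3) in \<open>auto simp: eok_def keeps_def stat_def\<close>)
qed

text \<open>The \<open>5 * k\<close> augmentations make up \<open>1500 * (k * (N * N))\<close> of
  the time bound; the other phases scan the matrix once or follow disjoint rows.\<close>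

lemma run_fan:
  assumes bd: "bd \<sigma>" and st: "stat \<sigma>" and s: "\<sigma> vs 0 = s" "s < 2" and i: "\<sigma> vi 0 = i" "i < k" and z: "\<sigma> aSt 0 = 3"
    and few: "card (used (stf \<sigma>)) + 10 * k + 2 \<le> t"
  shows "run fan \<sigma> (3000 * (k * (N * N))) (\<lambda>\<sigma>'. keeps fan_regs \<sigma> \<sigma>' \<and> extends (stf \<sigma>) (stf \<sigma>') \<and>
    card (used (stf \<sigma>')) \<le> card (used (stf \<sigma>)) + 10 * k + 2 \<and>
    bag_graph.robust n t B k (Eds s) (stf \<sigma>') (Suc s) (tm s i) \<and> \<sigma>' aSt 0 = 3)"
proof -
  interpret E: bag_graph n t B k "Eds s" by (rule side_graph)
  define r where "r = tm s i"
  have rn: "r < n" using tm_lt s i by (simp add: r_def)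
  define st1 where "st1 = claim (stf \<sigma>) (Suc s) r"
  have r1: "r \<in> settled st1" using claim_settled rn by (simp add: st1_def)
  \<comment> \<open>Claiming the bags of \<open>r\<close> uses up the \<open>2\<close> in
    \<open>few\<close>; the remaining \<open>10 * k\<close> is what \<open>fan_augment\<close>
    needs.\<close>
  have few1: "card (used st1) + 10 * k \<le> t" "card (used st1) \<le> card (used (stf \<sigma>)) + 2"
    using card_used_claim[of "stf \<sigma>" "Suc s" r] few by (auto simp: st1_def)
  let ?net = "netr s (\<lambda>v. v \<noteq> r) (\<lambda>_. True) (\<lambda>b. st1 b = 0) (\<lambda>y. (r, y) \<in> Eds s \<and> y \<noteq> r)"
  let ?F = "\<lambda>A \<tau>. keeps A \<sigma> \<tau> \<and> \<tau> aSt 0 = 3 \<and> stf \<tau> = st1 \<and> \<tau> vr 0 = r"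
  let ?A1 = "{vr}" and ?A2 = "{vr, aSt}" and ?A3 = "{vr, aSt, vx, vy, aM}"
  let ?A4 = "{vr, aSt, vx, vy, aM, vtl, aVis, aPar, aQ, vcur, vu, vc}"
  let ?A5 = "{vr, aSt, vx, vy, aM, vtl, aVis, aPar, aQ, vcur, vu, vc, aNx}"
  have stk: "stat \<tau>" "\<tau> vs 0 = s" if "keeps ?A5 \<sigma> \<tau>" for \<tau>
    using stat_keeps[OF that] st that s by (auto simp: keeps_def)
  have wk: "keeps ?A5 \<sigma> \<tau>" if "keeps A \<sigma> \<tau>" "A \<subseteq> ?A5" for A \<tau> using that by (auto simp: keeps_def)
  show ?thesis unfolding fan_def
  proof (rule run_seqI[where ?b1.0 = 20 and ?Q1.0 = "\<lambda>\<tau>. keeps ?A1 \<sigma> \<tau> \<and> \<tau> vr 0 = r"])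
    show "run (vr ::= rootE) \<sigma> 20 (\<lambda>\<tau>. keeps ?A1 \<sigma> \<tau> \<and> \<tau> vr 0 = r)"
    proof (rule run_block[OF _ bd])
      have "val \<sigma> rootE = r" using statD(2)[OF st] statD(5)[OF st s(2) i(2)] s i by (simp add: r_def)
      then show "safe K (vr ::= rootE) \<sigma>" "keeps ?A1 \<sigma> (stp (vr ::= rootE) \<sigma>) \<and> stp (vr ::= rootE) \<sigma> vr 0 = r"
        using rn N_ge(3) N_less_K by simp_all
    qed (auto simp: eok_def)
  next
    fix \<sigma>1 assume a1: "bd \<sigma>1" "keeps ?A1 \<sigma> \<sigma>1 \<and> \<sigma>1 vr 0 = r"
    have b1: "stat \<sigma>1" "\<sigma>1 vs 0 = s" "\<sigma>1 aSt 0 = 3" "stf \<sigma>1 = stf \<sigma>"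
      using stk[OF wk[of ?A1]] a1 stf_keeps[of ?A1 \<sigma> \<sigma>1] z by (auto simp: keeps_def)
    show "run (claimp vr ;; fill fan_netE ;; For vc (Mul (Const 5) (V vk)) augment ;; nexts ;; trace) \<sigma>1 (2900 * (k * (N * N)) + 40) (\<lambda>\<sigma>'. keeps fan_regs \<sigma> \<sigma>' \<and> extends (stf \<sigma>) (stf \<sigma>') \<and>
    card (used (stf \<sigma>')) \<le> card (used (stf \<sigma>)) + 10 * k + 2 \<and>
    E.robust (stf \<sigma>') (Suc s) (tm s i) \<and> \<sigma>' aSt 0 = 3)"
    proof (rule run_seqI[OF run_claimp[OF a1(1) b1(1,2) s(2) b1(3) conjunct2[OF a1(2)] rn]])
      fix \<sigma>2 assume a2: "bd \<sigma>2" "keeps {aSt} \<sigma>1 \<sigma>2 \<and> stf \<sigma>2 = claim (stf \<sigma>1) (Suc s) r \<and> \<sigma>2 aSt 0 = 3"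
      have b2: "?F ?A2 \<sigma>2" using a1 a2 b1 by (auto simp: st1_def keeps_def)
      note c2 = stk[OF wk[of ?A2 \<sigma>2]]
      have fill: "run (fill fan_netE) \<sigma>2 (700 * (N * N)) (\<lambda>\<sigma>'. keeps {vx, vy, aM} \<sigma>2 \<sigma>' \<and> mat N \<sigma>' = ?net)"
        unfolding fan_netE_def
      proof (rule run_netE[OF a2(1) _ _ s(2)])
        fix \<tau> assume t: "keeps {vx, vy, aM} \<sigma>2 \<tau>"
        have vr: "\<tau> vr 0 = r" "stat \<tau>" "\<tau> vs 0 = s" using t b2 c2 stat_keeps[OF t] by (auto simp: keeps_def)
        have "stf \<tau> = st1" using b2 stf_keeps[OF t] by simp
        then have sf: "\<tau> aSt (Suc b) = st1 b" for b by (auto simp: stf_def)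
        show "(val \<tau> (NeqE (V vx) (V vr)) \<noteq> 0) = (\<tau> vx 0 \<noteq> r)" using vr by auto
        show "(val \<tau> (Const 1) \<noteq> 0) = True" by simp
        show "(val \<tau> (NotE (Load aSt (Add yb (Const 1)))) \<noteq> 0) = (st1 (\<tau> vy 0 - 2 * n) = 0)"
          using sf statD(1)[OF vr(2)] by auto
        show "(val \<tau> (Mul (adjE (V vr) (V vy)) (NeqE (V vy) (V vr))) \<noteq> 0) = ((r, \<tau> vy 0) \<in> Eds s \<and> \<tau> vy 0 \<noteq> r)" if "\<tau> vy 0 < n"
          using statD(6)[OF vr(2) s(2) rn that] vr statD(1)[OF vr(2)] unfolding val_MulE val_NeqE by simp
      qed (use b2 c2 in \<open>auto simp: eok_def netE_defs\<close>)
      show "run (fill fan_netE ;; For vc (Mul (Const 5) (V vk)) augment ;; nexts ;; trace) \<sigma>2 (2900 * (k * (N * N))) (\<lambda>\<sigma>'. keeps fan_regs \<sigma> \<sigma>' \<and> extends (stf \<sigma>) (stf \<sigma>') \<and>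
    card (used (stf \<sigma>')) \<le> card (used (stf \<sigma>)) + 10 * k + 2 \<and>
    E.robust (stf \<sigma>') (Suc s) (tm s i) \<and> \<sigma>' aSt 0 = 3)"
      proof (rule run_seqI[OF fill])
        fix \<sigma>3 assume a3: "bd \<sigma>3" "keeps {vx, vy, aM} \<sigma>2 \<sigma>3 \<and> mat N \<sigma>3 = ?net"
        have b3: "?F ?A3 \<sigma>3" using a3 b2 by (auto simp: keeps_def stf_def)
        note c3 = stk[OF wk[of ?A3 \<sigma>3]]
        have flow: "run (For vc (Mul (Const 5) (V vk)) augment) \<sigma>3 (5 * k * (300 * (N * N) + cost (Mul (Const 5) (V vk)) + 10) + cost (Mul (Const 5) (V vk)) + 10)
          (\<lambda>\<sigma>'. keeps flow_regs \<sigma>3 \<sigma>' \<and> residual ?net (Suc (2 * n + t)) (2 * n + t) (5 * k) (mat N \<sigma>'))"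
        proof (rule run_flow[OF a3(1)])
          show "stat \<sigma>3" using c3 b3 by auto
          show "mat N \<sigma>3 = ?net" using a3 by blast
          show "eok (Mul (Const 5) (V vk))" by (simp add: eok_def)
          show "val \<tau> (Mul (Const 5) (V vk)) = 5 * k" if "keeps flow_regs \<sigma>3 \<tau>" for \<tau>
          proof -
            have "\<tau> vk 0 = \<sigma>3 vk 0" using that by (simp add: keeps_def)
            then show ?thesis using c3 b3 statD(2)[of \<sigma>3] by auto
          qed
          show "5 * k < K" by (rule N_ge(6))
          show "(Suc (2 * n + t), 2 * n + t) \<in> R\<^sup>*" if "j < 5 * k" "residual ?net (Suc (2 * n + t)) (2 * n + t) j R" for j R
            using E.fan_augment[OF r1 few1(1) that(2,1)] .
        qed
        show "run (For vc (Mul (Const 5) (V vk)) augment ;; nexts ;; trace) \<sigma>3 (2100 * (k * (N * N))) (\<lambda>\<sigma>'. keeps fan_regs \<sigma> \<sigma>' \<and> extends (stf \<sigma>) (stf \<sigma>') \<and>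
    card (used (stf \<sigma>')) \<le> card (used (stf \<sigma>)) + 10 * k + 2 \<and>
    E.robust (stf \<sigma>') (Suc s) (tm s i) \<and> \<sigma>' aSt 0 = 3)"
        proof (rule run_seqI[OF flow])
          fix \<sigma>4 assume a4: "bd \<sigma>4" "keeps flow_regs \<sigma>3 \<sigma>4 \<and> residual ?net (Suc (2 * n + t)) (2 * n + t) (5 * k) (mat N \<sigma>4)"
          have b4: "?F ?A4 \<sigma>4" using a4 b3 by (auto simp: keeps_def stf_def)
          have c4: "stat \<sigma>4" "\<sigma>4 vs 0 = s" using stk[OF wk[of ?A4 \<sigma>4]] b4 by auto
          obtain Y p \<beta> where rows: "rows s (\<lambda>v. v \<noteq> r) (\<lambda>_. True) (\<lambda>b. st1 b = 0) (\<lambda>y. (r, y) \<in> Eds s \<and> y \<noteq> r) (mat N \<sigma>4) Y p \<beta>"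
            and cY: "card Y = 5 * k" using rows_exist[OF conjunct2[OF a4(2)]] by blast
          show "run (nexts ;; trace) \<sigma>4 (300 * (N * N)) (\<lambda>\<sigma>'. keeps fan_regs \<sigma> \<sigma>' \<and> extends (stf \<sigma>) (stf \<sigma>') \<and>
    card (used (stf \<sigma>')) \<le> card (used (stf \<sigma>)) + 10 * k + 2 \<and>
    E.robust (stf \<sigma>') (Suc s) (tm s i) \<and> \<sigma>' aSt 0 = 3)"
          proof (rule run_seqI[OF run_nexts[OF a4(1) statD(4)[OF c4(1)] _ N_less_K statD(1)[OF c4(1)] N_ge(2)]])
            fix \<sigma>5 assume a5: "bd \<sigma>5" "keeps {vx, vy, aNx} \<sigma>4 \<sigma>5 \<and>
              (\<forall>v w. v < n \<and> w < N \<and> w \<noteq> v \<and> (\<forall>x. x \<noteq> v \<longrightarrow> ((x, n + v) \<in> mat N \<sigma>4) = (x = w)) \<longrightarrow> \<sigma>5 aNx v = w)"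
            have b5: "?F ?A5 \<sigma>5" using a5 b4 by (auto simp: keeps_def stf_def)
            have c5: "stat \<sigma>5" "\<sigma>5 vs 0 = s" using stk[OF wk[of ?A5 \<sigma>5]] b5 by auto
            have m5: "mat N \<sigma>5 = mat N \<sigma>4" using a5 by (intro mat_keeps[of "{vx, vy, aNx}"]) auto
            show "run trace \<sigma>5 (200 * (N * N)) (\<lambda>\<sigma>'. keeps fan_regs \<sigma> \<sigma>' \<and> extends (stf \<sigma>) (stf \<sigma>') \<and>
    card (used (stf \<sigma>')) \<le> card (used (stf \<sigma>)) + 10 * k + 2 \<and>
    E.robust (stf \<sigma>') (Suc s) (tm s i) \<and> \<sigma>' aSt 0 = 3)"
            proof (rule run_conseq[OF run_trace[OF a5(1) c5 s(2) _ rows[folded m5]] order_refl])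
              show "\<sigma>5 aSt 0 = 3" using b5 by blast
              show "\<sigma>5 aNx (p y ! l) = succ_of (p y) (\<beta> y) (Suc l)" if "y \<in> Y" "l < length (p y)" for y l
                by (rule rows_next[OF rows conjunct2[OF a5(2)] that])
              show "stf \<sigma>5 (\<beta> y) = 0" if "y \<in> Y" for y using rowsD(7)[OF rows that] b5 by simp
            next
              fix \<sigma>' assume a6: "keeps {vj, vcur, aSt} \<sigma>5 \<sigma>' \<and> fan_inv (stf \<sigma>5) (Suc s) Y p \<beta> n (stf \<sigma>') \<and> \<sigma>' aSt 0 = 3"
              have s5: "stf \<sigma>5 = st1" using b5 by blast
              have Yn: "Y \<subseteq> {..<n}" by (rule rowsY(2)[OF rows])
              have fi: "fan_inv st1 (Suc s) Y p \<beta> n (stf \<sigma>')" using a6 s5 by simp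
              have "E.robust (stf \<sigma>') (Suc s) r"
              proof (rule E.fan_inv_robust[OF fi Yn cY _ _ _ _ _ r1])
                show "0 < k" using k_pos by simp
                show "inj_on \<beta> Y" by (rule rowsY(3)[OF rows])
                show "hd (p y) = y \<and> (r, y) \<in> Eds s \<and> p y \<noteq> []" if "y \<in> Y" for y using rowsD(1-3)[OF rows that] by blast
                show "(p y ! l, p y ! Suc l) \<in> Eds s" if "y \<in> Y" "Suc l < length (p y)" for y l
                  using rowsD(9)[OF rows that] by blast
                show "y = y'" if "y \<in> Y" "y' \<in> Y" "v \<in> set (p y)" "v \<in> set (p y')" for y y' v
                  by (rule rowsY(4)[OF rows that])
              qed
              moreover have "Y \<inter> {..<n} = Y" using Yn by auto
              then have "card (used (stf \<sigma>')) \<le> card (used st1) + 10 * k" "extends st1 (stf \<sigma>')"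
                using fi cY by (auto simp: fan_inv_def)
              moreover have "extends (stf \<sigma>) st1" unfolding st1_def by (rule claim_extends)
              moreover have "keeps fan_regs \<sigma> \<sigma>'" using a6 b5 by (auto simp: keeps_def)
              ultimately show "keeps fan_regs \<sigma> \<sigma>' \<and> extends (stf \<sigma>) (stf \<sigma>') \<and>
                card (used (stf \<sigma>')) \<le> card (used (stf \<sigma>)) + 10 * k + 2 \<and>
                E.robust (stf \<sigma>') (Suc s) (tm s i) \<and> \<sigma>' aSt 0 = 3"
                using a6 few1(2) extends_trans by (auto simp: r_def)
            qed
          qed (use N_ge(1) in auto)
        next
          have "N * N \<le> k * (N * N)" "1 \<le> N * N" "k \<le> k * (N * N)" using k_pos N_ge(1) by auto
          moreover have "5 * k * (300 * (N * N) + cost (Mul (Const 5) (V vk)) + 10) + cost (Mul (Const 5) (V vk)) + 10 =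
            1500 * (k * (N * N)) + 70 * k + 14" by (simp add: algebra_simps)
          ultimately show "5 * k * (300 * (N * N) + cost (Mul (Const 5) (V vk)) + 10) + cost (Mul (Const 5) (V vk)) + 10 + 300 * (N * N) \<le> 2100 * (k * (N * N))"
            by linarith
        qed
      next
        have "N * N \<le> k * (N * N)" using k_pos by auto
        then show "700 * (N * N) + 2100 * (k * (N * N)) \<le> 2900 * (k * (N * N))" by linarith
      qed
    qed auto
  next
    have "1 \<le> k * (N * N)" using k_pos N_ge(1) by auto
    then show "20 + (2900 * (k * (N * N)) + 40) \<le> 3000 * (k * (N * N))" by linarith
  qed
qed

end

definition fans :: prog where "fans = For vs (Const 2) (For vi (V vk) fan)"

context linkage_ram
begin

lemma run_fans:
  assumes bd: "bd \<sigma>" and st: "stat \<sigma>" and z: "\<sigma> aSt 0 = 3" and fresh: "\<And>b. stf \<sigma> b = 0"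
  shows "run fans \<sigma> (8000 * (k * (k * (N * N)))) (\<lambda>\<sigma>'. keeps (fan_regs \<union> {vi, vs}) \<sigma> \<sigma>' \<and>
    card (used (stf \<sigma>')) \<le> 24 * k ^ 2 \<and>
    (\<forall>s<2. \<forall>i<k. bag_graph.robust n t B k (Eds s) (stf \<sigma>') (Suc s) (tm s i)) \<and> \<sigma>' aSt 0 = 3)"
proof -
  let ?S = "fan_regs \<union> {vi, vs}"
  let ?rob = "\<lambda>s i st. bag_graph.robust n t B k (Eds s) st (Suc s) (tm s i)"
  have rob_ext: "?rob s i st'" if "?rob s i st" "extends st st'" for s i st st'
    by (rule bag_graph.robust_extends[OF side_graph that]) simp
  let ?I = "\<lambda>s \<tau>. keeps ?S \<sigma> \<tau> \<and> card (used (stf \<tau>)) \<le> s * k * (10 * k + 2) \<and>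
     (\<forall>s'<s. \<forall>i<k. ?rob s' i (stf \<tau>)) \<and> \<tau> aSt 0 = 3"
  have kk: "k \<le> k ^ 2" using k_pos by (simp add: power2_eq_square)
  \<comment> \<open>For at most \<open>2 * k\<close> terminals already treated, one more fan fits:
    \<open>20 * k ^ 2 + 14 * k + 2 \<le> 60 * k ^ 2\<close>.\<close>
  have bound: "x * (10 * k + 2) + 10 * k + 2 \<le> t" if "x \<le> 2 * k" for x
  proof -
    have "x * (10 * k + 2) \<le> 2 * k * (10 * k + 2)" using that by (rule mult_le_mono1)
    also have "\<dots> = 20 * k ^ 2 + 4 * k" by (simp add: power2_eq_square algebra_simps)
    finally show ?thesis using kk k_pos t_eq by linarith
  qed
  show ?thesis unfolding fans_def
  proof (rule run_for[where I = ?I and m = 2 and c = "3012 * (k * (k * (N * N))) + 12"])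
    fix s \<tau> assume s: "s < 2" "bd \<tau>" "\<tau> vs 0 = s" "?I s \<tau>"
    let ?J = "\<lambda>i \<rho>. keeps ?S \<sigma> \<rho> \<and> \<rho> vs 0 = s \<and> card (used (stf \<rho>)) \<le> (s * k + i) * (10 * k + 2) \<and>
      (\<forall>s'<s. \<forall>i<k. ?rob s' i (stf \<rho>)) \<and> (\<forall>i'<i. ?rob s i' (stf \<rho>)) \<and> \<rho> aSt 0 = 3"
    show "run (For vi (V vk) fan) \<tau> (3012 * (k * (k * (N * N))) + 12) (\<lambda>\<tau>'. \<tau>' vs 0 = s \<and> ?I (Suc s) (\<tau>'(vs := (\<tau>' vs)(0 := Suc s))))"
    proof (rule run_for[where I = ?J and m = k and c = "3000 * (k * (N * N))"])
      fix i \<rho> assume i: "i < k" "bd \<rho>" "\<rho> vi 0 = i" "?J i \<rho>"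
      have str: "stat \<rho>" using stat_keeps[of ?S \<sigma> \<rho>] i st by auto
      have "s * k + i \<le> 2 * k" using s(1) i(1) by (cases s) (auto simp: less_Suc_eq)
      then have few: "card (used (stf \<rho>)) + 10 * k + 2 \<le> t" using bound[of "s * k + i"] i(4) by linarith
      show "run fan \<rho> (3000 * (k * (N * N))) (\<lambda>\<tau>'. \<tau>' vi 0 = i \<and> ?J (Suc i) (\<tau>'(vi := (\<tau>' vi)(0 := Suc i))))"
      proof (rule run_conseq[OF run_fan[OF i(2) str _ s(1) i(3,1) _ few] order_refl])
        fix \<rho>' assume r: "keeps fan_regs \<rho> \<rho>' \<and> extends (stf \<rho>) (stf \<rho>') \<and>
           card (used (stf \<rho>')) \<le> card (used (stf \<rho>)) + 10 * k + 2 \<and> ?rob s i (stf \<rho>') \<and> \<rho>' aSt 0 = 3"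
        have "keeps ?S \<sigma> \<rho>'" using r i by (auto simp: keeps_def)
        moreover have "\<rho>' vi = \<rho> vi" "\<rho>' vs = \<rho> vs" using r by (simp_all add: keeps_def)
        moreover have "card (used (stf \<rho>')) \<le> (s * k + Suc i) * (10 * k + 2)" using r i(4) by (simp add: algebra_simps)
        moreover have "\<forall>s'<s. \<forall>i<k. ?rob s' i (stf \<rho>')" using i(4) r rob_ext by blast
        moreover have "\<forall>i'<Suc i. ?rob s i' (stf \<rho>')" using i(4) r rob_ext less_Suc_eq by metis
        ultimately show "\<rho>' vi 0 = i \<and> ?J (Suc i) (\<rho>'(vi := (\<rho>' vi)(0 := Suc i)))" using r i by simp
      qed (use i in auto)
    next
      fix \<rho> assume r: "bd \<rho>" "?J k \<rho>"
      have "\<forall>s'<Suc s. \<forall>i<k. ?rob s' i (stf \<rho>)" using r less_Suc_eq by metis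
      then show "\<rho> vs 0 = s \<and> ?I (Suc s) (\<rho>(vs := (\<rho> vs)(0 := Suc s)))" using r by (simp add: algebra_simps)
    next
      have "k \<le> k * (k * (N * N))" using k_pos N_ge(1) by simp
      moreover have "k * (3000 * (k * (N * N)) + cost (V vk) + 10) + cost (V vk) + 10 = 3000 * (k * (k * (N * N))) + 12 * k + 12"
        by (simp add: algebra_simps)
      ultimately show "k * (3000 * (k * (N * N)) + cost (V vk) + 10) + cost (V vk) + 10 \<le> 3012 * (k * (k * (N * N))) + 12" by linarith
    next
      show "val \<rho> (V vk) = k" if "?J j \<rho>" for j \<rho>
      proof -
        have "\<rho> vk = \<sigma> vk" using that by (simp add: keeps_def)
        then show ?thesis using statD(2)[OF st] by simp
      qed
      show "?J 0 (\<tau>(vi := (\<tau> vi)(0 := 0)))" using s by simp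
    qed (use s N_ge(5) N_less_K in \<open>auto simp: eok_def\<close>)
  next
    fix \<tau> assume t: "bd \<tau>" "?I 2 \<tau>"
    have "2 * k * (10 * k + 2) = 20 * k ^ 2 + 4 * k" by (simp add: power2_eq_square algebra_simps)
    then show "keeps ?S \<sigma> \<tau> \<and> card (used (stf \<tau>)) \<le> 24 * k ^ 2 \<and> (\<forall>s<2. \<forall>i<k. ?rob s i (stf \<tau>)) \<and> \<tau> aSt 0 = 3"
      using t kk by auto
  next
    have "1 \<le> k * (k * (N * N))" using k_pos N_ge(1) by simp
    moreover have "2 * (3012 * x + 12 + cost (Const 2) + 10) + cost (Const 2) + 10 \<le> 8000 * x" if "1 \<le> x" for x
      using that by simp
    ultimately show "2 * (3012 * (k * (k * (N * N))) + 12 + cost (Const 2) + 10) + cost (Const 2) + 10 \<le> 8000 * (k * (k * (N * N)))"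
      by blast
  next
    show "?I 0 (\<sigma>(vs := (\<sigma> vs)(0 := 0)))" using z fresh by (simp add: used_def)
  qed (use bd K100 in \<open>auto simp: eok_def\<close>)
qed

end

subsection \<open>Linking\<close>

abbreviation (input) s1E :: expr where "s1E \<equiv> Add (V vs) (Const 1)"
abbreviation (input) c1E :: expr where "c1E \<equiv> Load aSt (Load aC1 xv)"
abbreviation (input) c2E :: expr where "c2E \<equiv> Load aSt (Load aC2 xv)"
text \<open>A choice between two tests by arithmetic: \<open>vs\<close> is \<open>0\<close> or
  \<open>1\<close>, so it and its negation act as selectors.\<close>

abbreviation (input) halfE :: expr where
  "halfE \<equiv> Add (Mul (NotE (V vs)) (LtE (Mul (Const 2) yb) (V vt))) (Mul (V vs) (LeE (V vt) (Mul (Const 2) yb)))"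

definition link_netE :: expr where
  "link_netE = netE (Const 1) (Add (Mul c1E c2E) (Add (EqE c1E s1E) (EqE c2E s1E)))
     (Mul (NotE (Load aSt (Add yb (Const 1)))) halfE) (Load aTm (Add (Mul (V vs) (V vn)) (V vy)))"

definition labels :: prog where
  "labels = For vi (V vk) (vcur ::= rootE ;;
     While (LtE (V vcur) (V vn)) (Store aLab (Add (Mul (V vs) (V vn)) (V vcur)) (Add (V vi) (Const 1)) ;; vcur ::= Load aNx (V vcur)) ;;
     Store aZ (Add (Mul (V vs) (V vk)) (V vi)) (Add (Sub (V vcur) n2E) (Const 1)))"

definition link :: prog where
  "link = fill link_netE ;; For vc (V vk) augment ;; nexts ;; labels"

abbreviation "link_regs \<equiv> {vx, vy, vtl, aVis, aPar, aQ, vcur, vu, aM, vc, aNx, vi, aLab, aZ}"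

context linkage_ram
begin

definition half :: "nat \<Rightarrow> nat \<Rightarrow> bool" where
  "half s b \<longleftrightarrow> s = 0 \<and> 2 * b < t \<or> s \<noteq> 0 \<and> t \<le> 2 * b"

text \<open>The result of linking one side, in the form that \<open>union_path\<close> and
  \<open>load_le_2\<close> ask for.\<close>

definition linked :: "nat \<Rightarrow> (nat \<Rightarrow> nat) \<Rightarrow> (nat \<Rightarrow> nat list) \<Rightarrow> (nat \<Rightarrow> nat) \<Rightarrow> bool" where
  "linked s st p z \<longleftrightarrow> inj_on z {..<k} \<and>
     (\<forall>i<k. \<forall>j<k. \<forall>v. v \<in> set (p i) \<longrightarrow> v \<in> set (p j) \<longrightarrow> i = j) \<and>
     (\<forall>i<k. p i \<noteq> [] \<and> hd (p i) = tm s i \<and> set (p i) \<subseteq> {..<n} \<and>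
        (\<forall>l. Suc l < length (p i) \<longrightarrow> (p i ! l, p i ! Suc l) \<in> Eds s) \<and> last (p i) \<in> B (z i) \<and> z i < t \<and>
        st (z i) = 0 \<and> half s (z i) \<and> (\<forall>v\<in>set (p i). v \<in> B (z i) \<or> allowed st (Suc s) v))"

text \<open>Memory keeps the vertex set of each path but not its order. That suffices, because the
  solution path is searched anew inside the union of paths and end bags.\<close>

definition labelled :: "nat \<Rightarrow> (nat \<Rightarrow> nat list) \<Rightarrow> (nat \<Rightarrow> nat) \<Rightarrow> memory \<Rightarrow> bool" where
  "labelled s p z \<sigma> \<longleftrightarrow> (\<forall>i<k. \<sigma> aZ (s * k + i) = Suc (z i)) \<and>
     (\<forall>v<n. \<forall>i<k. \<sigma> aLab (s * n + v) = Suc i \<longleftrightarrow> v \<in> set (p i))"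

text \<open>The state \<open>3\<close> of a missing bag is neither \<open>0\<close> nor the mark of
  a side, which are \<open>1\<close> and \<open>2\<close>; so it passes the test for settled
  vertices and fails the tests for claimed bags.\<close>

lemma allowed_iff:
  assumes "stat \<sigma>" "\<sigma> aSt 0 = 3" "v < n" "s < 2"
  shows "allowed (stf \<sigma>) (Suc s) v \<longleftrightarrow> \<sigma> aSt (\<sigma> aC1 v) \<noteq> 0 \<and> \<sigma> aSt (\<sigma> aC2 v) \<noteq> 0 \<or>
     \<sigma> aSt (\<sigma> aC1 v) = Suc s \<or> \<sigma> aSt (\<sigma> aC2 v) = Suc s"
proof -
  have "(\<exists>b<t. v \<in> B b \<and> stf \<sigma> b = Suc s) \<longleftrightarrow> \<sigma> aSt (\<sigma> aC1 v) = Suc s \<or> \<sigma> aSt (\<sigma> aC2 v) = Suc s" (is "?l = ?r")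
  proof
    assume ?l
    then show ?r using statD(7)[OF assms(1,3)] by (auto simp: stf_def)
  next
    assume ?r
    then obtain c where c: "c = \<sigma> aC1 v \<or> c = \<sigma> aC2 v" "\<sigma> aSt c = Suc s" by auto
    then have "c \<noteq> 0" "c \<le> t" using assms statD(8,9)[OF assms(1,3)] by (auto intro!: Nat.gr0I)
    then obtain b where "c = Suc b" "b < t" by (cases c) auto
    then show ?l using c statD(7)[OF assms(1,3), of b] by (auto simp: stf_def)
  qed
  then show ?thesis unfolding allowed_def settled_iff[OF assms(1-3)] by blast
qed

text \<open>Even if all claimed bags fall into one half, \<open>30 * k ^ 2 - 24 * k ^ 2\<close> of
  its bags are left.\<close>

lemma card_half: "s < 2 \<Longrightarrow> card (used st) \<le> 24 * k ^ 2 \<Longrightarrow> 2 * k \<le> card {b. b < t \<and> st b = 0 \<and> half s b}"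
proof -
  assume s: "s < 2" and u: "card (used st) \<le> 24 * k ^ 2"
  define H where "H = {b. b < t \<and> half s b}"
  have "H = (if s = 0 then {..<30 * k ^ 2} else {30 * k ^ 2..<60 * k ^ 2})"
    unfolding H_def half_def using t_eq by auto
  then have "card H = 30 * k ^ 2" by simp
  moreover have eq: "{b. b < t \<and> st b = 0 \<and> half s b} = H - used st" by (auto simp: H_def used_def)
  moreover have "card H - card (used st) \<le> card (H - used st)" by (rule diff_card_le_card_Diff) simp
  moreover have "k \<le> k ^ 2" using k_pos by (simp add: power2_eq_square)
  ultimately show ?thesis unfolding eq using u by linarith
qed

lemma run_labels:
  assumes bd: "bd \<sigma>" and st: "stat \<sigma>" and s: "\<sigma> vs 0 = s" "s < 2"
    and p: "\<And>i. i < k \<Longrightarrow> p i \<noteq> [] \<and> hd (p i) = tm s i \<and> set (p i) \<subseteq> {..<n} \<and> length (p i) \<le> n \<and> z i < t"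
    and disj: "\<And>i j v. i < k \<Longrightarrow> j < k \<Longrightarrow> v \<in> set (p i) \<Longrightarrow> v \<in> set (p j) \<Longrightarrow> i = j"
    and nx: "\<And>i l. i < k \<Longrightarrow> l < length (p i) \<Longrightarrow> \<sigma> aNx (p i ! l) = succ_of (p i) (z i) (Suc l)"
    and fresh: "\<And>v. v < n \<Longrightarrow> \<sigma> aLab (s * n + v) = 0"
  shows "run labels \<sigma> (100 * (N * N)) (\<lambda>\<sigma>'. keeps {vi, vcur, aLab, aZ} \<sigma> \<sigma>' \<and> labelled s p z \<sigma>' \<and>
    (\<forall>x. \<not> (s * n \<le> x \<and> x < s * n + n) \<longrightarrow> \<sigma>' aLab x = \<sigma> aLab x) \<and>
    (\<forall>x. \<not> (s * k \<le> x \<and> x < s * k + k) \<longrightarrow> \<sigma>' aZ x = \<sigma> aZ x))"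
proof -
  let ?S = "{vi, vcur, aLab, aZ}"
  let ?L = "\<lambda>Q \<tau>. (\<forall>v<n. \<forall>i<k. \<tau> aLab (s * n + v) = Suc i \<longleftrightarrow> Q v i)"
  \<comment> \<open>The segments of \<open>aLab\<close> and \<open>aZ\<close> that belong to the
    other side are not written; the second linking thereby preserves the result of the
    first.\<close>
  let ?fr = "\<lambda>\<tau>. (\<forall>x. \<not> (s * n \<le> x \<and> x < s * n + n) \<longrightarrow> \<tau> aLab x = \<sigma> aLab x) \<and>
    (\<forall>x. \<not> (s * k \<le> x \<and> x < s * k + k) \<longrightarrow> \<tau> aZ x = \<sigma> aZ x)"
  let ?I = "\<lambda>j \<tau>. keeps ?S \<sigma> \<tau> \<and> (\<forall>i<j. \<tau> aZ (s * k + i) = Suc (z i)) \<and> ?L (\<lambda>v i. i < j \<and> v \<in> set (p i)) \<tau> \<and> ?fr \<tau>"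
  let ?wb = "Store aLab (Add (Mul (V vs) (V vn)) (V vcur)) (Add (V vi) (Const 1)) ;; vcur ::= Load aNx (V vcur)"
  let ?w = "While (LtE (V vcur) (V vn)) ?wb"
  let ?e = "Store aZ (Add (Mul (V vs) (V vk)) (V vi)) (Add (Sub (V vcur) n2E) (Const 1))"
  show ?thesis unfolding labels_def
  proof (rule run_for[where I = ?I and m = k and c = "30 * n + 70"])
    fix j \<tau> assume j: "j < k" "bd \<tau>" "\<tau> vi 0 = j" "?I j \<tau>"
    have stt: "stat \<tau>" using stat_keeps[of ?S \<sigma> \<tau>] j st by simp
    have vs: "\<tau> vs 0 = s" using j s by (simp add: keeps_def)
    note d = statD(1-4)[OF stt]
    define q where "q = p j"
    have q: "q \<noteq> []" "hd q = tm s j" "set q \<subseteq> {..<n}" "length q \<le> n" "z j < t" using p[OF j(1)] by (auto simp: q_def)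
    have qn: "q ! l < n" if "l < length q" for l using q(3) nth_mem[OF that] by auto
    let ?P = "\<lambda>\<tau>'. \<tau>' vi 0 = j \<and> ?I (Suc j) (\<tau>'(vi := (\<tau>' vi)(0 := Suc j)))"
    \<comment> \<open>On the current path \<open>q\<close> exactly the first \<open>l\<close>
      vertices carry its label.\<close>
    let ?J = "\<lambda>m \<rho>. \<exists>l\<le>length q. m = length q - l \<and> \<rho> vcur 0 = succ_of q (z j) l \<and> keeps ?S \<sigma> \<rho> \<and> \<rho> vi 0 = j \<and>
       (\<forall>i<j. \<rho> aZ (s * k + i) = Suc (z i)) \<and> ?L (\<lambda>v i. i < j \<and> v \<in> set (p i) \<or> i = j \<and> v \<in> set (take l q)) \<rho> \<and> ?fr \<rho>"
    show "run (vcur ::= rootE ;; ?w ;; ?e) \<tau> (30 * n + 70) ?P"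
    proof (rule run_seqI[where ?b1.0 = 20 and ?Q1.0 = "?J (length q)"])
      have v: "val \<tau> rootE = tm s j" using statD(2)[OF stt] statD(5)[OF stt s(2) j(1)] vs j by simp
      show "run (vcur ::= rootE) \<tau> 20 (?J (length q))"
      proof (rule run_block[OF _ j(2)])
        show "safe K (vcur ::= rootE) \<tau>" using v tm_lt[OF s(2) j(1)] N_ge(3) N_less_K by simp
        have "stp (vcur ::= rootE) \<tau> = \<tau>(vcur := (\<tau> vcur)(0 := tm s j))" using v by simp
        then show "?J (length q) (stp (vcur ::= rootE) \<tau>)"
          using j q by (intro exI[of _ 0]) (auto simp: succ_of_def hd_conv_nth)
      qed (auto simp: eok_def)
    next
      fix \<tau>1 assume t1: "bd \<tau>1" "?J (length q) \<tau>1"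
      show "run (?w ;; ?e) \<tau>1 (30 * n + 50) ?P"
      proof (rule run_seqI)
        show "run ?w \<tau>1 (30 * n + 10) (\<lambda>\<rho>. ?J 0 \<rho>)"
        proof (rule run_while[where I = ?J and m = "length q" and c = 20])
          fix m \<rho> assume rho: "bd \<rho>" "?J m \<rho>" "val \<rho> (LtE (V vcur) (V vn)) \<noteq> 0"
          then obtain l where l: "l \<le> length q" "m = length q - l" "\<rho> vcur 0 = succ_of q (z j) l" "keeps ?S \<sigma> \<rho>" "\<rho> vi 0 = j"
            "\<forall>i<j. \<rho> aZ (s * k + i) = Suc (z i)"
            "?L (\<lambda>v i. i < j \<and> v \<in> set (p i) \<or> i = j \<and> v \<in> set (take l q)) \<rho>" "?fr \<rho>" by blast
          have dr: "\<rho> vn 0 = n" "\<rho> vs 0 = s" "\<rho> aNx = \<sigma> aNx" using l(4) s statD(1)[OF st] by (simp_all add: keeps_def)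
          have v: "\<rho> vcur 0 < n" using rho(3) dr by simp
          have ll: "l < length q" using v l(1,3) by (auto simp: succ_of_def split: if_splits)
          then have cur: "\<rho> vcur 0 = q ! l" using l(3) by (simp add: succ_of_def)
          have nxt: "\<rho> aNx (q ! l) = succ_of q (z j) (Suc l)" using nx[OF j(1), of l] ll dr by (simp add: q_def)
          let ?\<rho> = "\<rho>(aLab := (\<rho> aLab)(s * n + q ! l := Suc j), vcur := (\<rho> vcur)(0 := succ_of q (z j) (Suc l)))"
          have st': "stp ?wb \<rho> = ?\<rho>" using dr cur nxt l(5) by simp
          have tk: "set (take (Suc l) q) = insert (q ! l) (set (take l q))" using ll by (simp add: take_Suc_conv_app_nth)
          have "(?\<rho> aLab (s * n + v) = Suc i) = (i < j \<and> v \<in> set (p i) \<or> i = j \<and> v \<in> set (take (Suc l) q))" if vi: "v < n" "i < k" for v i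
          proof (cases "v = q ! l")
            case True
            have "i = j" if "v \<in> set (p i)" using disj[of i j v] that True vi(2) j(1) nth_mem[OF ll] by (auto simp: q_def)
            then show ?thesis using True tk by auto
          next
            case False
            have "\<rho> aLab (s * n + v) = Suc i \<longleftrightarrow> (i < j \<and> v \<in> set (p i) \<or> i = j \<and> v \<in> set (take l q))" using l(7) vi by blast
            then show ?thesis using False tk by simp
          qed
          then have "?L (\<lambda>v i. i < j \<and> v \<in> set (p i) \<or> i = j \<and> v \<in> set (take (Suc l) q)) ?\<rho>" by blast
          moreover have "?fr ?\<rho>" using l(8) qn[OF ll] by auto
          moreover have "keeps ?S \<sigma> ?\<rho>" using l(4) by simp
          ultimately have "\<exists>j'<m. ?J j' ?\<rho>"
            using ll l(1,2,5,6) by (intro exI[of _ "length q - Suc l"] conjI exI[of _ "Suc l"]) simp_all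
          moreover have "safe K ?wb \<rho>" using bdD[OF rho(1), of aNx] j(1) N_ge(5) N_less_K l(5) by simp
          ultimately show "run ?wb \<rho> 20 (\<lambda>\<tau>'. \<exists>j'<m. ?J j' \<tau>')"
            using rho(1) st' by (intro run_block) (auto simp: eok_def)
        next
          fix m \<rho> assume rho: "bd \<rho>" "?J m \<rho>" "val \<rho> (LtE (V vcur) (V vn)) = 0"
          then obtain l where l: "l \<le> length q" "m = length q - l" "\<rho> vcur 0 = succ_of q (z j) l" "keeps ?S \<sigma> \<rho>" by blast
          have "\<rho> vn 0 = n" using l(4) statD(1)[OF st] by (simp add: keeps_def)
          then have "l = length q" using l(1,3) qn[of l] rho(3) by (cases "l = length q") (auto simp: succ_of_def)
          then show "?J 0 \<rho>" using rho(2) l(2) by simp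
        next
          have "length q * 26 \<le> n * 26" using q by simp
          then show "length q * (20 + cost (LtE (V vcur) (V vn)) + 1) + cost (LtE (V vcur) (V vn)) + 1 \<le> 30 * n + 10" by simp
        qed (use t1 in \<open>auto simp: eok_def\<close>)
      next
        fix \<rho> assume rho: "bd \<rho>" "?J 0 \<rho>"
        then obtain l where l0: "l \<le> length q" "0 = length q - l" and l: "\<rho> vcur 0 = succ_of q (z j) l" "keeps ?S \<sigma> \<rho>" "\<rho> vi 0 = j"
            "\<forall>i<j. \<rho> aZ (s * k + i) = Suc (z i)"
            "?L (\<lambda>v i. i < j \<and> v \<in> set (p i) \<or> i = j \<and> v \<in> set (take l q)) \<rho>" "?fr \<rho>" by blast
        have lq: "l = length q" using l0 by simp
        have dr: "\<rho> vn 0 = n" "\<rho> vs 0 = s" "\<rho> vk 0 = k" using l(2) s statD(1,2)[OF st] by (simp_all add: keeps_def)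
        let ?\<rho> = "\<rho>(aZ := (\<rho> aZ)(s * k + j := Suc (z j)))"
        have st': "stp ?e \<rho> = ?\<rho>" using dr l lq by (simp add: succ_of_def)
        have eq: "i < j \<and> v \<in> set (p i) \<or> i = j \<and> v \<in> set (take l q) \<longleftrightarrow> i < Suc j \<and> v \<in> set (p i)" for i v
          using lq by (auto simp: q_def less_Suc_eq)
        have "?P ?\<rho>" using l j(1) unfolding eq by (auto simp: less_Suc_eq)
        moreover have "Suc (z j) \<le> K" using q(5) N_ge(4) N_less_K by simp
        then have "safe K ?e \<rho>" using dr l lq by (simp add: succ_of_def)
        ultimately show "run ?e \<rho> 40 ?P"
          using rho(1) st' by (intro run_block) (auto simp: eok_def)
      qed simp
    qed simp
  next
    have "k * n \<le> N * N" using N_ge(3,5) by (intro mult_le_mono) auto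
    moreover have "k \<le> N * N" using N_ge(5) square_bound[of N] N_ge(1) by linarith
    moreover have "k * (30 * n + 70 + cost (V vk) + 10) + cost (V vk) + 10 = 30 * (k * n) + 82 * k + 12" by (simp add: algebra_simps)
    moreover have "82 * k \<le> 82 * n" "k \<ge> 1" using kn k_pos by auto
    moreover have "6 * n \<le> N * N"
    proof -
      have "3 * (2 * n) \<le> N * N" using N_ge(2) t_eq k_pos kn N_def by (intro mult_le_mono) auto
      then show ?thesis by simp
    qed
    moreover have "5 * k \<le> n" by (rule kn)
    ultimately show "k * (30 * n + 70 + cost (V vk) + 10) + cost (V vk) + 10 \<le> 100 * (N * N)" by linarith
  next
    fix \<tau> assume "bd \<tau>" "?I k \<tau>"
    then show "keeps ?S \<sigma> \<tau> \<and> labelled s p z \<tau> \<and> ?fr \<tau>" by (auto simp: labelled_def)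
  next
    show "?I 0 (\<sigma>(vi := (\<sigma> vi)(0 := 0)))" using fresh by simp
    show "val \<tau> (V vk) = k" if "?I j \<tau>" for j \<tau>
    proof -
      have "\<tau> vk = \<sigma> vk" using that by (simp add: keeps_def)
      then show ?thesis using statD(2)[OF st] by simp
    qed
  qed (use bd N_ge(5) N_less_K in \<open>auto simp: eok_def\<close>)
qed

lemma run_link:
  assumes bd: "bd \<sigma>" and st: "stat \<sigma>" and s: "\<sigma> vs 0 = s" "s < 2" and z: "\<sigma> aSt 0 = 3"
    and few: "card (used (stf \<sigma>)) \<le> 24 * k ^ 2"
    and rob: "\<And>i. i < k \<Longrightarrow> bag_graph.robust n t B k (Eds s) (stf \<sigma>) (Suc s) (tm s i)"
    and fresh: "\<And>v. v < n \<Longrightarrow> \<sigma> aLab (s * n + v) = 0"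
  shows "run link \<sigma> (1500 * (k * (N * N))) (\<lambda>\<sigma>'. keeps link_regs \<sigma> \<sigma>' \<and>
    (\<exists>p w. linked s (stf \<sigma>) p w \<and> labelled s p w \<sigma>') \<and>
    (\<forall>x. \<not> (s * n \<le> x \<and> x < s * n + n) \<longrightarrow> \<sigma>' aLab x = \<sigma> aLab x) \<and>
    (\<forall>x. \<not> (s * k \<le> x \<and> x < s * k + k) \<longrightarrow> \<sigma>' aZ x = \<sigma> aZ x))" (is "run link \<sigma> _ ?Q")
proof -
  interpret E: bag_graph n t B k "Eds s" by (rule side_graph)
  define X where "X = tm s ` {..<k}"
  have cX: "card X = k" using tm_inj[OF s(2)] by (simp add: X_def card_image)
  let ?al = "allowed (stf \<sigma>) (Suc s)" and ?sk = "\<lambda>b. stf \<sigma> b = 0 \<and> half s b"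
  let ?net = "netr s (\<lambda>_. True) ?al ?sk (\<lambda>y. y \<in> X)"
  let ?A3 = "{vx, vy, aM}"
  let ?A4 = "{vx, vy, aM, vtl, aVis, aPar, aQ, vcur, vu, vc}"
  let ?A5 = "{vx, vy, aM, vtl, aVis, aPar, aQ, vcur, vu, vc, aNx}"
  have stk: "stat \<tau> \<and> \<tau> vs 0 = s \<and> stf \<tau> = stf \<sigma> \<and> \<tau> aSt 0 = 3 \<and> \<tau> aLab = \<sigma> aLab \<and> \<tau> aZ = \<sigma> aZ" if "keeps ?A5 \<sigma> \<tau>" for \<tau>
    using stat_keeps[OF that] stf_keeps[OF that] st that s z by (auto simp: keeps_def)
  have wk: "keeps ?A5 \<sigma> \<tau>" if "keeps A \<sigma> \<tau>" "A \<subseteq> ?A5" for A \<tau> using that by (auto simp: keeps_def)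
  have fill: "run (fill link_netE) \<sigma> (700 * (N * N)) (\<lambda>\<sigma>'. keeps ?A3 \<sigma> \<sigma>' \<and> mat N \<sigma>' = ?net)"
    unfolding link_netE_def
  proof (rule run_netE[OF bd st s])
    fix \<tau> assume t: "keeps {vx, vy, aM} \<sigma> \<tau>"
    note f = stk[OF wk[OF t]]
    have f1: "stat \<tau>" "\<tau> vs 0 = s" "stf \<tau> = stf \<sigma>" "\<tau> aSt 0 = 3" using f by auto
    note d = statD(1,3)[OF f1(1)]
    show "(val \<tau> (Const 1) \<noteq> 0) = True" by simp
    show "(val \<tau> (Add (Mul c1E c2E) (Add (EqE c1E s1E) (EqE c2E s1E))) \<noteq> 0) = ?al (\<tau> vx 0 - n)" if "n \<le> \<tau> vx 0" "\<tau> vx 0 < 2 * n"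
    proof -
      have lt: "\<tau> vx 0 - n < n" using that by auto
      have leaf: "val \<tau> c1E = \<tau> aSt (\<tau> aC1 (\<tau> vx 0 - n))" "val \<tau> c2E = \<tau> aSt (\<tau> aC2 (\<tau> vx 0 - n))" "val \<tau> s1E = Suc s" using d f1 by auto
      have "val \<tau> (Add (Mul c1E c2E) (Add (EqE c1E s1E) (EqE c2E s1E))) \<noteq> 0 \<longleftrightarrow>
         (val \<tau> c1E \<noteq> 0 \<and> val \<tau> c2E \<noteq> 0) \<or> val \<tau> c1E = val \<tau> s1E \<or> val \<tau> c2E = val \<tau> s1E"
        unfolding val_AddE val_MulE val_EqE by blast
      then show ?thesis using allowed_iff[OF f1(1,4) lt s(2)] unfolding leaf f1(3) by blast
    qed
    show "(val \<tau> (Mul (NotE (Load aSt (Add yb (Const 1)))) halfE) \<noteq> 0) = ?sk (\<tau> vy 0 - 2 * n)"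
    proof -
      have "\<tau> aSt (Suc b) = stf \<sigma> b" for b using f1(3) by (auto simp: stf_def dest: fun_cong)
      then have "(val \<tau> (NotE (Load aSt (Add yb (Const 1)))) \<noteq> 0) = (stf \<sigma> (\<tau> vy 0 - 2 * n) = 0)" using d by auto
      moreover have "(val \<tau> halfE \<noteq> 0) = half s (\<tau> vy 0 - 2 * n)"
        using d f1(2) by (cases "s = 0") (auto simp: half_def)
      ultimately show ?thesis unfolding val_MulE by blast
    qed
    show "(val \<tau> (Load aTm (Add (Mul (V vs) (V vn)) (V vy))) \<noteq> 0) = (\<tau> vy 0 \<in> X)" if "\<tau> vy 0 < n"
      using statD(10)[OF f1(1) s(2) that] d f1(2) by (simp add: X_def)
  qed (auto simp: eok_def netE_defs)
  show ?thesis unfolding link_def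
  proof (rule run_seqI[OF fill])
    fix \<sigma>3 assume a3: "bd \<sigma>3" "keeps ?A3 \<sigma> \<sigma>3 \<and> mat N \<sigma>3 = ?net"
    have s3: "stat \<sigma>3" using stk[OF wk[of ?A3 \<sigma>3]] a3 by auto
    have flow: "run (For vc (V vk) augment) \<sigma>3 (k * (300 * (N * N) + cost (V vk) + 10) + cost (V vk) + 10)
      (\<lambda>\<sigma>'. keeps flow_regs \<sigma>3 \<sigma>' \<and> residual ?net (Suc (2 * n + t)) (2 * n + t) k (mat N \<sigma>'))"
    proof (rule run_flow[OF a3(1) s3])
      show "mat N \<sigma>3 = ?net" using a3 by blast
      show "eok (V vk)" by (simp add: eok_def)
      show "val \<tau> (V vk) = k" if "keeps flow_regs \<sigma>3 \<tau>" for \<tau>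
      proof -
        have "\<tau> vk = \<sigma>3 vk" using that by (simp add: keeps_def)
        then show ?thesis using statD(2)[OF s3] by simp
      qed
      show "k < K" using N_ge(5) N_less_K by simp
      show "(Suc (2 * n + t), 2 * n + t) \<in> R\<^sup>*" if "j < k" "residual ?net (Suc (2 * n + t)) (2 * n + t) j R" for j R
      proof (rule E.link_augment[OF _ cX card_half[OF s(2) few] that(2,1)])
        show "E.robust (stf \<sigma>) (Suc s) r" if "r \<in> X" for r using that rob by (auto simp: X_def)
      qed
    qed
    show "run (For vc (V vk) augment ;; nexts ;; labels) \<sigma>3 (700 * (k * (N * N))) ?Q"
    proof (rule run_seqI[OF flow])
      fix \<sigma>4 assume a4: "bd \<sigma>4" "keeps flow_regs \<sigma>3 \<sigma>4 \<and> residual ?net (Suc (2 * n + t)) (2 * n + t) k (mat N \<sigma>4)"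
      have k4: "keeps ?A4 \<sigma> \<sigma>4" using a4 a3 by (auto simp: keeps_def)
      have s4: "stat \<sigma>4" using stk[OF wk[OF k4]] by auto
      obtain Y p \<beta> where rows: "rows s (\<lambda>_. True) ?al ?sk (\<lambda>y. y \<in> X) (mat N \<sigma>4) Y p \<beta>"
        and cY: "card Y = k" using rows_exist[OF conjunct2[OF a4(2)]] by blast
      \<comment> \<open>There are \<open>k\<close> rows with different starting vertices, all of
        them among the \<open>k\<close> terminals; so every terminal starts a row.\<close>
      have "Y \<subseteq> X" using rowsD(1)[OF rows] by blast
      then have YX: "Y = X" using cX cY by (intro card_subset_eq) (auto simp: X_def)
      define q where "q = (\<lambda>i. p (tm s i))"
      define w where "w = (\<lambda>i. \<beta> (tm s i))"
      have tY: "tm s i \<in> Y" if "i < k" for i using that YX by (simp add: X_def)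
      have inj: "i = j" if "i < k" "j < k" "tm s i = tm s j" for i j using tm_inj[OF s(2)] that by (auto simp: inj_on_def)
      have disj: "i = j" if "i < k" "j < k" "v \<in> set (q i)" "v \<in> set (q j)" for i j v
        using rowsY(4)[OF rows tY[OF that(1)] tY[OF that(2)]] that inj by (auto simp: q_def)
      have lk: "linked s (stf \<sigma>) q w" unfolding linked_def
      proof (intro conjI allI impI ballI)
        show "inj_on w {..<k}" using rowsY(3)[OF rows] tY inj by (auto simp: inj_on_def w_def)
        fix i assume i: "i < k"
        note r = rowsD[OF rows tY[OF i], folded q_def w_def]
        show "q i \<noteq> []" "hd (q i) = tm s i" "set (q i) \<subseteq> {..<n}" "last (q i) \<in> B (w i)" "w i < t" "stf \<sigma> (w i) = 0" "half s (w i)"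
          using r by (auto simp: q_def w_def)
        show "(q i ! l, q i ! Suc l) \<in> Eds s" if "Suc l < length (q i)" for l using r(9)[of l] that by (auto simp: q_def)
        \<comment> \<open>Every vertex of a row but the last is left along an arc of the graph,
          which the network permits for allowed vertices only. The last vertex lies in the end
          bag.\<close>
        show "v \<in> B (w i) \<or> ?al v" if v: "v \<in> set (q i)" for v
        proof -
          obtain l where l: "l < length (q i)" "v = q i ! l" using v by (auto simp: in_set_conv_nth)
          show ?thesis
          proof (cases "Suc l < length (q i)")
            case True
            then show ?thesis using r(9)[of l] l by (auto simp: q_def)
          next
            case False
            then have "l = length (q i) - 1" using l by simp
            then have "v = last (q i)" using l r(3) by (simp add: last_conv_nth q_def)
            then show ?thesis using r(8) by (simp add: q_def w_def)
          qed
        qed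
      qed (use disj in blast)
      show "run (nexts ;; labels) \<sigma>4 (200 * (N * N)) ?Q"
      proof (rule run_seqI[OF run_nexts[OF a4(1) statD(4)[OF s4] _ N_less_K statD(1)[OF s4] N_ge(2)]])
        fix \<sigma>5 assume a5: "bd \<sigma>5" "keeps {vx, vy, aNx} \<sigma>4 \<sigma>5 \<and>
          (\<forall>v w. v < n \<and> w < N \<and> w \<noteq> v \<and> (\<forall>x. x \<noteq> v \<longrightarrow> ((x, n + v) \<in> mat N \<sigma>4) = (x = w)) \<longrightarrow> \<sigma>5 aNx v = w)"
        have k5: "keeps ?A5 \<sigma> \<sigma>5" using a5 k4 by (auto simp: keeps_def)
        note f5 = stk[OF k5]
        show "run labels \<sigma>5 (100 * (N * N)) ?Q"
        proof (rule run_conseq[OF run_labels[where s = s and p = q and z = w] order_refl])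
          show "bd \<sigma>5" "stat \<sigma>5" "\<sigma>5 vs 0 = s" "s < 2" using a5 f5 s by auto
          show "q i \<noteq> [] \<and> hd (q i) = tm s i \<and> set (q i) \<subseteq> {..<n} \<and> length (q i) \<le> n \<and> w i < t" if "i < k" for i
            using rowsD[OF rows tY[OF that]] by (simp add: q_def w_def)
          show "i = j" if "i < k" "j < k" "v \<in> set (q i)" "v \<in> set (q j)" for i j v using disj that by blast
          show "\<sigma>5 aNx (q i ! l) = succ_of (q i) (w i) (Suc l)" if "i < k" "l < length (q i)" for i l
            using rows_next[OF rows conjunct2[OF a5(2)] tY[OF that(1)], of l] that by (simp add: q_def w_def)
          show "\<sigma>5 aLab (s * n + v) = 0" if "v < n" for v using fresh[OF that] f5 by simp
        next
          fix \<sigma>' assume a6: "keeps {vi, vcur, aLab, aZ} \<sigma>5 \<sigma>' \<and> labelled s q w \<sigma>' \<and>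
            (\<forall>x. \<not> (s * n \<le> x \<and> x < s * n + n) \<longrightarrow> \<sigma>' aLab x = \<sigma>5 aLab x) \<and>
            (\<forall>x. \<not> (s * k \<le> x \<and> x < s * k + k) \<longrightarrow> \<sigma>' aZ x = \<sigma>5 aZ x)"
          have "keeps link_regs \<sigma> \<sigma>'" using a6 k5 by (auto simp: keeps_def)
          then show "?Q \<sigma>'" using a6 lk f5 by auto
        qed
      qed (use N_ge(1) in auto)
    next
      have "N * N \<le> k * (N * N)" "1 \<le> N * N" "k \<le> k * (N * N)" using k_pos N_ge(1) by auto
      moreover have "k * (300 * (N * N) + cost (V vk) + 10) + cost (V vk) + 10 = 300 * (k * (N * N)) + 12 * k + 12" by (simp add: algebra_simps)
      ultimately show "k * (300 * (N * N) + cost (V vk) + 10) + cost (V vk) + 10 + 200 * (N * N) \<le> 700 * (k * (N * N))" by linarith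
    qed
  next
    have "N * N \<le> k * (N * N)" using k_pos by auto
    then show "700 * (N * N) + 700 * (k * (N * N)) \<le> 1500 * (k * (N * N))" by linarith
  qed
qed

end

subsection \<open>Output\<close>

abbreviation (input) i1E :: expr where "i1E \<equiv> Add (V vi) (Const 1)"
abbreviation (input) z1E :: expr where "z1E \<equiv> Load aZ (V vi)"
abbreviation (input) z2E :: expr where "z2E \<equiv> Load aZ (Add (V vk) (V vi))"

abbreviation (input) memE :: expr where
  "memE \<equiv> Add (Add (EqE (Load aLab xv) i1E) (EqE (Load aLab (Add (V vn) xv)) i1E))
     (Add (Add (EqE (Load aC1 xv) z1E) (EqE (Load aC2 xv) z1E)) (Add (EqE (Load aC1 xv) z2E) (EqE (Load aC2 xv) z2E)))"

text \<open>The same kind of network serves for the final search. It has no target bags, its only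
  starting vertex is the terminal in \<open>T\<close>, and its graph arcs leave vertices of the
  union only. Since \<open>vs\<close> is \<open>1\<close> at this point, these arcs are those of the
  converse graph.\<close>

definition out_netE :: expr where
  "out_netE = netE (Const 1) memE (Const 0) (EqE (V vy) rootE)"

text \<open>The search starts at the target, so that parent pointers list the path in forward order.\<close>

definition emit :: prog where
  "emit = (vcur ::= Load 0 (Add (Add (V vb) (Const 1)) (V vi)) ;; vp ::= V vo ;;
       Store 1 (Add (V vo) (Const 1)) (V vcur) ;; vo ::= Add (V vo) (Const 2)) ;;
     While (NeqE (Load aPar (V vcur)) (Sub (V vN) (Const 1)))
       (vcur ::= Sub (Load aPar (V vcur)) (V vn) ;; Store 1 (V vo) (V vcur) ;; vo ::= Add (V vo) (Const 1)) ;;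
     Store 1 (V vp) (Sub (Sub (V vo) (V vp)) (Const 1))"

definition outp :: prog where "outp = fill out_netE ;; search ;; emit"

abbreviation "out_regs \<equiv> {vx, vy, aM, vtl, aVis, aPar, aQ, vcur, vp, vo, 1}"

definition words :: "nat list list \<Rightarrow> nat list" where
  "words Ps = concat (map (\<lambda>P. length P # P) Ps)"

text \<open>Ranks strictly decrease along parent pointers, so a path read off a search tree has no
  repetition.\<close>

lemma sorted_rank_distinct: "sorted_wrt (\<lambda>x y. f y < (f x :: nat)) P \<Longrightarrow> distinct P"
  by (induction P) auto

section \<open>Correctness of the final search and of the output\<close>

context linkage_ram
begin

definition good_path :: "nat set \<Rightarrow> nat \<Rightarrow> nat list \<Rightarrow> bool" where
  "good_path U i P \<longleftrightarrow> P \<noteq> [] \<and> distinct P \<and> set P \<subseteq> U \<and> hd P = tm 0 i \<and> last P = tm (Suc 0) i \<and>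
     (\<forall>l. Suc l < length P \<longrightarrow> (P ! l, P ! Suc l) \<in> Ed)"

abbreviation "out_net U i \<equiv> netr (Suc 0) (\<lambda>_. True) (\<lambda>v. v \<in> U) (\<lambda>_. False) (\<lambda>y. y = tm (Suc 0) i)"

text \<open>The path is traversed from its end. An arc \<open>(v, u)\<close> inside \<open>U\<close>
  becomes two network arcs, from \<open>u\<close> to its exit copy and from there to
  \<open>v\<close>.\<close>

lemma out_reach:
  assumes i: "i < k" and U: "U \<subseteq> {..<n}" and path: "(tm 0 i, tm (Suc 0) i) \<in> (Ed \<inter> U \<times> U)\<^sup>*"
  shows "(Suc (2 * n + t), tm 0 i) \<in> (out_net U i)\<^sup>*"
proof -
  interpret bag_network n t B "\<lambda>u v. (u, v) \<in> Eds (Suc 0)" "\<lambda>_. True" "\<lambda>v. v \<in> U" "\<lambda>_. False" "\<lambda>y. y = tm (Suc 0) i" .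
  show ?thesis using path
  proof (induction rule: converse_rtrancl_induct)
    case base
    then show ?case using tm_lt[of "Suc 0" i] i by (intro r_into_rtrancl) (simp add: net_source)
  next
    case (step v u)
    show ?case
    proof (cases "v = u")
      case False
      have vu: "v < n" "u < n" "u \<in> U" "(v, u) \<in> Ed" using step.hyps U by auto
      then have "(u, v) \<in> Eds (Suc 0)" by (simp add: Eds_def)
      then have "(u, n + u) \<in> net" "(n + u, v) \<in> net" using vu False by (auto simp: net_in net_out)
      then show ?thesis using step.IH by (meson rtrancl.rtrancl_into_rtrancl)
    qed (use step in simp)
  qed
qed

lemma run_emit:
  assumes bd: "bd \<sigma>" and st: "stat \<sigma>" and i: "\<sigma> vi 0 = i" "i < k"
    and U: "U \<subseteq> {..<n}" "tm 0 i \<in> U" and reach: "(Suc (2 * n + t), tm 0 i) \<in> (out_net U i)\<^sup>*"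
    and tree: "search_tree (out_net U i) N (\<sigma> aPar)" and o: "\<sigma> vo 0 = o0" "o0 + n + 2 \<le> K"
  shows "run emit \<sigma> (100 * (N * N)) (\<lambda>\<sigma>'. keeps {vcur, vp, vo, 1} \<sigma> \<sigma>' \<and> (\<exists>P. good_path U i P \<and>
    \<sigma>' vo 0 = o0 + 1 + length P \<and> (\<forall>x<o0. \<sigma>' 1 x = \<sigma> 1 x) \<and> \<sigma>' 1 o0 = length P \<and>
    (\<forall>l<length P. \<sigma>' 1 (o0 + 1 + l) = P ! l)))"
proof -
  interpret bag_network n t B "\<lambda>u v. (u, v) \<in> Eds (Suc 0)" "\<lambda>_. True" "\<lambda>v. v \<in> U" "\<lambda>_. False" "\<lambda>y. y = tm (Suc 0) i" .
  define par where "par = \<sigma> aPar"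
  obtain rk where rk: "\<And>x. (sor, x) \<in> net\<^sup>* \<Longrightarrow> x \<noteq> sor \<Longrightarrow>
     (par x, x) \<in> net \<and> (sor, par x) \<in> net\<^sup>* \<and> rk (par x) < (rk x :: nat) \<and> rk x < N"
    using tree unfolding search_tree_def par_def by (auto simp: N_def)
  \<comment> \<open>Two parent steps in the network make one step in the graph: the parent of
    \<open>v\<close> is an exit copy \<open>n + u\<close>, and the parent of that is
    \<open>u\<close>. This is why the program subtracts \<open>n\<close> and skips the split
    arc.\<close>
  have step: "par v = sor \<and> v = tm (Suc 0) i \<or>
      (\<exists>u. par v = n + u \<and> u < n \<and> u \<in> U \<and> (v, u) \<in> Ed \<and> (sor, u) \<in> net\<^sup>* \<and> rk u < rk v)"
    if v: "v < n" "(sor, v) \<in> net\<^sup>*" for v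
  proof -
    have r: "(par v, v) \<in> net" "(sor, par v) \<in> net\<^sup>*" "rk (par v) < rk v" using rk[of v] v by auto
    consider "par v = sor" "v = tm (Suc 0) i" | u where "par v = n + u" "u < n" "u \<in> U" "(u, v) \<in> Eds (Suc 0)"
    proof -
      have "par v = sor \<and> v = tm (Suc 0) i \<or> n \<le> par v \<and> par v < 2 * n \<and> par v - n \<in> U \<and> (par v - n, v) \<in> Eds (Suc 0)"
        using r(1) v(1) by (auto simp: net_def net_arc_def)
      moreover have "par v = n + (par v - n) \<and> par v - n < n" if "n \<le> par v" "par v < 2 * n" using that by auto
      ultimately show thesis using that by blast
    qed
    then show ?thesis
    proof cases
      case 2
      have "n + u \<noteq> sor" using 2 by simp
      then have r2: "(par (n + u), n + u) \<in> net" "(sor, par (n + u)) \<in> net\<^sup>*" "rk (par (n + u)) < rk (n + u)"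
        using rk[of "n + u"] r(2) 2(1) by auto
      then have "par (n + u) = u" using net_into_out[OF 2(2)] by simp
      then show ?thesis using 2 r2 r(3) by (auto simp: Eds_def)
    qed simp
  qed
  let ?b = "vcur ::= Sub (Load aPar (V vcur)) (V vn) ;; Store 1 (V vo) (V vcur) ;; vo ::= Add (V vo) (Const 1)"
  let ?t = "NeqE (Load aPar (V vcur)) (Sub (V vN) (Const 1))"
  let ?S = "{vcur, vp, vo, 1}"
  let ?C = "\<lambda>P \<tau>. keeps ?S \<sigma> \<tau> \<and> \<tau> vp 0 = o0 \<and> \<tau> vo 0 = o0 + 1 + length P \<and> (\<forall>x<o0. \<tau> 1 x = \<sigma> 1 x) \<and>
     (\<forall>l<length P. \<tau> 1 (o0 + 1 + l) = P ! l)"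
  \<comment> \<open>The newest vertex has the smallest rank on the path, so appending its successor,
    of still smaller rank, preserves the order.\<close>
  let ?G = "\<lambda>P. P \<noteq> [] \<and> set P \<subseteq> U \<and> hd P = tm 0 i \<and> (\<forall>l. Suc l < length P \<longrightarrow> (P ! l, P ! Suc l) \<in> Ed) \<and>
     sorted_wrt (\<lambda>x y. rk y < rk x) P \<and> (\<forall>x\<in>set P. rk (last P) \<le> rk x) \<and> (sor, last P) \<in> net\<^sup>*"
  let ?J = "\<lambda>m \<tau>. \<exists>P. m = rk (last P) \<and> \<tau> vcur 0 = last P \<and> ?G P \<and> ?C P \<tau>"
  have len: "length P \<le> n" if "?G P" for P
  proof -
    have "distinct P" using that sorted_rank_distinct[of rk P] by blast
    moreover have "card (set P) \<le> card {..<n}" using that U by (intro card_mono) auto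
    ultimately show ?thesis by (simp add: distinct_card)
  qed
  have lastn: "last P < n" if "?G P" for P
  proof -
    have "last P \<in> set P" using that by simp
    then show ?thesis using that U(1) by blast
  qed
  have init: "run (vcur ::= Load 0 (Add (Add (V vb) (Const 1)) (V vi)) ;; vp ::= V vo ;;
       Store 1 (Add (V vo) (Const 1)) (V vcur) ;; vo ::= Add (V vo) (Const 2)) \<sigma> 40 (?J (rk (tm 0 i)))"
  proof (rule run_block[OF _ bd])
    have v: "\<sigma> 0 (Suc (\<sigma> vb 0 + i)) = tm 0 i" using statD(5)[OF st, of 0 i] i by simp
    have tK: "tm 0 i \<le> K" using tm_lt[of 0 i] i N_ge(3) N_less_K by simp
    show "safe K (vcur ::= Load 0 (Add (Add (V vb) (Const 1)) (V vi)) ;; vp ::= V vo ;;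
       Store 1 (Add (V vo) (Const 1)) (V vcur) ;; vo ::= Add (V vo) (Const 2)) \<sigma>"
      using v i o tK by simp
    show "?J (rk (tm 0 i)) (stp (vcur ::= Load 0 (Add (Add (V vb) (Const 1)) (V vi)) ;; vp ::= V vo ;;
       Store 1 (Add (V vo) (Const 1)) (V vcur) ;; vo ::= Add (V vo) (Const 2)) \<sigma>)"
      using v i o U reach by (intro exI[of _ "[tm 0 i]"]) auto
  qed (auto simp: eok_def)
  have loop: "run (While ?t ?b) \<tau>1 (50 * N + 20) (\<lambda>\<tau>. \<exists>P. ?G P \<and> last P = tm (Suc 0) i \<and> ?C P \<tau>)"
    if t1: "bd \<tau>1" "?J (rk (tm 0 i)) \<tau>1" for \<tau>1
  proof (rule run_while[where I = ?J and m = "rk (tm 0 i)" and c = 30])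
    fix m \<tau> assume t: "bd \<tau>" "?J m \<tau>" "val \<tau> ?t \<noteq> 0"
    then obtain P where P: "m = rk (last P)" "\<tau> vcur 0 = last P" "?G P" "?C P \<tau>" by blast
    have dt: "\<tau> aPar = par" "\<tau> vN 0 = N" "\<tau> vn 0 = n" using P(4) statD(1,4)[OF st] by (simp_all add: keeps_def par_def)
    have ne: "par (last P) \<noteq> sor" using t(3) P(2) dt unfolding val_NeqE by (simp add: N_def)
    obtain u where u: "par (last P) = n + u" "u < n" "u \<in> U" "(last P, u) \<in> Ed" "(sor, u) \<in> net\<^sup>*" "rk u < rk (last P)"
      using step[OF lastn[OF P(3)]] P(3) ne by blast
    let ?Q = "P @ [u]"
    have "(?Q ! l, ?Q ! Suc l) \<in> Ed" if "Suc l < length ?Q" for l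
    proof (cases "Suc l < length P")
      case True
      then show ?thesis using P(3) by (simp add: nth_append)
    next
      case False
      then have "l = length P - 1" "P \<noteq> []" using that P(3) by auto
      then show ?thesis using u(4) by (simp add: nth_append last_conv_nth)
    qed
    moreover have "sorted_wrt (\<lambda>x y. rk y < rk x) ?Q" "\<forall>x\<in>set ?Q. rk (last ?Q) \<le> rk x"
      using P(3) u(6) by (auto simp: sorted_wrt_append intro: less_imp_le less_le_trans)
    ultimately have G: "?G ?Q" using P(3) u by auto
    have lenQ: "length P + 1 \<le> n" using len[OF G] by simp
    let ?\<tau> = "stp ?b \<tau>"
    have st': "?\<tau> = \<tau>(vcur := (\<tau> vcur)(0 := u), 1 := (\<tau> 1)(o0 + 1 + length P := u), vo := (\<tau> vo)(0 := o0 + 1 + length ?Q))"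
      using P(2,4) dt u(1) by simp
    have "?C ?Q ?\<tau>" using P(4) unfolding st' by (auto simp: nth_append less_Suc_eq)
    moreover have "?\<tau> vcur 0 = last ?Q" unfolding st' by simp
    ultimately have "\<exists>j'<m. ?J j' ?\<tau>" using G P(1) u(6) by (intro exI[of _ "rk u"] conjI exI[of _ ?Q]) auto
    moreover have "safe K ?b \<tau>" using P(2,4) dt u(1,2) lenQ o N_ge(3) N_less_K by simp
    ultimately show "run ?b \<tau> 30 (\<lambda>\<tau>'. \<exists>j'<m. ?J j' \<tau>')" using t(1) by (intro run_block) (auto simp: eok_def)
  next
    fix m \<tau> assume t: "bd \<tau>" "?J m \<tau>" "val \<tau> ?t = 0"
    then obtain P where P: "\<tau> vcur 0 = last P" "?G P" "?C P \<tau>" by blast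
    have dt: "\<tau> aPar = par" "\<tau> vN 0 = N" using P(3) statD(4)[OF st] by (simp_all add: keeps_def par_def)
    have "\<not> val \<tau> ?t \<noteq> 0" using t(3) by simp
    then have e: "par (last P) = sor" unfolding val_NeqE using P(1) dt by (simp add: N_def)
    have "last P = tm (Suc 0) i" using step[OF lastn[OF P(2)]] P(2) e by auto
    then show "\<exists>P. ?G P \<and> last P = tm (Suc 0) i \<and> ?C P \<tau>" using P by blast
  next
    have "rk (tm 0 i) < N" using rk[of "tm 0 i"] reach tm_lt[of 0 i] i by auto
    then have "rk (tm 0 i) * 41 \<le> N * 41" by simp
    then show "rk (tm 0 i) * (30 + cost ?t + 1) + cost ?t + 1 \<le> 50 * N + 20" by simp
  qed (use t1 in \<open>auto simp: eok_def\<close>)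
  show ?thesis unfolding emit_def
  proof (rule run_seqI[OF init], rule run_seqI[OF loop])
    fix \<tau> assume t: "bd \<tau>" "\<exists>P. ?G P \<and> last P = tm (Suc 0) i \<and> ?C P \<tau>"
    then obtain P where P: "?G P" "last P = tm (Suc 0) i" "?C P \<tau>" by blast
    have gp: "good_path U i P" unfolding good_path_def using P sorted_rank_distinct[of rk P] by blast
    \<comment> \<open>The length precedes the path in the output but is known only now; its place at
      \<open>vp\<close> was left free.\<close>
    let ?e = "Store 1 (V vp) (Sub (Sub (V vo) (V vp)) (Const 1))"
    have st': "stp ?e \<tau> = \<tau>(1 := (\<tau> 1)(o0 := length P))" using P(3) by simp
    show "run ?e \<tau> 20 (\<lambda>\<sigma>'. keeps ?S \<sigma> \<sigma>' \<and> (\<exists>P. good_path U i P \<and>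
      \<sigma>' vo 0 = o0 + 1 + length P \<and> (\<forall>x<o0. \<sigma>' 1 x = \<sigma> 1 x) \<and> \<sigma>' 1 o0 = length P \<and>
      (\<forall>l<length P. \<sigma>' 1 (o0 + 1 + l) = P ! l)))"
    proof (rule run_block[OF _ t(1)])
      show "safe K ?e \<tau>" using P(3) len[OF P(1)] o by simp
      show "keeps ?S \<sigma> (stp ?e \<tau>) \<and> (\<exists>P. good_path U i P \<and>
      stp ?e \<tau> vo 0 = o0 + 1 + length P \<and> (\<forall>x<o0. stp ?e \<tau> 1 x = \<sigma> 1 x) \<and> stp ?e \<tau> 1 o0 = length P \<and>
      (\<forall>l<length P. stp ?e \<tau> 1 (o0 + 1 + l) = P ! l))" unfolding st' using P(3) gp by auto
    qed (auto simp: eok_def)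
  next
    show "50 * N + 20 + 20 \<le> 50 * N + 40" by simp
    show "40 + (50 * N + 40) \<le> 100 * (N * N)"
    proof -
      have "2 * N \<le> N * N" "2 \<le> N" using N_ge(1) by auto
      then show ?thesis by linarith
    qed
  qed
qed

lemma run_outp:
  assumes bd: "bd \<sigma>" and st: "stat \<sigma>" and s: "\<sigma> vs 0 = Suc 0" and i: "\<sigma> vi 0 = i" "i < k"
    and lab: "labelled 0 p1 z1 \<sigma>" "labelled (Suc 0) p2 z2 \<sigma>" and z: "z1 i < t" "z2 i < t"
    and U: "U = set (p1 i) \<union> set (p2 i) \<union> B (z1 i) \<union> B (z2 i)" "U \<subseteq> {..<n}" "tm 0 i \<in> U"
    and path: "(tm 0 i, tm (Suc 0) i) \<in> (Ed \<inter> U \<times> U)\<^sup>*" and o: "\<sigma> vo 0 = o0" "o0 + n + 2 \<le> K"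
  shows "run outp \<sigma> (1000 * (N * N)) (\<lambda>\<sigma>'. keeps out_regs \<sigma> \<sigma>' \<and> (\<exists>P. good_path U i P \<and>
    \<sigma>' vo 0 = o0 + 1 + length P \<and> (\<forall>x<o0. \<sigma>' 1 x = \<sigma> 1 x) \<and> \<sigma>' 1 o0 = length P \<and>
    (\<forall>l<length P. \<sigma>' 1 (o0 + 1 + l) = P ! l)))" (is "run outp \<sigma> _ ?Q")
proof -
  have fill: "run (fill out_netE) \<sigma> (700 * (N * N)) (\<lambda>\<sigma>'. keeps {vx, vy, aM} \<sigma> \<sigma>' \<and> mat N \<sigma>' = out_net U i)"
    unfolding out_netE_def
  proof (rule run_netE[OF bd st s])
    fix \<tau> assume t: "keeps {vx, vy, aM} \<sigma> \<tau>"
    have stt: "stat \<tau>" using stat_keeps[OF t] st by simp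
    have f: "\<tau> vi 0 = i" "\<tau> aLab = \<sigma> aLab" "\<tau> aZ = \<sigma> aZ" "\<tau> vs 0 = Suc 0" using t i s by (simp_all add: keeps_def)
    note d = statD(1,2)[OF stt]
    show "(val \<tau> (Const 1) \<noteq> 0) = True" by simp
    show "(val \<tau> (Const 0) \<noteq> 0) = False" by simp
    show "(val \<tau> (EqE (V vy) rootE) \<noteq> 0) = (\<tau> vy 0 = tm (Suc 0) i)"
      unfolding val_EqE using statD(5)[OF stt, of "Suc 0" i] i f d by simp
    show "(val \<tau> memE \<noteq> 0) = (\<tau> vx 0 - n \<in> U)" if x: "n \<le> \<tau> vx 0" "\<tau> vx 0 < 2 * n"
    proof -
      define v where "v = \<tau> vx 0 - n"
      have vn': "v < n" using x by (auto simp: v_def)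
      have leaf: "val \<tau> (Load aLab xv) = \<sigma> aLab v" "val \<tau> (Load aLab (Add (V vn) xv)) = \<sigma> aLab (n + v)" "val \<tau> i1E = Suc i"
        "val \<tau> (Load aC1 xv) = \<tau> aC1 v" "val \<tau> (Load aC2 xv) = \<tau> aC2 v" "val \<tau> z1E = Suc (z1 i)" "val \<tau> z2E = Suc (z2 i)"
        using f d lab i(2) by (auto simp: v_def labelled_def)
      have "\<sigma> aLab v = Suc i \<longleftrightarrow> v \<in> set (p1 i)" "\<sigma> aLab (n + v) = Suc i \<longleftrightarrow> v \<in> set (p2 i)"
        using lab vn' i(2) by (auto simp: labelled_def)
      moreover have "\<tau> aC1 v = Suc (z1 i) \<or> \<tau> aC2 v = Suc (z1 i) \<longleftrightarrow> v \<in> B (z1 i)"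
        "\<tau> aC1 v = Suc (z2 i) \<or> \<tau> aC2 v = Suc (z2 i) \<longleftrightarrow> v \<in> B (z2 i)"
        using statD(7)[OF stt vn'] z by blast+
      ultimately show ?thesis unfolding v_def[symmetric] U(1) val_AddE val_EqE leaf by blast
    qed
  qed (auto simp: eok_def netE_defs)
  show ?thesis unfolding outp_def
  proof (rule run_seqI[OF fill])
    fix \<sigma>1 assume a1: "bd \<sigma>1" "keeps {vx, vy, aM} \<sigma> \<sigma>1 \<and> mat N \<sigma>1 = out_net U i"
    have N1: "\<sigma>1 vN 0 = N" using a1 statD(4)[OF st] by (simp add: keeps_def)
    show "run (search ;; emit) \<sigma>1 (300 * (N * N)) ?Q"
    proof (rule run_seqI[OF run_search[OF a1(1) N1 _ N_less_K]])
      fix \<sigma>2 assume a2: "bd \<sigma>2" "keeps {vx, vy, vtl, aVis, aPar, aQ} \<sigma>1 \<sigma>2 \<and> search_tree (mat N \<sigma>1) N (\<sigma>2 aPar)"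
      have k2: "keeps {vx, vy, aM, vtl, aVis, aPar, aQ} \<sigma> \<sigma>2" using a1 a2 by (auto simp: keeps_def)
      have s2: "stat \<sigma>2" using stat_keeps[OF k2] st by simp
      have f2: "\<sigma>2 vi 0 = i" "\<sigma>2 vo 0 = o0" "\<sigma>2 1 = \<sigma> 1" using k2 i o by (simp_all add: keeps_def)
      have tree: "search_tree (out_net U i) N (\<sigma>2 aPar)" using a1 a2 by simp
      show "run emit \<sigma>2 (100 * (N * N)) ?Q"
      proof (rule run_conseq[OF run_emit[OF a2(1) s2 f2(1) i(2) U(2,3) out_reach[OF i(2) U(2) path] tree f2(2) o(2)] order_refl])
        fix \<sigma>' assume a3: "keeps {vcur, vp, vo, 1} \<sigma>2 \<sigma>' \<and> (\<exists>P. good_path U i P \<and>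
          \<sigma>' vo 0 = o0 + 1 + length P \<and> (\<forall>x<o0. \<sigma>' 1 x = \<sigma>2 1 x) \<and> \<sigma>' 1 o0 = length P \<and>
          (\<forall>l<length P. \<sigma>' 1 (o0 + 1 + l) = P ! l))"
        have "keeps out_regs \<sigma> \<sigma>'" using a3 k2 by (auto simp: keeps_def)
        then show "?Q \<sigma>'" using a3 f2(3) by auto
      qed
    qed (use N_ge(1) in auto)
  qed simp
qed

lemma words_snoc: "words (Ps @ [P]) = words Ps @ length P # P"
  by (simp add: words_def)

lemma run_outputs:
  assumes bd: "bd \<sigma>" and st: "stat \<sigma>" and s: "\<sigma> vs 0 = Suc 0"
    and lab: "labelled 0 p1 z1 \<sigma>" "labelled (Suc 0) p2 z2 \<sigma>" and z: "\<And>i. i < k \<Longrightarrow> z1 i < t \<and> z2 i < t"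
    and U: "U = (\<lambda>i. set (p1 i) \<union> set (p2 i) \<union> B (z1 i) \<union> B (z2 i))" "\<And>i. i < k \<Longrightarrow> U i \<subseteq> {..<n} \<and> tm 0 i \<in> U i"
    and path: "\<And>i. i < k \<Longrightarrow> (tm 0 i, tm (Suc 0) i) \<in> (Ed \<inter> U i \<times> U i)\<^sup>*" and o: "\<sigma> vo 0 = 0"
  shows "run (For vi (V vk) outp) \<sigma> (1100 * (k * (N * N))) (\<lambda>\<sigma>'. \<exists>Ps. length Ps = k \<and>
    (\<forall>i<k. good_path (U i) i (Ps ! i)) \<and> (\<forall>x<length (words Ps). \<sigma>' 1 x = words Ps ! x))"
proof -
  let ?S = "insert vi out_regs"
  let ?I = "\<lambda>j \<tau>. keeps ?S \<sigma> \<tau> \<and> (\<exists>Ps. length Ps = j \<and> (\<forall>i<j. good_path (U i) i (Ps ! i)) \<and>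
     \<tau> vo 0 = length (words Ps) \<and> length (words Ps) \<le> j * (n + 1) \<and> (\<forall>x<length (words Ps). \<tau> 1 x = words Ps ! x))"
  show ?thesis
  proof (rule run_for[where I = ?I and m = k and c = "1000 * (N * N)"])
    fix i \<tau> assume t: "i < k" "bd \<tau>" "\<tau> vi 0 = i" "?I i \<tau>"
    then obtain Ps where Ps: "length Ps = i" "\<forall>i'<i. good_path (U i') i' (Ps ! i')" "\<tau> vo 0 = length (words Ps)"
      "length (words Ps) \<le> i * (n + 1)" "\<forall>x<length (words Ps). \<tau> 1 x = words Ps ! x" by blast
    have kt: "keeps ?S \<sigma> \<tau>" using t by blast
    have stt: "stat \<tau>" using stat_keeps[OF kt] st by simp
    have f: "\<tau> vs 0 = Suc 0" "\<tau> aLab = \<sigma> aLab" "\<tau> aZ = \<sigma> aZ" using kt s by (simp_all add: keeps_def)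
    have lab': "labelled 0 p1 z1 \<tau>" "labelled (Suc 0) p2 z2 \<tau>" using lab f by (simp_all add: labelled_def)
    \<comment> \<open>A distinct path occupies at most \<open>n + 1\<close> words including its
      length, which keeps all output positions below \<open>K\<close>.\<close>
    have "i * (n + 1) + n + 2 \<le> k * (n + 1) + 1"
    proof -
      have "Suc i * (n + 1) \<le> k * (n + 1)" using t(1) by (intro mult_le_mono1) simp
      then show ?thesis by simp
    qed
    moreover have "k * (n + 1) \<le> N * N" using N_ge(3,5) by (intro mult_le_mono) auto
    ultimately have oK: "length (words Ps) + n + 2 \<le> K" using Ps(4) NK by linarith
    show "run outp \<tau> (1000 * (N * N)) (\<lambda>\<tau>'. \<tau>' vi 0 = i \<and> ?I (Suc i) (\<tau>'(vi := (\<tau>' vi)(0 := Suc i))))"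
    proof (rule run_conseq[OF run_outp[where U = "U i", OF t(2) stt f(1) t(3,1) lab' _ _ _ _ _ path[OF t(1)] Ps(3) oK] order_refl])
      show "z1 i < t" "z2 i < t" "U i \<subseteq> {..<n}" "tm 0 i \<in> U i" using z U(2) t(1) by auto
      show "U i = set (p1 i) \<union> set (p2 i) \<union> B (z1 i) \<union> B (z2 i)" by (simp add: U(1))
    next
      fix \<tau>' assume a: "keeps out_regs \<tau> \<tau>' \<and> (\<exists>P. good_path (U i) i P \<and>
        \<tau>' vo 0 = length (words Ps) + 1 + length P \<and> (\<forall>x<length (words Ps). \<tau>' 1 x = \<tau> 1 x) \<and> \<tau>' 1 (length (words Ps)) = length P \<and>
        (\<forall>l<length P. \<tau>' 1 (length (words Ps) + 1 + l) = P ! l))"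
      then obtain P where P: "good_path (U i) i P" "\<tau>' vo 0 = length (words Ps) + 1 + length P"
         "\<forall>x<length (words Ps). \<tau>' 1 x = \<tau> 1 x" "\<tau>' 1 (length (words Ps)) = length P"
         "\<forall>l<length P. \<tau>' 1 (length (words Ps) + 1 + l) = P ! l" by blast
      have "length P \<le> n"
      proof -
        have "distinct P" "set P \<subseteq> {..<n}" using P(1) U(2)[OF t(1)] by (auto simp: good_path_def)
        then have "card (set P) \<le> card {..<n}" by (intro card_mono) auto
        then show ?thesis using \<open>distinct P\<close> by (simp add: distinct_card)
      qed
      let ?Qs = "Ps @ [P]"
      have lw: "length (words ?Qs) = length (words Ps) + 1 + length P" by (simp add: words_snoc)
      have "\<tau>' 1 x = words ?Qs ! x" if x: "x < length (words ?Qs)" for x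
      proof -
        consider "x < length (words Ps)" | "x = length (words Ps)" | l where "x = length (words Ps) + 1 + l" "l < length P"
        proof -
          have "x = length (words Ps) + 1 + (x - length (words Ps) - 1) \<and> x - length (words Ps) - 1 < length P"
            if "\<not> x < length (words Ps)" "x \<noteq> length (words Ps)" using that x lw by auto
          then show thesis using that by blast
        qed
        then show ?thesis
        proof cases
          case 1
          then show ?thesis using P(3) Ps(5) by (simp add: words_snoc nth_append)
        next
          case 2
          then show ?thesis using P(4) by (simp add: words_snoc nth_append)
        next
          case 3
          then show ?thesis using P(5) by (simp add: words_snoc nth_append)
        qed
      qed
      moreover have "good_path (U i') i' (?Qs ! i')" if "i' < Suc i" for i'
        using that Ps(1,2) P(1) by (cases "i' = i") (auto simp: nth_append)
      moreover have "length (words ?Qs) \<le> Suc i * (n + 1)" using Ps(4) lw \<open>length P \<le> n\<close> by simp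
      ultimately have "\<exists>Qs. length Qs = Suc i \<and> (\<forall>i'<Suc i. good_path (U i') i' (Qs ! i')) \<and>
        \<tau>' vo 0 = length (words Qs) \<and> length (words Qs) \<le> Suc i * (n + 1) \<and> (\<forall>x<length (words Qs). \<tau>' 1 x = words Qs ! x)"
        using Ps(1) P(2) lw by (intro exI[of _ ?Qs]) auto
      moreover have "keeps ?S \<sigma> \<tau>'" using a kt by (auto simp: keeps_def)
      moreover have "\<tau>' vi = \<tau> vi" using a by (simp add: keeps_def)
      ultimately show "\<tau>' vi 0 = i \<and> ?I (Suc i) (\<tau>'(vi := (\<tau>' vi)(0 := Suc i)))" using t(3) by simp
    qed
  next
    show "?I 0 (\<sigma>(vi := (\<sigma> vi)(0 := 0)))" using o by (simp add: words_def)
    show "val \<tau> (V vk) = k" if "?I j \<tau>" for j \<tau>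
    proof -
      have "\<tau> vk = \<sigma> vk" using that by (simp add: keeps_def)
      then show ?thesis using statD(2)[OF st] by simp
    qed
  next
    fix \<tau> assume "bd \<tau>" "?I k \<tau>"
    then show "\<exists>Ps. length Ps = k \<and> (\<forall>i<k. good_path (U i) i (Ps ! i)) \<and> (\<forall>x<length (words Ps). \<tau> 1 x = words Ps ! x)"
      by blast
  next
    have "k \<le> k * (N * N)" "1 \<le> k" using k_pos N_ge(1) by auto
    moreover have "k * (1000 * (N * N) + cost (V vk) + 10) + cost (V vk) + 10 = 1000 * (k * (N * N)) + 12 * k + 12" by (simp add: algebra_simps)
    ultimately show "k * (1000 * (N * N) + cost (V vk) + 10) + cost (V vk) + 10 \<le> 1100 * (k * (N * N))" by linarith
  qed (use bd N_ge(5) N_less_K in \<open>auto simp: eok_def\<close>)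
qed

end

subsection \<open>Reading the input\<close>

text \<open>\<open>vb\<close> is the position right behind the digraph, where \<open>k\<close> is
  stored. The terminals begin at the next word, and the number of bags follows the
  \<open>2 * k\<close> terminals.\<close>

definition read_scalars :: prog where
  "read_scalars = vn ::= Load 0 (Const 0) ;; ve ::= Load 0 (Const 1) ;;
     vb ::= Add (Add (Const 2) (V vn)) (Mul (Const 2) (V ve)) ;; vk ::= Load 0 (V vb) ;;
     vt ::= Load 0 (Add (Add (V vb) (Const 1)) (Mul (Const 2) (V vk))) ;; vN ::= Add n2tE (Const 2) ;;
     Store aSt (Const 0) (Const 3)"

definition read_arcs :: prog where
  "read_arcs = For vj (V ve) (vu ::= Load 0 (Add (Add (Const 2) (V vn)) (Mul (Const 2) (V vj))) ;;
     vv ::= Load 0 (Add (Add (Const 3) (V vn)) (Mul (Const 2) (V vj))) ;;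
     Store aD (Add (Mul (V vu) (V vn)) (V vv)) (Const 1) ;;
     Store aD (Add (Add (Mul (V vn) (V vn)) (Mul (V vv) (V vn))) (V vu)) (Const 1))"

text \<open>The arcs of a bag are arcs of the graph and hence already in the matrix, so
  \<open>vpos\<close> jumps over them. By depth two, two slots per vertex suffice for the
  bags.\<close>

definition read_bags :: prog where
  "read_bags = vpos ::= Add (Add (V vb) (Const 2)) (Mul (Const 2) (V vk)) ;;
     For vi (V vt)
       (For vj (Load 0 (V vpos)) (vv ::= Load 0 (Add (Add (V vpos) (Const 2)) (V vj)) ;;
          Cond (Load aC1 (V vv)) (Store aC2 (V vv) (Add (V vi) (Const 1))) (Store aC1 (V vv) (Add (V vi) (Const 1)))) ;;
        vpos ::= Add (Add (V vpos) (Const 2)) (Add (Load 0 (V vpos)) (Mul (Const 2) (Load 0 (Add (V vpos) (Const 1))))))"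

definition read_terminals :: prog where
  "read_terminals = For vs (Const 2) (For vi (V vk) (Store aTm (Add (Mul (V vs) (V vn)) rootE) (Const 1)))"

definition main :: prog where
  "main = read_scalars ;; read_arcs ;; read_bags ;; read_terminals ;; fans ;;
     vs ::= Const 0 ;; link ;; vs ::= Const 1 ;; link ;; For vi (V vk) outp"

section \<open>Correctness of reading the input, and of the whole program\<close>

lemma matrix_index_less:
  assumes "u < n" "v < (n :: nat)" shows "u * n + v < n * n"
proof -
  have "u * n + v < Suc u * n" using assms by simp
  also have "\<dots> \<le> n * n" using assms by (intro mult_le_mono1) simp
  finally show ?thesis .
qed

text \<open>Here \<open>F v\<close> is the set of bags entered for \<open>v\<close> so far. That the
  first slot is filled before the second makes the test of \<open>aC1\<close> alone decide where a
  new bag goes.\<close>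

definition bag_table :: "nat \<Rightarrow> nat \<Rightarrow> (nat \<Rightarrow> nat) \<Rightarrow> (nat \<Rightarrow> nat) \<Rightarrow> (nat \<Rightarrow> nat set) \<Rightarrow> bool" where
  "bag_table n t c1 c2 F \<longleftrightarrow> (\<forall>v<n. F v = {b. c1 v = Suc b \<or> c2 v = Suc b} \<and> (c1 v = 0 \<longrightarrow> c2 v = 0) \<and> c1 v \<le> t \<and> c2 v \<le> t)"

text \<open>If the set of \<open>v\<close> has at most two elements after inserting a new bag, it
  had at most one before; so when the first slot is taken, the second is free.\<close>

lemma bag_table_insert:
  assumes T: "bag_table n t c1 c2 F" and v: "v < n" and b: "b < t" "b \<notin> F v" "card (insert b (F v)) \<le> 2"
  shows "c1 v = 0 \<Longrightarrow> bag_table n t (c1(v := Suc b)) c2 (F(v := insert b (F v)))"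
    "c1 v \<noteq> 0 \<Longrightarrow> bag_table n t c1 (c2(v := Suc b)) (F(v := insert b (F v)))"
proof -
  note Tv = T[unfolded bag_table_def, rule_format]
  show "bag_table n t (c1(v := Suc b)) c2 (F(v := insert b (F v)))" if z: "c1 v = 0"
  proof -
    have "F v = {}" using Tv[OF v] z by auto
    then show ?thesis using Tv Tv[OF v] z b(1) by (auto simp: bag_table_def)
  qed
  show "bag_table n t c1 (c2(v := Suc b)) (F(v := insert b (F v)))" if nz: "c1 v \<noteq> 0"
  proof -
    obtain b1 where b1: "c1 v = Suc b1" using nz by (cases "c1 v") auto
    have Fv: "F v = {b. c1 v = Suc b \<or> c2 v = Suc b}" using Tv[OF v] by blast
    have "F v = {b1}"
    proof (rule ccontr)
      assume "F v \<noteq> {b1}"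
      then obtain b2 where b2: "b2 \<noteq> b1" "c2 v = Suc b2" using Fv b1 by auto
      then have "F v = {b1, b2}" using Fv b1 by auto
      then show False using b b2 by simp
    qed
    then show ?thesis using Tv Tv[OF v] b1 b(1) by (auto simp: bag_table_def)
  qed
qed

context linkage_ram
begin

text \<open>The layout of the input array \<open>X\<close> as far as the program relies on it, with
  \<open>pos b\<close> the address of bag \<open>b\<close>. It separates the correctness of the
  program from the encoding of the instance.\<close>

definition input_at :: "(nat \<Rightarrow> nat) \<Rightarrow> nat \<Rightarrow> (nat \<Rightarrow> nat) \<Rightarrow> bool" where
  "input_at X e pos \<longleftrightarrow> X 0 = n \<and> X 1 = e \<and> e \<le> n * n \<and> X (2 + n + 2 * e) = k \<and>
     (\<forall>s<2. \<forall>i<k. X (2 + n + 2 * e + 1 + s * k + i) = tm s i) \<and> X (2 + n + 2 * e + 1 + 2 * k) = t \<and>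
     Ed = (\<lambda>j. (X (2 + n + 2 * j), X (3 + n + 2 * j))) ` {..<e} \<and> pos 0 = 2 + n + 2 * e + 2 + 2 * k \<and> pos 0 \<le> K \<and>
     (\<forall>b<t. pos (Suc b) = pos b + 2 + X (pos b) + 2 * X (pos b + 1) \<and> B b = (\<lambda>j. X (pos b + 2 + j)) ` {..<X (pos b)} \<and>
        inj_on (\<lambda>j. X (pos b + 2 + j)) {..<X (pos b)} \<and> pos (Suc b) \<le> K)"

context
  fixes X :: "nat \<Rightarrow> nat" and e :: nat and pos :: "nat \<Rightarrow> nat"
  assumes inp: "input_at X e pos"
begin

lemma inpD:
  shows "X 0 = n" "X 1 = e" "e \<le> n * n" "X (2 + n + 2 * e) = k"
    "\<And>s i. s < 2 \<Longrightarrow> i < k \<Longrightarrow> X (2 + n + 2 * e + 1 + s * k + i) = tm s i" "X (2 + n + 2 * e + 1 + 2 * k) = t"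
    "Ed = (\<lambda>j. (X (2 + n + 2 * j), X (3 + n + 2 * j))) ` {..<e}" "pos 0 = 2 + n + 2 * e + 2 + 2 * k" "pos 0 \<le> K"
    "\<And>b. b < t \<Longrightarrow> pos (Suc b) = pos b + 2 + X (pos b) + 2 * X (pos b + 1)"
    "\<And>b. b < t \<Longrightarrow> B b = (\<lambda>j. X (pos b + 2 + j)) ` {..<X (pos b)}"
    "\<And>b. b < t \<Longrightarrow> inj_on (\<lambda>j. X (pos b + 2 + j)) {..<X (pos b)}" "\<And>b. b < t \<Longrightarrow> pos (Suc b) \<le> K"
  using inp unfolding input_at_def by blast+

definition scal :: "memory \<Rightarrow> bool" where
  "scal \<tau> \<longleftrightarrow> \<tau> 0 = X \<and> \<tau> vn 0 = n \<and> \<tau> ve 0 = e \<and> \<tau> vb 0 = 2 + n + 2 * e \<and> \<tau> vk 0 = k \<and> \<tau> vt 0 = t \<and> \<tau> vN 0 = N"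

lemma scal_keeps: "keeps A \<sigma> \<tau> \<Longrightarrow> A \<inter> {0, vn, ve, vb, vk, vt, vN} = {} \<Longrightarrow> scal \<sigma> \<Longrightarrow> scal \<tau>"
  by (auto simp: scal_def keeps_def)

lemma run_read_scalars:
  assumes bd: "bd \<sigma>" and X: "\<sigma> 0 = X"
  shows "run read_scalars \<sigma> 80 (\<lambda>\<tau>. keeps {vn, ve, vb, vk, vt, vN, aSt} \<sigma> \<tau> \<and> scal \<tau> \<and> \<tau> aSt = (\<sigma> aSt)(0 := 3))"
proof -
  have nK: "n \<le> K" "t \<le> K" "k \<le> K" "N \<le> K" "e \<le> K" using N_ge N_less_K inpD(8,9) by linarith+
  have bK: "2 + n + 2 * e \<le> K" using inpD(8,9) by linarith
  have t': "X (Suc (2 + n + 2 * e + 2 * k)) = t" using inpD(6) by simp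
  let ?S1 = "\<sigma>(vn := (\<sigma> vn)(0 := n), ve := (\<sigma> ve)(0 := e), vb := (\<sigma> vb)(0 := 2 + n + 2 * e), vk := (\<sigma> vk)(0 := k),
     vt := (\<sigma> vt)(0 := t), vN := (\<sigma> vN)(0 := N), aSt := (\<sigma> aSt)(0 := 3))"
  have st: "stp read_scalars \<sigma> = ?S1"
    using inpD(1,2,4) t' X unfolding read_scalars_def by (simp add: N_def)
  have sf: "safe K read_scalars \<sigma>"
    using inpD(1,2,4) t' X nK bK K100 unfolding read_scalars_def by (simp add: N_def)
  show ?thesis
  proof (rule run_block[OF _ bd sf])
    show "keeps {vn, ve, vb, vk, vt, vN, aSt} \<sigma> (stp read_scalars \<sigma>) \<and> scal (stp read_scalars \<sigma>) \<and> stp read_scalars \<sigma> aSt = (\<sigma> aSt)(0 := 3)"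
      unfolding st by (simp add: scal_def X)
  qed (auto simp: read_scalars_def eok_def)
qed

lemma run_read_arcs:
  assumes bd: "bd \<sigma>" and sc: "scal \<sigma>" and fresh: "\<And>x. \<sigma> aD x = 0"
  shows "run read_arcs \<sigma> (80 * (N * N)) (\<lambda>\<tau>. keeps {vj, vu, vv, aD} \<sigma> \<tau> \<and>
    (\<forall>s<2. \<forall>u<n. \<forall>v<n. \<tau> aD (s * (n * n) + u * n + v) \<noteq> 0 \<longleftrightarrow> (u, v) \<in> Eds s))"
proof -
  let ?S = "{vj, vu, vv, aD}"
  define a c where "a = (\<lambda>j. X (2 + n + 2 * j))" and "c = (\<lambda>j. X (3 + n + 2 * j))"
  have E: "Ed = (\<lambda>j. (a j, c j)) ` {..<e}" using inpD(7) by (simp add: a_def c_def)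
  have lt: "a j < n" "c j < n" if "j < e" for j using Ed_sub that unfolding E by auto
  let ?D = "\<lambda>j \<tau>. \<forall>x. \<tau> aD x \<noteq> 0 \<longleftrightarrow> (\<exists>j'<j. x = a j' * n + c j' \<or> x = n * n + c j' * n + a j')"
  let ?I = "\<lambda>j \<tau>. keeps ?S \<sigma> \<tau> \<and> ?D j \<tau>"
  let ?b = "vu ::= Load 0 (Add (Add (Const 2) (V vn)) (Mul (Const 2) (V vj))) ;;
     vv ::= Load 0 (Add (Add (Const 3) (V vn)) (Mul (Const 2) (V vj))) ;;
     Store aD (Add (Mul (V vu) (V vn)) (V vv)) (Const 1) ;;
     Store aD (Add (Add (Mul (V vn) (V vn)) (Mul (V vv) (V vn))) (V vu)) (Const 1)"
  show ?thesis unfolding read_arcs_def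
  proof (rule run_for[where I = ?I and m = e and c = 60])
    fix j \<tau> assume j: "j < e" "bd \<tau>" "\<tau> vj 0 = j" "?I j \<tau>"
    have sct: "scal \<tau>" using scal_keeps[of ?S \<sigma> \<tau>] j sc by simp
    note d = sct[unfolded scal_def]
    have va: "\<tau> 0 (2 + n + 2 * j) = a j" "\<tau> 0 (3 + n + 2 * j) = c j" using d by (auto simp: a_def c_def)
    let ?\<tau> = "\<tau>(vu := (\<tau> vu)(0 := a j), vv := (\<tau> vv)(0 := c j), aD := (\<tau> aD)(a j * n + c j := 1, n * n + c j * n + a j := 1))"
    have st: "stp ?b \<tau> = ?\<tau>" using va d j(3) by simp
    have sf: "safe K ?b \<tau>" using va d j(3) lt[OF j(1)] N_ge(3) N_less_K K100 by simp
    show "run ?b \<tau> 60 (\<lambda>\<tau>'. \<tau>' vj 0 = j \<and> ?I (Suc j) (\<tau>'(vj := (\<tau>' vj)(0 := Suc j))))"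
    proof (rule run_block[OF _ j(2) sf])
      have "?D (Suc j) ?\<tau>" using j(4) by (auto simp: less_Suc_eq)
      then show "stp ?b \<tau> vj 0 = j \<and> ?I (Suc j) ((stp ?b \<tau>)(vj := ((stp ?b \<tau>) vj)(0 := Suc j)))"
        unfolding st using j by simp
    qed (auto simp: eok_def)
  next
    fix \<tau> assume t: "bd \<tau>" "?I e \<tau>"
    have idx: "x * n + y = x' * n + y' \<longleftrightarrow> x = x' \<and> y = y'" if "y < n" "y' < n" for x y x' y'
      using matrix_index_eq[OF that] .
    have Ej: "(u, v) \<in> Ed \<longleftrightarrow> (\<exists>j<e. u = a j \<and> v = c j)" for u v unfolding E by auto
    have "\<tau> aD (s * (n * n) + u * n + v) \<noteq> 0 \<longleftrightarrow> (u, v) \<in> Eds s" if s: "s < 2" and uv: "u < n" "v < n" for s u v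
    proof -
      \<comment> \<open>Indices of the first matrix are below \<open>n * n\<close> and those of the
        second are not, so entries of the two never collide.\<close>
      note mx = matrix_index_less
      consider "s = 0" | "s = 1" using s by linarith
      then show ?thesis
      proof cases
        case 1
        have "u * n + v = a j * n + c j \<or> u * n + v = n * n + c j * n + a j \<longleftrightarrow> u = a j \<and> v = c j" if "j < e" for j
          using idx[OF uv(2) lt(2)[OF that], of u "a j"] mx[OF uv] by auto
        then show ?thesis using t(2) 1 Ej by (auto simp: Eds_def)
      next
        case 2
        have "n * n + u * n + v = a j * n + c j \<or> n * n + u * n + v = n * n + c j * n + a j \<longleftrightarrow> u = c j \<and> v = a j" if "j < e" for j
          using idx[OF uv(2) lt(1)[OF that], of u "c j"] mx[OF lt[OF that]] by (auto simp: add.assoc)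
        then show ?thesis using t(2) 2 Ej[of v u] by (auto simp: Eds_def)
      qed
    qed
    then show "keeps ?S \<sigma> \<tau> \<and> (\<forall>s<2. \<forall>u<n. \<forall>v<n. \<tau> aD (s * (n * n) + u * n + v) \<noteq> 0 \<longleftrightarrow> (u, v) \<in> Eds s)"
      using t(2) by blast
  next
    have "n * n \<le> N * N" using N_ge(3) by (intro mult_le_mono) auto
    then have "e \<le> N * N" using inpD(3) by linarith
    moreover have "4 \<le> N * N" using N_ge(1) mult_le_mono[of 2 N 2 N] by simp
    moreover have "e * (60 + cost (V ve) + 10) + cost (V ve) + 10 = 72 * e + 12" by (simp add: algebra_simps)
    ultimately show "e * (60 + cost (V ve) + 10) + cost (V ve) + 10 \<le> 80 * (N * N)" by linarith
  next
    show "?I 0 (\<sigma>(vj := (\<sigma> vj)(0 := 0)))" using fresh by simp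
    show "val \<tau> (V ve) = e" if "?I j \<tau>" for j \<tau>
    proof -
      have "\<tau> ve = \<sigma> ve" using that by (simp add: keeps_def)
      then show ?thesis using sc by (simp add: scal_def)
    qed
    have "n * n \<le> N * N" using N_ge(3) by (intro mult_le_mono) auto
    then show "e < K" using inpD(3) NK by linarith
  qed (use bd in \<open>auto simp: eok_def\<close>)
qed

lemma run_read_bags:
  assumes bd: "bd \<sigma>" and sc: "scal \<sigma>" and fresh: "\<And>x. \<sigma> aC1 x = 0" "\<And>x. \<sigma> aC2 x = 0"
  shows "run read_bags \<sigma> (120 * (N * N)) (\<lambda>\<tau>. keeps {vi, vj, vv, vpos, aC1, aC2} \<sigma> \<tau> \<and>
    (\<forall>v<n. \<forall>b<t. v \<in> B b \<longleftrightarrow> \<tau> aC1 v = Suc b \<or> \<tau> aC2 v = Suc b) \<and> (\<forall>v<n. \<tau> aC1 v \<le> t \<and> \<tau> aC2 v \<le> t))"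
proof -
  let ?S = "{vi, vj, vv, vpos, aC1, aC2}"
  define F where "F = (\<lambda>b v. {b'. b' < b \<and> v \<in> B b'})"
  define G where "G = (\<lambda>b j v. F b v \<union> (if v \<in> (\<lambda>j. X (pos b + 2 + j)) ` {..<j} then {b} else {}))"
  let ?I = "\<lambda>b \<tau>. keeps ?S \<sigma> \<tau> \<and> \<tau> vpos 0 = pos b \<and> bag_table n t (\<tau> aC1) (\<tau> aC2) (F b)"
  let ?b = "vv ::= Load 0 (Add (Add (V vpos) (Const 2)) (V vj)) ;;
          Cond (Load aC1 (V vv)) (Store aC2 (V vv) (Add (V vi) (Const 1))) (Store aC1 (V vv) (Add (V vi) (Const 1)))"
  let ?p = "vpos ::= Add (Add (V vpos) (Const 2)) (Add (Load 0 (V vpos)) (Mul (Const 2) (Load 0 (Add (V vpos) (Const 1)))))"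
  have nv: "X (pos b) \<le> n" if "b < t" for b
  proof -
    have "card (B b) = X (pos b)" using inpD(11)[OF that] card_image[OF inpD(12)[OF that]] by simp
    then show ?thesis using card_mono[OF _ bag_sub[OF that]] by simp
  qed
  have loop: "run (For vi (V vt) (For vj (Load 0 (V vpos)) ?b ;; ?p)) \<sigma>1 (t * (42 * n + 60) + 12) (?I t)"
    if s1: "bd \<sigma>1" "?I 0 \<sigma>1" for \<sigma>1
  proof (rule run_for[where I = ?I and m = t and c = "42 * n + 48"])
    fix b \<tau> assume b: "b < t" "bd \<tau>" "\<tau> vi 0 = b" "?I b \<tau>"
    let ?P = "\<lambda>\<tau>'. \<tau>' vi 0 = b \<and> ?I (Suc b) (\<tau>'(vi := (\<tau>' vi)(0 := Suc b)))"
    let ?J = "\<lambda>j \<tau>. keeps ?S \<sigma> \<tau> \<and> \<tau> vi 0 = b \<and> \<tau> vpos 0 = pos b \<and> bag_table n t (\<tau> aC1) (\<tau> aC2) (G b j)"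
    show "run (For vj (Load 0 (V vpos)) ?b ;; ?p) \<tau> (42 * n + 48) ?P"
    proof (rule run_seqI)
      show "run (For vj (Load 0 (V vpos)) ?b) \<tau> (42 * n + 13) (?J (X (pos b)))"
      proof (rule run_for[where I = ?J and m = "X (pos b)" and c = 29])
        fix j \<rho> assume j: "j < X (pos b)" "bd \<rho>" "\<rho> vj 0 = j" "?J j \<rho>"
        have scr: "scal \<rho>" using scal_keeps[of ?S \<sigma> \<rho>] j sc by simp
        define v where "v = X (pos b + 2 + j)"
        have vB: "v \<in> B b" using inpD(11)[OF b(1)] j(1) by (auto simp: v_def)
        have vn': "v < n" using vB bag_sub[OF b(1)] by auto
        have r0: "\<rho> 0 (pos b + 2 + j) = v" using scr by (simp add: scal_def v_def)
        have notin: "v \<notin> (\<lambda>j. X (pos b + 2 + j)) ` {..<j}"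
        proof
          assume "v \<in> (\<lambda>j. X (pos b + 2 + j)) ` {..<j}"
          then obtain j' where "j' < j" "X (pos b + 2 + j') = X (pos b + 2 + j)" by (auto simp: v_def)
          then show False using inj_onD[OF inpD(12)[OF b(1)], of j' j] j(1) by auto
        qed
        have Gv: "G b j v = F b v" using notin by (simp add: G_def)
        have bG: "b \<notin> G b j v" unfolding Gv by (simp add: F_def)
        \<comment> \<open>Here depth two enters: the bags recorded for \<open>v\<close> together
          with the new one all contain \<open>v\<close>, so there are at most two.\<close>
        have "insert b (G b j v) \<subseteq> {b. b < t \<and> v \<in> B b}" unfolding Gv using b(1) vB by (auto simp: F_def)
        then have "card (insert b (G b j v)) \<le> card {b. b < t \<and> v \<in> B b}" by (intro card_mono) auto
        then have c2: "card (insert b (G b j v)) \<le> 2" using depth[of v] by linarith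
        have Gs: "(G b j)(v := insert b (G b j v)) = G b (Suc j)"
        proof
          fix w
          have "(\<lambda>j. X (pos b + 2 + j)) ` {..<Suc j} = insert v ((\<lambda>j. X (pos b + 2 + j)) ` {..<j})" by (auto simp: lessThan_Suc v_def)
          then show "((G b j)(v := insert b (G b j v))) w = G b (Suc j) w" by (auto simp: G_def)
        qed
        have bt: "bag_table n t (\<rho> aC1) (\<rho> aC2) (G b j)" using j by blast
        note ins = bag_table_insert[OF bt vn' b(1) bG c2, unfolded Gs]
        have vK: "v \<le> K" "Suc b \<le> K" using vn' b(1) N_ge N_less_K by auto
        show "run ?b \<rho> 29 (\<lambda>\<tau>'. \<tau>' vj 0 = j \<and> ?J (Suc j) (\<tau>'(vj := (\<tau>' vj)(0 := Suc j))))"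
        proof (cases "\<rho> aC1 v = 0")
          case True
          have st: "stp ?b \<rho> = \<rho>(vv := (\<rho> vv)(0 := v), aC1 := (\<rho> aC1)(v := Suc b))" using True r0 j by simp
          have sf: "safe K ?b \<rho>" using True r0 j vK by simp
          show ?thesis
          proof (rule run_block[OF _ j(2) sf])
            show "stp ?b \<rho> vj 0 = j \<and> ?J (Suc j) ((stp ?b \<rho>)(vj := (stp ?b \<rho> vj)(0 := Suc j)))"
              unfolding st using j ins(1)[OF True] by simp
          qed (auto simp: eok_def)
        next
          case False
          have st: "stp ?b \<rho> = \<rho>(vv := (\<rho> vv)(0 := v), aC2 := (\<rho> aC2)(v := Suc b))" using False r0 j by simp
          have sf: "safe K ?b \<rho>" using False r0 j vK by simp
          show ?thesis
          proof (rule run_block[OF _ j(2) sf])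
            show "stp ?b \<rho> vj 0 = j \<and> ?J (Suc j) ((stp ?b \<rho>)(vj := (stp ?b \<rho> vj)(0 := Suc j)))"
              unfolding st using j ins(2)[OF False] by simp
          qed (auto simp: eok_def)
        qed
      next
        have "G b 0 = F b" by (auto simp: G_def)
        then show "?J 0 (\<tau>(vj := (\<tau> vj)(0 := 0)))" using b by simp
        show "val \<rho> (Load 0 (V vpos)) = X (pos b)" if "?J j \<rho>" for j \<rho>
        proof -
          have "\<rho> 0 = \<sigma> 0" using that by (simp add: keeps_def)
          then show ?thesis using that sc by (simp add: scal_def)
        qed
        show "X (pos b) < K" using nv[OF b(1)] N_ge(3) N_less_K by linarith
        have "X (pos b) * 42 \<le> n * 42" using nv[OF b(1)] by simp
        then show "X (pos b) * (29 + cost (Load 0 (V vpos)) + 10) + cost (Load 0 (V vpos)) + 10 \<le> 42 * n + 13" by simp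
      qed (use b in \<open>auto simp: eok_def\<close>)
    next
      fix \<rho> assume r: "bd \<rho>" "?J (X (pos b)) \<rho>"
      have scr: "scal \<rho>" using scal_keeps[of ?S \<sigma> \<rho>] r sc by simp
      have "G b (X (pos b)) = F (Suc b)"
        unfolding G_def inpD(11)[OF b(1), symmetric] F_def by (rule ext) (auto simp: less_Suc_eq)
      then have bt: "bag_table n t (\<rho> aC1) (\<rho> aC2) (F (Suc b))" using r by simp
      have v: "val \<rho> (Add (Add (V vpos) (Const 2)) (Add (Load 0 (V vpos)) (Mul (Const 2) (Load 0 (Add (V vpos) (Const 1)))))) = pos (Suc b)"
        using r scr inpD(10)[OF b(1)] by (simp add: scal_def)
      show "run ?p \<rho> 35 ?P"
      proof (rule run_block[OF _ r(1)])
        show "safe K ?p \<rho>" using v inpD(13)[OF b(1)] by simp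
        have "stp ?p \<rho> = \<rho>(vpos := (\<rho> vpos)(0 := pos (Suc b)))" using v by simp
        then show "?P (stp ?p \<rho>)" using r bt by simp
      qed (auto simp: eok_def)
    qed simp
  next
    show "val \<tau> (V vt) = t" if "?I b \<tau>" for b \<tau>
    proof -
      have "\<tau> vt = \<sigma> vt" using that by (simp add: keeps_def)
      then show ?thesis using sc by (simp add: scal_def)
    qed
    show "t * (42 * n + 48 + cost (V vt) + 10) + cost (V vt) + 10 \<le> t * (42 * n + 60) + 12" by simp
  qed (use s1 N_ge(4) N_less_K in \<open>auto simp: eok_def\<close>)
  show ?thesis unfolding read_bags_def
  proof (rule run_seqI[where ?b1.0 = 20 and ?Q1.0 = "?I 0"])
    have v: "val \<sigma> (Add (Add (V vb) (Const 2)) (Mul (Const 2) (V vk))) = pos 0" using sc inpD(8) by (simp add: scal_def)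
    have "bag_table n t (\<sigma> aC1) (\<sigma> aC2) (F 0)" using fresh by (simp add: bag_table_def F_def)
    then show "run (vpos ::= Add (Add (V vb) (Const 2)) (Mul (Const 2) (V vk))) \<sigma> 20 (?I 0)"
      using v inpD(9) bd by (intro run_block) (auto simp: eok_def)
  next
    fix \<sigma>1 assume s1: "bd \<sigma>1" "?I 0 \<sigma>1"
    show "run (For vi (V vt) (For vj (Load 0 (V vpos)) ?b ;; ?p)) \<sigma>1 (t * (42 * n + 60) + 12) (\<lambda>\<tau>. keeps ?S \<sigma> \<tau> \<and>
      (\<forall>v<n. \<forall>b<t. v \<in> B b \<longleftrightarrow> \<tau> aC1 v = Suc b \<or> \<tau> aC2 v = Suc b) \<and> (\<forall>v<n. \<tau> aC1 v \<le> t \<and> \<tau> aC2 v \<le> t))"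
    proof (rule run_conseq[OF loop[OF s1] order_refl])
      fix \<tau> assume t: "?I t \<tau>"
      then have bt: "\<And>v. v < n \<Longrightarrow> F t v = {b. \<tau> aC1 v = Suc b \<or> \<tau> aC2 v = Suc b} \<and> \<tau> aC1 v \<le> t \<and> \<tau> aC2 v \<le> t"
        by (simp add: bag_table_def)
      have "v \<in> B b \<longleftrightarrow> \<tau> aC1 v = Suc b \<or> \<tau> aC2 v = Suc b" if "v < n" "b < t" for v b
      proof -
        have "v \<in> B b \<longleftrightarrow> b \<in> F t v" using that by (simp add: F_def)
        then show ?thesis using bt[OF that(1)] by simp
      qed
      then show "keeps ?S \<sigma> \<tau> \<and> (\<forall>v<n. \<forall>b<t. v \<in> B b \<longleftrightarrow> \<tau> aC1 v = Suc b \<or> \<tau> aC2 v = Suc b) \<and> (\<forall>v<n. \<tau> aC1 v \<le> t \<and> \<tau> aC2 v \<le> t)"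
        using t bt by blast
    qed
  next
    have "t * n \<le> N * N" using N_ge(3,4) by (intro mult_le_mono) auto
    moreover have "t \<le> N * N" using N_ge(1,4) square_bound[of N] by linarith
    moreover have "t * (42 * n + 60) = 42 * (t * n) + 60 * t" by (simp add: algebra_simps)
    moreover have "4 \<le> N * N" using N_ge(1) mult_le_mono[of 2 N 2 N] by simp
    ultimately show "20 + (t * (42 * n + 60) + 12) \<le> 120 * (N * N)" by linarith
  qed
qed

lemma run_read_terminals:
  assumes bd: "bd \<sigma>" and sc: "scal \<sigma>" and fresh: "\<And>x. \<sigma> aTm x = 0"
  shows "run read_terminals \<sigma> (100 * (N * N)) (\<lambda>\<tau>. keeps {vs, vi, aTm} \<sigma> \<tau> \<and>
    (\<forall>s<2. \<forall>v<n. \<tau> aTm (s * n + v) \<noteq> 0 \<longleftrightarrow> v \<in> tm s ` {..<k}))"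
proof -
  let ?S = "{vs, vi, aTm}"
  let ?I = "\<lambda>s \<tau>. keeps ?S \<sigma> \<tau> \<and> (\<forall>x. \<tau> aTm x \<noteq> 0 \<longleftrightarrow> (\<exists>s'<s. \<exists>i<k. x = s' * n + tm s' i))"
  let ?b = "Store aTm (Add (Mul (V vs) (V vn)) rootE) (Const 1)"
  show ?thesis unfolding read_terminals_def
  proof (rule run_for[where I = ?I and m = 2 and c = "52 * k + 12"])
    fix s \<tau> assume s: "s < 2" "bd \<tau>" "\<tau> vs 0 = s" "?I s \<tau>"
    let ?J = "\<lambda>i \<tau>. keeps ?S \<sigma> \<tau> \<and> \<tau> vs 0 = s \<and>
       (\<forall>x. \<tau> aTm x \<noteq> 0 \<longleftrightarrow> (\<exists>s'<s. \<exists>i<k. x = s' * n + tm s' i) \<or> (\<exists>i'<i. x = s * n + tm s i'))"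
    show "run (For vi (V vk) ?b) \<tau> (52 * k + 12) (\<lambda>\<tau>'. \<tau>' vs 0 = s \<and> ?I (Suc s) (\<tau>'(vs := (\<tau>' vs)(0 := Suc s))))"
    proof (rule run_for[where I = ?J and m = k and c = 40])
      fix i \<rho> assume i: "i < k" "bd \<rho>" "\<rho> vi 0 = i" "?J i \<rho>"
      have scr: "scal \<rho>" using scal_keeps[of ?S \<sigma> \<rho>] i sc by simp
      have v: "val \<rho> (Add (Mul (V vs) (V vn)) rootE) = s * n + tm s i"
        using scr i inpD(5)[OF s(1) i(1)] by (simp add: scal_def)
      have st: "stp ?b \<rho> = \<rho>(aTm := (\<rho> aTm)(s * n + tm s i := 1))" using v by simp
      show "run ?b \<rho> 40 (\<lambda>\<tau>'. \<tau>' vi 0 = i \<and> ?J (Suc i) (\<tau>'(vi := (\<tau>' vi)(0 := Suc i))))"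
      proof (rule run_block[OF _ i(2)])
        have "\<forall>x. ((\<rho> aTm)(s * n + tm s i := 1)) x \<noteq> 0 \<longleftrightarrow> (\<exists>s'<s. \<exists>i<k. x = s' * n + tm s' i) \<or> (\<exists>i'<Suc i. x = s * n + tm s i')"
          using i(4) by (auto simp: less_Suc_eq)
        then show "stp ?b \<rho> vi 0 = i \<and> ?J (Suc i) ((stp ?b \<rho>)(vi := (stp ?b \<rho> vi)(0 := Suc i)))"
          unfolding st using i by simp
      qed (use K100 in \<open>auto simp: eok_def\<close>)
    next
      fix \<rho> assume r: "bd \<rho>" "?J k \<rho>"
      then have "\<forall>x. \<rho> aTm x \<noteq> 0 \<longleftrightarrow> (\<exists>s'<Suc s. \<exists>i<k. x = s' * n + tm s' i)" by (auto simp: less_Suc_eq)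
      then show "\<rho> vs 0 = s \<and> ?I (Suc s) (\<rho>(vs := (\<rho> vs)(0 := Suc s)))" using r by simp
    next
      show "?J 0 (\<tau>(vi := (\<tau> vi)(0 := 0)))" using s by simp
      show "val \<rho> (V vk) = k" if "?J j \<rho>" for j \<rho>
      proof -
        have "\<rho> vk = \<sigma> vk" using that by (simp add: keeps_def)
        then show ?thesis using sc by (simp add: scal_def)
      qed
    qed (use s N_ge(5) N_less_K in \<open>auto simp: eok_def\<close>)
  next
    fix \<tau> assume t: "bd \<tau>" "?I 2 \<tau>"
    have "\<tau> aTm (s * n + v) \<noteq> 0 \<longleftrightarrow> v \<in> tm s ` {..<k}" if "s < 2" "v < n" for s v
    proof -
      have "s * n + v = s' * n + tm s' i \<longleftrightarrow> s = s' \<and> v = tm s' i" if "s' < 2" "i < k" for s' i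
        using matrix_index_eq[OF \<open>v < n\<close> tm_lt[OF that]] .
      then have "(\<exists>s'<2. \<exists>i<k. s * n + v = s' * n + tm s' i) \<longleftrightarrow> (\<exists>i<k. v = tm s i)" using that(1) by blast
      then show ?thesis using t(2) by auto
    qed
    then show "keeps ?S \<sigma> \<tau> \<and> (\<forall>s<2. \<forall>v<n. \<tau> aTm (s * n + v) \<noteq> 0 \<longleftrightarrow> v \<in> tm s ` {..<k})" using t by blast
  next
    have "5 * k \<le> N * N" using N_ge(3) kn square_bound[of N] by linarith
    moreover have "2 \<le> N" by (rule N_ge(1))
    then have "4 \<le> N * N" using mult_le_mono[of 2 N 2 N] by simp
    moreover have "2 * (52 * k + 12 + cost (Const 2) + 10) + cost (Const 2) + 10 \<le> 100 * x" if "5 * k \<le> x" "4 \<le> x" for x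
      using that by simp
    ultimately show "2 * (52 * k + 12 + cost (Const 2) + 10) + cost (Const 2) + 10 \<le> 100 * (N * N)" by blast
  next
    show "?I 0 (\<sigma>(vs := (\<sigma> vs)(0 := 0)))" using fresh by simp
  qed (use bd K100 in \<open>auto simp: eok_def\<close>)
qed

lemma run_main:
  assumes bd: "bd \<sigma>" and X: "\<sigma> 0 = X" and fresh: "\<And>a x. a \<noteq> 0 \<Longrightarrow> \<sigma> a x = 0"
  shows "run main \<sigma> (20000 * (k * (k * (N * N)))) (\<lambda>\<sigma>'. \<exists>Ps. length Ps = k \<and>
    (\<forall>i<k. good_path {..<n} i (Ps ! i)) \<and> (\<forall>v. card {i. i < k \<and> v \<in> set (Ps ! i)} \<le> 2) \<and>
    (\<forall>x<length (words Ps). \<sigma>' 1 x = words Ps ! x))" (is "run main \<sigma> _ ?Q")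
proof -
  define M where "M = k * (k * (N * N))"
  have M: "N * N \<le> M" "k * (N * N) \<le> M" "4 \<le> M"
  proof -
    have "1 * (N * N) \<le> k * (N * N)" "1 * (k * (N * N)) \<le> k * (k * (N * N))" using k_pos by (intro mult_le_mono1; simp)+
    moreover have "4 \<le> N * N" using N_ge(1) mult_le_mono[of 2 N 2 N] by simp
    ultimately show "N * N \<le> M" "k * (N * N) \<le> M" "4 \<le> M" unfolding M_def by linarith+
  qed
  let ?A1 = "{vn, ve, vb, vk, vt, vN, aSt}"
  let ?A2 = "?A1 \<union> {vj, vu, vv, aD}"
  let ?A3 = "?A2 \<union> {vi, vpos, aC1, aC2}"
  let ?A4 = "?A3 \<union> {vs, aTm}"
  \<comment> \<open>The output phase for arbitrary results of the two linkings. The sets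
    \<open>U i\<close> confine the solution paths, and their load bounds that of the paths.\<close>
  have fin: "run (For vi (V vk) outp) \<sigma>8 (1100 * (k * (N * N))) ?Q"
    if s8: "bd \<sigma>8" "stat \<sigma>8" "\<sigma>8 vs 0 = Suc 0" "\<sigma>8 vo 0 = 0" "labelled 0 p1 z1 \<sigma>8" "labelled (Suc 0) p2 z2 \<sigma>8"
      and lk: "linked 0 st p1 z1" "linked (Suc 0) st p2 z2" for \<sigma>8 st p1 z1 p2 z2
  proof -
    define U where "U = (\<lambda>i. set (p1 i) \<union> set (p2 i) \<union> B (z1 i) \<union> B (z2 i))"
    note l1 = lk(1)[unfolded linked_def] and l2 = lk(2)[unfolded linked_def]
    have z: "z1 i < t \<and> z2 i < t" if "i < k" for i using l1 l2 that by blast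
    have Un: "U i \<subseteq> {..<n}" if "i < k" for i
    proof -
      have "set (p1 i) \<subseteq> {..<n}" "set (p2 i) \<subseteq> {..<n}" using l1 l2 that by blast+
      then show ?thesis using bag_sub z[OF that] by (auto simp: U_def)
    qed
    have t0: "tm 0 i \<in> U i" if "i < k" for i
    proof -
      have "p1 i \<noteq> []" "hd (p1 i) = tm 0 i" using l1 that by blast+
      then have "tm 0 i \<in> set (p1 i)" using hd_in_set[of "p1 i"] by simp
      then show ?thesis by (simp add: U_def)
    qed
    have path: "(tm 0 i, tm (Suc 0) i) \<in> (Ed \<inter> U i \<times> U i)\<^sup>*" if i: "i < k" for i
    proof -
      have "(hd (p1 i), hd (p2 i)) \<in> (Ed \<inter> U i \<times> U i)\<^sup>*"
      proof (rule union_path)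
        show "p1 i \<noteq> []" "p2 i \<noteq> []" "last (p1 i) \<in> B (z1 i)" "last (p2 i) \<in> B (z2 i)" "z1 i < t" "z2 i < t"
          using l1 l2 i by blast+
        show "(p1 i ! l, p1 i ! Suc l) \<in> Ed" if "Suc l < length (p1 i)" for l
        proof -
          have "(p1 i ! l, p1 i ! Suc l) \<in> Eds 0" using l1 i that by blast
          then show ?thesis by (simp add: Eds_def)
        qed
        show "(p2 i ! Suc l, p2 i ! l) \<in> Ed" if "Suc l < length (p2 i)" for l
        proof -
          have "(p2 i ! l, p2 i ! Suc l) \<in> Eds (Suc 0)" using l2 i that by blast
          then show ?thesis by (simp add: Eds_def)
        qed
        show "set (p1 i) \<union> set (p2 i) \<union> B (z1 i) \<union> B (z2 i) \<subseteq> U i" by (simp add: U_def)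
      qed
      moreover have "hd (p1 i) = tm 0 i" "hd (p2 i) = tm (Suc 0) i" using l1 l2 i by blast+
      ultimately show ?thesis by simp
    qed
    have load: "card {i. i < k \<and> v \<in> U i} \<le> 2" for v
      unfolding U_def
    proof (rule load_le_2)
      show "inj_on z1 {..<k}" "inj_on z2 {..<k}" using l1 l2 by blast+
      show "z1 i \<noteq> z2 j" if "i < k" "j < k" for i j
      proof -
        have "half 0 (z1 i)" "half (Suc 0) (z2 j)" using l1 l2 that by blast+
        then show ?thesis by (auto simp: half_def)
      qed
      show "z1 i < t \<and> st (z1 i) = 0 \<and> z2 i < t \<and> st (z2 i) = 0" if "i < k" for i using l1 l2 that by blast
      show "i = j" if "i < k" "j < k" "v \<in> set (p1 i)" "v \<in> set (p1 j)" for i j v using l1 that by blast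
      show "i = j" if "i < k" "j < k" "v \<in> set (p2 i)" "v \<in> set (p2 j)" for i j v using l2 that by blast
      show "v \<in> B (z1 i) \<or> allowed st 1 v" if "i < k" "v \<in> set (p1 i)" for i v
        using l1 that unfolding One_nat_def by blast
      show "v \<in> B (z2 i) \<or> allowed st 2 v" if "i < k" "v \<in> set (p2 i)" for i v
        using l2 that unfolding numeral_2_eq_2 by blast
    qed
    show ?thesis
    proof (rule run_conseq[OF run_outputs[OF s8(1-3,5,6) z U_def _ path s8(4)] order_refl])
      show "U i \<subseteq> {..<n} \<and> tm 0 i \<in> U i" if "i < k" for i using Un t0 that by blast
    next
      fix \<sigma>' :: memory assume "\<exists>Ps. length Ps = k \<and> (\<forall>i<k. good_path (U i) i (Ps ! i)) \<and> (\<forall>x<length (words Ps). \<sigma>' 1 x = words Ps ! x)"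
      then obtain Ps where Ps: "length Ps = k" "\<forall>i<k. good_path (U i) i (Ps ! i)" "\<forall>x<length (words Ps). \<sigma>' 1 x = words Ps ! x" by blast
      have "card {i. i < k \<and> v \<in> set (Ps ! i)} \<le> 2" for v
      proof -
        have "{i. i < k \<and> v \<in> set (Ps ! i)} \<subseteq> {i. i < k \<and> v \<in> U i}" using Ps(2) by (auto simp: good_path_def)
        then have "card {i. i < k \<and> v \<in> set (Ps ! i)} \<le> card {i. i < k \<and> v \<in> U i}" by (intro card_mono) auto
        then show ?thesis using load[of v] by linarith
      qed
      moreover have "good_path {..<n} i (Ps ! i)" if "i < k" for i using Ps(2) Un[OF that] that unfolding good_path_def by blast
      ultimately show "?Q \<sigma>'" using Ps by blast
    qed
  qed
  show ?thesis unfolding main_def M_def[symmetric]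
  proof (rule run_seqI[OF run_read_scalars[OF bd X]])
    fix \<sigma>1 assume a1: "bd \<sigma>1" "keeps ?A1 \<sigma> \<sigma>1 \<and> scal \<sigma>1 \<and> \<sigma>1 aSt = (\<sigma> aSt)(0 := 3)"
    have f1: "\<sigma>1 aD x = 0" for x using a1 fresh by (simp add: keeps_def)
    show "run (read_arcs ;; read_bags ;; read_terminals ;; fans ;; vs ::= Const 0 ;; link ;; vs ::= Const 1 ;; link ;; For vi (V vk) outp) \<sigma>1 (19000 * M) ?Q"
    proof (rule run_seqI[OF run_read_arcs[OF a1(1) _ f1]])
      show "scal \<sigma>1" using a1 by blast
      fix \<sigma>2 assume a2: "bd \<sigma>2" "keeps {vj, vu, vv, aD} \<sigma>1 \<sigma>2 \<and>
        (\<forall>s<2. \<forall>u<n. \<forall>v<n. \<sigma>2 aD (s * (n * n) + u * n + v) \<noteq> 0 \<longleftrightarrow> (u, v) \<in> Eds s)"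
      have k2: "keeps ?A2 \<sigma> \<sigma>2" using a1 a2 by (auto simp: keeps_def)
      have sc2: "scal \<sigma>2" using scal_keeps[of "{vj, vu, vv, aD}" \<sigma>1 \<sigma>2] a1 a2 by simp
      have f2: "\<sigma>2 aC1 x = 0" "\<sigma>2 aC2 x = 0" for x using k2 fresh by (simp_all add: keeps_def)
      show "run (read_bags ;; read_terminals ;; fans ;; vs ::= Const 0 ;; link ;; vs ::= Const 1 ;; link ;; For vi (V vk) outp) \<sigma>2 (18000 * M) ?Q"
      proof (rule run_seqI[OF run_read_bags[OF a2(1) sc2 f2]])
        fix \<sigma>3 assume a3: "bd \<sigma>3" "keeps {vi, vj, vv, vpos, aC1, aC2} \<sigma>2 \<sigma>3 \<and>
          (\<forall>v<n. \<forall>b<t. v \<in> B b \<longleftrightarrow> \<sigma>3 aC1 v = Suc b \<or> \<sigma>3 aC2 v = Suc b) \<and> (\<forall>v<n. \<sigma>3 aC1 v \<le> t \<and> \<sigma>3 aC2 v \<le> t)"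
        have k3: "keeps ?A3 \<sigma> \<sigma>3" using k2 a3 by (auto simp: keeps_def)
        have sc3: "scal \<sigma>3" using scal_keeps[of "{vi, vj, vv, vpos, aC1, aC2}" \<sigma>2 \<sigma>3] sc2 a3 by simp
        have f3: "\<sigma>3 aTm x = 0" for x using k3 fresh by (simp add: keeps_def)
        show "run (read_terminals ;; fans ;; vs ::= Const 0 ;; link ;; vs ::= Const 1 ;; link ;; For vi (V vk) outp) \<sigma>3 (17000 * M) ?Q"
        proof (rule run_seqI[OF run_read_terminals[OF a3(1) sc3 f3]])
          fix \<sigma>4 assume a4: "bd \<sigma>4" "keeps {vs, vi, aTm} \<sigma>3 \<sigma>4 \<and> (\<forall>s<2. \<forall>v<n. \<sigma>4 aTm (s * n + v) \<noteq> 0 \<longleftrightarrow> v \<in> tm s ` {..<k})"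
          have k4: "keeps ?A4 \<sigma> \<sigma>4" using k3 a4 by (auto simp: keeps_def)
          have sc4: "scal \<sigma>4" using scal_keeps[of "{vs, vi, aTm}" \<sigma>3 \<sigma>4] sc3 a4 by simp
          have e4: "\<sigma>4 aD = \<sigma>2 aD" "\<sigma>4 aC1 = \<sigma>3 aC1" "\<sigma>4 aC2 = \<sigma>3 aC2" "\<sigma>4 aSt = \<sigma>1 aSt"
            using a2 a3 a4 by (simp_all add: keeps_def)
          have st4: "stat \<sigma>4" unfolding stat_def e4 using sc4 a2 a3 a4 inpD(5) by (simp add: scal_def)
          have z4: "\<sigma>4 aSt 0 = 3" "stf \<sigma>4 b = 0" for b using e4(4) a1 fresh by (simp_all add: stf_def)
          have fr4: "\<sigma>4 aLab x = 0" "\<sigma>4 vo 0 = 0" for x using k4 fresh by (simp_all add: keeps_def)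
          show "run (fans ;; vs ::= Const 0 ;; link ;; vs ::= Const 1 ;; link ;; For vi (V vk) outp) \<sigma>4 (16000 * M) ?Q"
          proof (rule run_seqI[OF run_fans[OF a4(1) st4 z4]])
            fix \<sigma>5 assume a5: "bd \<sigma>5" "keeps (fan_regs \<union> {vi, vs}) \<sigma>4 \<sigma>5 \<and> card (used (stf \<sigma>5)) \<le> 24 * k ^ 2 \<and>
              (\<forall>s<2. \<forall>i<k. bag_graph.robust n t B k (Eds s) (stf \<sigma>5) (Suc s) (tm s i)) \<and> \<sigma>5 aSt 0 = 3"
            have st5: "stat \<sigma>5" using stat_keeps[of "fan_regs \<union> {vi, vs}" \<sigma>4 \<sigma>5] a5 st4 by auto
            have fr5: "\<sigma>5 aLab x = 0" "\<sigma>5 vo 0 = 0" for x using a5 fr4 by (simp_all add: keeps_def)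
            \<comment> \<open>Linking does not write \<open>aSt\<close>. Both sides are therefore
              linked against the same state, which is what \<open>load_le_2\<close>
              requires.\<close>
            define S5 where "S5 = stf \<sigma>5"
            define \<sigma>6 where "\<sigma>6 = \<sigma>5(vs := (\<sigma>5 vs)(0 := 0))"
            have b6: "bd \<sigma>6" using a5 by (simp add: \<sigma>6_def bd_upd)
            have st6: "stat \<sigma>6" "stf \<sigma>6 = S5" "\<sigma>6 vs 0 = 0" "\<sigma>6 aSt 0 = 3" "\<sigma>6 vo 0 = 0"
              using st5 a5 fr5 by (simp_all add: \<sigma>6_def S5_def)
            have fr6: "\<sigma>6 aLab x = 0" for x using fr5 by (simp add: \<sigma>6_def)
            have few: "card (used S5) \<le> 24 * k ^ 2" using a5 by (simp add: S5_def)
            have rob: "bag_graph.robust n t B k (Eds s) S5 (Suc s) (tm s i)" if "s < 2" "i < k" for s i using a5 that by (simp add: S5_def)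
            have link2: "run (link ;; For vi (V vk) outp) \<sigma>7 (2700 * M) ?Q"
              if s7: "bd \<sigma>7" "stat \<sigma>7" "stf \<sigma>7 = S5" "\<sigma>7 vs 0 = Suc 0" "\<sigma>7 aSt 0 = 3" "\<sigma>7 vo 0 = 0"
                "linked 0 S5 p1 z1" "labelled 0 p1 z1 \<sigma>7" "\<And>v. v < n \<Longrightarrow> \<sigma>7 aLab (n + v) = 0" for \<sigma>7 p1 z1
            proof (rule run_seqI[OF run_link[OF s7(1,2,4) _ s7(5)]])
              show "Suc 0 < 2" by simp
              show "card (used (stf \<sigma>7)) \<le> 24 * k ^ 2" using few s7(3) by simp
              show "bag_graph.robust n t B k (Eds (Suc 0)) (stf \<sigma>7) (Suc (Suc 0)) (tm (Suc 0) i)" if "i < k" for i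
                using rob[of "Suc 0" i] that s7(3) by simp
              show "\<sigma>7 aLab (Suc 0 * n + v) = 0" if "v < n" for v using s7(9)[OF that] by simp
            next
              fix \<sigma>8 assume a8: "bd \<sigma>8" "keeps link_regs \<sigma>7 \<sigma>8 \<and> (\<exists>p w. linked (Suc 0) (stf \<sigma>7) p w \<and> labelled (Suc 0) p w \<sigma>8) \<and>
                (\<forall>x. \<not> (Suc 0 * n \<le> x \<and> x < Suc 0 * n + n) \<longrightarrow> \<sigma>8 aLab x = \<sigma>7 aLab x) \<and>
                (\<forall>x. \<not> (Suc 0 * k \<le> x \<and> x < Suc 0 * k + k) \<longrightarrow> \<sigma>8 aZ x = \<sigma>7 aZ x)"
              then obtain p2 z2 where p2: "linked (Suc 0) S5 p2 z2" "labelled (Suc 0) p2 z2 \<sigma>8" using s7(3) by auto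
              have "stat \<sigma>8" "\<sigma>8 vs 0 = Suc 0" "\<sigma>8 vo 0 = 0" using a8 s7 stat_keeps[of link_regs \<sigma>7 \<sigma>8] by (auto simp: keeps_def)
              \<comment> \<open>The second linking writes only the upper segments of
                \<open>aLab\<close> and \<open>aZ\<close>, from \<open>n\<close> and
                \<open>k\<close> on.\<close>
              moreover have "labelled 0 p1 z1 \<sigma>8" using s7(8) a8 by (auto simp: labelled_def)
              ultimately show "run (For vi (V vk) outp) \<sigma>8 (1100 * (k * (N * N))) ?Q"
                using fin[OF a8(1) _ _ _ _ p2(2) s7(7) p2(1)] by blast
            next
              show "1500 * (k * (N * N)) + 1100 * (k * (N * N)) \<le> 2700 * M" using M by linarith
            qed
            have mid: "run (vs ::= Const 1 ;; link ;; For vi (V vk) outp) \<tau> (2800 * M) ?Q"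
              if s7: "bd \<tau>" "keeps link_regs \<sigma>6 \<tau> \<and> (\<exists>p w. linked 0 (stf \<sigma>6) p w \<and> labelled 0 p w \<tau>) \<and>
                (\<forall>x. \<not> (0 * n \<le> x \<and> x < 0 * n + n) \<longrightarrow> \<tau> aLab x = \<sigma>6 aLab x) \<and>
                (\<forall>x. \<not> (0 * k \<le> x \<and> x < 0 * k + k) \<longrightarrow> \<tau> aZ x = \<sigma>6 aZ x)" for \<tau>
            proof -
              obtain p1 z1 where p1: "linked 0 S5 p1 z1" "labelled 0 p1 z1 \<tau>" using s7(2) st6(2) by auto
              define \<sigma>7 where "\<sigma>7 = \<tau>(vs := (\<tau> vs)(0 := Suc 0))"
              have kt: "keeps link_regs \<sigma>6 \<tau>" using s7 by blast
              have stt: "stat \<tau>" "stf \<tau> = S5" "\<tau> aSt 0 = 3" "\<tau> vo 0 = 0"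
                using stat_keeps[OF kt] stf_keeps[OF kt] kt st6 by (auto simp: keeps_def)
              have b7: "bd \<sigma>7" using s7 K100 by (simp add: \<sigma>7_def bd_upd)
              have "run (link ;; For vi (V vk) outp) \<sigma>7 (2700 * M) ?Q"
              proof (rule link2[OF b7 _ _ _ _ _ p1(1)])
                show "labelled 0 p1 z1 \<sigma>7" using p1(2) by (simp add: \<sigma>7_def labelled_def)
                show "\<sigma>7 aLab (n + v) = 0" if "v < n" for v using s7(2) fr6 by (simp add: \<sigma>7_def)
              qed (use stt in \<open>simp_all add: \<sigma>7_def\<close>)
              then have "run (vs ::= Const 1) \<tau> 4 (\<lambda>\<sigma>'. run (link ;; For vi (V vk) outp) \<sigma>' (2700 * M) ?Q)"
                using s7(1) K100 by - (rule run_block, auto simp: eok_def \<sigma>7_def)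
              then show ?thesis by (rule run_seq) (use M in linarith)
            qed
            have "run (link ;; vs ::= Const 1 ;; link ;; For vi (V vk) outp) \<sigma>6 (4500 * M) ?Q"
            proof (rule run_seqI[OF run_link[OF b6 st6(1,3) _ st6(4)] mid])
              show "(0::nat) < 2" by simp
              show "card (used (stf \<sigma>6)) \<le> 24 * k ^ 2" using few st6(2) by simp
              show "bag_graph.robust n t B k (Eds 0) (stf \<sigma>6) (Suc 0) (tm 0 i)" if "i < k" for i
                using rob[of 0 i] that st6(2) by simp
              show "\<sigma>6 aLab (0 * n + v) = 0" if "v < n" for v using fr6 by simp
              show "1500 * (k * (N * N)) + 2800 * M \<le> 4500 * M" using M by linarith
            qed
            then have "run (vs ::= Const 0) \<sigma>5 4 (\<lambda>\<sigma>'. run (link ;; vs ::= Const 1 ;; link ;; For vi (V vk) outp) \<sigma>' (4500 * M) ?Q)"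
              using a5(1) K100 by - (rule run_block, auto simp: eok_def \<sigma>6_def)
            then show "run (vs ::= Const 0 ;; link ;; vs ::= Const 1 ;; link ;; For vi (V vk) outp) \<sigma>5 (4600 * M) ?Q"
              by (rule run_seq) (use M in linarith)
          next
            show "8000 * (k * (k * (N * N))) + 4600 * M \<le> 16000 * M" unfolding M_def[symmetric] by simp
          qed
        next
          show "100 * (N * N) + 16000 * M \<le> 17000 * M" using M by linarith
        qed
      next
        show "120 * (N * N) + 17000 * M \<le> 18000 * M" using M by linarith
      qed
    next
      show "80 * (N * N) + 18000 * M \<le> 19000 * M" using M by linarith
    qed
  next
    show "80 + 19000 * M \<le> 20000 * M" using M by linarith
  qed
qed

end

end

section \<open>From digraphs to the algorithm\<close>

text \<open>Bags are nonempty and every vertex lies in at most two of them. This bounds the size of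
  the network, and with it the running time, in terms of \<open>n\<close>.\<close>

lemma (in bag_system) number_of_bags: "t \<le> 2 * n"
proof -
  have "{..<t} \<subseteq> (\<Union>v\<in>{..<n}. {b. b < t \<and> v \<in> B b})"
  proof
    fix b assume "b \<in> {..<t}"
    moreover from this obtain v where "v \<in> B b" using bag_ne[of b] by auto
    ultimately show "b \<in> (\<Union>v\<in>{..<n}. {b. b < t \<and> v \<in> B b})" using bag_sub[of b] by auto
  qed
  then have "card {..<t} \<le> card (\<Union>v\<in>{..<n}. {b. b < t \<and> v \<in> B b})" by (intro card_mono) auto
  also have "\<dots> \<le> (\<Sum>v\<in>{..<n}. card {b. b < t \<and> v \<in> B b})" by (rule card_UN_le) simp
  also have "\<dots> \<le> (\<Sum>v\<in>{..<n}. 2)" using depth by (intro sum_mono) auto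
  finally show ?thesis by simp
qed

definition numbered_arcs :: "('a \<Rightarrow> nat) \<Rightarrow> 'a pair_pre_digraph \<Rightarrow> (nat \<times> nat) set" where
  "numbered_arcs \<nu> G = (\<lambda>(u, v). (\<nu> u, \<nu> v)) ` parcs G"

lemma vwalk_arcs_subset:
  "(\<And>l. Suc l < length p \<Longrightarrow> (p ! l, p ! Suc l) \<in> A) \<Longrightarrow> set (vwalk_arcs p) \<subseteq> A"
proof (induction p rule: vwalk_arcs.induct)
  case (3 x y xs)
  have "(x, y) \<in> A" using "3.prems"[of 0] by simp
  moreover have "set (vwalk_arcs (y # xs)) \<subseteq> A"
  proof (rule "3.IH")
    fix l assume "Suc l < length (y # xs)"
    then show "((y # xs) ! l, (y # xs) ! Suc l) \<in> A" using "3.prems"[of "Suc l"] by simp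
  qed
  ultimately show ?case by simp
qed simp_all

lemma rtrancl_on_numbered:
  assumes "(x, y) \<in> rtrancl_on F r" "r \<subseteq> F \<times> F" "r \<subseteq> parcs G"
  shows "(\<nu> x, \<nu> y) \<in> (numbered_arcs \<nu> G \<inter> \<nu> ` F \<times> \<nu> ` F)\<^sup>*"
proof -
  have "(x, y) \<in> r\<^sup>*" using assms(1) by (rule rtrancl_on_rtranclI)
  then show ?thesis
  proof induction
    case (step b c)
    then have "(\<nu> b, \<nu> c) \<in> numbered_arcs \<nu> G"
      using assms(3) unfolding numbered_arcs_def by (intro image_eqI[of _ _ "(b, c)"]) auto
    moreover have "b \<in> F" "c \<in> F" using step assms(2) by auto
    ultimately have "(\<nu> b, \<nu> c) \<in> numbered_arcs \<nu> G \<inter> \<nu> ` F \<times> \<nu> ` F" by simp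
    then show ?case using step.IH by (meson rtrancl.rtrancl_into_rtrancl)
  qed simp
qed

section \<open>Encoded digraphs as seen in the input memory\<close>

lemma input_memory_nth:
  "xs = A @ ys @ C \<Longrightarrow> j < length ys \<Longrightarrow> input_memory xs 0 (length A + j) = ys ! j"
  by (simp add: input_memory_def nth_append)

lemma length_flat_pairs: "length (concat (map (\<lambda>(u, v). [f u, f v]) es)) = 2 * length es"
  by (induction es) auto

lemma nth_flat_pairs:
  assumes "j < length es"
  shows "concat (map (\<lambda>(u, v). [f u, f v]) es) ! (2 * j) = f (fst (es ! j))"
    "concat (map (\<lambda>(u, v). [f u, f v]) es) ! Suc (2 * j) = f (snd (es ! j))"
  using assms
proof (induction es arbitrary: j)
  case (Cons p es)
  { case 1 then show ?case using Cons.IH(1) by (cases j; cases p) auto }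
  { case 2 then show ?case using Cons.IH(2) by (cases j; cases p) auto }
qed simp_all

lemma length_concat_le:
  "(\<And>ys. ys \<in> set yss \<Longrightarrow> length ys \<le> m) \<Longrightarrow> length (concat yss) \<le> length yss * m"
  by (induction yss) (auto simp: add_mono)

lemma concat_split_nth:
  "b < length yss \<Longrightarrow> concat yss = concat (take b yss) @ yss ! b @ concat (drop (Suc b) yss)"
  by (subst id_take_nth_drop[of b yss]) simp_all

text \<open>Address arithmetic for one digraph encoded at position \<open>q\<close>; it serves for
  the graph itself, with \<open>q = 0\<close>, and for every bag.\<close>

lemma encodes_digraph_memory:
  assumes enc: "encodes_digraph \<nu> H ys" and xs: "xs = A @ ys @ C" and q: "q = length A"
  defines "X \<equiv> input_memory xs 0" and "nv \<equiv> card (pverts H)" and "ne \<equiv> card (parcs H)"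
  shows "X q = nv" "X (q + 1) = ne" "length ys = 2 + nv + 2 * ne"
    "(\<lambda>j. X (q + 2 + j)) ` {..<nv} = \<nu> ` pverts H"
    "inj_on \<nu> (pverts H) \<Longrightarrow> inj_on (\<lambda>j. X (q + 2 + j)) {..<nv}"
    "(\<lambda>j. (X (q + 2 + nv + 2 * j), X (q + 3 + nv + 2 * j))) ` {..<ne} = numbered_arcs \<nu> H"
proof -
  obtain vs es where vs: "distinct vs" "set vs = pverts H" and es: "distinct es" "set es = parcs H"
    and ys: "ys = [length vs, length es] @ map \<nu> vs @ concat (map (\<lambda>(u, v). [\<nu> u, \<nu> v]) es)"
    using enc unfolding encodes_digraph_def by blast
  let ?fl = "concat (map (\<lambda>(u, v). [\<nu> u, \<nu> v]) es)"
  have nv: "nv = length vs" and ne: "ne = length es"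
    using vs es distinct_card by (metis nv_def, metis ne_def)
  show len: "length ys = 2 + nv + 2 * ne" unfolding ys nv ne by (simp add: length_flat_pairs)
  have X: "X (q + j) = ys ! j" if "j < length ys" for j
    unfolding X_def q using input_memory_nth[OF xs that] .
  show "X q = nv" using X[of 0] len by (simp add: ys nv)
  show "X (q + 1) = ne" using X[of 1] len by (simp add: ys ne)
  have Xv: "X (q + 2 + j) = \<nu> (vs ! j)" if "j < nv" for j
    using X[of "2 + j"] len that by (simp add: ys nv nth_append add.assoc)
  have im: "(!) vs ` {..<nv} = pverts H" unfolding nv vs(2)[symmetric] by (auto simp: set_conv_nth)
  have "(\<lambda>j. X (q + 2 + j)) ` {..<nv} = \<nu> ` (!) vs ` {..<nv}" unfolding image_image using Xv by (intro image_cong) auto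
  then show "(\<lambda>j. X (q + 2 + j)) ` {..<nv} = \<nu> ` pverts H" unfolding im .
  show "inj_on (\<lambda>j. X (q + 2 + j)) {..<nv}" if inj: "inj_on \<nu> (pverts H)"
  proof (rule inj_onI)
    fix i j assume ij: "i \<in> {..<nv}" "j \<in> {..<nv}" "X (q + 2 + i) = X (q + 2 + j)"
    then have "\<nu> (vs ! i) = \<nu> (vs ! j)" using Xv by simp
    moreover have "vs ! i \<in> pverts H" "vs ! j \<in> pverts H" using ij im by blast+
    ultimately have "vs ! i = vs ! j" using inj by (meson inj_onD)
    then show "i = j" using ij vs(1) nv by (simp add: nth_eq_iff_index_eq)
  qed
  have Xe: "(X (q + 2 + nv + 2 * j), X (q + 3 + nv + 2 * j)) = (\<lambda>(u, v). (\<nu> u, \<nu> v)) (es ! j)" if j: "j < ne" for j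
  proof -
    have "X (q + (2 + nv + 2 * j)) = ?fl ! (2 * j)" using X[of "2 + nv + 2 * j"] len j
      by (simp add: ys nv nth_append)
    moreover have "X (q + (2 + nv + Suc (2 * j))) = ?fl ! Suc (2 * j)" using X[of "2 + nv + Suc (2 * j)"] len j
      by (simp add: ys nv nth_append)
    moreover have eq: "q + 2 + nv + 2 * j = q + (2 + nv + 2 * j)" "q + 3 + nv + 2 * j = q + (2 + nv + Suc (2 * j))" by simp_all
    ultimately show ?thesis unfolding eq using nth_flat_pairs[of j es \<nu>] j ne by (simp add: split_beta)
  qed
  have im: "(!) es ` {..<ne} = parcs H" unfolding ne es(2)[symmetric] by (auto simp: set_conv_nth)
  have "(\<lambda>j. (X (q + 2 + nv + 2 * j), X (q + 3 + nv + 2 * j))) ` {..<ne} = (\<lambda>(u, v). (\<nu> u, \<nu> v)) ` (!) es ` {..<ne}"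
    unfolding image_image using Xe by (intro image_cong) auto
  then show "(\<lambda>j. (X (q + 2 + nv + 2 * j), X (q + 3 + nv + 2 * j))) ` {..<ne} = numbered_arcs \<nu> H"
    unfolding im numbered_arcs_def .
qed

lemma encodes_digraph_entries:
  assumes "encodes_digraph \<nu> H ys" "x \<in> set ys"
  shows "x = card (pverts H) \<or> x = card (parcs H) \<or> x \<in> \<nu> ` (pverts H \<union> fst ` parcs H \<union> snd ` parcs H)"
proof -
  obtain vs es where vs: "distinct vs" "set vs = pverts H" and es: "distinct es" "set es = parcs H"
    and ys: "ys = [length vs, length es] @ map \<nu> vs @ concat (map (\<lambda>(u, v). [\<nu> u, \<nu> v]) es)"
    using assms(1) unfolding encodes_digraph_def by blast
  have "length vs = card (pverts H)" "length es = card (parcs H)" using vs es distinct_card by metis+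
  then show ?thesis using assms(2) unfolding ys by (force simp: vs(2) es(2))
qed

lemma encodes_digraph_exists:
  assumes "finite (pverts H)" "finite (parcs H)"
  shows "\<exists>ys. encodes_digraph \<nu> H ys"
  using finite_distinct_list[OF assms(1)] finite_distinct_list[OF assms(2)] unfolding encodes_digraph_def by blast

section \<open>Transfer of a linkage problem to numbered vertices and ordered bags\<close>

locale linkage_problem = pair_fin_digraph G for G :: "'a pair_pre_digraph" +
  fixes k n :: nat and Bs :: "'a pair_pre_digraph set" and S T :: "'a list" and \<nu> :: "'a \<Rightarrow> nat"
    and Hs :: "'a pair_pre_digraph list"
  assumes k_pos: "1 \<le> k" and n_def: "n = card (pverts G)"
    and conn: "strongly_m_connected (36 * k ^ 3 + 2 * k) G"
    and bramble: "bramble G Bs" and depth2: "depth_two Bs" and size: "card Bs = 60 * k ^ 2"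
    and inst: "linkage_instance k G S T" and num: "vertex_numbering G \<nu>"
    and Hs: "distinct Hs" "set Hs = Bs"
begin

abbreviation "t \<equiv> 60 * k ^ 2"
abbreviation "Bn \<equiv> \<lambda>b. \<nu> ` pverts (Hs ! b)"
abbreviation "En \<equiv> numbered_arcs \<nu> G"
definition tmn :: "nat \<Rightarrow> nat \<Rightarrow> nat" where "tmn s i = \<nu> ((if s = 0 then S else T) ! i)"
abbreviation "Nn \<equiv> Suc (Suc (2 * n + t))"

lemma bij: "bij_betw \<nu> (pverts G) {..<n}" using num by (simp add: vertex_numbering_def n_def)

lemma inj: "u \<in> pverts G \<Longrightarrow> v \<in> pverts G \<Longrightarrow> \<nu> u = \<nu> v \<longleftrightarrow> u = v"
  using bij by (auto simp: bij_betw_def inj_on_def)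

lemma nu_less: "v \<in> pverts G \<Longrightarrow> \<nu> v < n" using bij by (auto simp: bij_betw_def)

lemma nu_surj: "x < n \<Longrightarrow> \<exists>v\<in>pverts G. \<nu> v = x" using bij unfolding bij_betw_def by (metis imageE lessThan_iff)

lemma length_Hs: "length Hs = t" using distinct_card[OF Hs(1)] Hs(2) size by simp

lemma bag_in: "b < t \<Longrightarrow> Hs ! b \<in> Bs" using nth_mem[of b Hs] Hs(2) length_Hs by simp

lemma bag_subgraph:
  assumes "H \<in> Bs"
  shows "pverts H \<subseteq> pverts G" "parcs H \<subseteq> parcs G" "parcs H \<subseteq> pverts H \<times> pverts H" "pverts H \<noteq> {}"
    "\<And>u v. u \<in> pverts H \<Longrightarrow> v \<in> pverts H \<Longrightarrow> (u, v) \<in> rtrancl_on (pverts H) (parcs H)"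
proof -
  have sub: "subgraph (with_proj H) (with_proj G)" and sc: "strongly_connected (with_proj H)"
    using bramble assms by (auto simp: bramble_def)
  show "pverts H \<subseteq> pverts G" "parcs H \<subseteq> parcs G" using sub by (auto simp: subgraph_def)
  have "wf_digraph (with_proj H)" using sub by (auto simp: subgraph_def)
  then show "parcs H \<subseteq> pverts H \<times> pverts H" by (fastforce simp: wf_digraph_def)
  show "pverts H \<noteq> {}" using sc by (auto simp: strongly_connected_def)
  show "(u, v) \<in> rtrancl_on (pverts H) (parcs H)" if "u \<in> pverts H" "v \<in> pverts H" for u v
    using sc that by (auto simp: strongly_connected_def reachable_def)
qed

lemma k_le: "k \<le> k ^ 3" using k_pos by (auto simp: power3_eq_cube)

lemma n_ge: "39 \<le> n" "38 * k < n"
proof -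
  have "36 * k ^ 3 + 2 * k + 1 \<le> n" using conn by (simp add: strongly_m_connected_def n_def)
  then show "39 \<le> n" "38 * k < n" using k_le k_pos by linarith+
qed

lemma numbered_arc: "(u, v) \<in> parcs G \<Longrightarrow> (\<nu> u, \<nu> v) \<in> En"
  unfolding numbered_arcs_def by (intro image_eqI[of _ _ "(u, v)"]) auto

lemma numbered_arcD: "u \<in> pverts G \<Longrightarrow> v \<in> pverts G \<Longrightarrow> (\<nu> u, \<nu> v) \<in> En \<Longrightarrow> (u, v) \<in> parcs G"
proof -
  assume uv: "u \<in> pverts G" "v \<in> pverts G" "(\<nu> u, \<nu> v) \<in> En"
  then obtain x y where xy: "(x, y) \<in> parcs G" "\<nu> u = \<nu> x" "\<nu> v = \<nu> y" unfolding numbered_arcs_def by auto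
  then show ?thesis using uv inj in_arcsD1[OF xy(1)] in_arcsD2[OF xy(1)] by simp
qed

text \<open>Otherwise let \<open>R\<close> be the vertices reached from \<open>u\<close> outside
  \<open>C\<close>. Then \<open>R\<close> together with the deleted vertices on one side and
  everything outside \<open>R\<close> on the other form a nontrivial separation whose order is at
  most \<open>card C\<close>, and \<open>5 * k \<le> 36 * k ^ 3 + 2 * k\<close>.\<close>

lemma numbered_connected:
  assumes C: "finite C" "card C < 5 * k" and uv: "u < n" "v < n" "u \<notin> C" "v \<notin> C"
  shows "(u, v) \<in> (En \<inter> (- C) \<times> (- C))\<^sup>*"
proof (rule ccontr)
  assume no: "(u, v) \<notin> (En \<inter> (- C) \<times> (- C))\<^sup>*"
  let ?r = "(En \<inter> (- C) \<times> (- C))\<^sup>*"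
  obtain u' v' where u': "u' \<in> pverts G" "\<nu> u' = u" and v': "v' \<in> pverts G" "\<nu> v' = v" using nu_surj uv by metis
  define C' where "C' = {w \<in> pverts G. \<nu> w \<in> C}"
  define R where "R = {w \<in> pverts G. (u, \<nu> w) \<in> ?r}"
  have "inj_on \<nu> C'" using bij by (auto simp: bij_betw_def C'_def inj_on_def)
  then have cC: "card C' \<le> card C" using C(1) by (intro card_inj_on_le[of \<nu>]) (auto simp: C'_def)
  have finC': "finite C'" using finite_verts by (simp add: C'_def)
  have RC: "\<nu> w \<notin> C" if "w \<in> R" for w
  proof -
    have "(u, \<nu> w) \<in> ?r" using that by (simp add: R_def)
    then show ?thesis using uv(3) by (cases rule: rtranclE) auto
  qed
  let ?A = "R \<union> C'" and ?B = "pverts G - R"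
  have "separation G ?A ?B"
    unfolding separation_def
  proof (intro conjI notI)
    show "?A \<union> ?B = pverts G" by (auto simp: R_def C'_def)
    assume "\<exists>x\<in>?A - ?B. \<exists>y\<in>?B - ?A. (x, y) \<in> parcs G"
    then obtain x y where xy: "x \<in> R" "y \<in> pverts G" "y \<notin> R" "y \<notin> C'" "(x, y) \<in> parcs G" by (auto simp: C'_def)
    have "(\<nu> x, \<nu> y) \<in> En \<inter> (- C) \<times> (- C)" using numbered_arc[OF xy(5)] RC[OF xy(1)] xy(2,4) by (auto simp: C'_def)
    then have "y \<in> R" using xy(1,2) by (auto simp: R_def intro: rtrancl.rtrancl_into_rtrancl)
    then show False using xy(3) by simp
  qed
  moreover have "\<not> trivial_separation ?A ?B"
  proof -
    have "u' \<in> R" using u' by (simp add: R_def)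
    moreover have "v' \<notin> R" "v' \<notin> C'" using v' no uv by (auto simp: R_def C'_def)
    ultimately show ?thesis using u'(1) v'(1) by (auto simp: trivial_separation_def)
  qed
  moreover have "sep_order ?A ?B + 1 \<le> 36 * k ^ 3 + 2 * k"
  proof -
    have "?A \<inter> ?B \<subseteq> C'" by auto
    then have "sep_order ?A ?B \<le> card C'" unfolding sep_order_def using finC' by (rule card_mono[rotated])
    then show ?thesis using cC C(2) k_le k_pos by linarith
  qed
  ultimately show False using conn unfolding strongly_m_connected_def by blast
qed

lemma bag_system_n: "bag_system n t Bn"
proof
  fix b assume b: "b < t"
  note s = bag_subgraph[OF bag_in[OF b]]
  show "Bn b \<subseteq> {..<n}" using s(1) nu_less by auto
  show "Bn b \<noteq> {}" using s(4) by simp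
next
  fix v
  show "card {b. b < t \<and> v \<in> Bn b} \<le> 2"
  proof (cases "v < n")
    case True
    then obtain w where w: "w \<in> pverts G" "\<nu> w = v" using nu_surj by blast
    have "{b. b < t \<and> v \<in> Bn b} = {b. b < t \<and> w \<in> pverts (Hs ! b)}"
    proof -
      have "v \<in> Bn b \<longleftrightarrow> w \<in> pverts (Hs ! b)" if "b < t" for b
      proof
        assume "v \<in> Bn b"
        then obtain w' where w': "w' \<in> pverts (Hs ! b)" "\<nu> w' = v" by auto
        then have "w' \<in> pverts G" using bag_subgraph(1)[OF bag_in[OF that]] by auto
        then show "w \<in> pverts (Hs ! b)" using w' w inj by auto
      qed (use w in auto)
      then show ?thesis by blast
    qed
    \<comment> \<open>Bags are counted by index here and as digraphs in \<open>depth_two\<close>;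
      distinctness of \<open>Hs\<close> makes the two counts comparable.\<close>
    moreover have "card {b. b < t \<and> w \<in> pverts (Hs ! b)} \<le> card {H \<in> Bs. w \<in> pverts H}"
    proof (rule card_inj_on_le[of "\<lambda>b. Hs ! b"])
      show "inj_on (\<lambda>b. Hs ! b) {b. b < t \<and> w \<in> pverts (Hs ! b)}"
        using Hs(1) length_Hs by (auto simp: inj_on_def nth_eq_iff_index_eq)
      show "(\<lambda>b. Hs ! b) ` {b. b < t \<and> w \<in> pverts (Hs ! b)} \<subseteq> {H \<in> Bs. w \<in> pverts H}" using bag_in by auto
      show "finite {H \<in> Bs. w \<in> pverts H}" unfolding Hs(2)[symmetric] by simp
    qed
    moreover have "card {H \<in> Bs. w \<in> pverts H} \<le> 2"
    proof (rule ccontr)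
      assume "\<not> ?thesis"
      then have "\<exists>\<C>\<subseteq>Bs. card \<C> > 2 \<and> (\<forall>H\<in>\<C>. w \<in> pverts H)" by (intro exI[of _ "{H \<in> Bs. w \<in> pverts H}"]) auto
      then show False using depth2 by (auto simp: depth_two_def)
    qed
    ultimately show ?thesis by simp
  next
    case False
    have "v \<notin> Bn b" if "b < t" for b
    proof
      assume "v \<in> Bn b"
      then obtain w where "w \<in> pverts (Hs ! b)" "v = \<nu> w" by blast
      then have "v < n" using bag_subgraph(1)[OF bag_in[OF that]] nu_less by blast
      then show False using False by simp
    qed
    then have "{b. b < t \<and> v \<in> Bn b} = {}" by blast
    then show ?thesis by (simp only: card.empty)
  qed
qed

lemma touching:
  assumes "b < t" "b' < t"
  shows "\<exists>x\<in>Bn b. \<exists>y\<in>Bn b'. x = y \<or> (x, y) \<in> En" "\<exists>x\<in>Bn b. \<exists>y\<in>Bn b'. x = y \<or> (y, x) \<in> En"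
proof -
  let ?H = "Hs ! b" and ?K = "Hs ! b'"
  have "pverts ?H \<inter> pverts ?K \<noteq> {} \<or> ((\<exists>u\<in>pverts ?H. \<exists>v\<in>pverts ?K. (u, v) \<in> parcs G) \<and>
         (\<exists>u\<in>pverts ?K. \<exists>v\<in>pverts ?H. (u, v) \<in> parcs G))"
    using bramble bag_in[OF assms(1)] bag_in[OF assms(2)] unfolding bramble_def by blast
  then show "\<exists>x\<in>Bn b. \<exists>y\<in>Bn b'. x = y \<or> (x, y) \<in> En" "\<exists>x\<in>Bn b. \<exists>y\<in>Bn b'. x = y \<or> (y, x) \<in> En"
    using numbered_arc by blast+
qed

lemma length_ST: "length S = k" "length T = k" "distinct S" "distinct T" "set S \<subseteq> pverts G" "set T \<subseteq> pverts G"
  using inst by (auto simp: linkage_instance_def)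

text \<open>Origin of the exponents: the network has at most \<open>5 * n\<close> nodes and
  \<open>25 * n ^ 2 < n ^ 4\<close> since \<open>n \<ge> 39\<close>, so \<open>n ^ 4\<close> can
  serve as the bound on stored words. Intermediate values then stay within
  \<open>(n ^ 4) ^ 60 = n ^ 240\<close>, which is below \<open>n ^ 241\<close>.\<close>

lemma linkage_ram_n: "linkage_ram (n ^ 241) (n ^ 4) n t Bn k En tmn Nn"
proof -
  interpret bag_system n t Bn by (rule bag_system_n)
  have n39: "39 \<le> n" by (rule n_ge(1))
  have nn: "n ^ 4 = n * n * (n * n)" by (simp add: power4_eq_xxxx)
  have "39 * 39 \<le> n * n" using n39 by (intro mult_le_mono) auto
  then have n2: "1521 \<le> n * n" by simp
  have N5: "Nn \<le> 5 * n" using number_of_bags n39 by linarith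
  show ?thesis
  proof unfold_locales
    have "100 * 1 \<le> n * n * (n * n)" by (intro mult_le_mono) (use n2 in linarith)+
    then show "100 \<le> n ^ 4" by (simp add: nn)
    have "(n ^ 4) ^ 60 = n ^ 240" by (simp flip: power_mult)
    also have "\<dots> < n ^ 241" using n39 by (intro power_strict_increasing) auto
    finally show "(n ^ 4) ^ 60 < n ^ 241" .
    show "En \<subseteq> {..<n} \<times> {..<n}"
      by (auto simp: numbered_arcs_def intro!: nu_less dest: in_arcsD1 in_arcsD2)
    show "(u, v) \<in> (En \<inter> (- C) \<times> (- C))\<^sup>*" if "finite C" "card C < 5 * k" "u < n" "v < n" "u \<notin> C" "v \<notin> C" for C u v
      using numbered_connected that by blast
    show "(x, y) \<in> (En \<inter> Bn b \<times> Bn b)\<^sup>*" if b: "b < t" and xy: "x \<in> Bn b" "y \<in> Bn b" for b x y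
    proof -
      obtain x' y' where "x' \<in> pverts (Hs ! b)" "x = \<nu> x'" "y' \<in> pverts (Hs ! b)" "y = \<nu> y'" using xy by blast
      then show ?thesis using bag_subgraph[OF bag_in[OF b]] rtrancl_on_numbered[of x' y' "pverts (Hs ! b)" "parcs (Hs ! b)" G \<nu>] by auto
    qed
    show "\<exists>x\<in>Bn b. \<exists>y\<in>Bn b'. x = y \<or> (x, y) \<in> En" "\<exists>x\<in>Bn b. \<exists>y\<in>Bn b'. x = y \<or> (y, x) \<in> En" if "b < t" "b' < t" for b b'
      using touching[OF that] by blast+
    have "Nn * Nn \<le> 5 * n * (5 * n)" using N5 by (intro mult_le_mono)
    also have "\<dots> = 25 * (n * n)" by simp
    also have "\<dots> < n * n * (n * n)" by (intro mult_strict_right_mono) (use n2 in linarith)+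
    finally show "Nn * Nn < n ^ 4" by (simp add: nn)
    show "5 * k \<le> n" using n_ge(2) by linarith
    show "tmn s i < n" if "s < 2" "i < k" for s i
    proof -
      have "(if s = 0 then S else T) ! i \<in> set (if s = 0 then S else T)" by (rule nth_mem) (simp add: that length_ST)
      then show ?thesis using length_ST unfolding tmn_def by (intro nu_less) (auto split: if_splits)
    qed
    show "inj_on (tmn s) {..<k}" if "s < 2" for s
    proof (rule inj_onI)
      fix i j assume ij: "i \<in> {..<k}" "j \<in> {..<k}" "tmn s i = tmn s j"
      let ?L = "if s = 0 then S else T"
      have L: "length ?L = k" "distinct ?L" "set ?L \<subseteq> pverts G" using length_ST by auto
      then have "?L ! i \<in> pverts G" "?L ! j \<in> pverts G" using ij by (metis lessThan_iff nth_mem subsetD)+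
      then have "?L ! i = ?L ! j" using ij(3) inj unfolding tmn_def by blast
      then show "i = j" using L ij nth_eq_iff_index_eq by blast
    qed
  qed (use k_pos in auto)
qed

lemma subgraph_card:
  assumes "H \<in> Bs \<or> H = G"
  shows "card (pverts H) \<le> n" "card (parcs H) \<le> n * n" "pverts H \<subseteq> pverts G" "parcs H \<subseteq> pverts G \<times> pverts G"
    "finite (pverts H)" "finite (parcs H)"
proof -
  show 1: "pverts H \<subseteq> pverts G" using assms bag_subgraph(1) by auto
  have "parcs G \<subseteq> pverts G \<times> pverts G" by (auto dest: in_arcsD1 in_arcsD2)
  then show 2: "parcs H \<subseteq> pverts G \<times> pverts G" using assms bag_subgraph(2) by blast
  have fin: "finite (pverts G)" by simp
  show "card (pverts H) \<le> n" unfolding n_def by (rule card_mono[OF fin 1])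
  have "card (parcs H) \<le> card (pverts G \<times> pverts G)" by (rule card_mono[OF finite_cartesian_product[OF fin fin] 2])
  then show "card (parcs H) \<le> n * n" by (simp add: n_def card_cartesian_product)
  show "finite (pverts H)" using 1 fin by (rule finite_subset)
  show "finite (parcs H)" using 2 finite_cartesian_product[OF fin fin] by (rule finite_subset)
qed

lemma entries_le:
  assumes "H \<in> Bs \<or> H = G" "encodes_digraph \<nu> H ys" "x \<in> set ys"
  shows "x \<le> n * n"
proof -
  have nn: "n \<le> n * n" by simp
  have \<nu>: "\<nu> w \<le> n * n" if "w \<in> pverts G" for w using nu_less[OF that] nn by linarith
  have sub: "pverts H \<union> fst ` parcs H \<union> snd ` parcs H \<subseteq> pverts G" using subgraph_card(3,4)[OF assms(1)] by auto
  consider "x = card (pverts H)" | "x = card (parcs H)" | w where "w \<in> pverts G" "x = \<nu> w"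
    using encodes_digraph_entries[OF assms(2,3)] sub by blast
  then show ?thesis using subgraph_card(1,2)[OF assms(1)] nn \<nu> by cases (blast intro: order.trans)+
qed

text \<open>The left side bounds all addresses in the input: at most \<open>2 * n\<close> bags, each
  of at most \<open>2 + n + 2 * (n * n)\<close> words. Its leading term is \<open>4 * n ^ 3\<close>,
  and \<open>n \<ge> 39\<close>.\<close>

lemma memory_bound: "4 + n + 2 * (n * n) + 2 * k + 2 * n * (2 + n + 2 * (n * n)) \<le> n ^ 4"
proof -
  define a b where "a = n * n" and "b = n * (n * n)"
  have "39 * n \<le> n * n" "39 * (n * n) \<le> n * (n * n)" "39 * (n * (n * n)) \<le> n * (n * (n * n))"
    using n_ge(1) by (intro mult_le_mono1; simp)+
  then have "39 * n \<le> a" "39 * a \<le> b" "39 * b \<le> n ^ 4" unfolding a_def b_def by (simp_all add: power4_eq_xxxx mult.assoc)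
  moreover have "2 * n * (2 + n + 2 * (n * n)) = 4 * n + 2 * a + 4 * b" by (simp add: a_def b_def algebra_simps)
  ultimately show ?thesis using n_ge unfolding a_def[symmetric] by linarith
qed

lemma program_solves:
  assumes gs: "encodes_digraph \<nu> G gs" and xss: "list_all2 (encodes_digraph \<nu>) Hs xss"
    and xs: "xs = gs @ [length S] @ map \<nu> S @ map \<nu> T @ length Hs # concat xss"
  shows "\<exists>Ps. half_integral_solution G S T Ps \<and>
    computes_within (n ^ 241) main xs (500000 * k ^ 4 * n ^ 2) (path_words \<nu> Ps)"
proof -
  interpret L: linkage_ram "n ^ 241" "n ^ 4" n t Bn k En tmn Nn by (rule linkage_ram_n)
  define X where "X = input_memory xs 0"
  define e where "e = card (parcs G)"
  \<comment> \<open>The graph takes \<open>2 + n + 2 * e\<close> words; then come \<open>k\<close>,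
    the \<open>2 * k\<close> terminals and the number of bags.\<close>
  define pos where "pos b = 2 + n + 2 * e + 2 + 2 * k + length (concat (take b xss))" for b
  have t2: "t \<le> 2 * n" using bag_system.number_of_bags[OF bag_system_n] .
  have len: "length xss = t" using list_all2_lengthD[OF xss] length_Hs by simp
  have enc: "encodes_digraph \<nu> (Hs ! b) (xss ! b)" if "b < t" for b
    using list_all2_nthD[OF xss] that length_Hs by simp
  have xs0: "xs = [] @ gs @ ([k] @ map \<nu> S @ map \<nu> T @ t # concat xss)" by (simp add: xs length_ST length_Hs)
  note g = encodes_digraph_memory[OF gs xs0 refl, folded X_def n_def e_def, simplified]
  have lg: "length gs = 2 + n + 2 * e" using g(3) by simp
  have e_le: "e \<le> n * n" using subgraph_card(2)[of G] by (simp add: e_def)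
  have Xk: "X (2 + n + 2 * e) = k"
    using input_memory_nth[of xs gs "[k]" "map \<nu> S @ map \<nu> T @ t # concat xss" 0] lg
    by (simp add: X_def xs length_ST length_Hs)
  have XS: "X (2 + n + 2 * e + 1 + i) = \<nu> (S ! i)" if "i < k" for i
    using input_memory_nth[of xs "gs @ [k]" "map \<nu> S" "map \<nu> T @ t # concat xss" i] lg that
    by (simp add: X_def xs length_ST length_Hs)
  have XT: "X (2 + n + 2 * e + 1 + k + i) = \<nu> (T ! i)" if "i < k" for i
    using input_memory_nth[of xs "gs @ [k] @ map \<nu> S" "map \<nu> T" "t # concat xss" i] lg that
    by (simp add: X_def xs length_ST length_Hs)
  have Xt: "X (2 + n + 2 * e + 1 + 2 * k) = t"
    using input_memory_nth[of xs "gs @ [k] @ map \<nu> S @ map \<nu> T" "[t]" "concat xss" 0] lg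
    by (simp add: X_def xs length_ST length_Hs mult_2 add.assoc)
  have pos_le: "pos b \<le> n ^ 4" for b
  proof -
    have "length ys \<le> 2 + n + 2 * (n * n)" if ys: "ys \<in> set (take b xss)" for ys
    proof -
      obtain c where c: "c < t" "ys = xss ! c" using ys len by (auto simp: in_set_conv_nth)
      have "length ys = 2 + card (pverts (Hs ! c)) + 2 * card (parcs (Hs ! c))"
        unfolding c(2) by (rule encodes_digraph_memory(3)[OF enc[OF c(1)] refl refl])
      then show ?thesis using subgraph_card(1,2)[of "Hs ! c"] bag_in[OF c(1)] by simp
    qed
    then have "length (concat (take b xss)) \<le> length (take b xss) * (2 + n + 2 * (n * n))" by (rule length_concat_le)
    also have "\<dots> \<le> 2 * n * (2 + n + 2 * (n * n))" using t2 len by (intro mult_le_mono1) auto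
    finally show ?thesis using memory_bound e_le unfolding pos_def by linarith
  qed
  have bag: "pos (Suc b) = pos b + 2 + X (pos b) + 2 * X (pos b + 1) \<and> Bn b = (\<lambda>j. X (pos b + 2 + j)) ` {..<X (pos b)} \<and>
        inj_on (\<lambda>j. X (pos b + 2 + j)) {..<X (pos b)}" if b: "b < t" for b
  proof -
    let ?A = "gs @ [k] @ map \<nu> S @ map \<nu> T @ t # concat (take b xss)"
    have "xs = ?A @ xss ! b @ concat (drop (Suc b) xss)"
      using concat_split_nth[of b xss] b len by (simp add: xs length_ST length_Hs)
    note mem = encodes_digraph_memory[OF enc[OF b] this]
    have "pos b = length ?A" by (simp add: pos_def lg length_ST)
    then have m: "X (pos b) = card (pverts (Hs ! b))" "X (pos b + 1) = card (parcs (Hs ! b))"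
      "length (xss ! b) = 2 + card (pverts (Hs ! b)) + 2 * card (parcs (Hs ! b))"
      "(\<lambda>j. X (pos b + 2 + j)) ` {..<card (pverts (Hs ! b))} = \<nu> ` pverts (Hs ! b)"
      unfolding X_def by (fact mem)+
    have mi: "inj_on (\<lambda>j. X (pos b + 2 + j)) {..<card (pverts (Hs ! b))}" if "inj_on \<nu> (pverts (Hs ! b))"
      unfolding X_def using mem(5)[OF \<open>pos b = length ?A\<close> that] .
    have "concat (take (Suc b) xss) = concat (take b xss) @ xss ! b" using b len by (simp add: take_Suc_conv_app_nth)
    then have "pos (Suc b) = pos b + length (xss ! b)" by (simp add: pos_def)
    moreover have "inj_on \<nu> (pverts (Hs ! b))"
      using bij bag_subgraph(1)[OF bag_in[OF b]] by (auto simp: bij_betw_def intro: inj_on_subset)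
    ultimately show ?thesis using m mi by simp
  qed
  have inp: "L.input_at X e pos"
    unfolding L.input_at_def
  proof (intro conjI allI impI)
    show "X (2 + n + 2 * e + 1 + s * k + i) = tmn s i" if "s < 2" "i < k" for s i
      using XS[OF that(2)] XT[OF that(2)] that(1) by (auto simp: tmn_def less_2_cases_iff)
    show "En = (\<lambda>j. (X (2 + n + 2 * j), X (3 + n + 2 * j))) ` {..<e}" using g(6) by simp
    show "pos 0 = 2 + n + 2 * e + 2 + 2 * k" by (simp add: pos_def)
    show "pos 0 \<le> n ^ 4" by (rule pos_le)
    fix b assume "b < t"
    note bag = bag[OF this]
    show "pos (Suc b) \<le> n ^ 4" by (rule pos_le)
    show "pos (Suc b) = pos b + 2 + X (pos b) + 2 * X (pos b + 1)" "Bn b = (\<lambda>j. X (pos b + 2 + j)) ` {..<X (pos b)}"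
      "inj_on (\<lambda>j. X (pos b + 2 + j)) {..<X (pos b)}" using bag by blast+
  qed (use g(1,2) e_le Xk Xt in auto)
  have bd: "L.bd (input_memory xs)"
    unfolding L.bd_def
  proof (intro allI)
    fix a i
    have "n * n \<le> n ^ 4" "n \<le> n * n" using memory_bound n_ge(1) by auto
    moreover have "x \<le> n * n" if x: "x \<in> set xs" for x
    proof -
      consider "x \<in> set gs" | "x = k" | "x \<in> \<nu> ` (set S \<union> set T)" | "x = t" | "x \<in> set (concat xss)"
        using x unfolding xs0 by auto
      then show ?thesis
      proof cases
        case 1
        then show ?thesis using entries_le[OF _ gs] by blast
      next
        case 2
        then show ?thesis using n_ge(2) \<open>n \<le> n * n\<close> by linarith
      next
        case 3
        then obtain w where "w \<in> pverts G" "x = \<nu> w" using length_ST by auto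
        then show ?thesis using nu_less[of w] \<open>n \<le> n * n\<close> by linarith
      next
        case 4
        have "2 * n \<le> n * n" using n_ge(1) by (intro mult_le_mono1) simp
        then show ?thesis using 4 t2 by linarith
      next
        case 5
        then obtain ys where "ys \<in> set xss" "x \<in> set ys" by auto
        then obtain b where "b < t" "x \<in> set (xss ! b)" using len in_set_conv_nth[of ys xss] by auto
        then show ?thesis using entries_le[OF _ enc] bag_in by blast
      qed
    qed
    ultimately have "xs ! i \<le> n ^ 4" if "i < length xs" using nth_mem[OF that] order.trans by blast
    then show "input_memory xs a i \<le> n ^ 4" by (auto simp: input_memory_def)
  qed
  have "L.run main (input_memory xs) (20000 * (k * (k * (Nn * Nn)))) (\<lambda>\<sigma>'. \<exists>Ps. length Ps = k \<and>
    (\<forall>i<k. L.good_path {..<n} i (Ps ! i)) \<and> (\<forall>v. card {i. i < k \<and> v \<in> set (Ps ! i)} \<le> 2) \<and>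
    (\<forall>x<length (words Ps). \<sigma>' 1 x = words Ps ! x))"
    by (rule L.run_main[OF inp bd]) (simp_all add: X_def input_memory_def)
  then obtain \<tau> \<sigma>' Qs where ex: "exec (n ^ 241) main (input_memory xs) \<tau> \<sigma>'" "\<tau> \<le> 20000 * (k * (k * (Nn * Nn)))"
    and Qs: "length Qs = k" "\<And>i. i < k \<Longrightarrow> L.good_path {..<n} i (Qs ! i)"
      "\<And>v. card {i. i < k \<and> v \<in> set (Qs ! i)} \<le> 2" "\<And>x. x < length (words Qs) \<Longrightarrow> \<sigma>' 1 x = words Qs ! x"
    unfolding L.run_def by blast
  \<comment> \<open>The inverse numbering carries the computed paths back to the vertices of
    \<open>G\<close>.\<close>
  define g where "g = inv_into (pverts G) \<nu>"
  have g: "g x \<in> pverts G" "\<nu> (g x) = x" if "x < n" for x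
    using that bij unfolding g_def bij_betw_def by (auto simp: inv_into_into f_inv_into_f)
  have g\<nu>: "g (\<nu> w) = w" if "w \<in> pverts G" for w using that bij by (simp add: g_def bij_betw_def)
  define Ps where "Ps = map (map g) Qs"
  have sol: "half_integral_solution G S T Ps"
    unfolding half_integral_solution_def
  proof (intro conjI allI impI)
    show "length Ps = length S" by (simp add: Ps_def Qs(1) length_ST)
    fix i assume "i < length S"
    then have i: "i < k" by (simp add: length_ST)
    let ?Q = "Qs ! i"
    note q = Qs(2)[OF i, unfolded L.good_path_def]
    have P: "Ps ! i = map g ?Q" using i Qs(1) by (simp add: Ps_def)
    have inQ: "x < n" if "x \<in> set ?Q" for x using q that by blast
    show "vpath (Ps ! i) (with_proj G)"
    proof (rule vpathI)
      have "set (vwalk_arcs (map g ?Q)) \<subseteq> parcs G"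
      proof (rule vwalk_arcs_subset)
        fix l assume l: "Suc l < length (map g ?Q)"
        then have "(?Q ! l, ?Q ! Suc l) \<in> En" "?Q ! l < n" "?Q ! Suc l < n" using q inQ by auto
        then show "(map g ?Q ! l, map g ?Q ! Suc l) \<in> parcs G" using l g numbered_arcD by simp
      qed
      moreover have "set (map g ?Q) \<subseteq> pverts G" using inQ g(1) by auto
      ultimately show "vwalk (Ps ! i) (with_proj G)" unfolding P using q by (intro vwalkI) auto
      have "inj_on g (set ?Q)" using inQ g(2) by (metis inj_onI)
      then show "distinct (Ps ! i)" unfolding P using q by (simp add: distinct_map)
    qed
    have "S ! i \<in> pverts G" "T ! i \<in> pverts G" using length_ST i nth_mem by (metis subsetD)+
    then show "hd (Ps ! i) = S ! i" "last (Ps ! i) = T ! i"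
      unfolding P using q g\<nu> by (simp_all add: hd_map last_map tmn_def)
  next
    fix v
    have "{i. i < length S \<and> v \<in> set (Ps ! i)} \<subseteq> {i. i < k \<and> \<nu> v \<in> set (Qs ! i)}"
    proof
      fix i assume "i \<in> {i. i < length S \<and> v \<in> set (Ps ! i)}"
      then have i: "i < k" and "v \<in> set (map g (Qs ! i))" using Qs(1) by (auto simp: Ps_def length_ST)
      then obtain x where x: "x \<in> set (Qs ! i)" "v = g x" by auto
      then have "x < n" using Qs(2)[OF i] unfolding L.good_path_def by blast
      then show "i \<in> {i. i < k \<and> \<nu> v \<in> set (Qs ! i)}" using x i g(2) by simp
    qed
    then have "card {i. i < length S \<and> v \<in> set (Ps ! i)} \<le> card {i. i < k \<and> \<nu> v \<in> set (Qs ! i)}" by (intro card_mono) auto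
    then show "card {i. i < length S \<and> v \<in> set (Ps ! i)} \<le> 2" using Qs(3) order.trans by blast
  qed
  have "map \<nu> (map g Q) = Q" if Q: "Q \<in> set Qs" for Q
  proof -
    obtain i where i: "i < k" "Q = Qs ! i" using Q Qs(1) by (auto simp: in_set_conv_nth)
    then have "set Q \<subseteq> {..<n}" using Qs(2)[OF i(1)] unfolding L.good_path_def by blast
    then show ?thesis using g(2) by (simp add: subset_iff map_idI)
  qed
  then have "map (\<lambda>P. length P # map \<nu> P) Ps = map (\<lambda>P. length P # P) Qs" unfolding Ps_def by simp
  then have pw: "path_words \<nu> Ps = words Qs" by (simp add: path_words_def words_def)
  \<comment> \<open>At most \<open>5 * n\<close> nodes turn \<open>20000 * k ^ 2 * N ^ 2\<close>
    into \<open>500000 * k ^ 2 * n ^ 2\<close>, and \<open>k ^ 2 \<le> k ^ 4\<close>.\<close>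
  have "Nn * Nn \<le> 5 * n * (5 * n)" using t2 n_ge(1) by (intro mult_le_mono) auto
  then have "k * (k * (Nn * Nn)) \<le> k * (k * (5 * n * (5 * n)))" by (intro mult_le_mono2)
  also have "\<dots> = 25 * (k ^ 2 * n ^ 2)" by (simp add: power2_eq_square algebra_simps)
  also have "\<dots> \<le> 25 * (k ^ 4 * n ^ 2)" using k_pos by (intro mult_le_mono2 mult_le_mono1 power_increasing) auto
  finally have "\<tau> \<le> 500000 * k ^ 4 * n ^ 2" using ex(2) by simp
  then have "computes_within (n ^ 241) main xs (500000 * k ^ 4 * n ^ 2) (path_words \<nu> Ps)"
    unfolding computes_within_def pw using ex(1) Qs(4) by blast
  then show ?thesis using sol by blast
qed

end

theorem theorem5p1:
  shows "\<exists>(p :: prog) (c :: nat) (C :: nat). \<forall>k \<ge> 1. \<exists>t > 0.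
    \<forall>(G :: 'a pair_pre_digraph) (\<B> :: 'a pair_pre_digraph set) (n :: nat).
      pair_fin_digraph G \<and> n = card (pverts G) \<and>
      strongly_m_connected (36 * k ^ 3 + 2 * k) G \<and>
      bramble G \<B> \<and> depth_two \<B> \<and> card \<B> = t \<longrightarrow>
      (\<forall>S T. linkage_instance k G S T \<longrightarrow> half_integrally_feasible G S T) \<and>
      (\<forall>S T \<nu> xs.
         linkage_instance k G S T \<and> vertex_numbering G \<nu> \<and> encodes_input \<nu> G S T \<B> xs \<longrightarrow>
         (\<exists>Ps. half_integral_solution G S T Ps \<and>
               computes_within (n ^ c) p xs (C * k ^ 4 * n ^ 2) (path_words \<nu> Ps)))"
proof -
  have solved: "\<exists>Ps. half_integral_solution G S T Ps \<and>
      computes_within (n ^ 241) main xs (500000 * k ^ 4 * n ^ 2) (path_words \<nu> Ps)"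
    if "1 \<le> k" "pair_fin_digraph G" "n = card (pverts G)" "strongly_m_connected (36 * k ^ 3 + 2 * k) G"
      "bramble G \<B>" "depth_two \<B>" "card \<B> = 60 * k ^ 2" "linkage_instance k G S T" "vertex_numbering G \<nu>"
      and enc: "encodes_input \<nu> G S T \<B> xs"
    for k n :: nat and G :: "'a pair_pre_digraph" and \<B> S T \<nu> xs
  proof -
    obtain gs Hs xss where *: "encodes_digraph \<nu> G gs" "distinct Hs" "set Hs = \<B>" "list_all2 (encodes_digraph \<nu>) Hs xss"
      "xs = gs @ [length S] @ map \<nu> S @ map \<nu> T @ length Hs # concat xss"
      using enc unfolding encodes_input_def encodes_bags_def by blast
    interpret pair_fin_digraph G by fact
    interpret linkage_problem G k n \<B> S T \<nu> Hs using that * by unfold_locales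
    show ?thesis by (rule program_solves[OF *(1,4,5)])
  qed
  \<comment> \<open>Existence of a solution is also obtained from the program: some numbering, some
    order of the bags and some encoding exist, and a run on this input yields paths.\<close>
  have feasible: "half_integrally_feasible G S T"
    if "1 \<le> k" and G: "pair_fin_digraph G" and "strongly_m_connected (36 * k ^ 3 + 2 * k) G"
      "bramble G \<B>" "depth_two \<B>" "card \<B> = 60 * k ^ 2" "linkage_instance k G S T"
    for k :: nat and G :: "'a pair_pre_digraph" and \<B> S T
  proof -
    interpret pair_fin_digraph G by fact
    obtain \<nu> where "bij_betw \<nu> (pverts G) {0..<card (pverts G)}"
      using ex_bij_betw_finite_nat[of "pverts G"] by auto
    then have \<nu>: "vertex_numbering G \<nu>" by (simp add: vertex_numbering_def atLeast0LessThan)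
    \<comment> \<open>An infinite set has cardinality \<open>0\<close>, so a positive size makes the
      bramble finite and its bags can be listed.\<close>
    have "card \<B> \<noteq> 0" using that by simp
    then have "finite \<B>" by (meson card.infinite)
    then obtain Hs where Hs: "distinct Hs" "set Hs = \<B>" using finite_distinct_list by blast
    interpret linkage_problem G k "card (pverts G)" \<B> S T \<nu> Hs by unfold_locales (use that \<nu> Hs in \<open>auto simp del: One_nat_def\<close>)
    have "\<exists>ys. encodes_digraph \<nu> H ys" if "H \<in> \<B> \<or> H = G" for H
      using encodes_digraph_exists subgraph_card(5,6)[OF that] by blast
    then obtain f where f: "\<And>H. H \<in> \<B> \<or> H = G \<Longrightarrow> encodes_digraph \<nu> H (f H)" by metis
    have "list_all2 (encodes_digraph \<nu>) Hs (map f Hs)" using f Hs(2) by (auto simp: list_all2_conv_all_nth)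
    then show ?thesis using program_solves[OF f[of G] _ refl] unfolding half_integrally_feasible_def by blast
  qed
  show ?thesis
  proof (rule exI[of _ main], rule exI[of _ 241], rule exI[of _ 500000], intro allI impI)
    fix k :: nat assume k: "1 \<le> k"
    then have "0 < 60 * k ^ 2" by simp
    then show "\<exists>t > 0. \<forall>(G :: 'a pair_pre_digraph) (\<B> :: 'a pair_pre_digraph set) (n :: nat).
      pair_fin_digraph G \<and> n = card (pverts G) \<and> strongly_m_connected (36 * k ^ 3 + 2 * k) G \<and>
      bramble G \<B> \<and> depth_two \<B> \<and> card \<B> = t \<longrightarrow>
      (\<forall>S T. linkage_instance k G S T \<longrightarrow> half_integrally_feasible G S T) \<and>
      (\<forall>S T \<nu> xs.
         linkage_instance k G S T \<and> vertex_numbering G \<nu> \<and> encodes_input \<nu> G S T \<B> xs \<longrightarrow>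
         (\<exists>Ps. half_integral_solution G S T Ps \<and>
               computes_within (n ^ 241) main xs (500000 * k ^ 4 * n ^ 2) (path_words \<nu> Ps)))"
      using solved[OF k] feasible[OF k] by (intro exI[of _ "60 * k ^ 2"]) blast
  qed
qed

end
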